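(* Let $\mathbf{k}$ be a field and let $D$ be a transparent diagram with $\ell$ boxes. Then $$\mathfrak{S}_D=\sum_{(i_1,\dots,i_\ell)\in\mathrm{Red}(D)}\mathsf{Z}\,x_{i_\ell}\mathsf{R}_{i_\ell+1}\cdots\mathsf{Z}\,x_{i_1}\mathsf{R}_{i_1+1}(1),$$ where $\mathsf{Z}=1/(1-\mathsf{R}_1)=1+\mathsf{R}_1+\mathsf{R}_1^2+\cdots$, $x_i$ denotes multiplication by $x_i$, and the operators are composed so that the rightmost acts first.
   Context: Diagrams. A diagram is a finite tuple $D=[a^{(1)},\dots,a^{(m)}]$ of finite subsets of $\mathbb{Z}_{>0}$ (its columns); a box $(i,j)$ (row $i$, column $j$) belongs to $D$ iff $i\in a^{(j)}$. Diagrams differing by reordering columns or by adding or deleting empty columns are identified. $D$ is $k$-full if for every column $a^{(j)}$, $k\in a^{(j)}$ implies $k+1\in a^{(j)}$. $D$ has a descent at $k$ if, possibly after reordering columns, there is a column $a^{(j)}$ whose largest element is $k$, such that all columns $a^{(j')}$ with $j'<j$ are $k$-full (i.e. $k\in a^{(j')}\Rightarrow k+1\in a^{(j')}$), and all columns with $j'>j$ satisfy $a^{(j')}\cap\{1,\dots,k+1\}\subseteq a^{(j)}$. $\mathrm{Des}(D)$ is the set of descents. The witnessing column is unique up to repetition; take the leftmost one. Then $s_kD$ is the diagram obtained by deleting the box $(k,j)$ of the witnessing column and then swapping rows $k$ and $k+1$. $D$ is clear if for every $k\ge1$, $D$ is $k$-full or has a descent at $k$. Transparent diagrams are defined inductively: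 the empty diagram $\emptyset$ is transparent; a nonempty $D$ is transparent if $D$ is clear and $s_kD$ is transparent for every $k\in\mathrm{Des}(D)$. For a diagram $D$ with $\ell$ boxes, $\mathrm{Red}(D)$ is the set of reduced words of $D$: sequences $(i_1,\dots,i_\ell)$ for which there are diagrams $D=D_\ell,\dots,D_1,D_0=\emptyset$ with $i_j\in\mathrm{Des}(D_j)$ and $D_{j-1}=s_{i_j}D_j$ for $1\le j\le\ell$. Flagged Schur modules. Let $n$ be at least the largest row index of a box of $D$, let $E$ have basis $z_1,\dots,z_n$ over $\mathbf{k}$, and for $0\le i\le n$ let $E_i=E/\langle z_{i+1},\dots,z_n\rangle$. Put $TE^D=\bigwedge^{r_1}E\otimes\cdots\otimes\bigwedge^{r_m}E$ with $r_j=|a^{(j)}|$; it has basis $z_\tau=\bigotimes_j z_{b^{(j)}_1}\wedge\cdots\wedge z_{b^{(j)}_{r_j}}$, where $\tau=(b^{(1)},\dots,b^{(m)})$, $b^{(j)}=\{b^{(j)}_1<\dots<b^{(j)}_{r_j}\}\subseteq\{1,\dots,n\}$. The $D$-exchange relations are the elements of the kernel of $TE^D\to\mathbf{k}[z_{pq}]_{1\le p,q\le n}$, $z_\tau\mapsto\prod_j\Delta_{a^{(j)},b^{(j)}}$, where $\Delta_{a,b}$ is the minor of the generic matrix $(z_{pq})$ on rows $a$ and columns $b$. For $a=\{a_1<\dots<a_r\}$, let $E_\bullet^a$ be the quotient of $\bigwedge^rE$ by the sum over $0\le i<r$ of the images of $\bigwedge^iE\otimes\bigwedge^{r-i}\ker(E\to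 E_{a_{i+1}})$; put $TE_\bullet^D=\bigotimes_jE_\bullet^{a^{(j)}}$. The flagged Schur module $E_\bullet^D$ is the quotient of $TE_\bullet^D$ by the image of the $D$-exchange relations. $\mathfrak{S}_D=\sum_\lambda\dim (E^D_\bullet)_\lambda\,x^\lambda\in\mathbb{Z}[x_1,x_2,\dots]$ is its character with respect to the torus of diagonal matrices $\mathrm{diag}(t_1,\dots,t_n)$ acting by $z_j\mapsto t_jz_j$. It does not depend on $n$. Operators on polynomials: $\mathsf{R}_k$ is the ring endomorphism of $\mathbb{Z}[x_1,x_2,\dots]$ with $x_i\mapsto x_i$ for $i<k$, $x_k\mapsto0$, $x_i\mapsto x_{i-1}$ for $i>k$. On polynomials without constant term $\mathsf{R}_1$ is locally nilpotent, so $\mathsf{Z}=\sum_{p\ge0}\mathsf{R}_1^p$ is well defined there (in the formula it is only applied to such polynomials). *)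

theory Defs
  imports
    "Jordan_Normal_Form.VS_Connect"
    "HOL-Library.Poly_Mapping"
    "HOL-Library.Multiset"
    "HOL-Combinatorics.Transposition"
begin

section \<open>Diagrams\<close>

text \<open>A diagram is the list of its columns. The identification of diagrams that differ by
  reordering columns and by adding or deleting empty columns is kept explicit as \<open>diag_eq\<close>.\<close>

type_synonym diagram = "nat set list"

definition is_diagram :: "diagram \<Rightarrow> bool" where
  "is_diagram D \<longleftrightarrow> (\<forall>a \<in> set D. finite a \<and> 0 \<notin> a)"

definition diag_eq :: "diagram \<Rightarrow> diagram \<Rightarrow> bool" (infix "\<simeq>" 50) where
  "D \<simeq> D' \<longleftrightarrow> filter_mset (\<lambda>a. a \<noteq> {}) (mset D) = filter_mset (\<lambda>a. a \<noteq> {}) (mset D')"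

definition num_boxes :: "diagram \<Rightarrow> nat" where
  "num_boxes D = (\<Sum>a\<leftarrow>D. card a)"

definition col_full :: "nat \<Rightarrow> nat set \<Rightarrow> bool" where
  "col_full k a \<longleftrightarrow> (k \<in> a \<longrightarrow> k + 1 \<in> a)"

definition k_full :: "nat \<Rightarrow> diagram \<Rightarrow> bool" where
  "k_full k D \<longleftrightarrow> (\<forall>a \<in> set D. col_full k a)"

text \<open>\<open>L @ a # R\<close> is a reordering of the columns of \<open>D\<close> in which \<open>a\<close> witnesses a descent at \<open>k\<close>.
  The columns in \<open>L\<close> are \<open>k\<close>-full and \<open>a\<close> is not, so \<open>a\<close> is automatically the leftmost
  of its copies.\<close>

definition descent_witness :: "nat \<Rightarrow> diagram \<Rightarrow> diagram \<Rightarrow> nat set \<Rightarrow> diagram \<Rightarrow> bool" where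
  "descent_witness k D L a R \<longleftrightarrow>
     mset D = mset (L @ a # R) \<and> a \<noteq> {} \<and> Max a = k \<and>
     (\<forall>b \<in> set L. col_full k b) \<and> (\<forall>b \<in> set R. b \<inter> {1..k + 1} \<subseteq> a)"

definition Des :: "diagram \<Rightarrow> nat set" where
  "Des D = {k. \<exists>L a R. descent_witness k D L a R}"

text \<open>Up to \<open>\<simeq>\<close> the choice of the reordering is irrelevant. The value is meaningful only for
  \<open>k \<in> Des D\<close>.\<close>

definition s_diag :: "nat \<Rightarrow> diagram \<Rightarrow> diagram" where
  "s_diag k D = (SOME D'. \<exists>L a R. descent_witness k D L a R \<and>
     D' = map (\<lambda>b. Transposition.transpose k (k + 1) ` b) (L @ (a - {k}) # R))"

definition clear_diag :: "diagram \<Rightarrow> bool" where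
  "clear_diag D \<longleftrightarrow> (\<forall>k \<ge> 1. k_full k D \<or> k \<in> Des D)"

inductive transparent :: "diagram \<Rightarrow> bool" where
  transparent_empty: "D \<simeq> [] \<Longrightarrow> transparent D"
| transparent_step:
    "\<not> D \<simeq> [] \<Longrightarrow> clear_diag D \<Longrightarrow> (\<And>k. k \<in> Des D \<Longrightarrow> transparent (s_diag k D)) \<Longrightarrow> transparent D"

text \<open>In \<open>Red\<close>, the letter \<open>w ! j\<close> is the \<open>(j+1)\<close>-st letter of the word, since lists are indexed
  from \<open>0\<close>, and \<open>Ds ! j\<close> is the \<open>j\<close>-th diagram of the chain.\<close>

definition Red :: "diagram \<Rightarrow> nat list set" where
  "Red D = {w. length w = num_boxes D \<and>
     (\<exists>Ds. length Ds = Suc (num_boxes D) \<and> Ds ! num_boxes D \<simeq> D \<and> Ds ! 0 \<simeq> [] \<and>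
        (\<forall>j < num_boxes D. w ! j \<in> Des (Ds ! Suc j) \<and> Ds ! j \<simeq> s_diag (w ! j) (Ds ! Suc j)))}"


section \<open>Polynomials and operators\<close>

text \<open>Exponent vectors are finitely supported functions on the indices of the variables;
  the variables in use are \<open>x\<^sub>1, x\<^sub>2, \<dots>\<close> and \<open>x\<^sub>0\<close> never occurs.\<close>

type_synonym expvec = "nat \<Rightarrow>\<^sub>0 nat"
type_synonym zpoly = "expvec \<Rightarrow>\<^sub>0 int"

definition x_var :: "nat \<Rightarrow> zpoly" where
  "x_var i = Poly_Mapping.single (Poly_Mapping.single i 1) 1"

definition subst_vars :: "(nat \<Rightarrow> zpoly) \<Rightarrow> zpoly \<Rightarrow> zpoly" where
  "subst_vars \<sigma> f = (\<Sum>m \<in> Poly_Mapping.keys f.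
     of_int (Poly_Mapping.lookup f m) * (\<Prod>i \<in> Poly_Mapping.keys m. \<sigma> i ^ Poly_Mapping.lookup m i))"

definition R_op :: "nat \<Rightarrow> zpoly \<Rightarrow> zpoly" where
  "R_op k = subst_vars (\<lambda>i. if i < k then x_var i else if i = k then 0 else x_var (i - 1))"

text \<open>\<open>Sum_any\<close> is the sum of a finitely supported family; the family is finitely supported when
  \<open>f\<close> is a polynomial in \<open>x\<^sub>1, x\<^sub>2, \<dots>\<close> without constant term.\<close>

definition Z_op :: "zpoly \<Rightarrow> zpoly" where
  "Z_op f = Sum_any (\<lambda>p. (R_op 1 ^^ p) f)"

text \<open>\<open>fold\<close> applies the operator of the first letter of the word first.\<close>

definition word_poly :: "nat list \<Rightarrow> zpoly" where
  "word_poly w = fold (\<lambda>i f. Z_op (x_var i * R_op (i + 1) f)) w 1"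


section \<open>Vector spaces with a basis and their quotients\<close>

text \<open>The space with basis \<open>B\<close> is the set of \<open>v :: 'b \<Rightarrow>\<^sub>0 'k\<close> with \<open>keys v \<subseteq> B\<close>.\<close>

definition scale :: "'k::field \<Rightarrow> ('b \<Rightarrow>\<^sub>0 'k) \<Rightarrow> ('b \<Rightarrow>\<^sub>0 'k)" where
  "scale c v = Poly_Mapping.map (\<lambda>x. c * x) v"

lemma lookup_scale [simp]:
  "Poly_Mapping.lookup (scale c v) b = c * Poly_Mapping.lookup v b"
  by (simp add: scale_def Poly_Mapping.map.rep_eq when_def)

global_interpretation pm: vector_space "scale :: 'k::field \<Rightarrow> ('b \<Rightarrow>\<^sub>0 'k) \<Rightarrow> _"
  by unfold_locales (auto intro!: poly_mapping_eqI simp: lookup_add algebra_simps)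

definition coset :: "('b \<Rightarrow>\<^sub>0 'k::field) set \<Rightarrow> ('b \<Rightarrow>\<^sub>0 'k) \<Rightarrow> ('b \<Rightarrow>\<^sub>0 'k) set" where
  "coset U v = {v + u | u. u \<in> U}"

text \<open>The quotient \<open>W / U\<close> for subspaces \<open>U \<subseteq> W\<close>; \<open>mult\<close> and \<open>one\<close> are fields of the
  record type that play no role for modules.\<close>

definition quotient_space ::
    "('b \<Rightarrow>\<^sub>0 'k::field) set \<Rightarrow> ('b \<Rightarrow>\<^sub>0 'k) set \<Rightarrow> ('k, ('b \<Rightarrow>\<^sub>0 'k) set) module" where
  "quotient_space W U =
     \<lparr>carrier = coset U ` W, mult = (\<lambda>_ _. undefined), one = undefined,
      zero = U, add = (\<lambda>X Y. {x + y | x y. x \<in> X \<and> y \<in> Y}),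
      smult = (\<lambda>c X. {scale c x + u | x u. x \<in> X \<and> u \<in> U})\<rparr>"

lemma coset_add:
  assumes "pm.subspace U" shows "{x + y | x y. x \<in> coset U v \<and> y \<in> coset U w} = coset U (v + w)"
proof (intro Set.set_eqI iffI)
  fix z assume "z \<in> {x + y | x y. x \<in> coset U v \<and> y \<in> coset U w}"
  then obtain a b where "z = (v + a) + (w + b)" "a \<in> U" "b \<in> U" by (auto simp: coset_def)
  hence "z = (v + w) + (a + b)" "a + b \<in> U" using pm.subspace_add[OF assms] by (auto simp: algebra_simps)
  thus "z \<in> coset U (v + w)" unfolding coset_def by blast
next
  fix z assume "z \<in> coset U (v + w)"
  then obtain u where "z = (v + u) + (w + 0)" "u \<in> U" by (auto simp: coset_def algebra_simps)
  thus "z \<in> {x + y | x y. x \<in> coset U v \<and> y \<in> coset U w}"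
    using pm.subspace_0[OF assms] unfolding coset_def by blast
qed

lemma coset_smult:
  assumes "pm.subspace U" shows "{scale c x + u | x u. x \<in> coset U v \<and> u \<in> U} = coset U (scale c v)"
proof (intro Set.set_eqI iffI)
  fix z assume "z \<in> {scale c x + u | x u. x \<in> coset U v \<and> u \<in> U}"
  then obtain a b where "z = scale c (v + a) + b" "a \<in> U" "b \<in> U" by (auto simp: coset_def)
  hence "z = scale c v + (scale c a + b)" "scale c a + b \<in> U"
    using pm.subspace_add[OF assms] pm.subspace_scale[OF assms] by (auto simp: pm.scale_right_distrib algebra_simps)
  thus "z \<in> coset U (scale c v)" unfolding coset_def by blast
next
  fix z assume "z \<in> coset U (scale c v)"
  then obtain u where "z = scale c (v + 0) + u" "u \<in> U" by (auto simp: coset_def)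
  thus "z \<in> {scale c x + u | x u. x \<in> coset U v \<and> u \<in> U}"
    using pm.subspace_0[OF assms] unfolding coset_def by blast
qed

lemma quot_simps:
  assumes U: "pm.subspace U"
  shows "carrier (quotient_space W U) = coset U ` W"
    "zero (quotient_space W U) = coset U 0"
    "add (quotient_space W U) (coset U v) (coset U w) = coset U (v + w)"
    "smult (quotient_space W U) c (coset U v) = coset U (scale c v)"
  using coset_add[OF U] coset_smult[OF U] by (auto simp: quotient_space_def) (auto simp: coset_def)

lemma vectorspace_quotient_space:
  fixes W U :: "('b \<Rightarrow>\<^sub>0 'k::field) set"
  assumes W: "pm.subspace W" and U: "pm.subspace U"
  shows "vectorspace class_ring (quotient_space W U)"
proof -
  note d = quot_simps[OF U]
  have F: "Ring.field (class_ring :: 'k ring)" by (rule class_field)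
  have A: "abelian_group (quotient_space W U)"
  proof (rule abelian_groupI)
    fix x assume "x \<in> carrier (quotient_space W U)"
    then obtain v where v: "v \<in> W" "x = coset U v" by (auto simp: d)
    have "coset U (-v) \<in> carrier (quotient_space W U)" using v pm.subspace_neg[OF W] by (auto simp: d)
    moreover have "add (quotient_space W U) (coset U (-v)) x = zero (quotient_space W U)"
      by (simp add: d v)
    ultimately show "\<exists>y\<in>carrier (quotient_space W U). add (quotient_space W U) y x = zero (quotient_space W U)" by blast
  qed (auto simp: d ac_simps pm.subspace_0[OF W] pm.subspace_add[OF W])
  have "Module.module class_ring (quotient_space W U)"
  proof (rule Module.moduleI)
    show "cring (class_ring :: 'k ring)" using F by (simp add: Ring.field_def Ring.domain_def)
    show "abelian_group (quotient_space W U)" by (rule A)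
  qed (auto simp: d class_ring_simps pm.subspace_scale[OF W] pm.scale_right_distrib pm.scale_left_distrib )
  thus ?thesis using F by (simp add: vectorspace_def)
qed


section \<open>Flagged Schur modules\<close>

text \<open>\<open>ext S r\<close> is the \<open>r\<close>-th exterior power of the span of the \<open>z\<^sub>s\<close>, \<open>s \<in> S\<close>: a subset
  \<open>b = {b\<^sub>1 < \<dots> < b\<^sub>r}\<close> stands for the basis vector \<open>z_b\<^sub>1 \<and> \<dots> \<and> z_b\<^sub>r\<close>.\<close>

definition ext :: "nat set \<Rightarrow> nat \<Rightarrow> (nat set \<Rightarrow>\<^sub>0 'k::field) set" where
  "ext S r = {v. \<forall>b \<in> Poly_Mapping.keys v. finite b \<and> b \<subseteq> S \<and> card b = r}"

definition wedge :: "(nat set \<Rightarrow>\<^sub>0 'k::field) \<Rightarrow> (nat set \<Rightarrow>\<^sub>0 'k) \<Rightarrow> (nat set \<Rightarrow>\<^sub>0 'k)" where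
  "wedge u v = (\<Sum>b \<in> Poly_Mapping.keys u. \<Sum>c \<in> Poly_Mapping.keys v.
     if b \<inter> c = {}
     then Poly_Mapping.single (b \<union> c)
       ((-1) ^ card {(x, y). x \<in> b \<and> y \<in> c \<and> y < x}
         * Poly_Mapping.lookup u b * Poly_Mapping.lookup v c)
     else 0)"

text \<open>The tuple \<open>\<tau> = (b\<^sup>1, \<dots>, b\<^sup>m)\<close>, as a list, stands for the basis vector \<open>z_\<tau>\<close>
  of the tensor product.\<close>

definition TE :: "nat \<Rightarrow> diagram \<Rightarrow> (nat set list \<Rightarrow>\<^sub>0 'k::field) set" where
  "TE n D = {v. \<forall>\<tau> \<in> Poly_Mapping.keys v. list_all2 (\<lambda>a b. b \<subseteq> {1..n} \<and> card b = card a) D \<tau>}"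

definition tensor :: "(nat set \<Rightarrow>\<^sub>0 'k::field) list \<Rightarrow> (nat set list \<Rightarrow>\<^sub>0 'k)" where
  "tensor ws = (\<Sum>\<tau> \<in> listset (map Poly_Mapping.keys ws).
     Poly_Mapping.single \<tau> (\<Prod>j < length ws. Poly_Mapping.lookup (ws ! j) (\<tau> ! j)))"

text \<open>The subspace of the exterior power by which \<open>E\<^sub>\<bullet>\<^sup>a\<close> is the quotient. For
  \<open>c = a\<^sub>i\<^sub>+\<^sub>1\<close>, which is \<open>sorted_list_of_set a ! i\<close>, the kernel of \<open>E \<rightarrow> E_c\<close> is spanned by
  \<open>z_j\<close> for \<open>c < j \<le> n\<close>.\<close>

definition flag_ker :: "nat \<Rightarrow> nat set \<Rightarrow> (nat set \<Rightarrow>\<^sub>0 'k::field) set" where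
  "flag_ker n a = pm.span (\<Union>i < card a.
     {wedge u v | u v. u \<in> ext {1..n} i \<and> v \<in> ext {sorted_list_of_set a ! i <.. n} (card a - i)})"

text \<open>The tensor product of the quotients \<open>E\<^sub>\<bullet>\<^sup>a\<close> over the columns \<open>a\<close> of \<open>D\<close> is \<open>TE n D\<close> modulo
  the pure tensors that have a factor in some \<open>flag_ker n a\<close>.\<close>

definition flag_rels :: "nat \<Rightarrow> diagram \<Rightarrow> (nat set list \<Rightarrow>\<^sub>0 'k::field) set" where
  "flag_rels n D = pm.span {tensor ws | ws.
     list_all2 (\<lambda>a w. w \<in> ext {1..n} (card a)) D ws \<and>
     (\<exists>j < length D. ws ! j \<in> flag_ker n (D ! j))}"

type_synonym 'k matpoly = "(nat \<times> nat \<Rightarrow>\<^sub>0 nat) \<Rightarrow>\<^sub>0 'k"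

definition z_var :: "nat \<Rightarrow> nat \<Rightarrow> 'k::field matpoly" where
  "z_var p q = Poly_Mapping.single (Poly_Mapping.single (p, q) 1) 1"

definition minor :: "nat set \<Rightarrow> nat set \<Rightarrow> 'k::field matpoly" where
  "minor a b = det (mat (card a) (card b)
     (\<lambda>(i, j). z_var (sorted_list_of_set a ! i) (sorted_list_of_set b ! j)))"

definition minor_map :: "diagram \<Rightarrow> (nat set list \<Rightarrow>\<^sub>0 'k::field) \<Rightarrow> 'k matpoly" where
  "minor_map D v = (\<Sum>\<tau> \<in> Poly_Mapping.keys v.
     Poly_Mapping.single 0 (Poly_Mapping.lookup v \<tau>) * (\<Prod>j < length D. minor (D ! j) (\<tau> ! j)))"

definition exchange_rels :: "nat \<Rightarrow> diagram \<Rightarrow> (nat set list \<Rightarrow>\<^sub>0 'k::field) set" where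
  "exchange_rels n D = {v \<in> TE n D. minor_map D v = 0}"

definition schur_rels :: "nat \<Rightarrow> diagram \<Rightarrow> (nat set list \<Rightarrow>\<^sub>0 'k::field) set" where
  "schur_rels n D = {u + v | u v. u \<in> flag_rels n D \<and> v \<in> exchange_rels n D}"

definition flagged_schur_module ::
    "nat \<Rightarrow> diagram \<Rightarrow> ('k, (nat set list \<Rightarrow>\<^sub>0 'k::field) set) module" where
  "flagged_schur_module n D = quotient_space (TE n D) (schur_rels n D)"


section \<open>Characters\<close>

text \<open>Over a finite field the \<open>'k\<close>-points of the torus do not separate its characters, so weights
  are taken with respect to the torus as an algebraic group, that is, for the generic point
  \<open>diag(t\<^sub>1, \<dots>, t\<^sub>n)\<close> over \<open>'k[t\<^sub>1, \<dots>, t\<^sub>n]\<close>. An element of \<open>V \<otimes> 'k[t]\<close> is a finitely supported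
  function from exponent vectors to \<open>V\<close>, and \<open>generic_torus v\<close> is the image of \<open>v\<close>, with
  \<open>z_\<tau>\<close> mapped to \<open>t^(weight \<tau>) z_\<tau>\<close>.\<close>

definition weight :: "nat set list \<Rightarrow> expvec" where
  "weight \<tau> = (\<Sum>b\<leftarrow>\<tau>. \<Sum>i \<in> b. Poly_Mapping.single i 1)"

definition generic_torus ::
    "(nat set list \<Rightarrow>\<^sub>0 'k::field) \<Rightarrow> (expvec \<Rightarrow>\<^sub>0 (nat set list \<Rightarrow>\<^sub>0 'k))" where
  "generic_torus v = (\<Sum>\<tau> \<in> Poly_Mapping.keys v.
     Poly_Mapping.single (weight \<tau>) (Poly_Mapping.single \<tau> (Poly_Mapping.lookup v \<tau>)))"

text \<open>The class of \<open>v\<close> has weight \<open>\<lambda>\<close> iff the generic point maps it to \<open>t^\<lambda>\<close> times itself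
  in \<open>(TE n D / U) \<otimes> 'k[t]\<close> for \<open>U = schur_rels n D\<close>; an element of \<open>TE n D \<otimes> 'k[t]\<close> vanishes there
  iff all its coefficients are in \<open>U\<close>.\<close>

definition weight_vectors ::
    "nat \<Rightarrow> diagram \<Rightarrow> expvec \<Rightarrow> (nat set list \<Rightarrow>\<^sub>0 'k::field) set set" where
  "weight_vectors n D l = coset (schur_rels n D) `
     {v \<in> TE n D. \<forall>\<mu>. Poly_Mapping.lookup (generic_torus v - Poly_Mapping.single l v) \<mu>
        \<in> schur_rels n D}"

definition weight_space ::
    "nat \<Rightarrow> diagram \<Rightarrow> expvec \<Rightarrow> ('k, (nat set list \<Rightarrow>\<^sub>0 'k::field) set) module" where
  "weight_space n D l = (flagged_schur_module n D)\<lparr>carrier := weight_vectors n D l\<rparr>"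

text \<open>\<open>vectorspace.dim\<close> is specified for vector spaces only, hence the following facts.\<close>

lemma minor_map_superset:
  assumes "finite S" "Poly_Mapping.keys v \<subseteq> S"
  shows "minor_map D v = (\<Sum>\<tau> \<in> S.
     Poly_Mapping.single 0 (Poly_Mapping.lookup v \<tau>) * (\<Prod>j < length D. minor (D ! j) (\<tau> ! j)))"
  unfolding minor_map_def using assms by (intro sum.mono_neutral_left) (auto simp: in_keys_iff)

lemma minor_map_add: "minor_map D (u + v) = minor_map D u + minor_map D v"
  using keys_add[of u v]
  by (simp add: minor_map_superset[of "Poly_Mapping.keys u \<union> Poly_Mapping.keys v"]
      lookup_add single_add algebra_simps sum.distrib)

lemma minor_map_scale: "minor_map D (scale c v) = Poly_Mapping.single 0 c * minor_map D v"
  by (subst minor_map_superset[of "Poly_Mapping.keys v"], simp, force simp: in_keys_iff)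
    (simp add: minor_map_def sum_distrib_left mult_single mult.assoc flip: mult.assoc)

lemma subspace_TE: "pm.subspace (TE n D)"
proof (rule pm.subspaceI)
  fix x y :: "nat set list \<Rightarrow>\<^sub>0 'a" assume "x \<in> TE n D" "y \<in> TE n D"
  thus "x + y \<in> TE n D" using keys_add[of x y] unfolding TE_def by blast
next
  fix c and x :: "nat set list \<Rightarrow>\<^sub>0 'a" assume "x \<in> TE n D"
  thus "scale c x \<in> TE n D" by (auto simp: TE_def in_keys_iff)
qed (simp add: TE_def)

lemma subspace_schur_rels: "pm.subspace (schur_rels n D)"
proof -
  have "pm.subspace (exchange_rels n D)"
    using subspace_TE[of n D] by (auto simp: pm.subspace_def exchange_rels_def minor_map_add minor_map_scale) (simp add: minor_map_def)
  moreover have "pm.subspace (flag_rels n D)" unfolding flag_rels_def by (rule pm.subspace_span)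
  ultimately show ?thesis unfolding schur_rels_def using pm.subspace_sums by blast
qed

lemma generic_torus_superset:
  assumes "finite S" "Poly_Mapping.keys v \<subseteq> S"
  shows "generic_torus v = (\<Sum>\<tau> \<in> S.
     Poly_Mapping.single (weight \<tau>) (Poly_Mapping.single \<tau> (Poly_Mapping.lookup v \<tau>)))"
  unfolding generic_torus_def using assms by (intro sum.mono_neutral_left) (auto simp: in_keys_iff)

lemma generic_torus_add: "generic_torus (u + v) = generic_torus u + generic_torus v"
  using keys_add[of u v]
  by (simp add: generic_torus_superset[of "Poly_Mapping.keys u \<union> Poly_Mapping.keys v"]
      lookup_add single_add algebra_simps sum.distrib)

lemma lookup_poly_mapping_sum: "Poly_Mapping.lookup (sum f A) x = (\<Sum>a\<in>A. Poly_Mapping.lookup (f a) x)"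
  by (induction A rule: infinite_finite_induct) (auto simp: lookup_add)

lemma lookup_generic_torus_scale: "Poly_Mapping.lookup (generic_torus (scale c v)) m = scale c (Poly_Mapping.lookup (generic_torus v) m)"
  by (subst generic_torus_superset[of "Poly_Mapping.keys v"], simp, force simp: in_keys_iff)
    (auto simp: generic_torus_def lookup_poly_mapping_sum pm.scale_sum_right lookup_single when_def intro!: sum.cong poly_mapping_eqI)

lemma vectorspace_weight_space: "vectorspace class_ring (weight_space n D l :: ('k::field, _) module)"
proof -
  let ?U = "schur_rels n D :: (_ \<Rightarrow>\<^sub>0 'k) set"
  let ?W = "{v \<in> TE n D. \<forall>\<mu>. Poly_Mapping.lookup (generic_torus v - Poly_Mapping.single l v) \<mu> \<in> ?U}"
  note S = subspace_schur_rels[of n D, where 'a='k] subspace_TE[of n D, where 'a='k]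
  have "pm.subspace ?W"
  proof (rule pm.subspaceI)
    show "0 \<in> ?W" using S by (simp add: pm.subspace_0 generic_torus_def)
  next
    fix x y assume *: "x \<in> ?W" "y \<in> ?W"
    have "Poly_Mapping.lookup (generic_torus (x+y) - Poly_Mapping.single l (x+y)) \<mu> =
      Poly_Mapping.lookup (generic_torus x - Poly_Mapping.single l x) \<mu> + 
      Poly_Mapping.lookup (generic_torus y - Poly_Mapping.single l y) \<mu>" for \<mu>
      by (simp add: generic_torus_add single_add lookup_add lookup_minus)
    thus "x + y \<in> ?W" using * S by (auto intro!: pm.subspace_add)
  next
    fix c x assume *: "x \<in> ?W"
    have "Poly_Mapping.lookup (generic_torus (scale c x) - Poly_Mapping.single l (scale c x)) \<mu> =
      scale c (Poly_Mapping.lookup (generic_torus x - Poly_Mapping.single l x) \<mu>)" for \<mu>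
      by (simp add: lookup_generic_torus_scale lookup_minus lookup_single when_def pm.scale_right_diff_distrib)
    thus "scale c x \<in> ?W" using * S by (auto intro!: pm.subspace_scale)
  qed
  hence "vectorspace class_ring (quotient_space ?W ?U)" by (rule vectorspace_quotient_space) (rule S)
  moreover have "quotient_space ?W ?U = weight_space n D l"
    by (simp add: weight_space_def flagged_schur_module_def quotient_space_def weight_vectors_def)
  ultimately show ?thesis by simp
qed

text \<open>The base field enters as a type argument.\<close>

definition schur_char :: "'k::field itself \<Rightarrow> nat \<Rightarrow> diagram \<Rightarrow> zpoly" where
  "schur_char _ n D = Sum_any (\<lambda>l. Poly_Mapping.single l
     (int (vectorspace.dim class_ring (weight_space n D l :: ('k, _) module))))"

end

theory Submission
  imports Defs "HOL-Library.Product_Lexorder"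
begin

text \<open>For a flag \<open>A\<close>, assigning to each row \<open>l\<close> a finite set \<open>A l\<close> of letters, let \<open>FM A D\<close> be the span
  of the products of minors \<open>\<Delta>\<^bsub>a,b\<^esub>\<close> over the columns \<open>a\<close> of \<open>D\<close>, evaluated on the generic matrix whose
  entries outside the flag are zero. The key is an exactness statement for transparent \<open>D\<close>: if the
  letter \<open>p\<close> enters the flag at row \<open>k\<close> and \<open>A k = A (k + 1)\<close>, then the elements of \<open>FM A D\<close> divisible by
  \<open>z\<^bsub>k,p\<^esub>\<close> are zero if \<open>D\<close> is \<open>k\<close>-full, and are \<open>z\<^bsub>k,p\<^esub>\<close> times the elements of \<open>FM A D'\<close> if \<open>D\<close> has a
  descent at \<open>k\<close>, where \<open>s\<^sub>k D\<close> is \<open>D'\<close> with the rows \<open>k\<close> and \<open>k + 1\<close> swapped. It is proved by induction on the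
  number of boxes, together with an intrinsic description \<open>Isp\<close> of \<open>FM A D\<close> inside the polynomials:
  expand along the top row \<open>x\<close>, and require that substituting \<open>\<Sum>\<^bsub>j\<in>B\<^esub> \<sigma>\<^sub>j z\<^sub>j + \<epsilon> z\<^sub>x\<close> for the row \<open>z\<^sub>x\<close> gives a
  polynomial divisible by \<open>\<epsilon>\<close> to the number of columns that contain \<open>B\<close> and \<open>x\<close>.

  Shrinking the constant flag one letter at a time to the standard flag, exactness shows that
  \<open>schur_rels\<close> is the kernel of the restricted minor map, so that the flagged Schur module is \<open>FM A D\<close>
  for the standard flag. Exactness in the weights in which the letter \<open>k + 1\<close> does not occur
  says \<open>R\<^sub>k\<^sub>+\<^sub>1 h = R\<^sub>k h + x\<^sub>k R\<^sub>k\<^sub>+\<^sub>1 h'\<close> for the characters \<open>h\<close> of \<open>D\<close> and \<open>h'\<close> of \<open>s\<^sub>k D\<close>, without the second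
  term if there is no descent at \<open>k\<close>. Summation over \<open>k\<close> gives \<open>(1 - R\<^sub>1) h\<close>, and \<open>Z\<close> inverts \<open>1 - R\<^sub>1\<close>.\<close>

text \<open>A span of products cannot be divided term by term: from \<open>V (k, p) * H\<close> in
  \<open>FM A D\<close> nothing about \<open>H\<close> can be read off the generators.
  \<open>Isp\<close> trades membership for conditions on coefficients and on powers of \<epsilon>,
  and these survive the cancellation of \<open>V (k, p)\<close>. The powers come from columns that
  contain \<open>B\<close> and \<open>x\<close>: there row \<open>x\<close> may be changed by
  multiples of the rows of \<open>B\<close> without changing the minor, so the substitution only
  contributes the factor \<epsilon>. Sufficiency of \<open>Isp\<close> is obtained by stripping
  letters off the flag, and each stripping uses exactness for the same \<open>D\<close>; exactness
  is therefore proved from \<open>Isp\<close> instead of from membership, with both statements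
  available for fewer boxes. The delicate case is the one in which the top row is
  \<open>k + 1\<close>. After the swap, row \<open>k\<close> becomes the top row, so
  \<open>H\<close> has to be described along row \<open>k\<close>, while the hypothesis gives
  divisibility along row \<open>k + 1\<close>. The two substitutions solve one linear relation
  between the rows for different rows, and they differ by a power of a \<sigma> that \<epsilon> does
  not divide.\<close>

type_synonym ('v, 'a) mp = "('v \<Rightarrow>\<^sub>0 nat) \<Rightarrow>\<^sub>0 'a"

abbreviation lk :: "('a \<Rightarrow>\<^sub>0 'b::zero) \<Rightarrow> 'a \<Rightarrow> 'b" where "lk \<equiv> Poly_Mapping.lookup"
abbreviation ks :: "('a \<Rightarrow>\<^sub>0 'b::zero) \<Rightarrow> 'a set" where "ks \<equiv> Poly_Mapping.keys"
abbreviation sg :: "'a \<Rightarrow> 'b \<Rightarrow> 'a \<Rightarrow>\<^sub>0 'b::zero" where "sg \<equiv> Poly_Mapping.single"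

section \<open>Monomials and substitution homomorphisms\<close>

definition V :: "'v \<Rightarrow> ('v, 'a::comm_ring_1) mp" where "V v = sg (sg v 1) 1"
definition C :: "'a \<Rightarrow> ('v, 'a::comm_ring_1) mp" where "C c = sg 0 c"

definition mon :: "('v \<Rightarrow> 'r) \<Rightarrow> ('v \<Rightarrow>\<^sub>0 nat) \<Rightarrow> 'r::comm_ring_1" where
  "mon g m = (\<Prod>v\<in>ks m. g v ^ lk m v)"

definition psub :: "('v \<Rightarrow> ('w, 'a) mp) \<Rightarrow> ('v, 'a::comm_ring_1) mp \<Rightarrow> ('w, 'a) mp" where
  "psub g F = (\<Sum>m\<in>ks F. C (lk F m) * mon g m)"

lemma C_simps [simp]: "C 0 = 0" "C 1 = 1" "C (a + b) = C a + C b" "C (a * b) = C a * C b" "C (- a) = - C a"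
  by (simp_all add: C_def single_add mult_single single_uminus)

lemma mon_superset: "finite S \<Longrightarrow> ks m \<subseteq> S \<Longrightarrow> mon g m = (\<Prod>v\<in>S. g v ^ lk m v)"
  unfolding mon_def by (intro prod.mono_neutral_left) (auto simp: in_keys_iff)

lemma mon_add: "mon g (m + n) = mon g m * mon g n"
proof -
  let ?S = "ks m \<union> ks n"
  have "ks (m + n) \<subseteq> ?S" by (rule keys_add)
  thus ?thesis by (simp add: mon_superset[of ?S] lookup_add power_add prod.distrib)
qed

lemma mon_0 [simp]: "mon g 0 = 1" by (simp add: mon_def)
lemma mon_single [simp]: "mon g (sg v n) = g v ^ n" by (cases "n = 0") (simp_all add: mon_def)

lemma psub_superset: "finite S \<Longrightarrow> ks F \<subseteq> S \<Longrightarrow> psub g F = (\<Sum>m\<in>S. C (lk F m) * mon g m)"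
  unfolding psub_def by (intro sum.mono_neutral_left) (auto simp: in_keys_iff)

lemma psub_0 [simp]: "psub g 0 = 0" by (simp add: psub_def)

lemma psub_add: "psub g (F + G) = psub g F + psub g G"
  using keys_add[of F G]
  by (simp add: psub_superset[of "ks F \<union> ks G"] lookup_add algebra_simps sum.distrib)

lemma psub_single: "psub g (sg m c) = C c * mon g m"
  by (cases "c = 0") (simp_all add: psub_def)

lemma psub_sum: "psub g (sum F A) = (\<Sum>a\<in>A. psub g (F a))"
  by (induction A rule: infinite_finite_induct) (auto simp: psub_add)

lemma mp_single_sum: "F = (\<Sum>m\<in>ks F. sg m (lk F m))"
  by (rule poly_mapping_eqI) (simp add: lookup_sum lookup_single when_def in_keys_iff)

lemma psub_mult: "psub g (F * G) = psub g F * psub g G"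
proof -
  have "F * G = (\<Sum>m\<in>ks F. \<Sum>n\<in>ks G. sg (m + n) (lk F m * lk G n))"
    using arg_cong2[where f="(*)", OF mp_single_sum[of F] mp_single_sum[of G]]
    by (simp add: sum_product mult_single)
  hence "psub g (F * G) = (\<Sum>m\<in>ks F. \<Sum>n\<in>ks G. (C (lk F m) * mon g m) * (C (lk G n) * mon g n))"
    by (simp add: psub_sum psub_single mon_add algebra_simps)
  also have "\<dots> = psub g F * psub g G"
    by (simp add: psub_def sum_product)
  finally show ?thesis .
qed

lemma psub_C [simp]: "psub g (C c) = C c" by (simp add: C_def psub_single)
lemma psub_V [simp]: "psub g (V v) = g v" by (simp add: V_def psub_single)
lemma psub_1 [simp]: "psub g 1 = 1" using psub_C[of g 1] by simp
lemma psub_uminus: "psub g (- F) = - psub g F"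
  using psub_add[of g F "- F"] by (simp add: eq_neg_iff_add_eq_0 add.commute)
lemma psub_diff: "psub g (F - G) = psub g F - psub g G"
  using psub_add[of g F "- G"] by (simp add: psub_uminus)
lemma psub_prod: "psub g (prod F A) = (\<Prod>a\<in>A. psub g (F a))"
  by (induction A rule: infinite_finite_induct) (auto simp: psub_mult)
lemma psub_power: "psub g (F ^ n) = psub g F ^ n"
  by (induction n) (auto simp: psub_mult)
lemma psub_prod_list: "psub g (prod_list xs) = prod_list (map (psub g) xs)"
  by (induction xs) (auto simp: psub_mult)
lemma psub_mon: "psub h (mon g m) = mon (\<lambda>v. psub h (g v)) m"
  by (simp add: mon_def psub_prod psub_power)

lemma psub_psub: "psub h (psub g F) = psub (\<lambda>v. psub h (g v)) F"
  by (simp add: psub_def[of g] psub_sum psub_mult psub_mon) (simp add: psub_def)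

lemma sg_1_mon: "sg m 1 = (mon V m :: ('v, 'a::comm_ring_1) mp)"
proof (induction m rule: Poly_Mapping.update_induct)
  case const thus ?case by simp
next
  case (update m v n)
  have e: "Poly_Mapping.update v n m = sg v n + m"
    using update by (intro poly_mapping_eqI) (auto simp: lookup_update lookup_add lookup_single when_def not_in_keys_iff_lookup_eq_zero)
  have "sg (sg v n) (1::'a) = V v ^ n"
  proof (induction n)
    case (Suc n)
    have "sg (sg v (Suc n)) (1::'a) = sg (sg v 1) 1 * sg (sg v n) 1"
      by (simp add: mult_single flip: single_add)
    thus ?case using Suc by (simp add: V_def)
  qed simp
  moreover have "sg (sg v n + m) (1::'a) = sg (sg v n) 1 * sg m 1" by (simp add: mult_single)
  ultimately show ?case unfolding e using update.IH by (simp add: mon_add)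
qed

lemma sg_C_mon: "sg m c = C c * (mon V m :: ('v, 'a::comm_ring_1) mp)"
  by (simp add: C_def mult_single flip: sg_1_mon)

lemma psub_V_id [simp]: "psub V F = F"
  by (subst (2) mp_single_sum[of F]) (simp add: psub_def sg_C_mon)

section \<open>Variables occurring in a polynomial\<close>

definition vars :: "('v, 'a::zero) mp \<Rightarrow> 'v set" where "vars F = (\<Union>m\<in>ks F. ks m)"

lemma psub_cong: "(\<And>v. v \<in> vars F \<Longrightarrow> g v = h v) \<Longrightarrow> psub g F = psub h F"
  unfolding psub_def mon_def vars_def
  by (intro sum.cong arg_cong2[where f="(*)"] prod.cong refl) (metis UN_I)

lemma vars_add: "vars (F + G) \<subseteq> vars F \<union> vars G" using keys_add[of F G] unfolding vars_def by blast
lemma vars_uminus [simp]: "vars (- F :: ('v, 'a::ab_group_add) mp) = vars F"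
  by (auto simp: vars_def in_keys_iff)
lemma vars_mult: "vars (F * G :: ('v, 'a::comm_ring_1) mp) \<subseteq> vars F \<union> vars G"
proof
  fix v assume "v \<in> vars (F * G)"
  then obtain m where m: "m \<in> ks (F * G)" "v \<in> ks m" by (auto simp: vars_def)
  then obtain a b where "a \<in> ks F" "b \<in> ks G" "m = a + b" using keys_mult[of F G] by auto
  thus "v \<in> vars F \<union> vars G" using m keys_add[of a b] unfolding vars_def by blast
qed
lemma vars_0 [simp]: "vars 0 = {}" by (simp add: vars_def)
lemma vars_C [simp]: "vars (C c) = {}" by (auto simp: vars_def C_def)
lemma vars_1 [simp]: "vars (1 :: ('v, 'a::comm_ring_1) mp) = {}" using vars_C[of 1] by simp
lemma vars_V [simp]: "vars (V v :: ('v, 'a::comm_ring_1) mp) = {v}" by (auto simp: vars_def V_def)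
lemma vars_sum: "vars (sum F A) \<subseteq> (\<Union>a\<in>A. vars (F a))"
proof (induction A rule: infinite_finite_induct)
  case (insert x A) thus ?case using vars_add[of "F x" "sum F A"] by auto
qed auto
lemma vars_prod: "vars (prod F A :: ('v, 'a::comm_ring_1) mp) \<subseteq> (\<Union>a\<in>A. vars (F a))"
proof (induction A rule: infinite_finite_induct)
  case (insert x A) thus ?case using vars_mult[of "F x" "prod F A"] by auto
qed auto
lemma vars_power: "vars (F ^ n :: ('v, 'a::comm_ring_1) mp) \<subseteq> vars F"
proof (induction n)
  case (Suc n) thus ?case using vars_mult[of F "F ^ n"] by auto
qed auto
lemma vars_psub: "vars (psub g F) \<subseteq> (\<Union>v\<in>vars F. vars (g v))"
proof -
  have "vars (C (lk F m) * mon g m) \<subseteq> (\<Union>v\<in>vars F. vars (g v))" if "m \<in> ks F" for m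
  proof -
    have "vars (mon g m) \<subseteq> (\<Union>v\<in>ks m. vars (g v))"
    proof -
      have "vars (mon g m) \<subseteq> (\<Union>v\<in>ks m. vars (g v ^ lk m v))" unfolding mon_def by (rule vars_prod)
      also have "\<dots> \<subseteq> (\<Union>v\<in>ks m. vars (g v))" by (intro UN_mono vars_power subset_refl)
      finally show ?thesis .
    qed
    also have "\<dots> \<subseteq> (\<Union>v\<in>vars F. vars (g v))" using that by (intro UN_mono) (auto simp: vars_def[of F])
    finally show ?thesis using vars_mult[of "C (lk F m)" "mon g m"] unfolding vars_C Un_empty_left by (rule order_trans[rotated])
  qed
  moreover have "vars (psub g F) \<subseteq> (\<Union>m\<in>ks F. vars (C (lk F m) * mon g m))"
    unfolding psub_def by (rule vars_sum)
  ultimately show ?thesis by (meson UN_least order_trans)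
qed

lemma mp_induct [case_names const var add mult]:
  assumes "\<And>c. P (C c)" "\<And>v. P (V v)" "\<And>F G. P F \<Longrightarrow> P G \<Longrightarrow> P (F + G)" "\<And>F G. P F \<Longrightarrow> P G \<Longrightarrow> P (F * G)"
  shows "P (F :: ('v, 'a::comm_ring_1) mp)"
proof -
  have one: "P 1" using assms(1)[of 1] by simp
  have p1: "P (V v ^ n)" for v n by (induction n) (simp_all add: one assms(2,4))
  have p2: "finite S \<Longrightarrow> P (\<Prod>v\<in>S. V v ^ h v)" for S and h :: "'v \<Rightarrow> nat"
    by (induction S rule: finite_induct) (simp_all add: one assms(4) p1)
  have p3: "finite S \<Longrightarrow> P (\<Sum>m\<in>S. C (h m) * mon V m)" for S and h :: "_ \<Rightarrow> 'a"
  proof (induction S rule: finite_induct)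
    case (insert m S)
    have "P (mon V m)" unfolding mon_def by (rule p2) simp
    hence "P (C (h m) * mon V m)" by (rule assms(4)[OF assms(1)])
    thus ?case using insert assms(3) by simp
  qed (use assms(1)[of 0] in simp)
  show ?thesis using p3[of "ks F" "lk F"] by (subst psub_V_id[symmetric], subst psub_def) simp
qed

lemma scale_conv: "scale c F = C c * F"
  by (simp add: scale_def C_def mult_map_scale_conv_mult)

lemma psub_scale: "psub g (scale c F) = scale c (psub g F)"
  by (simp add: scale_conv psub_mult)

lemma V_neq_0 [simp]: "V v \<noteq> (0 :: ('v, 'a::comm_ring_1) mp)"
  by (metis V_def lookup_single_eq lookup_zero zero_neq_one)

subsection \<open>Divisibility by a variable\<close>

lemma V_dvd_diff: "V v dvd F - psub (V(v := 0)) F"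
proof (induction F rule: mp_induct)
  case (var w) thus ?case by auto
next
  case (add F G)
  have "F + G - psub (V(v := 0)) (F + G) = (F - psub (V(v := 0)) F) + (G - psub (V(v := 0)) G)" by (simp add: psub_add)
  thus ?case using dvd_add[OF add] by metis
next
  case (mult F G)
  have "F * G - psub (V(v := 0)) (F * G) = (F - psub (V(v := 0)) F) * G + psub (V(v := 0)) F * (G - psub (V(v := 0)) G)"
    by (simp add: psub_mult algebra_simps)
  moreover have "V v dvd \<dots>" using mult by (intro dvd_add dvd_mult dvd_mult2)
  ultimately show ?case by (simp only:)
qed auto

text \<open>Once divisibility by a variable is the vanishing of a substitution, cancellations become
  calculations with ring homomorphisms.\<close>

lemma V_dvd_iff: "V v dvd F \<longleftrightarrow> psub (V(v := 0)) F = 0"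
proof
  assume "V v dvd F" thus "psub (V(v := 0)) F = 0" by (auto simp: psub_mult)
next
  assume "psub (V(v := 0)) F = 0" thus "V v dvd F" using V_dvd_diff[of v F] by simp
qed

text \<open>A variable is prime because setting it to 0 is a ring homomorphism into a domain. The
  linear order on the variables makes the polynomial ring an instance of a domain; for pairs of
  numbers the lexicographic order supplies it.\<close>

lemma V_dvd_mult:
  fixes P Q :: "('v::linorder, 'a::idom) mp"
  assumes "V v dvd P * Q" "\<not> V v dvd P" shows "V v dvd Q"
  using assms by (auto simp: V_dvd_iff psub_mult)

text \<open>Main use: a power of \<epsilon> dividing a product is moved past a factor that
  \<epsilon> does not divide.\<close>

lemma V_power_dvd_mult:
  fixes P Q :: "('v::linorder, 'a::idom) mp"
  assumes "V v ^ n dvd P * Q" "\<not> V v dvd P" shows "V v ^ n dvd Q"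
  using assms
proof (induction n arbitrary: Q)
  case (Suc n)
  have "V v dvd P * Q" using Suc.prems(1) by (metis dvd_mult_left power_Suc)
  then obtain R where R: "Q = V v * R" using V_dvd_mult Suc.prems(2) by blast
  have "V v * V v ^ n dvd V v * (P * R)" using Suc.prems(1) by (simp add: R algebra_simps)
  hence "V v ^ n dvd P * R" by simp
  hence "V v ^ n dvd R" by (rule Suc.IH[OF _ Suc.prems(2)])
  thus ?case unfolding R power_Suc by (rule mult_dvd_mono[OF dvd_refl])
qed simp

lemma V_dvd_V: "V v dvd (V w :: ('v, 'a::comm_ring_1) mp) \<longleftrightarrow> v = w"
  unfolding V_dvd_iff psub_V by simp

lemma not_V_dvd_free: "v \<notin> vars F \<Longrightarrow> F \<noteq> 0 \<Longrightarrow> \<not> V v dvd F"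
proof -
  assume "v \<notin> vars F" "F \<noteq> 0"
  moreover have "psub (V(v := 0)) F = psub V F" using \<open>v \<notin> vars F\<close> by (intro psub_cong) auto
  ultimately show ?thesis by (simp add: V_dvd_iff)
qed

lemma not_V_dvd_power: "v \<noteq> w \<Longrightarrow> \<not> V v dvd (V w ^ n :: ('v::linorder, 'a::idom) mp)"
  by (simp add: V_dvd_iff psub_power)

lemma lookup_single_mult: "lk (sg Y c * G) (Y + m) = c * lk (G :: ('v, 'a::comm_ring_1) mp) m"
proof -
  have "sg Y c * G = (\<Sum>n\<in>ks G. sg (Y + n) (c * lk G n))"
    by (subst mp_single_sum[of G]) (simp add: sum_distrib_left mult_single)
  hence "lk (sg Y c * G) (Y + m) = (\<Sum>n\<in>ks G. c * lk G n when n = m)"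
    by (simp add: lookup_sum lookup_single)
  thus ?thesis by (simp add: when_def in_keys_iff)
qed

lemma lookup_single_mult_0: "(\<And>m. k \<noteq> Y + m) \<Longrightarrow> lk (sg Y c * G) k = (0 :: 'a::comm_ring_1)"
proof -
  assume a: "\<And>m. k \<noteq> Y + m"
  have "sg Y c * G = (\<Sum>n\<in>ks G. sg (Y + n) (c * lk G n))"
    by (subst mp_single_sum[of G]) (simp add: sum_distrib_left mult_single)
  moreover have "Y + n \<noteq> k" for n using a[of n] by blast
  ultimately show ?thesis by (simp add: lookup_sum lookup_single when_def)
qed

lemma vars_V_mult: "vars H \<subseteq> vars (V v * H :: ('v, 'a::comm_ring_1) mp)"
proof
  fix w assume "w \<in> vars H"
  then obtain m where m: "m \<in> ks H" "w \<in> ks m" by (auto simp: vars_def)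
  have "sg v 1 + m \<in> ks (V v * H)" using m lookup_single_mult[of "sg v 1" 1 H m] by (simp add: V_def in_keys_iff)
  moreover have "w \<in> ks (sg v 1 + m)" using m by (auto simp: in_keys_iff lookup_add)
  ultimately show "w \<in> vars (V v * H)" unfolding vars_def by blast
qed

subsection \<open>Coefficients with respect to a set of variables\<close>

text \<open>The coefficient of the monomial \<open>X\<close>, where \<open>F\<close> is read as a
  polynomial in the variables of \<open>S\<close> over the remaining variables. It has this meaning
  for \<open>ks X \<subseteq> S\<close>; the condition on \<open>m\<close> discards monomials whose
  \<open>S\<close>-part is larger than \<open>X\<close>.\<close>

definition cf :: "'v set \<Rightarrow> ('v \<Rightarrow>\<^sub>0 nat) \<Rightarrow> ('v, 'a::comm_ring_1) mp \<Rightarrow> ('v, 'a) mp" where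
  "cf S X F = Abs_poly_mapping (\<lambda>m. if ks m \<inter> S = {} then lk F (X + m) else 0)"

lemma lookup_cf: "lk (cf S X F) m = (if ks m \<inter> S = {} then lk F (X + m) else 0)"
proof -
  have "finite {m. lk F (X + m) \<noteq> 0}"
    by (rule finite_imageD[of "\<lambda>m. X + m"], rule finite_subset[of _ "ks F"]) (auto simp: in_keys_iff inj_on_def)
  hence "finite {m. (if ks m \<inter> S = {} then lk F (X + m) else 0) \<noteq> 0}" by (rule finite_subset[rotated]) auto
  thus ?thesis by (simp add: cf_def)
qed

lemma cf_add: "cf S X (F + G) = cf S X F + cf S X G"
  by (rule poly_mapping_eqI) (simp add: lookup_cf lookup_add)
lemma cf_0 [simp]: "cf S X 0 = 0" by (rule poly_mapping_eqI) (simp add: lookup_cf)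
lemma cf_diff: "cf S X (F - G) = cf S X F - cf S X G"
  by (rule poly_mapping_eqI) (simp add: lookup_cf lookup_minus)
lemma cf_scale: "cf S X (scale c F) = scale c (cf S X F)"
  by (rule poly_mapping_eqI) (simp add: lookup_cf)
lemma cf_sum: "cf S X (sum F A) = (\<Sum>a\<in>A. cf S X (F a))"
  by (induction A rule: infinite_finite_induct) (auto simp: cf_add)

lemma vars_cf: "vars (cf S X F) \<inter> S = {}"
proof -
  have "ks m \<inter> S = {}" if "m \<in> ks (cf S X F)" for m
    using that by (auto simp: in_keys_iff[of m] lookup_cf split: if_splits)
  thus ?thesis by (auto simp: vars_def)
qed

lemma vars_cf_subset: "vars (cf S X F) \<subseteq> vars F"
proof
  fix v assume "v \<in> vars (cf S X F)"
  then obtain m where m: "m \<in> ks (cf S X F)" "v \<in> ks m" by (auto simp: vars_def)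
  hence "X + m \<in> ks F" "v \<in> ks (X + m)" by (auto simp: in_keys_iff lookup_cf lookup_add split: if_splits)
  thus "v \<in> vars F" unfolding vars_def by blast
qed

text \<open>The \<open>S\<close>-part of an exponent vector. The \<open>S\<close>-parts of the
  monomials of \<open>F\<close> form the finite index set of the expansion
  \<open>cf_decomp\<close>.\<close>

definition pr :: "'v set \<Rightarrow> ('v \<Rightarrow>\<^sub>0 nat) \<Rightarrow> ('v \<Rightarrow>\<^sub>0 nat)" where
  "pr S m = (\<Sum>v\<in>ks m \<inter> S. sg v (lk m v))"

lemma lookup_pr: "lk (pr S m) v = (if v \<in> S then lk m v else 0)"
  by (auto simp: pr_def lookup_sum lookup_single when_def in_keys_iff)

lemma keys_pr: "ks (pr S m) = ks m \<inter> S" by (auto simp: in_keys_iff lookup_pr split: if_splits)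

lemma pr_split: "pr S m + pr (- S) m = m" by (rule poly_mapping_eqI) (simp add: lookup_pr lookup_add)

lemma pure_add_eq:
  fixes X Y m n :: "'a \<Rightarrow>\<^sub>0 nat"
  assumes "ks X \<subseteq> S" "ks Y \<subseteq> S" "ks m \<inter> S = {}" "ks n \<inter> S = {}" "X + m = Y + n"
  shows "X = Y \<and> m = n"
proof -
  have e: "lk X v + lk m v = lk Y v + lk n v" for v using assms(5) by (metis lookup_add)
  have z: "v \<notin> ks k \<Longrightarrow> lk k v = 0" for v and k :: "'a \<Rightarrow>\<^sub>0 nat" by (simp add: in_keys_iff)
  have "lk X v = lk Y v \<and> lk m v = lk n v" for v
  proof (cases "v \<in> S")
    case True
    hence "lk m v = 0" "lk n v = 0" using assms(3,4) z by auto
    thus ?thesis using e[of v] by simp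
  next
    case False
    hence "lk X v = 0" "lk Y v = 0" using assms(1,2) z by blast+
    thus ?thesis using e[of v] by simp
  qed
  thus ?thesis by (auto intro: poly_mapping_eqI)
qed

lemma cf_pure_mult:
  assumes "ks X \<subseteq> S" "ks Y \<subseteq> S" "vars G \<inter> S = {}"
  shows "cf S X (sg Y 1 * G) = (if X = Y then G else 0)"
proof (rule poly_mapping_eqI)
  fix m
  have G0: "lk G n = 0" if "ks n \<inter> S \<noteq> {}" for n
  proof (rule ccontr)
    assume "lk G n \<noteq> 0"
    hence "n \<in> ks G" by (simp add: in_keys_iff)
    hence "ks n \<subseteq> vars G" by (auto simp: vars_def)
    thus False using assms(3) that by blast
  qed
  show "lk (cf S X (sg Y 1 * G)) m = lk (if X = Y then G else 0) m"
  proof (cases "ks m \<inter> S = {}")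
    case False thus ?thesis using G0 by (auto simp: lookup_cf)
  next
    case m: True
    show ?thesis
    proof (cases "X = Y")
      case True thus ?thesis using m lookup_single_mult[of Y 1 G m] by (simp add: lookup_cf)
    next
      case F: False
      have "lk (sg Y 1 * G) (X + m) = 0"
      proof (cases "\<exists>n. X + m = Y + n")
        case True
        then obtain n where n: "X + m = Y + n" by blast
        have "ks n \<inter> S \<noteq> {}" using pure_add_eq[OF assms(1,2) m _ n] F by blast
        thus ?thesis using G0 n lookup_single_mult[of Y 1 G n] by simp
      qed (use lookup_single_mult_0 in blast)
      thus ?thesis using m F by (simp add: lookup_cf)
    qed
  qed
qed

lemma cf_decomp: "F = (\<Sum>X\<in>pr S ` ks F. sg X 1 * cf S X F)"
proof -
  have "(\<Sum>X\<in>pr S ` ks F. sg X 1 * cf S X F) = (\<Sum>X\<in>pr S ` ks F. \<Sum>m\<in>{m\<in>ks F. pr S m = X}. sg m (lk F m))"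
  proof (rule sum.cong[OF refl])
    fix X assume "X \<in> pr S ` ks F"
    hence X: "ks X \<subseteq> S" by (auto simp: keys_pr)
    have "cf S X F = (\<Sum>n\<in>ks (cf S X F). sg n (lk F (X + n)))"
      by (subst mp_single_sum) (auto intro!: sum.cong simp: lookup_cf in_keys_iff split: if_splits)
    hence "sg X 1 * cf S X F = (\<Sum>n\<in>ks (cf S X F). sg (X + n) (lk F (X + n)))"
      by (metis (no_types, lifting) mult_1 mult_single sum.cong sum_distrib_left)
    also have "\<dots> = (\<Sum>m\<in>{m\<in>ks F. pr S m = X}. sg m (lk F m))"
    proof (rule sum.reindex_bij_witness[of _ "\<lambda>m. pr (-S) m" "\<lambda>n. X + n"])
      fix n assume "n \<in> ks (cf S X F)"
      hence n: "ks n \<inter> S = {}" "X + n \<in> ks F" by (auto simp: in_keys_iff lookup_cf split: if_splits)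
      have "pr S (X + n) = X \<and> pr (- S) (X + n) = n"
        using pure_add_eq[of "pr S (X + n)" S X "pr (- S) (X + n)" n] X n by (auto simp: keys_pr pr_split)
      thus "pr (- S) (X + n) = n" "X + n \<in> {m \<in> ks F. pr S m = X}" using n by auto
    next
      fix m assume m: "m \<in> {m \<in> ks F. pr S m = X}"
      thus "X + pr (- S) m = m" using pr_split[of S m] by auto
      thus "pr (- S) m \<in> ks (cf S X F)" using m by (auto simp: in_keys_iff lookup_cf keys_pr)
    qed simp
    finally show "sg X 1 * cf S X F = (\<Sum>m\<in>{m\<in>ks F. pr S m = X}. sg m (lk F m))" .
  qed
  also have "\<dots> = (\<Sum>m\<in>ks F. sg m (lk F m))"
    by (rule sum.image_gen[symmetric]) simp
  finally show ?thesis using mp_single_sum[of F] by simp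
qed

lemma cf_unique:
  assumes "finite T" "\<And>X. X \<in> T \<Longrightarrow> ks X \<subseteq> S" "\<And>X. X \<in> T \<Longrightarrow> vars (G X) \<inter> S = {}" "ks Y \<subseteq> S"
  shows "cf S Y (\<Sum>X\<in>T. sg X 1 * G X) = (if Y \<in> T then G Y else 0)"
proof -
  have "cf S Y (\<Sum>X\<in>T. sg X 1 * G X) = (\<Sum>X\<in>T. if Y = X then G X else 0)"
    unfolding cf_sum using assms by (intro sum.cong refl) (simp add: cf_pure_mult)
  thus ?thesis using assms(1) by simp
qed

lemma cf_zero_outside: "ks X \<subseteq> S \<Longrightarrow> X \<notin> pr S ` ks F \<Longrightarrow> cf S X F = 0"
  by (subst cf_decomp[of F S], subst cf_unique) (auto simp: keys_pr vars_cf)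

lemma cf_eqI: "(\<And>X. ks X \<subseteq> S \<Longrightarrow> cf S X F = cf S X G) \<Longrightarrow> F = G"
proof -
  assume a: "\<And>X. ks X \<subseteq> S \<Longrightarrow> cf S X F = cf S X G"
  have "cf S X (F - G) = 0" if "ks X \<subseteq> S" for X using a that by (simp add: cf_diff)
  hence "F - G = 0" by (subst cf_decomp[of "F - G" S]) (auto intro!: sum.neutral simp: keys_pr)
  thus ?thesis by simp
qed

lemma cf_free_mult:
  assumes "vars P \<inter> S = {}" "ks X \<subseteq> S"
  shows "cf S X (P * F) = P * cf S X F"
proof -
  have "P * F = (\<Sum>Y\<in>pr S ` ks F. sg Y 1 * (P * cf S Y F))"
    by (subst cf_decomp[of F S]) (simp add: sum_distrib_left mult.left_commute)
  moreover have "cf S X (\<Sum>Y\<in>pr S ` ks F. sg Y 1 * (P * cf S Y F)) = (if X \<in> pr S ` ks F then P * cf S X F else 0)"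
    using assms vars_cf[of S _ F] vars_mult[of P] by (intro cf_unique) (auto simp: keys_pr, blast)
  ultimately show ?thesis using assms(2) cf_zero_outside[of X S F] by auto
qed

lemma cf_V_mult: "v \<in> S \<Longrightarrow> cf S (sg v 1 + X) (V v * F) = cf S X F"
  by (rule poly_mapping_eqI) (simp add: lookup_cf V_def lookup_single_mult add.assoc)

text \<open>The substitution sends the expansion by \<open>S\<close>-monomials to an expansion of
  the same kind, and such an expansion is unique.\<close>

lemma cf_psub:
  assumes "\<And>v. v \<in> S \<Longrightarrow> g v = V v" "\<And>v. v \<in> vars F - S \<Longrightarrow> vars (g v) \<inter> S = {}" "ks X \<subseteq> S"
  shows "cf S X (psub g F) = psub g (cf S X F)"
proof -
  have m: "psub g (sg Y 1) = sg Y 1" if "ks Y \<subseteq> S" for Y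
    using psub_cong[of "sg Y 1 :: ('a, 'b) mp" g V] assms(1) that by (auto simp: vars_def)
  have "psub g F = (\<Sum>Y\<in>pr S ` ks F. sg Y 1 * psub g (cf S Y F))"
    by (subst cf_decomp[of F S]) (auto simp: psub_sum psub_mult m keys_pr intro!: sum.cong)
  moreover have "vars (psub g (cf S Y F)) \<inter> S = {}" for Y
    using vars_psub[of g "cf S Y F"] vars_cf[of S Y F] vars_cf_subset[of S Y F] assms(2) by blast
  hence "cf S X (\<Sum>Y\<in>pr S ` ks F. sg Y 1 * psub g (cf S Y F)) = (if X \<in> pr S ` ks F then psub g (cf S X F) else 0)"
    using assms(3) by (intro cf_unique) (auto simp: keys_pr)
  ultimately show ?thesis using assms(3) cf_zero_outside[of X S F] by auto
qed

lemma cf_comm: "S \<inter> T = {} \<Longrightarrow> ks X \<subseteq> S \<Longrightarrow> ks Y \<subseteq> T \<Longrightarrow> cf S X (cf T Y F) = cf T Y (cf S X F)"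
proof (rule poly_mapping_eqI)
  fix m assume a: "S \<inter> T = {}" "ks X \<subseteq> S" "ks Y \<subseteq> T"
  have k: "ks (n + m) = ks n \<union> ks m" for n :: "'a \<Rightarrow>\<^sub>0 nat" by (auto simp: in_keys_iff lookup_add)
  show "lk (cf S X (cf T Y F)) m = lk (cf T Y (cf S X F)) m"
    using a by (auto simp: lookup_cf k add.left_commute)
qed

section \<open>Images of subspaces under substitution\<close>

lemma subspace_psub_image: "pm.subspace W \<Longrightarrow> pm.subspace (psub g ` W)"
  unfolding pm.subspace_def
  by (auto simp: image_iff psub_scale[symmetric] psub_add[symmetric] intro: bexI[of _ 0])

lemma psub_image_span: "psub g ` pm.span T = pm.span (psub g ` T)"
proof
  show "psub g ` pm.span T \<subseteq> pm.span (psub g ` T)"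
  proof
    fix y assume "y \<in> psub g ` pm.span T"
    then obtain x where x: "x \<in> pm.span T" "y = psub g x" by auto
    have "psub g x \<in> pm.span (psub g ` T)" using x(1)
      by (induction rule: pm.span_induct_alt) (auto simp: psub_add psub_scale intro: pm.span_add pm.span_scale pm.span_base pm.span_zero)
    thus "y \<in> pm.span (psub g ` T)" using x by simp
  qed
  show "pm.span (psub g ` T) \<subseteq> psub g ` pm.span T"
    by (rule pm.span_minimal) (auto intro: pm.span_base subspace_psub_image)
qed

section \<open>Products of flagged minors\<close>

abbreviation sl :: "nat set \<Rightarrow> nat list" where "sl \<equiv> sorted_list_of_set"

section \<open>Minors and their Laplace expansions\<close>

lemma z_var_V: "z_var p q = V (p, q)" by (simp add: z_var_def V_def)

lemma comm_ring_hom_psub: "comm_ring_hom (psub g)"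
  by unfold_locales (simp_all add: psub_add psub_mult)

lemma psub_minor: "psub g (minor a b) = det (mat (card a) (card b) (\<lambda>(i, j). g (sl a ! i, sl b ! j)))"
proof -
  interpret comm_ring_hom "psub g" by (rule comm_ring_hom_psub)
  have "map_mat (psub g) (mat (card a) (card b) (\<lambda>(i, j). z_var (sl a ! i) (sl b ! j)))
      = mat (card a) (card b) (\<lambda>(i, j). g (sl a ! i, sl b ! j))"
    by (rule eq_matI) (auto simp: z_var_V)
  thus ?thesis unfolding minor_def by (metis hom_det)
qed

lemma sl_remove:
  assumes "finite a" "i < card a" "i' < card a - 1"
  shows "sl (a - {sl a ! i}) ! i' = sl a ! (if i' < i then i' else Suc i')"
proof -
  have "sl (a - {sl a ! i}) = remove1 (sl a ! i) (sl a)" using assms by (simp add: sorted_list_of_set_remove)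
  also have "\<dots> = take i (sl a) @ drop (Suc i) (sl a)"
  proof -
    have e: "sl a = take i (sl a) @ sl a ! i # drop (Suc i) (sl a)"
      using assms by (simp add: id_take_nth_drop)
    have "distinct (sl a)" by simp
    hence "sl a ! i \<notin> set (take i (sl a))" by (subst (asm) e) auto
    thus ?thesis by (subst (2) e) (simp add: remove1_append)
  qed
  finally show ?thesis using assms by (simp add: nth_append)
qed

lemma sl_nth_in: "finite a \<Longrightarrow> i < card a \<Longrightarrow> sl a ! i \<in> a"
  by (metis length_sorted_list_of_set nth_mem set_sorted_list_of_set)

lemma sl_index: "finite a \<Longrightarrow> x \<in> a \<Longrightarrow> \<exists>i<card a. sl a ! i = x"
  by (metis in_set_conv_nth length_sorted_list_of_set set_sorted_list_of_set)

lemma sl_inj: "finite a \<Longrightarrow> i < card a \<Longrightarrow> j < card a \<Longrightarrow> sl a ! i = sl a ! j \<Longrightarrow> i = j"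
  by (metis distinct_sorted_list_of_set length_sorted_list_of_set nth_eq_iff_index_eq)

lemma sl_bij: "finite a \<Longrightarrow> bij_betw ((!) (sl a)) {..<card a} a"
  using sl_index sl_nth_in sl_inj by (auto simp: bij_betw_def inj_on_def image_iff)

lemma C_power: "C (a ^ n) = C a ^ n" by (induction n) simp_all

lemma minor_mat_delete:
  assumes "finite a" "finite b" "card a = card b" "i < card a" "j < card b"
  shows "det (mat_delete (mat (card a) (card b) (\<lambda>(i, j). z_var (sl a ! i) (sl b ! j))) i j :: 'k::field matpoly mat)
     = minor (a - {sl a ! i}) (b - {sl b ! j})"
proof -
  have "card (a - {sl a ! i}) = card a - 1" "card (b - {sl b ! j}) = card b - 1"
    using assms by (auto simp: sl_nth_in)
  moreover have "(mat_delete (mat (card a) (card b) (\<lambda>(i, j). z_var (sl a ! i) (sl b ! j))) i j :: 'k matpoly mat)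
    = mat (card a - 1) (card b - 1) (\<lambda>(i', j'). z_var (sl (a - {sl a ! i}) ! i') (sl (b - {sl b ! j}) ! j'))"
    by (rule eq_matI) (use assms in \<open>auto simp: mat_delete_def sl_remove\<close>)
  ultimately show ?thesis by (simp only: minor_def)
qed

text \<open>Laplace expansion with unnamed signs. Positions of letters enter only through the signs,
  so the sum can run over the letters of \<open>b\<close> instead of column indices.\<close>

lemma minor_row:
  assumes "finite c" "finite b" "card b = card c" "x \<in> c"
  shows "\<exists>s :: nat \<Rightarrow> 'k::field. minor c b = (\<Sum>q\<in>b. C (s q) * V (x, q) * minor (c - {x}) (b - {q}))"
proof -
  define n where "n = card c"
  let ?A = "mat (card c) (card b) (\<lambda>(i, j). z_var (sl c ! i) (sl b ! j)) :: 'k matpoly mat"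
  obtain i where i: "i < n" "sl c ! i = x" using sl_index assms n_def by blast
  define s :: "nat \<Rightarrow> 'k" where "s q = (-1) ^ (i + the_inv_into {..<n} ((!) (sl b)) q)" for q
  have bij: "bij_betw ((!) (sl b)) {..<n} b" using sl_bij assms n_def by metis
  have "minor c b = (\<Sum>j<n. ?A $$ (i, j) * cofactor ?A i j)"
    unfolding minor_def using laplace_expansion_row[of ?A n i] assms i by (simp add: n_def)
  also have "\<dots> = (\<Sum>j<n. C (s (sl b ! j)) * V (x, sl b ! j) * minor (c - {x}) (b - {sl b ! j}))"
  proof (rule sum.cong[OF refl])
    fix j assume j: "j \<in> {..<n}"
    have "the_inv_into {..<n} ((!) (sl b)) (sl b ! j) = j"
      using bij j by (intro the_inv_into_f_f) (auto simp: bij_betw_def)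
    moreover have "det (mat_delete ?A i j) = minor (c - {x}) (b - {sl b ! j})"
      using minor_mat_delete[of c b i j] assms i j n_def by simp
    ultimately show "?A $$ (i, j) * cofactor ?A i j = C (s (sl b ! j)) * V (x, sl b ! j) * minor (c - {x}) (b - {sl b ! j})"
      using i j assms n_def by (simp add: cofactor_def s_def C_power z_var_V)
  qed
  also have "\<dots> = (\<Sum>q\<in>b. C (s q) * V (x, q) * minor (c - {x}) (b - {q}))"
    by (rule sum.reindex_bij_betw[OF bij])
  finally show ?thesis by blast
qed

text \<open>The coefficients are recorded as nonzero because \<open>V_mult_FM\<close> and
  \<open>V_FM_Bad\<close> divide by the one belonging to the row \<open>k\<close>.\<close>

lemma minor_col:
  assumes "finite c" "finite b" "card b = card c" "q \<in> b"
  shows "\<exists>s :: nat \<Rightarrow> 'k::field. (\<forall>x. s x \<noteq> 0) \<and> minor c b = (\<Sum>x\<in>c. C (s x) * V (x, q) * minor (c - {x}) (b - {q}))"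
proof -
  define n where "n = card c"
  let ?A = "mat (card c) (card b) (\<lambda>(i, j). z_var (sl c ! i) (sl b ! j)) :: 'k matpoly mat"
  obtain j where j: "j < n" "sl b ! j = q" using sl_index assms n_def by metis
  define s :: "nat \<Rightarrow> 'k" where "s x = (-1) ^ (the_inv_into {..<n} ((!) (sl c)) x + j)" for x
  have bij: "bij_betw ((!) (sl c)) {..<n} c" using sl_bij assms n_def by metis
  have "minor c b = (\<Sum>i<n. ?A $$ (i, j) * cofactor ?A i j)"
    unfolding minor_def using laplace_expansion_column[of ?A n j] assms j by (simp add: n_def)
  also have "\<dots> = (\<Sum>i<n. C (s (sl c ! i)) * V (sl c ! i, q) * minor (c - {sl c ! i}) (b - {q}))"
  proof (rule sum.cong[OF refl])
    fix i assume i: "i \<in> {..<n}"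
    have "the_inv_into {..<n} ((!) (sl c)) (sl c ! i) = i"
      using bij i by (intro the_inv_into_f_f) (auto simp: bij_betw_def)
    moreover have "det (mat_delete ?A i j) = minor (c - {sl c ! i}) (b - {q})"
      using minor_mat_delete[of c b i j] assms i j n_def by simp
    ultimately show "?A $$ (i, j) * cofactor ?A i j = C (s (sl c ! i)) * V (sl c ! i, q) * minor (c - {sl c ! i}) (b - {q})"
      using i j assms n_def by (simp add: cofactor_def s_def C_power z_var_V)
  qed
  also have "\<dots> = (\<Sum>x\<in>c. C (s x) * V (x, q) * minor (c - {x}) (b - {q}))"
    by (rule sum.reindex_bij_betw[OF bij])
  finally show ?thesis by (intro exI[of _ s]) (simp add: s_def)
qed

lemma minor_empty [simp]: "minor {} {} = 1" by (simp add: minor_def)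

text \<open>Setting all entries outside \<open>a \<times> b\<close> to zero does not change the
  submatrix.\<close>

lemma vars_minor:
  assumes "finite a" "finite b" "card b = card a"
  shows "vars (minor a b :: 'a::field matpoly) \<subseteq> a \<times> b"
proof -
  let ?h = "(\<lambda>w. if w \<in> a \<times> b then V w else 0) :: nat \<times> nat \<Rightarrow> 'a matpoly"
  have "psub ?h (minor a b) = psub V (minor a b)"
    unfolding psub_minor using assms by (intro arg_cong[where f=det] eq_matI) (auto simp: sl_nth_in)
  moreover have "vars (?h w) \<subseteq> a \<times> b" for w by simp
  ultimately show ?thesis using vars_psub[of ?h "minor a b"]
    by (metis (no_types, lifting) UN_least order_trans psub_V_id)
qed

section \<open>Spans of products of minors\<close>

definition adm :: "diagram \<Rightarrow> nat set list \<Rightarrow> bool" where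
  "adm D \<tau> \<longleftrightarrow> list_all2 (\<lambda>c b. finite b \<and> card b = card c) D \<tau>"

definition mprod :: "diagram \<Rightarrow> nat set list \<Rightarrow> 'k::field matpoly" where
  "mprod D \<tau> = prod_list (map2 minor D \<tau>)"

text \<open>The letters are not bounded by any \<open>n\<close>, so that \<open>FM\<close> depends
  only on the diagram and the flag. The passage to tuples with letters up to \<open>n\<close> is
  \<open>rA_uncontained\<close>.\<close>

definition gens :: "diagram \<Rightarrow> 'k::field matpoly set" where
  "gens D = {mprod D \<tau> | \<tau>. adm D \<tau>}"

definition rA :: "(nat \<Rightarrow> nat set) \<Rightarrow> 'k::field matpoly \<Rightarrow> 'k matpoly" where
  "rA A = psub (\<lambda>(l, q). if l = 0 \<or> q \<in> A l then V (l, q) else 0)"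

definition FM :: "(nat \<Rightarrow> nat set) \<Rightarrow> diagram \<Rightarrow> 'k::field matpoly set" where
  "FM A D = pm.span (rA A ` gens D)"

text \<open>An element for one flag is the restriction of an unrestricted combination of products.
  Restricting that combination to a larger flag is how elements are lifted.\<close>

lemma FM_image: "FM A D = rA A ` pm.span (gens D)"
  by (simp add: FM_def rA_def psub_image_span)

lemma subspace_FM: "pm.subspace (FM A D)" by (simp add: FM_def)

lemma gens_Nil [simp]: "gens [] = {1}" by (auto simp: gens_def adm_def mprod_def)

lemma gens_Cons: "gens (c # D) = {minor c b * P | b P. finite b \<and> card b = card c \<and> P \<in> gens D}"
proof (intro Set.set_eqI iffI)
  fix F :: "'a matpoly" assume "F \<in> gens (c # D)"
  then obtain \<tau> where t: "adm (c # D) \<tau>" "F = mprod (c # D) \<tau>" by (auto simp: gens_def)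
  then obtain b \<tau>' where "\<tau> = b # \<tau>'" "finite b" "card b = card c" "adm D \<tau>'"
    by (auto simp: adm_def list_all2_Cons1)
  thus "F \<in> {minor c b * P | b P. finite b \<and> card b = card c \<and> P \<in> gens D}"
    using t by (auto simp: gens_def mprod_def)
next
  fix F :: "'a matpoly" assume "F \<in> {minor c b * P | b P. finite b \<and> card b = card c \<and> P \<in> gens D}"
  then obtain b \<tau> where "F = minor c b * mprod D \<tau>" "finite b" "card b = card c" "adm D \<tau>" by (auto simp: gens_def)
  hence "F = mprod (c # D) (b # \<tau>)" "adm (c # D) (b # \<tau>)" by (simp_all add: mprod_def adm_def)
  thus "F \<in> gens (c # D)" by (auto simp: gens_def)
qed

lemma gens_middle: "gens (D1 @ c # D2) = gens (c # D1 @ D2)"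
proof (induction D1)
  case (Cons d D1)
  show ?case unfolding append_Cons gens_Cons[of d] Cons.IH
    unfolding gens_Cons by (auto; metis mult.left_commute)
qed simp

lemma gens_mset: "mset D = mset D' \<Longrightarrow> gens D = (gens D' :: 'k::field matpoly set)"
proof (induction D arbitrary: D')
  case (Cons c D)
  have "c \<in> set D'" using Cons.prems by (metis list.set_intros(1) set_mset_mset)
  then obtain D1 D2 where D': "D' = D1 @ c # D2" by (meson split_list)
  have "gens D = (gens (D1 @ D2) :: 'k matpoly set)" using Cons.prems by (intro Cons.IH) (simp add: D')
  thus ?case unfolding D' gens_middle gens_Cons by simp
qed simp

lemma gens_empty_column: "gens ({} # D) = gens D"
proof -
  have "gens ({} # D) = {minor {} {} * P | P :: 'a matpoly. P \<in> gens D}"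
    unfolding gens_Cons by (metis (no_types, opaque_lifting) card_0_eq card.empty finite.emptyI)
  thus ?thesis by simp
qed

lemma gens_filter: "gens (filter (\<lambda>a. a \<noteq> {}) D) = (gens D :: 'a::field matpoly set)"
proof (induction D)
  case (Cons c D)
  thus ?case
  proof (cases "c = {}")
    case True thus ?thesis using Cons by (simp add: gens_empty_column)
  next
    case False
    hence "gens (filter (\<lambda>a. a \<noteq> {}) (c # D)) = (gens (c # filter (\<lambda>a. a \<noteq> {}) D) :: 'a matpoly set)" by simp
    also have "\<dots> = gens (c # D)" unfolding gens_Cons Cons ..
    finally show ?thesis .
  qed
qed simp

lemma gens_equiv: "D \<simeq> D' \<Longrightarrow> gens D = (gens D' :: 'a::field matpoly set)"
proof -
  assume "D \<simeq> D'"
  hence "gens (filter (\<lambda>a. a \<noteq> {}) D) = (gens (filter (\<lambda>a. a \<noteq> {}) D') :: 'a matpoly set)"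
    by (intro gens_mset) (simp add: diag_eq_def)
  thus ?thesis by (simp only: gens_filter)
qed

lemma FM_mset: "mset D = mset D' \<Longrightarrow> FM A D = FM A D'" unfolding FM_def by (simp only: gens_mset[of D D'])
lemma FM_equiv: "D \<simeq> D' \<Longrightarrow> FM A D = FM A D'" unfolding FM_def by (simp only: gens_equiv[of D D'])

lemma FM_least: "pm.subspace W \<Longrightarrow> (\<And>P. P \<in> gens D \<Longrightarrow> rA A P \<in> W) \<Longrightarrow> FM A D \<subseteq> W"
  unfolding FM_def by (rule pm.span_minimal) auto

lemma subspace_vimage_mult: "pm.subspace W \<Longrightarrow> pm.subspace {F. P * F \<in> W}" for P :: "('v, 'a::field) mp"
  by (auto simp: pm.subspace_def distrib_left scale_conv mult.left_commute[of P])

lemma rA_mult: "rA A (F * G) = rA A F * rA A G" by (simp add: rA_def psub_mult)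
lemma rA_scale: "rA A (scale c F) = scale c (rA A F)" by (simp add: rA_def psub_scale)

lemma FM_Cons_mult:
  assumes "F \<in> FM A D" "finite b" "card b = card c"
  shows "rA A (minor c b) * F \<in> FM A (c # D)"
proof -
  have "FM A D \<subseteq> {F :: 'a matpoly. rA A (minor c b) * F \<in> FM A (c # D)}"
  proof (rule FM_least)
    show "pm.subspace {F. rA A (minor c b) * F \<in> FM A (c # D)}" by (intro subspace_vimage_mult subspace_FM)
    fix P :: "'a matpoly" assume "P \<in> gens D"
    hence "minor c b * P \<in> gens (c # D)" using assms by (auto simp: gens_Cons)
    hence "rA A (minor c b * P) \<in> FM A (c # D)" unfolding FM_def by (intro pm.span_base) auto
    thus "rA A P \<in> {F. rA A (minor c b) * F \<in> FM A (c # D)}" by (simp add: rA_mult)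
  qed
  thus ?thesis using assms by auto
qed

lemma FM_Nil: "FM A [] = pm.span {1}" by (simp add: FM_def rA_def)

definition rowset :: "diagram \<Rightarrow> nat set" where "rowset D = \<Union> (set D)"

lemma is_diagram_Cons: "is_diagram (c # D) \<longleftrightarrow> finite c \<and> 0 \<notin> c \<and> is_diagram D"
  by (auto simp: is_diagram_def)

lemma subspace_vars: "pm.subspace {F :: ('v, 'a::field) mp. vars F \<subseteq> S}"
proof (rule pm.subspaceI)
  fix c and F :: "('v, 'a) mp" assume "F \<in> {F. vars F \<subseteq> S}"
  thus "scale c F \<in> {F. vars F \<subseteq> S}" using vars_mult[of "C c" F] by (auto simp: scale_conv)
next
  fix F G :: "('v, 'a) mp" assume "F \<in> {F. vars F \<subseteq> S}" "G \<in> {F. vars F \<subseteq> S}"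
  thus "F + G \<in> {F. vars F \<subseteq> S}" using vars_add[of F G] by auto
qed simp

lemma vars_FM:
  assumes "is_diagram D" "F \<in> FM A D"
  shows "vars F \<subseteq> {(l, q). l \<in> rowset D \<and> q \<in> A l}"
proof -
  have g: "vars P \<subseteq> rowset D \<times> UNIV" if "P \<in> gens D" "is_diagram D" for D and P :: "'k::field matpoly"
    using that
  proof (induction D arbitrary: P)
    case (Cons c D)
    then obtain b Q where P: "P = minor c b * Q" "finite b" "card b = card c" "Q \<in> gens D" by (auto simp: gens_Cons)
    have "vars (minor c b :: 'k matpoly) \<subseteq> c \<times> UNIV" using vars_minor[of c b] P Cons.prems by (auto simp: is_diagram_Cons)
    moreover have "vars Q \<subseteq> rowset D \<times> UNIV" using Cons P by (auto simp: is_diagram_Cons)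
    ultimately show ?case unfolding P using vars_mult[of "minor c b" Q] by (auto simp: rowset_def)
  qed simp
  have "FM A D \<subseteq> {F :: 'a matpoly. vars F \<subseteq> {(l, q). l \<in> rowset D \<and> q \<in> A l}}"
  proof (rule FM_least[OF subspace_vars])
    fix P :: "'a matpoly" assume P: "P \<in> gens D"
    let ?g = "\<lambda>(l, q). if l = 0 \<or> q \<in> A l then V (l, q) else 0 :: 'a matpoly"
    have z: "0 \<notin> rowset D" using assms(1) by (auto simp: rowset_def is_diagram_def)
    have "vars (?g v) \<subseteq> {(l, q). l \<in> rowset D \<and> q \<in> A l}" if "v \<in> vars P" for v
    proof (cases v)
      case (Pair l q)
      hence l: "l \<in> rowset D" using g[OF P assms(1)] that by auto
      hence "l \<noteq> 0" using z by metis
      thus ?thesis using l by (simp add: Pair)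
    qed
    moreover have "vars (rA A P) \<subseteq> (\<Union>v\<in>vars P. vars (?g v))" unfolding rA_def by (rule vars_psub)
    ultimately show "rA A P \<in> {F. vars F \<subseteq> {(l, q). l \<in> rowset D \<and> q \<in> A l}}" by blast
  qed
  thus ?thesis using assms by auto
qed

section \<open>Expansion along a row\<close>

definition rvars :: "nat \<Rightarrow> (nat \<times> nat) set" where "rvars x = {x} \<times> UNIV"
definition dg :: "('v \<Rightarrow>\<^sub>0 nat) \<Rightarrow> nat" where "dg X = (\<Sum>v\<in>ks X. lk X v)"
definition delrow :: "nat \<Rightarrow> diagram \<Rightarrow> diagram" where "delrow x D = map (\<lambda>c. c - {x}) D"
definition nB :: "nat \<Rightarrow> nat set \<Rightarrow> diagram \<Rightarrow> nat" where "nB x B D = length (filter (\<lambda>c. x \<in> c \<and> B \<subseteq> c) D)"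

text \<open>Row \<open>0\<close> of the generic matrix does not occur in the minors of a diagram; its variables serve as
  \<open>\<epsilon> = z\<^sub>0\<^sub>0\<close> and \<open>\<sigma>\<^sub>j = z\<^sub>0\<^sub>j\<close>, and no flag restricts it.\<close>

definition sigma :: "nat \<Rightarrow> nat set \<Rightarrow> 'k::field matpoly \<Rightarrow> 'k matpoly" where
  "sigma x B = psub (\<lambda>(l, q). if l = x then (\<Sum>j\<in>B. V (0, j) * V (j, q)) + V (0, 0) * V (x, q) else V (l, q))"

text \<open>The first two clauses treat the monomials of row \<open>x\<close> separately from each
  other. Only the third one sees how the coefficients of different monomials fit together.\<close>

definition Isp :: "nat \<Rightarrow> (nat \<Rightarrow> nat set) \<Rightarrow> diagram \<Rightarrow> 'k::field matpoly \<Rightarrow> bool" where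
  "Isp x A D F \<longleftrightarrow>
    (\<forall>X. ks X \<subseteq> rvars x \<longrightarrow> cf (rvars x) X F \<in> FM A (delrow x D)) \<and>
    (\<forall>X. ks X \<subseteq> rvars x \<longrightarrow> cf (rvars x) X F \<noteq> 0 \<longrightarrow> dg X = nB x {} D \<and> snd ` ks X \<subseteq> A x) \<and>
    (\<forall>B. x \<notin> B \<longrightarrow> V (0, 0) ^ nB x B D dvd rA A (sigma x B F))"

lemma dg_superset: "finite S \<Longrightarrow> ks X \<subseteq> S \<Longrightarrow> dg X = (\<Sum>v\<in>S. lk X v)"
  unfolding dg_def by (intro sum.mono_neutral_left) (auto simp: in_keys_iff)
lemma dg_0 [simp]: "dg 0 = 0" by (simp add: dg_def)
lemma dg_single [simp]: "dg (sg v n) = n" by (cases "n = 0") (simp_all add: dg_def)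
lemma dg_add: "dg (X + Y) = dg X + dg Y"
  using keys_add[of X Y] by (simp add: dg_superset[of "ks X \<union> ks Y"] lookup_add sum.distrib)

lemma nB_simps [simp]: "nB x B [] = 0" "nB x B (c # D) = (if x \<in> c \<and> B \<subseteq> c then 1 else 0) + nB x B D"
  by (simp_all add: nB_def)
lemma nB_append [simp]: "nB x B (D1 @ D2) = nB x B D1 + nB x B D2" by (simp add: nB_def)
lemma nB_mset: "mset D = mset D' \<Longrightarrow> nB x B D = nB x B D'"
  unfolding nB_def by (metis mset_filter size_mset)
lemma delrow_simps [simp]: "delrow x [] = []" "delrow x (c # D) = (c - {x}) # delrow x D"
  "delrow x (D1 @ D2) = delrow x D1 @ delrow x D2"
  by (simp_all add: delrow_def)

lemma is_diagram_delrow: "is_diagram D \<Longrightarrow> is_diagram (delrow x D)" by (auto simp: is_diagram_def delrow_def)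
lemma rowset_delrow: "rowset (delrow x D) = rowset D - {x}" by (auto simp: rowset_def delrow_def)

section \<open>Degree and letters in a single row\<close>

definition XG :: "nat \<Rightarrow> (nat \<Rightarrow> nat set) \<Rightarrow> nat \<Rightarrow> 'k::field matpoly set \<Rightarrow> 'k matpoly set" where
  "XG x A m W = {sg X 1 * H | X H. ks X \<subseteq> rvars x \<and> snd ` ks X \<subseteq> A x \<and> dg X = m \<and> H \<in> W}"

lemma XG_I: "ks X \<subseteq> rvars x \<Longrightarrow> snd ` ks X \<subseteq> A x \<Longrightarrow> dg X = m \<Longrightarrow> H \<in> W \<Longrightarrow> sg X 1 * H \<in> XG x A m W"
  by (auto simp: XG_def)

lemma span_mult_closed:
  fixes P :: "('v, 'a::field) mp"
  assumes "F \<in> pm.span S" "\<And>G. G \<in> S \<Longrightarrow> P * G \<in> pm.span T"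
  shows "P * F \<in> pm.span T"
proof -
  have "pm.span S \<subseteq> {F. P * F \<in> pm.span T}"
    using assms(2) by (intro pm.span_minimal subspace_vimage_mult) auto
  thus ?thesis using assms(1) by auto
qed

text \<open>By Laplace expansion each column containing \<open>x\<close> contributes one entry of
  row \<open>x\<close> and a minor of the column without \<open>x\<close>. The degree therefore
  counts these columns.\<close>

lemma gens_XG:
  assumes "P \<in> gens D" "is_diagram D" "x \<ge> 1"
  shows "rA A P \<in> pm.span (XG x A (nB x {} D) (FM A (delrow x D)))"
  using assms
proof (induction D arbitrary: P)
  case Nil
  have "(1 :: 'a matpoly) \<in> XG x A 0 (FM A [])"
    unfolding XG_def by (rule CollectI, rule exI[of _ 0], rule exI[of _ 1]) (auto simp: FM_Nil intro: pm.span_base)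
  thus ?case using Nil by (auto intro: pm.span_base simp: rA_def)
next
  case (Cons c D)
  then obtain b Q where P: "P = minor c b * Q" "finite b" "card b = card c" "Q \<in> gens D" by (auto simp: gens_Cons)
  let ?n = "nB x {} D" and ?W = "FM A (delrow x D) :: 'a matpoly set"
  have Q: "rA A Q \<in> pm.span (XG x A ?n ?W)" using Cons P by (auto simp: is_diagram_Cons)
  have c: "finite c" using Cons.prems by (simp add: is_diagram_Cons)
  show ?case
  proof (cases "x \<in> c")
    case False
    hence d: "c - {x} = c" by auto
    have "rA A (minor c b) * rA A Q \<in> pm.span (XG x A ?n (FM A (c # delrow x D)))"
    proof (rule span_mult_closed[OF Q])
      fix G assume "G \<in> XG x A ?n ?W"
      then obtain X H where G: "G = sg X 1 * H" "ks X \<subseteq> rvars x" "snd ` ks X \<subseteq> A x" "dg X = ?n" "H \<in> ?W" by (auto simp: XG_def)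
      have "rA A (minor c b) * G = sg X 1 * (rA A (minor c b) * H)" by (simp add: G mult.left_commute)
      moreover have "rA A (minor c b) * H \<in> FM A (c # delrow x D)" using P G by (intro FM_Cons_mult)
      ultimately have "rA A (minor c b) * G \<in> XG x A ?n (FM A (c # delrow x D))"
        unfolding XG_def using G(2-4) by blast
      thus "rA A (minor c b) * G \<in> pm.span (XG x A ?n (FM A (c # delrow x D)))" by (rule pm.span_base)
    qed
    thus ?thesis using False by (simp add: P rA_mult d)
  next
    case True
    obtain s :: "nat \<Rightarrow> 'a" where s: "minor c b = (\<Sum>q\<in>b. C (s q) * V (x, q) * minor (c - {x}) (b - {q}))"
      using minor_row[OF c P(2,3) True] by blast
    let ?T = "pm.span (XG x A (Suc ?n) (FM A ((c - {x}) # delrow x D)))"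
    have "C (s q) * rA A (V (x, q)) * rA A (minor (c - {x}) (b - {q})) * rA A Q \<in> ?T" if q: "q \<in> b" for q
    proof (cases "q \<in> A x")
      case False
      hence "rA A (V (x, q)) = (0 :: 'a matpoly)" using \<open>x \<ge> 1\<close> by (simp add: rA_def)
      thus ?thesis by (simp add: pm.span_zero)
    next
      case qA: True
      hence v: "rA A (V (x, q)) = (V (x, q) :: 'a matpoly)" by (simp add: rA_def)
      show ?thesis
      proof (rule span_mult_closed[OF Q])
        fix G assume "G \<in> XG x A ?n ?W"
        then obtain X H where G: "G = sg X 1 * H" "ks X \<subseteq> rvars x" "snd ` ks X \<subseteq> A x" "dg X = ?n" "H \<in> ?W" by (auto simp: XG_def)
        let ?H = "rA A (minor (c - {x}) (b - {q})) * H"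
        have "V (x, q) * sg X 1 = (sg (sg (x, q) 1 + X) 1 :: 'a matpoly)" by (simp add: V_def mult_single)
        hence eq: "C (s q) * rA A (V (x, q)) * rA A (minor (c - {x}) (b - {q})) * G = scale (s q) (sg (sg (x, q) 1 + X) 1 * ?H)"
          unfolding v G scale_conv by (simp add: ac_simps)
        have H: "?H \<in> FM A ((c - {x}) # delrow x D)" using P G True q c by (intro FM_Cons_mult) auto
        have k: "ks (sg (x, q) 1 + X) \<subseteq> insert (x, q) (ks X)" using keys_add[of "sg (x, q) 1" X] by auto
        have "sg (sg (x, q) 1 + X) 1 * ?H \<in> XG x A (Suc ?n) (FM A ((c - {x}) # delrow x D))"
        proof (rule XG_I[OF _ _ _ H])
          show "ks (sg (x, q) 1 + X) \<subseteq> rvars x" using k G(2) by (auto simp: rvars_def)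
          show "snd ` ks (sg (x, q) 1 + X) \<subseteq> A x" using image_mono[OF k, of snd] G(3) qA by auto
        qed (simp add: dg_add G)
        thus "C (s q) * rA A (V (x, q)) * rA A (minor (c - {x}) (b - {q})) * G \<in> ?T"
          unfolding eq by (intro pm.span_scale pm.span_base)
      qed
    qed
    hence "(\<Sum>q\<in>b. C (s q) * rA A (V (x, q)) * rA A (minor (c - {x}) (b - {q})) * rA A Q) \<in> ?T"
      by (rule pm.span_sum)
    moreover have "rA A P = (\<Sum>q\<in>b. C (s q) * rA A (V (x, q)) * rA A (minor (c - {x}) (b - {q})) * rA A Q)"
      unfolding P rA_mult s by (simp add: rA_def psub_sum psub_mult sum_distrib_right)
    ultimately show ?thesis using True by simp
  qed
qed

text \<open>The assertion is linear in \<open>F\<close>, so it suffices to look at the spanning set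
  \<open>XG\<close>, where the cofactor \<open>H\<close> is free of row \<open>x\<close> and the
  coefficient can be read off.\<close>

lemma FM_cf:
  assumes "F \<in> FM A D" "is_diagram D" "x \<ge> 1" "ks X \<subseteq> rvars x"
  shows "cf (rvars x) X F \<in> FM A (delrow x D)"
    "cf (rvars x) X F \<noteq> 0 \<Longrightarrow> dg X = nB x {} D \<and> snd ` ks X \<subseteq> A x"
proof -
  let ?W = "{F. cf (rvars x) X F \<in> FM A (delrow x D) \<and> (cf (rvars x) X F = 0 \<or> dg X = nB x {} D \<and> snd ` ks X \<subseteq> A x)} :: 'a matpoly set"
  have "pm.subspace ?W"
    using subspace_FM[of A "delrow x D", where ?'a='a] by (auto simp: pm.subspace_def cf_add cf_scale)
  moreover have "XG x A (nB x {} D) (FM A (delrow x D)) \<subseteq> ?W"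
  proof
    fix G :: "'a matpoly" assume "G \<in> XG x A (nB x {} D) (FM A (delrow x D))"
    then obtain Y H where G: "G = sg Y 1 * H" "ks Y \<subseteq> rvars x" "snd ` ks Y \<subseteq> A x" "dg Y = nB x {} D" "H \<in> FM A (delrow x D)"
      by (auto simp: XG_def)
    have "vars H \<inter> rvars x = {}" using vars_FM[OF _ G(5)] assms(2) by (auto simp: is_diagram_delrow rowset_delrow rvars_def)
    hence "cf (rvars x) X G = (if X = Y then H else 0)" unfolding G using assms(4) G(2) by (intro cf_pure_mult) auto
    thus "G \<in> ?W" using G pm.subspace_0[OF subspace_FM[of A "delrow x D"]] by auto
  qed
  ultimately have "pm.span (XG x A (nB x {} D) (FM A (delrow x D))) \<subseteq> ?W" by (intro pm.span_minimal)
  moreover have "FM A D \<subseteq> pm.span (XG x A (nB x {} D) (FM A (delrow x D)))"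
    using gens_XG assms by (intro FM_least) auto
  ultimately have "F \<in> ?W" using assms(1) by blast
  thus "cf (rvars x) X F \<in> FM A (delrow x D)" "cf (rvars x) X F \<noteq> 0 \<Longrightarrow> dg X = nB x {} D \<and> snd ` ks X \<subseteq> A x" by auto
qed

text \<open>A letter outside \<open>A x\<close> is outside \<open>A j\<close> for every
  \<open>j\<close> in \<open>B\<close>. So an entry of row \<open>x\<close> that the flag removes is
  replaced by a combination of entries that the flag removes as well.\<close>

lemma rA_sigma_rA:
  assumes "\<And>j. j \<in> B \<Longrightarrow> A j \<subseteq> A x" "x \<ge> 1" "0 \<notin> B"
  shows "rA A (sigma x B (rA A F)) = rA A (sigma x B F)"
proof -
  have "rA A (sigma x B (case v of (l, q) \<Rightarrow> if l = 0 \<or> q \<in> A l then V (l, q) else 0))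
      = rA A (sigma x B (V v :: 'a matpoly))" for v
  proof (cases v)
    case (Pair l q)
    have "j \<noteq> 0 \<and> q \<notin> A j" if "j \<in> B" "q \<notin> A x" for j using that assms by (metis subsetD)
    thus ?thesis using assms(2) unfolding Pair
      by (auto simp: rA_def sigma_def psub_sum psub_mult psub_add intro!: sum.neutral)
  qed
  thus ?thesis unfolding rA_def[of A] sigma_def psub_psub
    by (simp only: psub_V)
qed

text \<open>The sum is the determinant in which row \<open>x\<close> has been replaced by row
  \<open>j\<close>, so it has two equal rows.\<close>

lemma minor_repeated_row:
  assumes "finite c" "finite b" "card b = card c" "x \<in> c" "j \<in> c" "j \<noteq> x"
    "minor c b = (\<Sum>q\<in>b. C (s q) * V (x, q) * minor (c - {x}) (b - {q}))"
  shows "(\<Sum>q\<in>b. C (s q) * V (j, q) * minor (c - {x}) (b - {q})) = (0 :: 'k::field matpoly)"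
proof -
  let ?g = "\<lambda>(l, q). if l = x then V (j, q) else V (l, q) :: 'k matpoly"
  let ?A = "mat (card c) (card b) (\<lambda>(i, j). ?g (sl c ! i, sl b ! j))"
  obtain i k where i: "i < card c" "sl c ! i = x" and k: "k < card c" "sl c ! k = j"
    using sl_index[OF assms(1)] assms(4,5) by metis
  have "psub ?g (minor c b) = 0"
    unfolding psub_minor
    by (rule det_identical_rows[of _ "card c" i k]) (use i k assms in \<open>auto intro!: eq_vecI\<close>)
  moreover have "psub ?g (minor (c - {x}) (b - {q})) = minor (c - {x}) (b - {q})" if "q \<in> b" for q
  proof -
    have "vars (minor (c - {x}) (b - {q}) :: 'k matpoly) \<subseteq> (c - {x}) \<times> (b - {q})" using assms that by (intro vars_minor) auto
    hence "psub ?g (minor (c - {x}) (b - {q})) = psub V (minor (c - {x}) (b - {q}))" by (intro psub_cong) auto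
    thus ?thesis by simp
  qed
  ultimately show ?thesis unfolding assms(7) by (simp add: psub_sum psub_mult)
qed

text \<open>The determinant is linear in row \<open>x\<close>. Each \<sigma> term repeats a row of
  the column and vanishes, which leaves \<epsilon> times the original minor.\<close>

lemma sigma_minor:
  assumes "finite c" "finite b" "card b = card c" "x \<in> c" "B \<subseteq> c" "x \<notin> B"
  shows "sigma x B (minor c b) = V (0, 0) * (minor c b :: 'k::field matpoly)"
proof -
  obtain s :: "nat \<Rightarrow> 'k" where s: "minor c b = (\<Sum>q\<in>b. C (s q) * V (x, q) * minor (c - {x}) (b - {q}))"
    using minor_row[OF assms(1-4)] by blast
  have m: "sigma x B (minor (c - {x}) (b - {q})) = (minor (c - {x}) (b - {q}) :: 'k matpoly)" if "q \<in> b" for q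
  proof -
    have "vars (minor (c - {x}) (b - {q}) :: 'k matpoly) \<subseteq> (c - {x}) \<times> (b - {q})" using assms that by (intro vars_minor) auto
    hence "sigma x B (minor (c - {x}) (b - {q})) = psub V (minor (c - {x}) (b - {q}) :: 'k matpoly)"
      unfolding sigma_def by (intro psub_cong) auto
    thus ?thesis by simp
  qed
  have "sigma x B (minor c b) = (\<Sum>q\<in>b. C (s q) * ((\<Sum>j\<in>B. V (0, j) * V (j, q)) + V (0, 0) * V (x, q)) * minor (c - {x}) (b - {q}))"
  proof -
    have "sigma x B (minor c b) = (\<Sum>q\<in>b. C (s q) * sigma x B (V (x, q)) * sigma x B (minor (c - {x}) (b - {q})))"
      unfolding s by (simp add: sigma_def psub_sum psub_mult)
    also have "\<dots> = (\<Sum>q\<in>b. C (s q) * ((\<Sum>j\<in>B. V (0, j) * V (j, q)) + V (0, 0) * V (x, q)) * minor (c - {x}) (b - {q}))"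
      by (intro sum.cong refl) (simp add: m, simp add: sigma_def)
    finally show ?thesis .
  qed
  also have "\<dots> = (\<Sum>j\<in>B. V (0, j) * (\<Sum>q\<in>b. C (s q) * V (j, q) * minor (c - {x}) (b - {q})))
      + V (0, 0) * (\<Sum>q\<in>b. C (s q) * V (x, q) * minor (c - {x}) (b - {q}))"
    unfolding sum_distrib_left sum.swap[of _ b B]
    by (simp add: algebra_simps sum_distrib_left sum_distrib_right sum.distrib sum.swap[of _ b B])
  also have "(\<Sum>j\<in>B. V (0, j) * (\<Sum>q\<in>b. C (s q) * V (j, q) * minor (c - {x}) (b - {q}))) = 0"
  proof (rule sum.neutral, rule ballI)
    fix j assume "j \<in> B"
    thus "V (0, j) * (\<Sum>q\<in>b. C (s q) * V (j, q) * minor (c - {x}) (b - {q})) = 0"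
      using minor_repeated_row[of c b x j s] assms s by auto
  qed
  finally show ?thesis using s by simp
qed

lemma gens_sigma:
  assumes "P \<in> gens D" "is_diagram D" "x \<ge> 1" "x \<notin> B"
  shows "V (0, 0) ^ nB x B D dvd rA A (sigma x B P)"
  using assms
proof (induction D arbitrary: P)
  case (Cons c D)
  then obtain b Q where P: "P = minor c b * Q" "finite b" "card b = card c" "Q \<in> gens D" by (auto simp: gens_Cons)
  have Q: "V (0, 0) ^ nB x B D dvd rA A (sigma x B Q)" using Cons P by (auto simp: is_diagram_Cons)
  have e: "rA A (sigma x B P) = rA A (sigma x B (minor c b)) * rA A (sigma x B Q)" by (simp add: P rA_def sigma_def psub_mult)
  show ?case
  proof (cases "x \<in> c \<and> B \<subseteq> c")
    case True
    have "sigma x B (minor c b) = V (0, 0) * (minor c b :: 'a matpoly)" using True Cons.prems P by (intro sigma_minor) (auto simp: is_diagram_Cons)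
    hence "rA A (sigma x B (minor c b)) = V (0, 0) * rA A (minor c b :: 'a matpoly)" by (simp add: rA_def psub_mult)
    hence "V (0, 0) ^ 1 dvd rA A (sigma x B (minor c b :: 'a matpoly))" by simp
    hence "V (0, 0) ^ 1 * V (0, 0) ^ nB x B D dvd rA A (sigma x B P)" unfolding e by (intro mult_dvd_mono Q)
    thus ?thesis using True by simp
  next
    case False thus ?thesis using Q e by auto
  qed
qed simp

lemma rA_dvd_span:
  fixes E :: "'k::field matpoly"
  shows "pm.subspace {F. E dvd rA A (sigma x B F)}"
  by (rule pm.subspaceI) (auto simp: rA_def sigma_def psub_add psub_mult scale_conv)

lemma FM_sigma:
  assumes "F \<in> FM A D" "is_diagram D" "x \<ge> 1" "x \<notin> B" "\<And>j. j \<in> rowset D \<Longrightarrow> A j \<subseteq> A x"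
  shows "V (0, 0) ^ nB x B D dvd rA A (sigma x B F)"
proof (cases "nB x B D = 0")
  case False
  then obtain c where c: "c \<in> set D" "B \<subseteq> c" by (auto simp: nB_def filter_empty_conv)
  \<comment> \<open>Some column contains \<open>B\<close>, so \<open>B\<close> consists of rows of
    \<open>D\<close>, and the hypothesis on the flag applies to it.\<close>
  hence B: "\<And>j. j \<in> B \<Longrightarrow> A j \<subseteq> A x" "0 \<notin> B" using assms by (auto simp: rowset_def is_diagram_def)
  have "FM A D \<subseteq> {F :: 'a matpoly. V (0, 0) ^ nB x B D dvd rA A (sigma x B F)}"
    using gens_sigma[of _ D x B A] assms
    by (intro FM_least rA_dvd_span) (auto simp: rA_sigma_rA[of B A x, OF B(1) assms(3) B(2)])
  thus ?thesis using assms(1) by auto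
qed simp

lemma FM_Isp:
  assumes "F \<in> FM A D" "is_diagram D" "x \<ge> 1" "\<And>j. j \<in> rowset D \<Longrightarrow> A j \<subseteq> A x"
  shows "Isp x A D F"
  unfolding Isp_def using FM_cf[OF assms(1-3)] FM_sigma[OF assms(1-3)] assms(4) by blast

section \<open>Descents and transparency up to equivalence\<close>

abbreviation tau :: "nat \<Rightarrow> nat \<Rightarrow> nat" where "tau k \<equiv> Transposition.transpose k (k + 1)"
definition swp :: "nat \<Rightarrow> diagram \<Rightarrow> diagram" where "swp k D = map (\<lambda>b. tau k ` b) D"

lemma swp_simps [simp]: "swp k [] = []" "swp k (c # D) = tau k ` c # swp k D" "swp k (D1 @ D2) = swp k D1 @ swp k D2"
  by (simp_all add: swp_def)

lemma diag_eq_refl [simp]: "D \<simeq> D" by (simp add: diag_eq_def)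
lemma diag_eq_sym: "D \<simeq> D' \<Longrightarrow> D' \<simeq> D" by (simp add: diag_eq_def)
lemma diag_eq_trans: "D \<simeq> D' \<Longrightarrow> D' \<simeq> D'' \<Longrightarrow> D \<simeq> D''" by (simp add: diag_eq_def)
lemma diag_eq_mset: "mset D = mset D' \<Longrightarrow> D \<simeq> D'" by (simp add: diag_eq_def)

lemma diag_eq_map:
  assumes "D \<simeq> D'" "\<And>c. f c = {} \<longleftrightarrow> c = {}"
  shows "map f D \<simeq> map f D'"
proof -
  have "filter_mset (\<lambda>a. a \<noteq> {}) (image_mset f M) = image_mset f (filter_mset (\<lambda>a. a \<noteq> {}) M)" for M
    using assms(2) by (induction M) auto
  thus ?thesis using assms(1) by (simp add: diag_eq_def)
qed

lemma diag_eq_swp: "D \<simeq> D' \<Longrightarrow> swp k D \<simeq> swp k D'"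
  unfolding swp_def by (rule diag_eq_map) auto

lemma diag_eq_set: "D \<simeq> D' \<Longrightarrow> c \<noteq> {} \<Longrightarrow> c \<in> set D \<longleftrightarrow> c \<in> set D'"
proof -
  assume a: "D \<simeq> D'" "c \<noteq> {}"
  have "c \<in># filter_mset (\<lambda>a. a \<noteq> {}) (mset D) \<longleftrightarrow> c \<in># filter_mset (\<lambda>a. a \<noteq> {}) (mset D')"
    using a(1) by (simp add: diag_eq_def)
  thus ?thesis using a(2) by simp
qed

lemma diag_eq_Nil: "D \<simeq> [] \<longleftrightarrow> (\<forall>c\<in>set D. c = {})"
proof -
  have "filter_mset (\<lambda>a. a \<noteq> {}) (mset D) = {#} \<longleftrightarrow> (\<forall>c\<in>set D. c = {})" by (induction D) auto
  thus ?thesis by (simp add: diag_eq_def)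
qed

lemma is_diagram_cong: "D \<simeq> D' \<Longrightarrow> is_diagram D \<longleftrightarrow> is_diagram D'"
  unfolding is_diagram_def by (metis diag_eq_set diag_eq_sym finite.emptyI empty_iff)

lemma k_full_cong: "D \<simeq> D' \<Longrightarrow> k_full k D \<longleftrightarrow> k_full k D'"
  unfolding k_full_def col_full_def by (metis diag_eq_set diag_eq_sym empty_iff)

lemma num_boxes_filter: "num_boxes D = sum_mset (image_mset card (filter_mset (\<lambda>a. a \<noteq> {}) (mset D)))"
  unfolding num_boxes_def by (induction D) auto

lemma num_boxes_cong: "D \<simeq> D' \<Longrightarrow> num_boxes D = num_boxes D'"
  by (simp add: num_boxes_filter diag_eq_def)

lemma num_boxes_simps [simp]: "num_boxes [] = 0" "num_boxes (c # D) = card c + num_boxes D"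
  "num_boxes (D1 @ D2) = num_boxes D1 + num_boxes D2"
  by (simp_all add: num_boxes_def)

lemma inj_tau: "inj_on (tau k) S" by (meson inj_on_subset inj_transpose top_greatest)

lemma num_boxes_swp: "num_boxes (swp k D) = num_boxes D"
  by (induction D) (simp_all add: card_image inj_tau)

lemma witness_cong:
  assumes "D \<simeq> D'" "descent_witness k D L a R"
  shows "\<exists>L' R'. descent_witness k D' L' a R' \<and> L @ (a - {k}) # R \<simeq> L' @ (a - {k}) # R'"
proof -
  let ?f = "filter (\<lambda>a. a \<noteq> {})"
  \<comment> \<open>Empty columns satisfy the condition on the right part trivially, so all empty
    columns of \<open>D'\<close> are collected there.\<close>
  define L' R' where "L' = ?f L" and "R' = ?f R @ filter (\<lambda>a. a = {}) D'"
  have a: "a \<noteq> {}" and m: "mset D = mset (L @ a # R)" using assms(2) by (auto simp: descent_witness_def)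
  have "filter_mset (\<lambda>a. a \<noteq> {}) (mset D') = filter_mset (\<lambda>a. a \<noteq> {}) (mset (L @ a # R))"
    using assms(1) unfolding diag_eq_def m[symmetric] by (rule sym)
  hence "mset (L' @ a # R') = filter_mset (\<lambda>a. a \<noteq> {}) (mset D') + filter_mset (\<lambda>a. \<not> a \<noteq> {}) (mset D')"
    using a by (simp add: L'_def R'_def)
  also have "\<dots> = mset D'" by (rule multiset_partition[symmetric])
  finally have "descent_witness k D' L' a R'" using assms(2) by (auto simp: descent_witness_def L'_def R'_def)
  moreover have "L @ (a - {k}) # R \<simeq> L' @ (a - {k}) # R'"
    by (simp add: diag_eq_def L'_def R'_def filter_filter_mset)
  ultimately show ?thesis by blast
qed

lemma Des_cong: "D \<simeq> D' \<Longrightarrow> Des D = Des D'"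
  unfolding Des_def using witness_cong diag_eq_sym by blast

lemma witness_col:
  assumes "is_diagram D" "descent_witness k D L a R"
  shows "finite a" "k \<in> a" "a \<subseteq> {1..k}" "k \<ge> 1" "a \<in> set D" "\<not> col_full k a"
proof -
  show s: "a \<in> set D" using assms(2) unfolding descent_witness_def
    by (metis in_set_conv_decomp set_mset_mset)
  show f: "finite a" using s assms(1) by (auto simp: is_diagram_def)
  show k: "k \<in> a" using f assms(2) Max_in by (auto simp: descent_witness_def)
  have le: "\<And>i. i \<in> a \<Longrightarrow> i \<le> k" using f assms(2) Max_ge by (auto simp: descent_witness_def)
  have z: "0 \<notin> a" using s assms(1) by (auto simp: is_diagram_def)
  show "a \<subseteq> {1..k}" using le z by (auto simp: Suc_le_eq) (metis neq0_conv)
  thus "k \<ge> 1" using k by auto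
  show "\<not> col_full k a" using le[of "k + 1"] k by (auto simp: col_full_def)
qed

text \<open>A column with largest element \<open>k\<close> is not \<open>k\<close>-full, so it
  cannot stand to the left of another witness. If it stands to the right, it is contained in that
  witness. By symmetry both contain each other.\<close>

lemma witness_unique:
  assumes "is_diagram D" "descent_witness k D L a R" "descent_witness k D L' a' R'"
  shows "a = a'" "mset (L @ (a - {k}) # R) = mset (L' @ (a' - {k}) # R')"
proof -
  have sub: "a \<subseteq> a'" if "descent_witness k D L a R" "descent_witness k D L' a' R'" for L a R L' a' R'
  proof -
    note w = witness_col[OF assms(1) that(1)]
    have "a \<in> set (L' @ a' # R')" using w(5) that(2) unfolding descent_witness_def by (metis set_mset_mset)
    moreover have "a \<notin> set L'" using w(6) that(2) by (auto simp: descent_witness_def)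
    ultimately have "a = a' \<or> a \<inter> {1..k+1} \<subseteq> a'" using that(2) unfolding descent_witness_def by auto
    then consider "a = a'" | "a \<inter> {1..k+1} \<subseteq> a'" by blast
    thus ?thesis
    proof cases
      case 2
      moreover have "a \<inter> {1..k+1} = a" using w(3) by auto
      ultimately show ?thesis by simp
    qed simp
  qed
  show "a = a'" using sub[OF assms(2,3)] sub[OF assms(3,2)] by blast
  thus "mset (L @ (a - {k}) # R) = mset (L' @ (a' - {k}) # R')"
    using assms(2,3) by (auto simp: descent_witness_def)
qed

text \<open>The choice in \<open>s_diag\<close> may use another witness, but uniqueness makes the
  resulting columns agree up to order.\<close>

lemma s_diag_witness:
  assumes "is_diagram D" "descent_witness k D L a R"
  shows "s_diag k D \<simeq> swp k (L @ (a - {k}) # R)"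
proof -
  have "\<exists>L a R. descent_witness k D L a R \<and> s_diag k D = map (\<lambda>b. tau k ` b) (L @ (a - {k}) # R)"
    unfolding s_diag_def by (rule someI_ex) (use assms(2) in blast)
  then obtain L' a' R' where w: "descent_witness k D L' a' R'" "s_diag k D = swp k (L' @ (a' - {k}) # R')"
    unfolding swp_def by blast
  show ?thesis unfolding w(2)
    using witness_unique(2)[OF assms(1) w(1) assms(2)] by (intro diag_eq_swp diag_eq_mset)
qed

lemma s_diag_cong:
  assumes "D \<simeq> D'" "is_diagram D" "k \<in> Des D"
  shows "s_diag k D \<simeq> s_diag k D'"
proof -
  obtain L a R where w: "descent_witness k D L a R" using assms(3) by (auto simp: Des_def)
  obtain L' R' where w': "descent_witness k D' L' a R'" "L @ (a - {k}) # R \<simeq> L' @ (a - {k}) # R'"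
    using witness_cong[OF assms(1) w] by blast
  have d: "is_diagram D'" using assms is_diagram_cong by blast
  show ?thesis
    using s_diag_witness[OF assms(2) w] diag_eq_swp[OF w'(2), of k] diag_eq_sym[OF s_diag_witness[OF d w'(1)]]
    by (blast intro: diag_eq_trans)
qed

lemma is_diagram_swp: "is_diagram D \<Longrightarrow> k \<ge> 1 \<Longrightarrow> is_diagram (swp k D)"
  by (auto simp: is_diagram_def swp_def transpose_def image_iff)

lemma is_diagram_witness:
  assumes "is_diagram D" "descent_witness k D L a R"
  shows "is_diagram (L @ a # R)" "is_diagram (L @ (a - {k}) # R)"
proof -
  have "set D = set (L @ a # R)" using assms(2) unfolding descent_witness_def by (metis set_mset_mset)
  thus "is_diagram (L @ a # R)" using assms(1) by (simp add: is_diagram_def)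
  thus "is_diagram (L @ (a - {k}) # R)" by (auto simp: is_diagram_def)
qed

lemma is_diagram_s_diag:
  assumes "is_diagram D" "k \<in> Des D" shows "is_diagram (s_diag k D)"
proof -
  obtain L a R where w: "descent_witness k D L a R" using assms(2) by (auto simp: Des_def)
  show ?thesis
    using is_diagram_cong[OF s_diag_witness[OF assms(1) w]]
      is_diagram_swp[OF is_diagram_witness(2)[OF assms(1) w] witness_col(4)[OF assms(1) w]] by simp
qed

lemma num_boxes_witness:
  assumes "is_diagram D" "descent_witness k D L a R"
  shows "num_boxes D = Suc (num_boxes (swp k (L @ (a - {k}) # R)))"
proof -
  have "num_boxes D = num_boxes (L @ a # R)"
    using assms(2) by (intro num_boxes_cong diag_eq_mset) (simp add: descent_witness_def)
  moreover have "card a = Suc (card (a - {k}))"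
    using witness_col[OF assms] by (metis card.remove)
  ultimately show ?thesis by (simp only: num_boxes_swp num_boxes_simps)
qed

lemma transparent_cong: "transparent D \<Longrightarrow> D \<simeq> D' \<Longrightarrow> is_diagram D \<Longrightarrow> transparent D'"
proof (induction D arbitrary: D' rule: transparent.induct)
  case (transparent_empty D)
  thus ?case by (intro transparent.transparent_empty) (blast intro: diag_eq_trans diag_eq_sym)
next
  case (transparent_step D)
  show ?case
  proof (rule transparent.transparent_step)
    show "\<not> D' \<simeq> []" using transparent_step.hyps(1) transparent_step.prems(1) diag_eq_trans by blast
    show "clear_diag D'" using transparent_step.hyps(2) k_full_cong[OF transparent_step.prems(1)]
        Des_cong[OF transparent_step.prems(1)] by (simp add: clear_diag_def)
    fix k assume "k \<in> Des D'"
    hence k: "k \<in> Des D" using Des_cong[OF transparent_step.prems(1)] by simp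
    show "transparent (s_diag k D')"
      using transparent_step.IH[OF k s_diag_cong[OF transparent_step.prems k]] is_diagram_s_diag[OF transparent_step.prems(2) k] by blast
  qed
qed

lemma transparent_witness:
  assumes "transparent D" "is_diagram D" "descent_witness k D L a R"
  shows "transparent (swp k (L @ (a - {k}) # R))"
proof -
  have k: "k \<in> Des D" using assms(3) by (auto simp: Des_def)
  have "\<not> D \<simeq> []" using witness_col(2,5)[OF assms(2,3)] by (auto simp: diag_eq_Nil)
  with assms(1) have "transparent (s_diag k D)" by cases (use k in auto)
  thus ?thesis using transparent_cong s_diag_witness[OF assms(2,3)] is_diagram_s_diag[OF assms(2) k] by blast
qed

lemma transparent_clear:
  assumes "transparent D" "k \<ge> 1"
  shows "k_full k D \<or> (\<exists>L a R. descent_witness k D L a R)"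
  using assms(1)
proof cases
  case transparent_empty
  thus ?thesis by (auto simp: diag_eq_Nil k_full_def col_full_def)
next
  case transparent_step
  thus ?thesis using assms(2) by (auto simp: clear_diag_def Des_def)
qed

section \<open>Rows under deletion and swapping\<close>

lemma delrow_mset: "mset D = mset D' \<Longrightarrow> mset (delrow x D) = mset (delrow x D')" by (simp add: delrow_def)

lemma rowset_simps [simp]: "rowset [] = {}" "rowset (c # D) = c \<union> rowset D" "rowset (D1 @ D2) = rowset D1 \<union> rowset D2"
  by (auto simp: rowset_def)
lemma rowset_mset: "mset D = mset D' \<Longrightarrow> rowset D = rowset D'"
  unfolding rowset_def by (metis set_mset_mset)
lemma rowset_swp: "rowset (swp k D) = tau k ` rowset D" by (auto simp: rowset_def swp_def)
lemma tau_mem [simp]: "tau k x \<in> tau k ` S \<longleftrightarrow> x \<in> S" by (rule inj_image_mem_iff) (rule inj_transpose)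
lemma tau_subset [simp]: "tau k ` B \<subseteq> tau k ` S \<longleftrightarrow> B \<subseteq> S" by (rule inj_image_subset_iff) (rule inj_transpose)
lemma tau_diff: "tau k ` (S - T) = tau k ` S - tau k ` T" by (rule image_set_diff) (rule inj_transpose)
lemma nB_swp: "nB (tau k x) (tau k ` B) (swp k D) = nB x B D"
  by (induction D) (simp_all only: swp_simps nB_simps tau_mem tau_subset)
lemma delrow_swp: "delrow (tau k x) (swp k D) = swp k (delrow x D)"
  by (induction D) (simp_all only: swp_simps delrow_simps tau_diff image_insert image_empty)

lemma delrow_id: "x \<notin> rowset D \<Longrightarrow> delrow x D = D" by (induction D) auto

lemma nB_pos: "nB x {} D > 0 \<longleftrightarrow> x \<in> rowset D" by (induction D) auto

lemma swp_witness_mset: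
  "descent_witness k D L a R \<Longrightarrow> mset D = mset (L @ a # R)" by (simp add: descent_witness_def)

text \<open>If row \<open>K\<close> is occupied, then \<open>D\<close> is not \<open>K\<close>-full,
  since row \<open>K + 1\<close> is empty, and so there is a descent at \<open>K\<close>. The swap
  moves the other boxes of row \<open>K\<close> to row \<open>K + 1\<close>, which then has one box
  fewer than row \<open>K\<close> had. Deleting that new top row gives the same diagram as deleting
  row \<open>K\<close> from \<open>D\<close>, so induction on the boxes of the deleted row
  works.\<close>

lemma transparent_delrow_top:
  assumes "transparent D" "is_diagram D" "rowset D \<subseteq> {1..K}"
  shows "transparent (delrow K D)"
  using assms
proof (induction "nB K {} D" arbitrary: D K)
  case 0
  hence "K \<notin> rowset D" using nB_pos[of K D] by simp
  thus ?case using 0 by (simp add: delrow_id)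
next
  case (Suc n)
  have K: "K \<in> rowset D" using Suc.hyps(2) nB_pos[of K D] by simp
  hence K1: "K \<ge> 1" using Suc.prems(3) by auto
  have "\<not> k_full K D"
    using K Suc.prems(3) by (fastforce simp: k_full_def col_full_def rowset_def)
  then obtain L a R where w: "descent_witness K D L a R" using transparent_clear[OF Suc.prems(1) K1] by blast
  define D1 where "D1 = swp K (L @ (a - {K}) # R)"
  have m: "mset D = mset (L @ a # R)" using w by (rule swp_witness_mset)
  have rs: "rowset (L @ a # R) \<subseteq> {1..K}" using rowset_mset[OF m] Suc.prems(3) by simp
  have d: "is_diagram (L @ (a - {K}) # R)" by (rule is_diagram_witness(2)[OF Suc.prems(2) w])
  have "transparent D1" unfolding D1_def by (rule transparent_witness[OF Suc.prems(1,2) w])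
  moreover have "is_diagram D1" unfolding D1_def by (rule is_diagram_swp[OF d K1])
  moreover have "rowset D1 \<subseteq> {1..K + 1}"
    unfolding D1_def rowset_swp using rs by (auto simp: transpose_def)
  moreover have "nB (K + 1) {} D1 = n"
  proof -
    have "nB (K + 1) {} D1 = nB K {} (L @ (a - {K}) # R)"
      using nB_swp[of K K "{}" "L @ (a - {K}) # R"] unfolding D1_def by simp
    moreover have "nB K {} D = nB K {} (L @ a # R)" by (rule nB_mset[OF m])
    ultimately show ?thesis using Suc.hyps(2) witness_col(2)[OF Suc.prems(2) w] by simp
  qed
  ultimately have t: "transparent (delrow (K + 1) D1)" using Suc.hyps(1)[of "K + 1" D1] by simp
  have "delrow (K + 1) D1 = swp K (delrow K (L @ (a - {K}) # R))"
    using delrow_swp[of K K "L @ (a - {K}) # R"] unfolding D1_def by simp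
  also have "delrow K (L @ (a - {K}) # R) = delrow K (L @ a # R)" by simp
  \<comment> \<open>Rows \<open>K\<close> and \<open>K + 1\<close> are now both empty, so the swap
    fixes every column.\<close>
  also have "swp K (delrow K (L @ a # R)) = delrow K (L @ a # R)"
  proof -
    have "tau K ` c = c" if "c \<in> set (delrow K (L @ a # R))" for c
    proof -
      have "c \<subseteq> {1..K} - {K}" using that rs by (auto simp: delrow_def rowset_def)
      hence "\<And>i. i \<in> c \<Longrightarrow> tau K i = i" by (auto simp: transpose_def)
      thus ?thesis by simp
    qed
    thus ?thesis unfolding swp_def by (simp add: map_idI)
  qed
  finally have "transparent (delrow K (L @ a # R))" using t by simp
  moreover have "delrow K (L @ a # R) \<simeq> delrow K D" using delrow_mset[OF m] by (intro diag_eq_mset) simp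
  moreover have "is_diagram (delrow K (L @ a # R))" using is_diagram_witness(1)[OF Suc.prems(2) w] by (rule is_diagram_delrow)
  ultimately show ?case using transparent_cong by blast
qed

section \<open>Swapping two rows\<close>

context
  fixes \<rho> :: "'v \<Rightarrow> 'v"
  assumes invol: "\<And>v. \<rho> (\<rho> v) = v"
begin

lemma inj_invol: "inj \<rho>" by (rule injI) (metis invol)

lemma lookup_mk: "lk (Poly_Mapping.map_key \<rho> m) v = lk m (\<rho> v)"
  by (simp add: map_key.rep_eq inj_invol)

lemma mk_mk: "Poly_Mapping.map_key \<rho> (Poly_Mapping.map_key \<rho> m) = m"
  by (rule poly_mapping_eqI) (simp add: lookup_mk invol)

lemma mk_add: "Poly_Mapping.map_key \<rho> (m + n :: 'v \<Rightarrow>\<^sub>0 nat) = Poly_Mapping.map_key \<rho> m + Poly_Mapping.map_key \<rho> n"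
  by (rule poly_mapping_eqI) (simp add: lookup_mk lookup_add)

lemma ks_mk: "ks (Poly_Mapping.map_key \<rho> m) = \<rho> ` ks m"
  proof (intro Set.set_eqI iffI)
  fix v assume "v \<in> ks (Poly_Mapping.map_key \<rho> m)"
  hence "\<rho> v \<in> ks m" by (simp add: in_keys_iff lookup_mk)
  thus "v \<in> \<rho> ` ks m" using invol by (metis imageI)
qed (auto simp: in_keys_iff lookup_mk invol)

lemma dg_mk: "dg (Poly_Mapping.map_key \<rho> m) = dg m"
  unfolding dg_def ks_mk by (subst sum.reindex) (auto simp: lookup_mk invol inj_on_def dest: injD[OF inj_invol])

lemma psub_rename_single: "psub (\<lambda>v. V (\<rho> v)) (sg m c) = (sg (Poly_Mapping.map_key \<rho> m) c :: ('v, 'a::comm_ring_1) mp)"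
proof -
  have "mon (\<lambda>v. V (\<rho> v)) m = (mon V (Poly_Mapping.map_key \<rho> m) :: ('v, 'a) mp)"
    unfolding mon_def ks_mk by (subst prod.reindex) (auto simp: lookup_mk invol inj_on_def dest: injD[OF inj_invol])
  have "psub (\<lambda>v. V (\<rho> v)) (sg m c) = C c * mon (\<lambda>v. V (\<rho> v)) m" by (rule psub_single)
  also have "\<dots> = sg (Poly_Mapping.map_key \<rho> m) c" unfolding \<open>mon _ _ = _\<close> by (rule sg_C_mon[symmetric])
  finally show ?thesis .
qed

lemma lookup_psub_rename: "lk (psub (\<lambda>v. V (\<rho> v)) F) m = lk (F :: ('v, 'a::comm_ring_1) mp) (Poly_Mapping.map_key \<rho> m)"
proof -
  have "psub (\<lambda>v. V (\<rho> v)) F = (\<Sum>n\<in>ks F. sg (Poly_Mapping.map_key \<rho> n) (lk F n))"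
    by (subst mp_single_sum) (simp add: psub_sum psub_rename_single)
  hence "lk (psub (\<lambda>v. V (\<rho> v)) F) m = (\<Sum>n\<in>ks F. lk F n when Poly_Mapping.map_key \<rho> n = m)"
    by (simp add: lookup_sum lookup_single)
  also have "\<dots> = (\<Sum>n\<in>ks F. if n = Poly_Mapping.map_key \<rho> m then lk F n else 0)"
    by (rule sum.cong[OF refl]) (auto simp: mk_mk when_def)
  finally show ?thesis by (simp add: in_keys_iff)
qed

lemma cf_psub_rename:
  "cf S X (psub (\<lambda>v. V (\<rho> v)) F) = psub (\<lambda>v. V (\<rho> v)) (cf (\<rho> ` S) (Poly_Mapping.map_key \<rho> X) (F :: ('v, 'a::comm_ring_1) mp))"
proof (rule poly_mapping_eqI)
  fix m :: "'v \<Rightarrow>\<^sub>0 nat"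
  have "ks (Poly_Mapping.map_key \<rho> m) \<inter> \<rho> ` S = {} \<longleftrightarrow> ks m \<inter> S = {}"
    unfolding ks_mk image_Int[OF inj_invol, symmetric] by simp
  thus "lk (cf S X (psub (\<lambda>v. V (\<rho> v)) F)) m = lk (psub (\<lambda>v. V (\<rho> v)) (cf (\<rho> ` S) (Poly_Mapping.map_key \<rho> X) F)) m"
    by (simp add: lookup_cf lookup_psub_rename mk_add)
qed

lemma psub_rename_eq_0: "psub (\<lambda>v. V (\<rho> v)) F = 0 \<longleftrightarrow> F = (0 :: ('v, 'a::comm_ring_1) mp)"
proof
  assume "psub (\<lambda>v. V (\<rho> v)) F = 0"
  hence "psub (\<lambda>v. V (\<rho> v)) (psub (\<lambda>v. V (\<rho> v)) F) = 0" by simp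
  thus "F = 0" by (simp add: psub_psub invol)
qed simp

end

text \<open>In row 0 the letters are exchanged instead: the parameter \<open>V (0, j)\<close>
  belongs to the row \<open>j\<close> in \<open>sigma\<close>, so it has to follow the swap of the
  rows.\<close>

definition rsv :: "nat \<Rightarrow> nat \<times> nat \<Rightarrow> nat \<times> nat" where
  "rsv k = (\<lambda>(l, q). if l = 0 then (0, tau k q) else (tau k l, q))"

definition rs :: "nat \<Rightarrow> 'k::field matpoly \<Rightarrow> 'k matpoly" where "rs k = psub (\<lambda>v. V (rsv k v))"

lemma tau_0: "k \<ge> 1 \<Longrightarrow> tau k l = 0 \<longleftrightarrow> l = 0" by (auto simp: transpose_def)

lemma tau_eq_iff: "tau k a = tau k b \<longleftrightarrow> a = b" by (rule inj_eq) (rule inj_transpose)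

lemma rsv_rsv: "k \<ge> 1 \<Longrightarrow> rsv k (rsv k v) = v"
  using tau_0[of k] by (cases v) (auto simp: rsv_def)

lemma rs_rs: "k \<ge> 1 \<Longrightarrow> rs k (rs k F) = F" by (simp add: rs_def psub_psub rsv_rsv)
lemma rs_mult: "rs k (F * G) = rs k F * rs k G" by (simp add: rs_def psub_mult)
lemma rs_eq_0: "k \<ge> 1 \<Longrightarrow> rs k F = 0 \<longleftrightarrow> F = 0" unfolding rs_def by (rule psub_rename_eq_0) (rule rsv_rsv)

text \<open>If both rows occur in \<open>c\<close>, the swap exchanges two rows of the determinant
  and costs a sign. Otherwise it preserves the order of the rows in \<open>c\<close>, because no row
  lies strictly between \<open>k\<close> and \<open>k + 1\<close>.\<close>

lemma rs_minor:
  assumes c: "finite c" "0 \<notin> c" and b: "card b = card c"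
  shows "\<exists>s :: 'k::field. s \<noteq> 0 \<and> rs k (minor c b) = C s * minor (tau k ` c) b"
proof (cases "k \<in> c \<and> k + 1 \<in> c")
  case True
  have "\<exists>i<card c. sl c ! i = k" by (rule sl_index[OF c(1) conjunct1[OF True]])
  then obtain i where i: "i < card c" "sl c ! i = k" by (elim exE conjE)
  have "\<exists>i<card c. sl c ! i = k + 1" by (rule sl_index[OF c(1) conjunct2[OF True]])
  then obtain j where j: "j < card c" "sl c ! j = k + 1" by (elim exE conjE)
  let ?A = "mat (card c) (card c) (\<lambda>(i, j). z_var (sl c ! i) (sl b ! j)) :: 'k matpoly mat"
  have e: "tau k (sl c ! r) = sl c ! (if r = i then j else if r = j then i else r)" if "r < card c" for r
  proof -
    have "sl c ! r = k \<longleftrightarrow> r = i" "sl c ! r = k + 1 \<longleftrightarrow> r = j"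
      using sl_inj[OF c(1) that i(1)] sl_inj[OF c(1) that j(1)] i(2) j(2) by fastforce+
    thus ?thesis by (simp add: transpose_def i(2) j(2))
  qed
  have nz: "sl c ! r \<noteq> 0" if "r < card c" for r using sl_nth_in[OF c(1) that] c(2) by metis
  have "i \<noteq> j"
  proof
    assume "i = j"
    hence "k = k + 1" using i(2) j(2) by metis
    thus False by simp
  qed
  have "rs k (minor c b) = det (mat (card c) (card c) (\<lambda>(i, j). V (tau k (sl c ! i), sl b ! j)))"
    unfolding rs_def psub_minor b by (intro arg_cong[where f=det] eq_matI) (auto simp: rsv_def nz)
  also have "mat (card c) (card c) (\<lambda>(i, j). V (tau k (sl c ! i), sl b ! j)) = swaprows i j ?A"
    by (rule eq_matI) (use i(1) j(1) in \<open>auto simp: e[simplified] z_var_V mat_swaprows_def\<close>)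
  also have "det (swaprows i j ?A) = - det ?A" using i(1) j(1) \<open>i \<noteq> j\<close> by (intro det_swaprows) auto
  also have "\<dots> = C (-1) * minor c b" by (simp add: minor_def b)
  finally have 1: "rs k (minor c b) = C (-1) * (minor c b :: 'k matpoly)" .
  have "tau k ` c = c" using True by (auto simp: transpose_def image_iff)
  thus ?thesis using 1 by (intro exI[of _ "-1"]) simp
next
  case False
  have "sorted_wrt (<) (sl c)" by (simp add: strict_sorted_iff)
  hence "sorted_wrt (<) (map (tau k) (sl c))"
    unfolding sorted_wrt_map
  proof (rule sorted_wrt_mono_rel[rotated])
    fix x y assume "x \<in> set (sl c)" "y \<in> set (sl c)" "x < y"
    thus "tau k x < tau k y" using False c(1) by (auto simp: transpose_def)
  qed
  hence s: "sl (tau k ` c) = map (tau k) (sl c)"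
    using c by (intro strict_sorted_equal) auto
  have cd: "card (tau k ` c) = card c" by (rule card_image) (rule inj_tau)
  have nz: "sl c ! r \<noteq> 0" if "r < card c" for r using sl_nth_in[OF c(1) that] c(2) by metis
  have "rs k (minor c b) = minor (tau k ` c) b"
    unfolding rs_def psub_minor unfolding minor_def cd by (intro arg_cong[where f=det] eq_matI) (auto simp: rsv_def nz s[simplified] z_var_V c)
  thus ?thesis by (intro exI[of _ 1]) simp
qed

lemma rs_gens:
  assumes "P \<in> gens D" "is_diagram D"
  shows "\<exists>s P'. P' \<in> gens (swp k D) \<and> rs k P = C s * (P' :: 'k::field matpoly)"
  using assms
proof (induction D arbitrary: P)
  case Nil
  thus ?case by (intro exI[of _ 1]) (simp add: rs_def)
next
  case (Cons c D)
  then obtain b Q where P: "P = minor c b * Q" "finite b" "card b = card c" "Q \<in> gens D" by (auto simp: gens_Cons)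
  have d: "finite c" "0 \<notin> c" "is_diagram D" using Cons.prems by (auto simp: is_diagram_Cons)
  obtain s Q' where Q: "Q' \<in> gens (swp k D)" "rs k Q = C s * Q'" using Cons.IH[OF P(4) d(3)] by blast
  obtain t :: 'k where t: "rs k (minor c b) = C t * minor (tau k ` c) b" using rs_minor[OF d(1,2) P(3)] by blast
  have cd: "card (tau k ` c) = card c" by (rule card_image) (rule inj_tau)
  have "rs k P = C (t * s) * (minor (tau k ` c) b * Q')" by (simp add: P rs_mult t Q ac_simps)
  moreover have "minor (tau k ` c) b * Q' \<in> gens (swp k (c # D))"
    using P(2,3) Q(1) cd by (auto simp: gens_Cons)
  ultimately show ?case by blast
qed

lemma rs_rA:
  assumes "k \<ge> 1" "A k = A (k + 1)"
  shows "rs k (rA A F) = rA A (rs k F)"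
proof -
  have "A (tau k l) = A l" for l using assms(2) by (auto simp: transpose_def)
  hence "psub (\<lambda>v. V (rsv k v)) (case v of (l, q) \<Rightarrow> if l = 0 \<or> q \<in> A l then V (l, q) else 0)
    = psub (\<lambda>(l, q). if l = 0 \<or> q \<in> A l then V (l, q) else 0) (V (rsv k v) :: 'a matpoly)" for v
    using tau_0[OF assms(1)] by (cases v) (auto simp: rsv_def)
  thus ?thesis unfolding rs_def rA_def psub_psub by presburger
qed

lemma rs_FM:
  assumes "F \<in> FM A D" "is_diagram D" "k \<ge> 1" "A k = A (k + 1)"
  shows "rs k F \<in> FM A (swp k D)"
proof -
  have "FM A D \<subseteq> {F :: 'a matpoly. rs k F \<in> FM A (swp k D)}"
  proof (rule FM_least)
    show "pm.subspace {F :: 'a matpoly. rs k F \<in> FM A (swp k D)}"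
      using subspace_FM[of A "swp k D"] by (auto simp: pm.subspace_def rs_def psub_add psub_scale)
    fix P :: "'a matpoly" assume "P \<in> gens D"
    then obtain s P' where P: "P' \<in> gens (swp k D)" "rs k P = C s * P'" using rs_gens[OF _ assms(2)] by blast
    have "rs k (rA A P) = scale s (rA A P')"
      unfolding rs_rA[OF assms(3,4)] P(2) by (simp add: rA_def psub_mult scale_conv)
    also have "\<dots> \<in> FM A (swp k D)" unfolding FM_def using P(1) by (intro pm.span_scale pm.span_base) auto
    finally show "rA A P \<in> {F. rs k F \<in> FM A (swp k D)}" by simp
  qed
  thus ?thesis using assms(1) by auto
qed

lemma swp_swp: "swp k (swp k D) = D" by (simp add: swp_def image_comp comp_def)

lemma rs_FM_iff:
  assumes "is_diagram D" "k \<ge> 1" "A k = A (k + 1)"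
  shows "rs k F \<in> FM A (swp k D) \<longleftrightarrow> F \<in> FM A D"
  using rs_FM[of F A D k] rs_FM[of "rs k F" A "swp k D" k] assms is_diagram_swp[of D k] by (auto simp: rs_rs swp_swp)

lemma rs_sigma:
  assumes "k \<ge> 1" "x \<ge> 1" "0 \<notin> B"
  shows "sigma (tau k x) (tau k ` B) (rs k F) = rs k (sigma x B F)"
proof -
  have t: "tau k x \<noteq> 0" using tau_0[OF assms(1)] assms(2) by simp
  have s: "(\<Sum>j\<in>tau k ` B. V (0, j) * V (j, q)) = (\<Sum>j\<in>B. psub (\<lambda>v. V (rsv k v)) (V (0, j) * V (j, q)) :: 'a matpoly)" for q
    by (subst sum.reindex[OF inj_tau], rule sum.cong)
      (use assms(3) tau_0[OF assms(1)] in \<open>auto simp: psub_mult rsv_def\<close>)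
  have z: "tau k 0 = 0" using tau_0[OF assms(1)] by simp
  have "psub (\<lambda>(l, q). if l = tau k x then (\<Sum>j\<in>tau k ` B. V (0, j) * V (j, q)) + V (0, 0) * V (tau k x, q) else V (l, q)) (V (rsv k v))
    = psub (\<lambda>v. V (rsv k v)) (case v of (l, q) \<Rightarrow> if l = x then (\<Sum>j\<in>B. V (0, j) * V (j, q)) + V (0, 0) * V (x, q) else (V (l, q) :: 'a matpoly))" for v
    using t assms(2) z unfolding s by (cases v) (auto simp: rsv_def psub_add psub_mult psub_sum tau_eq_iff[simplified])
  thus ?thesis unfolding sigma_def rs_def psub_psub by presburger
qed

text \<open>Transports the intrinsic description to the swapped diagram, in which the image of row
  \<open>x\<close> can be the top row. There the induction hypothesis applies.\<close>

lemma rs_Isp: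
  assumes I: "Isp x A D F" and d: "is_diagram D" and k: "k \<ge> 1" "A k = A (k + 1)" and x: "x \<ge> 1"
  shows "Isp (tau k x) A (swp k D) (rs k F)"
proof -
  have t: "tau k x \<noteq> 0" using tau_0[OF k(1)] x by simp
  have r: "rsv k ` rvars (tau k x) = rvars x"
    using t x by (auto simp: rsv_def rvars_def image_iff intro!: bexI)
  have Ax: "A (tau k x) = A x" using k(2) by (auto simp: transpose_def)
  let ?m = "Poly_Mapping.map_key (rsv k) :: (nat \<times> nat \<Rightarrow>\<^sub>0 nat) \<Rightarrow> _"
  note inv = rsv_rsv[OF k(1)]
  have cf: "cf (rvars (tau k x)) X (rs k F) = rs k (cf (rvars x) (?m X) F)" for X :: "nat \<times> nat \<Rightarrow>\<^sub>0 nat"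
    unfolding rs_def cf_psub_rename[OF inv] r ..
  have km: "ks (?m X) \<subseteq> rvars x" if "ks X \<subseteq> rvars (tau k x)" for X :: "nat \<times> nat \<Rightarrow>\<^sub>0 nat"
    unfolding ks_mk[OF inv] r[symmetric] using that by (rule image_mono)
  show ?thesis unfolding Isp_def
  proof (intro conjI allI impI)
    fix X :: "nat \<times> nat \<Rightarrow>\<^sub>0 nat" assume X: "ks X \<subseteq> rvars (tau k x)"
    show "cf (rvars (tau k x)) X (rs k F) \<in> FM A (delrow (tau k x) (swp k D))"
      unfolding cf delrow_swp using I km[OF X] by (intro rs_FM is_diagram_delrow d k) (simp add: Isp_def)
    assume "cf (rvars (tau k x)) X (rs k F) \<noteq> 0"
    hence "cf (rvars x) (?m X) F \<noteq> 0" unfolding cf using rs_eq_0[OF k(1)] by blast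
    hence e: "dg (?m X) = nB x {} D" "snd ` ks (?m X) \<subseteq> A x" using I km[OF X] by (auto simp: Isp_def)
    show "dg X = nB (tau k x) {} (swp k D)" using e(1) nB_swp[of k x "{}" D] dg_mk[OF inv, of X] by simp
    have "snd ` ks (?m X) = snd ` ks X"
      unfolding ks_mk[OF inv] image_image using X t by (intro image_cong) (auto simp: rvars_def rsv_def)
    thus "snd ` ks X \<subseteq> A (tau k x)" using e(2) Ax by simp
  next
    fix B assume B: "tau k x \<notin> B"
    define B' where "B' = tau k ` B"
    have BB: "B = tau k ` B'" by (simp add: B'_def image_comp comp_def)
    have xB: "x \<notin> B'" using B unfolding BB by (blast intro: imageI)
    have n: "nB (tau k x) B (swp k D) = nB x B' D" unfolding BB by (rule nB_swp)
    show "V (0, 0) ^ nB (tau k x) B (swp k D) dvd rA A (sigma (tau k x) B (rs k F))"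
    proof (cases "0 \<in> B'")
      case True
      hence "nB x B' D = 0" using d by (auto simp: nB_def is_diagram_def filter_empty_conv)
      thus ?thesis unfolding n by simp
    next
      case False
      have "V (0, 0) ^ nB x B' D dvd rA A (sigma x B' F)" using I xB by (auto simp: Isp_def)
      then obtain G where G: "rA A (sigma x B' F) = V (0, 0) ^ nB x B' D * G" by blast
      have "rA A (sigma (tau k x) B (rs k F)) = rs k (rA A (sigma x B' F))"
        unfolding BB rs_sigma[OF k(1) x False] rs_rA[OF k] ..
      also have "\<dots> = V (0, 0) ^ nB x B' D * rs k G"
      proof -
        have t0: "tau k 0 = 0" using tau_0[OF k(1)] by simp
        show ?thesis unfolding G by (simp only: rs_def psub_mult psub_power psub_V rsv_def case_prod_conv refl if_True t0)
      qed
      finally show ?thesis unfolding n by simp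
    qed
  qed
qed

section \<open>Homogeneity and restriction of the flag\<close>

lemma psub_pure_scaled:
  assumes "\<And>v. v \<in> ks X \<Longrightarrow> g v = t * h v"
  shows "psub g (sg X 1) = t ^ dg X * psub h (sg X 1 :: ('v, 'a::comm_ring_1) mp)"
proof -
  have "mon g X = (\<Prod>v\<in>ks X. t ^ lk X v * h v ^ lk X v)"
    unfolding mon_def using assms by (intro prod.cong) (auto simp: power_mult_distrib)
  also have "\<dots> = t ^ dg X * mon h X" by (simp add: prod.distrib mon_def dg_def power_sum)
  finally show ?thesis by (simp add: psub_single)
qed

text \<open>All \<open>S\<close>-monomials of \<open>F\<close> have degree \<open>d\<close>, and
  each variable of \<open>S\<close> brings one factor \<open>t\<close>, so every term of the
  expansion by \<open>S\<close> acquires the same power.\<close>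

lemma psub_homog:
  fixes F :: "('v, 'a::comm_ring_1) mp"
  assumes "\<And>X. ks X \<subseteq> S \<Longrightarrow> cf S X F \<noteq> 0 \<Longrightarrow> dg X = d"
    and "\<And>v. v \<in> S \<Longrightarrow> g v = t * h v" "\<And>v. v \<notin> S \<Longrightarrow> v \<in> vars F \<Longrightarrow> g v = h v"
  shows "psub g F = t ^ d * psub h F"
proof -
  have eq: "psub g (sg X 1 * cf S X F) = t ^ d * psub h (sg X 1 * cf S X F)" if X: "ks X \<subseteq> S" for X
  proof (cases "cf S X F = 0")
    case False
    hence d: "dg X = d" using assms(1) X by blast
    have "psub g (cf S X F) = psub h (cf S X F)"
    proof (rule psub_cong)
      fix v assume "v \<in> vars (cf S X F)"
      thus "g v = h v" using vars_cf[of S X F] vars_cf_subset[of S X F] assms(3) by blast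
    qed
    moreover have "psub g (sg X 1) = t ^ dg X * psub h (sg X 1 :: ('v, 'a) mp)"
      using X assms(2) by (intro psub_pure_scaled) blast
    ultimately show ?thesis by (simp add: psub_mult d mult.assoc)
  qed simp
  have k: "ks X \<subseteq> S" if "X \<in> pr S ` ks F" for X using that by (auto simp: keys_pr)
  have "psub g F = (\<Sum>X\<in>pr S ` ks F. psub g (sg X 1 * cf S X F))"
    by (subst cf_decomp[of F S]) (rule psub_sum)
  also have "\<dots> = (\<Sum>X\<in>pr S ` ks F. t ^ d * psub h (sg X 1 * cf S X F))"
    by (rule sum.cong[OF refl]) (rule eq[OF k])
  also have "\<dots> = t ^ d * psub h F"
    unfolding sum_distrib_left[symmetric] psub_sum[symmetric] using cf_decomp[of F S] by simp
  finally show ?thesis .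
qed

lemma cf_zero_V:
  fixes F :: "('v, 'a::comm_ring_1) mp"
  assumes "ks X \<subseteq> S"
  shows "cf S X (psub (V(v := 0)) F) =
    (if v \<in> S then if lk X v = 0 then cf S X F else 0 else psub (V(v := 0)) (cf S X F))"
proof (cases "v \<in> S")
  case True
  have p: "psub (V(v := 0)) (sg Y 1) = (if lk Y v = 0 then sg Y 1 else 0 :: ('v, 'a) mp)" for Y
  proof (cases "lk Y v = 0")
    case True
    hence "psub (V(v := 0)) (sg Y 1) = psub V (sg Y 1 :: ('v, 'a) mp)"
      by (intro psub_cong) (auto simp: vars_def in_keys_iff split: if_splits)
    thus ?thesis using True by simp
  next
    case False
    hence "v \<in> ks Y" by (simp add: in_keys_iff)
    hence "mon (V(v := 0)) Y = (0 :: ('v, 'a) mp)" unfolding mon_def using False by (intro prod_zero bexI[of _ v]) (simp_all add: power_0_left)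
    thus ?thesis using False by (simp add: psub_single)
  qed
  have q: "psub (V(v := 0)) (cf S Y F) = cf S Y F" for Y
  proof -
    have "psub (V(v := 0)) (cf S Y F) = psub V (cf S Y F)" using vars_cf[of S Y F] True by (intro psub_cong) auto
    thus ?thesis by simp
  qed
  let ?T = "{Y \<in> pr S ` ks F. lk Y v = 0}"
  have "psub (V(v := 0)) F = (\<Sum>Y\<in>pr S ` ks F. psub (V(v := 0)) (sg Y 1 * cf S Y F))"
    by (subst cf_decomp[of F S]) (rule psub_sum)
  also have "\<dots> = (\<Sum>Y\<in>pr S ` ks F. if lk Y v = 0 then sg Y 1 * cf S Y F else 0)"
    by (intro sum.cong refl) (simp add: psub_mult p q)
  also have "\<dots> = (\<Sum>Y\<in>?T. sg Y 1 * cf S Y F)" by (simp add: sum.If_cases Int_def)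
  finally have "cf S X (psub (V(v := 0)) F) = cf S X (\<Sum>Y\<in>?T. sg Y 1 * cf S Y F)" by simp
  also have "\<dots> = (if X \<in> ?T then cf S X F else 0)"
    by (rule cf_unique) (auto simp: keys_pr vars_cf assms)
  also have "\<dots> = (if lk X v = 0 then cf S X F else 0)"
    using cf_zero_outside[OF assms, of F] by auto
  finally show ?thesis using True by simp
next
  case False
  hence "cf S X (psub (V(v := 0)) F) = psub (V(v := 0)) (cf S X F)"
    by (intro cf_psub assms) auto
  thus ?thesis using False by simp
qed

section \<open>Dependence on the flag\<close>

lemma rA_cong:
  assumes "\<And>l q. (l, q) \<in> vars F \<Longrightarrow> l \<noteq> 0 \<Longrightarrow> A l = A' l"
  shows "rA A F = rA A' F"
  unfolding rA_def using assms by (intro psub_cong) (auto split: prod.splits)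

lemma vars_gens:
  assumes "P \<in> gens D" "is_diagram D"
  shows "vars (P :: 'k::field matpoly) \<subseteq> rowset D \<times> UNIV"
proof -
  have "P = rA (\<lambda>_. UNIV) P" by (simp add: rA_def case_prod_unfold)
  also have "\<dots> \<in> FM (\<lambda>_. UNIV) D" unfolding FM_def using assms(1) by (intro pm.span_base) auto
  finally show ?thesis using vars_FM[OF assms(2)] by blast
qed

lemma FM_cong:
  assumes "is_diagram D" "\<And>l. l \<in> rowset D \<Longrightarrow> A l = A' l"
  shows "FM A D = (FM A' D :: 'k::field matpoly set)"
proof -
  have "rA A P = rA A' P" if "P \<in> gens D" for P :: "'k matpoly"
    using vars_gens[OF that assms(1)] assms(2) by (intro rA_cong) blast
  thus ?thesis unfolding FM_def by (metis (no_types, lifting) image_cong)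
qed

lemma rA_id:
  assumes "vars F \<subseteq> {(l, q). q \<in> A l}" shows "rA A F = F"
proof -
  have "rA A F = psub V F" unfolding rA_def using assms by (intro psub_cong) auto
  thus ?thesis by simp
qed

lemma IspD:
  assumes "Isp x A D F"
  shows "ks X \<subseteq> rvars x \<Longrightarrow> cf (rvars x) X F \<in> FM A (delrow x D)"
    and "ks X \<subseteq> rvars x \<Longrightarrow> cf (rvars x) X F \<noteq> 0 \<Longrightarrow> dg X = nB x {} D"
    and "ks X \<subseteq> rvars x \<Longrightarrow> cf (rvars x) X F \<noteq> 0 \<Longrightarrow> snd ` ks X \<subseteq> A x"
    and "x \<notin> B \<Longrightarrow> V (0, 0) ^ nB x B D dvd rA A (sigma x B F)"
  using assms unfolding Isp_def by simp_all

lemma IspI: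
  assumes "\<And>X. ks X \<subseteq> rvars x \<Longrightarrow> cf (rvars x) X F \<in> FM A (delrow x D)"
    and "\<And>X. ks X \<subseteq> rvars x \<Longrightarrow> cf (rvars x) X F \<noteq> 0 \<Longrightarrow> dg X = nB x {} D"
    and "\<And>X. ks X \<subseteq> rvars x \<Longrightarrow> cf (rvars x) X F \<noteq> 0 \<Longrightarrow> snd ` ks X \<subseteq> A x"
    and "\<And>B. x \<notin> B \<Longrightarrow> nB x B D \<noteq> 0 \<Longrightarrow> V (0, 0) ^ nB x B D dvd rA A (sigma x B F)"
  shows "Isp x A D F"
proof -
  have "V (0, 0) ^ nB x B D dvd rA A (sigma x B F)" if "x \<notin> B" for B
    using assms(4)[OF that] by (cases "nB x B D = 0") simp_all
  thus ?thesis unfolding Isp_def using assms(1-3) by (intro conjI allI impI)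
qed

lemma Isp_letters:
  assumes "Isp x A D F" "is_diagram D" "x \<in> rowset D"
  shows "vars F \<subseteq> {(l, q). l \<in> rowset D \<and> q \<in> A l}"
proof -
  let ?S = "{(l, q). l \<in> rowset D \<and> q \<in> A l}"
  have "sg X 1 * cf (rvars x) X F \<in> {G. vars G \<subseteq> ?S}" if X: "X \<in> pr (rvars x) ` ks F" for X
  proof (cases "cf (rvars x) X F = 0")
    case False
    have X': "ks X \<subseteq> rvars x" using X by (auto simp: keys_pr)
    note h = IspD(3)[OF assms(1) X' False] IspD(1)[OF assms(1) X']
    have "vars (sg X 1 :: 'a matpoly) \<subseteq> ?S"
    proof
      fix v assume "v \<in> vars (sg X 1 :: 'a matpoly)"
      hence v: "v \<in> ks X" by (simp add: vars_def)
      hence "snd v \<in> A x" "v \<in> rvars x" using h(1) X' by blast+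
      thus "v \<in> ?S" using assms(3) by (auto simp: rvars_def)
    qed
    moreover have "vars (cf (rvars x) X F) \<subseteq> {(l, q). l \<in> rowset (delrow x D) \<and> q \<in> A l}"
      by (rule vars_FM[OF is_diagram_delrow[OF assms(2)] h(2)])
    hence "vars (cf (rvars x) X F) \<subseteq> ?S" unfolding rowset_delrow by blast
    ultimately show ?thesis using vars_mult[of "sg X 1" "cf (rvars x) X F"] by blast
  qed simp
  hence "(\<Sum>X\<in>pr (rvars x) ` ks F. sg X 1 * cf (rvars x) X F) \<in> {G. vars G \<subseteq> ?S}"
    by (rule pm.subspace_sum[OF subspace_vars])
  thus ?thesis using cf_decomp[of F "rvars x"] by simp
qed

text \<open>Without boxes in row \<open>x\<close> the only admissible monomial of that row is 1, and
  its coefficient is all of \<open>F\<close>.\<close>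

lemma Isp_empty_row:
  assumes "Isp x A D F" "x \<notin> rowset D" shows "F \<in> FM A D"
proof -
  have n: "nB x {} D = 0" using nB_pos[of x D] assms(2) by simp
  have "sg X 1 * cf (rvars x) X F \<in> FM A D" if X: "X \<in> pr (rvars x) ` ks F" for X
  proof (cases "cf (rvars x) X F = 0")
    case True thus ?thesis by (simp add: pm.subspace_0[OF subspace_FM])
  next
    case False
    have X': "ks X \<subseteq> rvars x" using X by (auto simp: keys_pr)
    have "dg X = 0" "cf (rvars x) X F \<in> FM A D"
      using IspD(2)[OF assms(1) X' False] IspD(1)[OF assms(1) X'] n delrow_id[OF assms(2)] by simp_all
    moreover have "X = 0" using \<open>dg X = 0\<close> by (auto simp: dg_def in_keys_iff poly_mapping_eq_iff fun_eq_iff)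
    ultimately show ?thesis by simp
  qed
  hence "(\<Sum>X\<in>pr (rvars x) ` ks F. sg X 1 * cf (rvars x) X F) \<in> FM A D" by (rule pm.subspace_sum[OF subspace_FM])
  thus ?thesis using cf_decomp[of F "rvars x"] by simp
qed

lemma Isp_diff:
  assumes "Isp x A D F" "Isp x A D G" shows "Isp x A D (F - G)"
proof (rule IspI)
  fix X :: "nat \<times> nat \<Rightarrow>\<^sub>0 nat" assume X: "ks X \<subseteq> rvars x"
  show "cf (rvars x) X (F - G) \<in> FM A (delrow x D)"
    unfolding cf_diff by (intro pm.subspace_diff[OF subspace_FM] IspD(1)[OF assms(1) X] IspD(1)[OF assms(2) X])
  assume "cf (rvars x) X (F - G) \<noteq> 0"
  hence "cf (rvars x) X F \<noteq> 0 \<or> cf (rvars x) X G \<noteq> 0" by (auto simp: cf_diff)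
  thus "dg X = nB x {} D" "snd ` ks X \<subseteq> A x"
    using IspD(2,3)[OF assms(1) X] IspD(2,3)[OF assms(2) X] by satx+
next
  fix B assume B: "x \<notin> B"
  show "V (0, 0) ^ nB x B D dvd rA A (sigma x B (F - G))"
    using dvd_diff[OF IspD(4)[OF assms(1) B] IspD(4)[OF assms(2) B]] by (simp add: sigma_def rA_def psub_diff)
qed

lemma nB_B:
  assumes "nB x B D \<noteq> 0" shows "B \<subseteq> rowset D" "x \<in> rowset D"
  using assms by (auto simp: nB_def filter_empty_conv rowset_def)

lemma vars_sigma:
  assumes "vars F \<subseteq> {(l, q). l \<in> S}" "0 \<in> S" "B \<subseteq> S" "x \<in> S"
  shows "vars (sigma x B F :: 'k::field matpoly) \<subseteq> {(l, q). l \<in> S}"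
proof -
  let ?W = "{G :: 'k matpoly. vars G \<subseteq> {(l, q). l \<in> S}}"
  note sub = subspace_vars[of "{(l, q). l \<in> S}", where ?'a='k]
  have m: "V (i, p) * V (j, q) \<in> ?W" if "i \<in> S" "j \<in> S" for i j p q
  proof -
    have "vars (V (i, p) * V (j, q) :: 'k matpoly) \<subseteq> vars (V (i, p) :: 'k matpoly) \<union> vars (V (j, q) :: 'k matpoly)" by (rule vars_mult)
    hence "vars (V (i, p) * V (j, q) :: 'k matpoly) \<subseteq> {(i, p)} \<union> {(j, q)}" by (simp only: vars_V)
    thus ?thesis using that by blast
  qed
  have w: "(\<Sum>j\<in>B. V (0, j) * V (j, q)) + V (0, 0) * V (x, q) \<in> ?W" for q
    by (intro pm.subspace_add[OF sub] pm.subspace_sum[OF sub] m) (use assms in blast)+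
  have "vars (case v of (l, q) \<Rightarrow> if l = x then (\<Sum>j\<in>B. V (0, j) * V (j, q)) + V (0, 0) * V (x, q) else (V (l, q) :: 'k matpoly))
      \<subseteq> {(l, q). l \<in> S}" if "v \<in> vars F" for v
  proof (cases v)
    case (Pair l q)
    have "l \<in> S" using that assms(1) Pair by blast
    thus ?thesis unfolding Pair case_prod_conv using CollectD[OF w[of q]] by (cases "l = x") (simp_all only: if_True if_False refl vars_V, simp)
  qed
  thus ?thesis unfolding sigma_def by (intro order_trans[OF vars_psub] UN_least)
qed

lemma Isp_cong:
  assumes "Isp x A D F" "is_diagram D" "x \<in> rowset D" "\<And>l. l \<in> rowset D \<Longrightarrow> A l = A' l"
  shows "Isp x A' D F"
proof (rule IspI)
  note v = Isp_letters[OF assms(1-3)]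
  fix X :: "nat \<times> nat \<Rightarrow>\<^sub>0 nat" assume X: "ks X \<subseteq> rvars x"
  have "FM A (delrow x D) = (FM A' (delrow x D) :: 'a matpoly set)"
    using assms(2,4) by (intro FM_cong is_diagram_delrow) (auto simp: rowset_delrow)
  thus "cf (rvars x) X F \<in> FM A' (delrow x D)" using IspD(1)[OF assms(1) X] by simp
  assume nz: "cf (rvars x) X F \<noteq> 0"
  show "dg X = nB x {} D" by (rule IspD(2)[OF assms(1) X nz])
  show "snd ` ks X \<subseteq> A' x" using IspD(3)[OF assms(1) X nz] assms(4)[OF assms(3)] by simp
next
  fix B assume B: "x \<notin> B" and nz: "nB x B D \<noteq> 0"
  have "vars (sigma x B F) \<subseteq> {(l, q). l \<in> insert 0 (rowset D)}"
    using Isp_letters[OF assms(1-3)] nB_B[OF nz] by (intro vars_sigma) auto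
  hence "rA A' (sigma x B F) = rA A (sigma x B F)" using assms(4) by (intro rA_cong) auto
  thus "V (0, 0) ^ nB x B D dvd rA A' (sigma x B F)" using IspD(4)[OF assms(1) B] by simp
qed

lemma rA_restrict:
  assumes "k \<ge> 1"
  shows "psub (V((k, p) := 0)) (rA A F) = rA (A(k := A k - {p})) F"
proof -
  have "psub (V((k, p) := 0)) (case v of (l, q) \<Rightarrow> if l = 0 \<or> q \<in> A l then V (l, q) else 0)
    = (case v of (l, q) \<Rightarrow> if l = 0 \<or> q \<in> (A(k := A k - {p})) l then V (l, q) else (0 :: 'a matpoly))" for v
    using assms by (cases v) auto
  thus ?thesis unfolding rA_def psub_psub by presburger
qed

lemma FM_restrict:
  assumes "F \<in> FM A D" "k \<ge> 1"
  shows "psub (V((k, p) := 0)) F \<in> FM (A(k := A k - {p})) D"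
  using assms unfolding FM_image by (auto simp: rA_restrict)

text \<open>The point is that setting \<open>V (k, p)\<close> to 0 is compatible with the
  substitution. For \<open>k = K\<close> the substituted entry involves \<open>V (K, p)\<close> and
  entries at \<open>p\<close> of rows smaller than \<open>K\<close>; the reduced flag admits
  \<open>p\<close> in none of them.\<close>

lemma Isp_restrict:
  assumes I: "Isp K A D F" and d: "is_diagram D" and K: "rowset D \<subseteq> {1..K}" "K \<in> rowset D"
    and k: "1 \<le> k" "k \<le> K" and p: "\<And>l. 1 \<le> l \<Longrightarrow> l < k \<Longrightarrow> p \<notin> A l"
  shows "Isp K (A(k := A k - {p})) D (psub (V((k, p) := 0)) F)"
proof (rule IspI)
  let ?A = "A(k := A k - {p})"
  have z: "(k, p) \<in> rvars K \<longleftrightarrow> k = K" by (auto simp: rvars_def)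
  have eq: "FM ?A (delrow K D) = (FM A (delrow K D) :: 'a matpoly set)" if "k = K"
    using d that by (intro FM_cong is_diagram_delrow) (auto simp: rowset_delrow)
  fix X :: "nat \<times> nat \<Rightarrow>\<^sub>0 nat" assume X: "ks X \<subseteq> rvars K"
  have 1: "cf (rvars K) X F \<in> FM A (delrow K D)" by (rule IspD(1)[OF I X])
  show "cf (rvars K) X (psub (V((k, p) := 0)) F) \<in> FM ?A (delrow K D)"
    unfolding cf_zero_V[OF X] z
    using 1 eq FM_restrict[OF 1 k(1), of p] pm.subspace_0[OF subspace_FM[of ?A "delrow K D", where ?'a='a]] by auto
  assume nz: "cf (rvars K) X (psub (V((k, p) := 0)) F) \<noteq> 0"
  hence "cf (rvars K) X F \<noteq> 0" unfolding cf_zero_V[OF X] by (auto split: if_splits)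
  note 2 = IspD(2)[OF I X this] IspD(3)[OF I X this]
  show "dg X = nB K {} D" by (rule 2)
  show "snd ` ks X \<subseteq> ?A K"
  proof (cases "k = K")
    case True
    hence "(K, p) \<notin> ks X" using nz unfolding cf_zero_V[OF X] z by (auto simp: in_keys_iff split: if_splits)
    thus ?thesis using 2(2) X True by (auto simp: rvars_def)
  qed (use 2 in auto)
next
  let ?A = "A(k := A k - {p})"
  fix B assume B: "K \<notin> B" and nz: "nB K B D \<noteq> 0"
  show "V (0, 0) ^ nB K B D dvd rA ?A (sigma K B (psub (V((k, p) := 0)) F))"
  proof -
    have BK: "1 \<le> j \<and> j < K" if "j \<in> B" for j
      using nB_B(1)[OF nz] K(1) B that by (metis atLeastAtMost_iff le_neq_implies_less subsetD)
    have "rA ?A (sigma K B (V (k, p))) = (0 :: 'a matpoly)"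
    proof (cases "k = K")
      case True
      have "rA ?A (V (0, j) * V (j, p)) = (0 :: 'a matpoly)" if "j \<in> B" for j
        using BK[OF that] p[of j] True by (simp add: rA_def psub_mult)
      moreover have "rA ?A (V (0, 0) * V (K, p)) = (0 :: 'a matpoly)" using True k by (simp add: rA_def psub_mult)
      ultimately show ?thesis using True by (simp add: sigma_def rA_def psub_add psub_sum)
    next
      case False
      thus ?thesis using k by (simp add: sigma_def rA_def)
    qed
    hence "rA ?A (sigma K B ((V((k, p) := 0)) v)) = rA ?A (sigma K B (V v :: 'a matpoly))" for v
      by (cases "v = (k, p)") (simp_all add: sigma_def rA_def)
    moreover have "rA ?A (sigma K B (psub f F)) = psub (\<lambda>v. rA ?A (sigma K B (f v))) F" for f :: "_ \<Rightarrow> 'a matpoly"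
      by (simp only: sigma_def rA_def psub_psub)
    ultimately have "rA ?A (sigma K B (psub (V((k, p) := 0)) F)) = rA ?A (sigma K B (psub V F))" by presburger
    hence "rA ?A (sigma K B (psub (V((k, p) := 0)) F)) = rA ?A (sigma K B F)" by (simp only: psub_V_id)
    also have "\<dots> = psub (V((k, p) := 0)) (rA A (sigma K B F))" by (rule rA_restrict[OF k(1), symmetric])
    finally have e: "rA ?A (sigma K B (psub (V((k, p) := 0)) F)) = psub (V((k, p) := 0)) (rA A (sigma K B F))" .
    have "V (0, 0) ^ nB K B D dvd rA A (sigma K B F)" by (rule IspD(4)[OF I B])
    then obtain G where "rA A (sigma K B F) = V (0, 0) ^ nB K B D * G" by blast
    thus ?thesis unfolding e using k by (simp add: psub_mult psub_power)
  qed
qed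

text \<open>Among the rows of \<open>a\<close> only the largest, \<open>k\<close>, admits the letter
  \<open>p\<close>. Hence a flagged minor of \<open>a\<close> with letter \<open>p\<close> is, up to
  a nonzero constant, \<open>V (k, p)\<close> times the minor without row \<open>k\<close> and
  letter \<open>p\<close>. If \<open>p\<close> already occurs in \<open>b\<close>, the minor of
  \<open>a - {k}\<close> vanishes.\<close>

lemma V_mult_FM:
  assumes w: "descent_witness k D L a R" and d: "is_diagram D"
    and p: "p \<in> A k" "\<And>l. 1 \<le> l \<Longrightarrow> l < k \<Longrightarrow> p \<notin> A l"
    and H: "H \<in> FM A (L @ (a - {k}) # R)"
  shows "V (k, p) * H \<in> FM A D"
proof -
  note wc = witness_col[OF d w]
  have al: "1 \<le> l \<and> l < k" if "l \<in> a - {k}" for l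
  proof -
    have "l \<in> {1..k}" "l \<noteq> k" using that wc(3) by auto
    thus ?thesis by auto
  qed
  have eq: "FM A D = (FM A (a # L @ R) :: 'a matpoly set)"
    using swp_witness_mset[OF w] by (intro FM_mset) simp
  have "FM A (L @ (a - {k}) # R) = (FM A ((a - {k}) # L @ R) :: 'a matpoly set)" by (rule FM_mset) simp
  hence H': "H \<in> FM A ((a - {k}) # L @ R)" using H by blast
  have "FM A ((a - {k}) # L @ R) \<subseteq> {H :: 'a matpoly. V (k, p) * H \<in> FM A (a # L @ R)}"
  proof (rule FM_least[OF subspace_vimage_mult[OF subspace_FM]])
    fix P :: "'a matpoly" assume "P \<in> gens ((a - {k}) # L @ R)"
    then obtain b Q where P: "P = minor (a - {k}) b * Q" "finite b" "card b = card (a - {k})" "Q \<in> gens (L @ R)"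
      by (auto simp: gens_Cons)
    have Q: "rA A Q \<in> FM A (L @ R)" unfolding FM_def using P(4) by (intro pm.span_base) auto
    have rk: "rA A (V (k, p)) = (V (k, p) :: 'a matpoly)" using p by (simp add: rA_def)
    have r0: "rA A (V (l, p)) = (0 :: 'a matpoly)" if "l \<in> a - {k}" for l
      using al[OF that] p(2) by (simp add: rA_def)
    show "rA A P \<in> {H. V (k, p) * H \<in> FM A (a # L @ R)}"
    proof (cases "p \<in> b")
      case True
      obtain s :: "nat \<Rightarrow> 'a" where "minor (a - {k}) b = (\<Sum>x\<in>a - {k}. C (s x) * V (x, p) * minor (a - {k} - {x}) (b - {p}))"
        using minor_col[OF _ P(2,3) True, where ?'k='a] wc(1) by auto
      hence "rA A (minor (a - {k}) b) = (\<Sum>x\<in>a - {k}. rA A (C (s x)) * rA A (V (x, p)) * rA A (minor (a - {k} - {x}) (b - {p})))"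
        by (simp add: rA_def psub_sum psub_mult)
      also have "\<dots> = 0" by (rule sum.neutral) (simp add: r0)
      finally show ?thesis by (simp add: P(1) rA_mult pm.subspace_0[OF subspace_FM])
    next
      case False
      have cd: "card (insert p b) = card a" using False P(2,3) card.remove[OF wc(1,2)] by simp
      obtain s :: "nat \<Rightarrow> 'a" where s: "s k \<noteq> 0"
        "minor a (insert p b) = (\<Sum>x\<in>a. C (s x) * V (x, p) * minor (a - {x}) (insert p b - {p}))"
        using minor_col[OF wc(1) _ cd, of p, where ?'k='a] P(2) by auto
      have ib: "insert p b - {p} = b" using False by auto
      have "rA A (minor a (insert p b)) = (\<Sum>x\<in>a. C (s x) * rA A (V (x, p)) * rA A (minor (a - {x}) b))"
        unfolding s(2) ib by (simp add: rA_def psub_sum psub_mult)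
      also have "\<dots> = C (s k) * rA A (V (k, p)) * rA A (minor (a - {k}) b) + (\<Sum>x\<in>a - {k}. C (s x) * rA A (V (x, p)) * rA A (minor (a - {x}) b))"
        using wc(1,2) by (rule sum.remove)
      also have "(\<Sum>x\<in>a - {k}. C (s x) * rA A (V (x, p)) * rA A (minor (a - {x}) b)) = 0"
        by (rule sum.neutral) (simp add: r0)
      finally have m: "rA A (minor a (insert p b)) = C (s k) * V (k, p) * rA A (minor (a - {k}) b)" by (simp only: rk add_0_right)
      have c: "C (inverse (s k)) * C (s k) = (1 :: 'a matpoly)" using s(1) by (simp flip: C_simps(4))
      have "C (inverse (s k)) * (C (s k) * V (k, p) * rA A (minor (a - {k}) b) * rA A Q) = V (k, p) * (rA A (minor (a - {k}) b) * rA A Q)"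
        by (simp only: mult.assoc[symmetric] c mult_1)
      hence "scale (inverse (s k)) (rA A (minor a (insert p b)) * rA A Q) = V (k, p) * rA A P"
        by (simp only: m scale_conv P(1) rA_mult)
      moreover have "rA A (minor a (insert p b)) * rA A Q \<in> FM A (a # L @ R)"
        by (rule FM_Cons_mult[OF Q _ cd]) (use P(2) in simp)
      hence "scale (inverse (s k)) (rA A (minor a (insert p b)) * rA A Q) \<in> FM A (a # L @ R)"
        by (rule pm.subspace_scale[OF subspace_FM])
      ultimately show ?thesis by simp
    qed
  qed
  thus ?thesis unfolding eq using H' by blast
qed

section \<open>Exactness for transparent diagrams\<close>

definition incA :: "(nat \<Rightarrow> nat set) \<Rightarrow> bool" where
  "incA A \<longleftrightarrow> (\<forall>l\<ge>1. finite (A l)) \<and> (\<forall>l m. 1 \<le> l \<longrightarrow> l \<le> m \<longrightarrow> A l \<subseteq> A m)"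

text \<open>Every witness is allowed and the rows are not yet swapped, so that no choice or
  identification enters. The converse inclusion for the descent part is
  \<open>V_mult_FM\<close>.\<close>

definition E_concl :: "nat \<Rightarrow> diagram \<Rightarrow> (nat \<Rightarrow> nat set) \<Rightarrow> 'k::field matpoly \<Rightarrow> bool" where
  "E_concl k D A H \<longleftrightarrow> (k_full k D \<longrightarrow> H = 0) \<and>
     (\<forall>L a R. descent_witness k D L a R \<longrightarrow> H \<in> FM A (L @ (a - {k}) # R))"

lemma E_conclD:
  assumes "E_concl k D A H"
  shows "k_full k D \<Longrightarrow> H = 0" "descent_witness k D L a R \<Longrightarrow> H \<in> FM A (L @ (a - {k}) # R)"
  using assms by (simp_all add: E_concl_def)

lemma incA_mono: "incA A \<Longrightarrow> 1 \<le> l \<Longrightarrow> l \<le> m \<Longrightarrow> A l \<subseteq> A m" by (simp add: incA_def)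

lemma num_boxes_delrow: "is_diagram D \<Longrightarrow> num_boxes D = num_boxes (delrow K D) + nB K {} D"
proof (induction D)
  case (Cons c D)
  have "card c = card (c - {K}) + (if K \<in> c then 1 else 0)"
    using Cons.prems card.remove[of c K] by (auto simp: is_diagram_Cons)
  thus ?case using Cons by (simp add: is_diagram_Cons del: card_Diff_insert)
qed simp

lemma nB_delrow: "y \<noteq> x \<Longrightarrow> y \<notin> B \<Longrightarrow> nB x B (delrow y D) = nB x B D"
  by (induction D) auto

lemma nB_swap_index: "nB x (insert y B) D = nB y (insert x B) D"
  by (induction D) auto

lemma nB_eqI: "(\<And>c. c \<in> set D \<Longrightarrow> x \<in> c \<and> B \<subseteq> c \<longleftrightarrow> x \<in> c \<and> B' \<subseteq> c) \<Longrightarrow> nB x B D = nB x B' D"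
  by (induction D) auto

lemma nB_ex: "nB x B D \<noteq> 0 \<Longrightarrow> \<exists>c\<in>set D. x \<in> c \<and> B \<subseteq> c"
  by (auto simp: nB_def filter_empty_conv)

lemma delrow_commute: "delrow x (delrow y D) = delrow y (delrow x D)"
  by (auto simp: delrow_def)

lemma vars_rA: "vars (rA A F) \<subseteq> vars F"
proof -
  have "vars (case v of (l, q) \<Rightarrow> if l = 0 \<or> q \<in> A l then V (l, q) else (0 :: 'a matpoly)) \<subseteq> {v}" for v
    by (cases v) auto
  note h = this
  have "(\<Union>v\<in>vars F. vars (case v of (l, q) \<Rightarrow> if l = 0 \<or> q \<in> A l then V (l, q) else (0 :: 'a matpoly))) \<subseteq> vars F"
  proof (rule UN_least)
    fix v assume "v \<in> vars F"
    hence "{v} \<subseteq> vars F" by simp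
    with h show "vars (case v of (l, q) \<Rightarrow> if l = 0 \<or> q \<in> A l then V (l, q) else (0 :: 'a matpoly)) \<subseteq> vars F" by (rule order_trans)
  qed
  thus ?thesis unfolding rA_def by (rule order_trans[OF vars_psub])
qed

lemma sigma_conv: "psub (\<lambda>v. sigma x B (V v)) F = sigma x B F"
  unfolding sigma_def psub_V ..

lemma sigma_V: "sigma x B (V (l, q)) =
    (if l = x then (\<Sum>j\<in>B. V (0, j) * V (j, q)) + V (0, 0) * V (x, q) else V (l, q))"
  by (simp add: sigma_def)

lemma rA_V: "rA A (V (l, q)) = (if l = 0 \<or> q \<in> A l then V (l, q) else 0)"
  by (simp add: rA_def)

lemma rA_add: "rA A (F + G) = rA A F + rA A G" by (simp add: rA_def psub_add)
lemma rA_sum: "rA A (sum f S) = (\<Sum>s\<in>S. rA A (f s))" by (simp add: rA_def psub_sum)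

lemma swp_rows: "rowset D \<subseteq> {1..K} \<Longrightarrow> 1 \<le> k \<Longrightarrow> k + 1 \<le> K \<Longrightarrow> rowset (swp k D) \<subseteq> {1..K}"
  unfolding rowset_swp by (auto simp: transpose_def)

lemma ks_single_add: "ks (sg v 1 + X) = insert v (ks X)" for X :: "'a \<Rightarrow>\<^sub>0 nat"
  by (auto simp: in_keys_iff lookup_add lookup_single when_def split: if_splits)

section \<open>The inductive step for exactness, by the position of \<open>k\<close> relative to the
  top row \<open>K\<close>\<close>

context
  fixes D :: diagram and A :: "nat \<Rightarrow> nat set" and K k p :: nat and H :: "'k::field matpoly"
  assumes trD: "transparent D" and dD: "is_diagram D"
    and IHI: "\<And>D' A K (F :: 'k matpoly). num_boxes D' < num_boxes D \<Longrightarrow> transparent D' \<Longrightarrow> is_diagram D' \<Longrightarrow>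
      incA A \<Longrightarrow> rowset D' \<subseteq> {1..K} \<Longrightarrow> Isp K A D' F \<Longrightarrow> F \<in> FM A D'"
    and IHE: "\<And>D' A k p (H :: 'k matpoly). num_boxes D' < num_boxes D \<Longrightarrow> transparent D' \<Longrightarrow> is_diagram D' \<Longrightarrow>
      incA A \<Longrightarrow> 1 \<le> k \<Longrightarrow> p \<in> A k \<Longrightarrow> (\<And>l. 1 \<le> l \<Longrightarrow> l < k \<Longrightarrow> p \<notin> A l) \<Longrightarrow> A k = A (k + 1) \<Longrightarrow>
      V (k, p) * H \<in> FM A D' \<Longrightarrow> E_concl k D' A H"
    and A: "incA A" and rows: "rowset D \<subseteq> {1..K}" and K: "K \<in> rowset D"
    and k: "1 \<le> k" and p: "p \<in> A k" "\<And>l. 1 \<le> l \<Longrightarrow> l < k \<Longrightarrow> p \<notin> A l" and Ak: "A k = A (k + 1)"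
    and I: "Isp K A D (V (k, p) * H)"
begin

lemma rows_wit:
  assumes "descent_witness k D L a R" shows "rowset (L @ (a - {k}) # R) \<subseteq> {1..K}"
  using rowset_mset[OF swp_witness_mset[OF assms]] rows by auto

text \<open>Transparency is available for the swapped diagram, which also has fewer boxes. The
  intrinsic description is carried there, turned into membership by the induction hypothesis, and
  membership is carried back.\<close>

lemma wit_done:
  assumes w: "descent_witness k D L a R" and x: "x \<ge> 1" and G: "Isp x A (L @ (a - {k}) # R) G"
    and r: "rowset (swp k (L @ (a - {k}) # R)) \<subseteq> {1..tau k x}"
  shows "(G :: 'k matpoly) \<in> FM A (L @ (a - {k}) # R)"
proof -
  let ?D = "L @ (a - {k}) # R"
  have d: "is_diagram ?D" by (rule is_diagram_witness(2)[OF dD w])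
  have "rs k G \<in> FM A (swp k ?D)"
  proof (rule IHI[OF _ _ _ A r])
    show "num_boxes (swp k ?D) < num_boxes D" using num_boxes_witness[OF dD w] by simp
    show "transparent (swp k ?D)" by (rule transparent_witness[OF trD dD w])
    show "is_diagram (swp k ?D)" by (rule is_diagram_swp[OF d k])
    show "Isp (tau k x) A (swp k ?D) (rs k G)" by (rule rs_Isp[OF G d k Ak x])
  qed
  thus ?thesis using rs_FM_iff[OF d k Ak] by blast
qed

lemma K1: "1 \<le> K" using K rows by auto

text \<open>The product contains no variable of row \<open>k\<close>, so a factor
  \<open>V (k, p)\<close> forces it to be 0.\<close>

lemma core_high: assumes "K < k" shows "E_concl k D A H"
proof -
  have "(k, p) \<notin> vars (V (k, p) * H)" using Isp_letters[OF I dD K] rows assms by auto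
  hence "H = 0" using not_V_dvd_free[of "(k, p)" "V (k, p) * H"] by auto
  thus ?thesis by (simp add: E_concl_def pm.subspace_0[OF subspace_FM])
qed

text \<open>Neither the swap nor \<open>V (k, p)\<close> touches row \<open>K\<close>. The factor
  therefore passes through the coefficients along row \<open>K\<close> and through the substitution,
  and exactness for the diagram without row \<open>K\<close> applies to each coefficient.\<close>

lemma core_low: assumes kK: "k + 1 < K" shows "E_concl k D A H"
proof -
  have cfF: "cf (rvars K) X (V (k, p) * H) = V (k, p) * cf (rvars K) X H" if "ks X \<subseteq> rvars K" for X
    by (rule cf_free_mult[OF _ that]) (use kK in \<open>auto simp: rvars_def\<close>)
  have mem: "V (k, p) * cf (rvars K) X H \<in> FM A (delrow K D)" if X: "ks X \<subseteq> rvars K" for X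
    using IspD(1)[OF I X] unfolding cfF[OF X] .
  have "nB K {} D > 0" using K nB_pos[of K D] by simp
  hence nb: "num_boxes (delrow K D) < num_boxes D" using num_boxes_delrow[OF dD, of K] by simp
  have E: "E_concl k (delrow K D) A (cf (rvars K) X H)" if X: "ks X \<subseteq> rvars K" for X
    by (rule IHE[OF nb transparent_delrow_top[OF trD dD rows] is_diagram_delrow[OF dD] A k p Ak mem[OF X]])
  show ?thesis unfolding E_concl_def
  proof (intro conjI allI impI)
    assume "k_full k D"
    hence "k_full k (delrow K D)" using kK by (auto simp: k_full_def col_full_def delrow_def)
    hence "cf (rvars K) X H = cf (rvars K) X 0" if "ks X \<subseteq> rvars K" for X
      using E_conclD(1)[OF E[OF that]] by simp
    thus "H = 0" by (rule cf_eqI)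
  next
    fix L a R assume w: "descent_witness k D L a R"
    let ?D = "L @ (a - {k}) # R"
    have ak: "K \<notin> a" using witness_col(3)[OF dD w] kK by auto
    have m: "mset D = mset (L @ a # R)" by (rule swp_witness_mset[OF w])
    have w': "descent_witness k (delrow K D) (delrow K L) a (delrow K R)"
      unfolding descent_witness_def
    proof (intro conjI)
      show "mset (delrow K D) = mset (delrow K L @ a # delrow K R)" using delrow_mset[OF m, of K] ak by simp
      show "a \<noteq> {}" "Max a = k" using w by (auto simp: descent_witness_def)
      show "\<forall>b\<in>set (delrow K L). col_full k b" using w kK by (auto simp: descent_witness_def delrow_def col_full_def)
      show "\<forall>b\<in>set (delrow K R). b \<inter> {1..k + 1} \<subseteq> a" using w by (auto simp: descent_witness_def delrow_def)
    qed
    have De: "delrow K L @ (a - {k}) # delrow K R = delrow K ?D" using ak by simp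
    have cfH: "cf (rvars K) X H \<in> FM A (delrow K ?D)" if "ks X \<subseteq> rvars K" for X
      using E_conclD(2)[OF E[OF that] w'] unfolding De .
    have n: "nB K B ?D = nB K B D" for B using nB_mset[OF m, of K B] ak by simp
    have "Isp K A ?D H"
    proof (rule IspI)
      fix X :: "nat \<times> nat \<Rightarrow>\<^sub>0 nat" assume X: "ks X \<subseteq> rvars K"
      show "cf (rvars K) X H \<in> FM A (delrow K ?D)" by (rule cfH[OF X])
      assume "cf (rvars K) X H \<noteq> 0"
      hence nz: "cf (rvars K) X (V (k, p) * H) \<noteq> 0" unfolding cfF[OF X] by simp
      show "dg X = nB K {} ?D" unfolding n by (rule IspD(2)[OF I X nz])
      show "snd ` ks X \<subseteq> A K" by (rule IspD(3)[OF I X nz])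
    next
      fix B assume B: "K \<notin> B"
      have "rA A (sigma K B (V (k, p) * H)) = V (k, p) * rA A (sigma K B H)"
        using kK p(1) by (simp add: sigma_def rA_def psub_mult)
      hence "V (0, 0) ^ nB K B D dvd V (k, p) * rA A (sigma K B H)" using IspD(4)[OF I B] by simp
      moreover have "\<not> V (0, 0) dvd (V (k, p) :: 'k matpoly)" using k by (simp add: V_dvd_V)
      ultimately show "V (0, 0) ^ nB K B ?D dvd rA A (sigma K B H)" unfolding n by (rule V_power_dvd_mult)
    qed
    moreover have "tau k K = K" using kK by (simp add: transpose_def)
    ultimately show "H \<in> FM A ?D"
      using wit_done[OF w K1] swp_rows[OF rows_wit[OF w] k] kK by simp
  qed
qed

text \<open>Cancelling \<open>V (K, p)\<close> lowers the degree in row \<open>K\<close> by one and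
  costs exactly one power of \<epsilon>: since \<open>p\<close> is in no earlier row of the flag,
  the substituted entry is \<open>V (0, 0) * V (K, p)\<close>. The column \<open>a\<close> loses its
  box in row \<open>K\<close>, and every \<open>B\<close> that matters is contained in
  \<open>a\<close>, so the counts drop by one as well.\<close>

lemma core_top: assumes kK: "k = K" shows "E_concl k D A H"
  unfolding E_concl_def
proof (intro conjI allI impI)
  obtain c where "c \<in> set D" "K \<in> c" using K by (auto simp: rowset_def)
  moreover assume "k_full k D"
  ultimately have "K + 1 \<in> rowset D" using kK by (auto simp: k_full_def col_full_def rowset_def)
  thus "H = 0" using rows by auto
next
  fix L a R assume w: "descent_witness k D L a R"
  let ?D = "L @ (a - {k}) # R"
  have m: "mset D = mset (L @ a # R)" by (rule swp_witness_mset[OF w])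
  have Ka: "K \<in> a" using witness_col(2)[OF dD w] kK by simp
  have n: "nB K B D = (if B \<subseteq> a then 1 else 0) + nB K B ?D" if "K \<notin> B" for B
    using nB_mset[OF m, of K B] Ka kK by simp
  have cfF: "cf (rvars K) (sg (K, p) 1 + X) (V (k, p) * H) = cf (rvars K) X H" for X
    unfolding kK by (rule cf_V_mult) (simp add: rvars_def)
  have "mset (delrow K D) = mset (delrow K ?D)" using delrow_mset[OF m, of K] kK by simp
  hence FMeq: "FM A (delrow K D) = (FM A (delrow K ?D) :: 'k matpoly set)" by (rule FM_mset)
  have "Isp K A ?D H"
  proof (rule IspI)
    fix X :: "nat \<times> nat \<Rightarrow>\<^sub>0 nat" assume X: "ks X \<subseteq> rvars K"
    have X': "ks (sg (K, p) 1 + X) \<subseteq> rvars K" unfolding ks_single_add using X by (simp add: rvars_def)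
    show "cf (rvars K) X H \<in> FM A (delrow K ?D)" using IspD(1)[OF I X'] unfolding cfF FMeq .
    assume "cf (rvars K) X H \<noteq> 0"
    hence nz: "cf (rvars K) (sg (K, p) 1 + X) (V (k, p) * H) \<noteq> 0" unfolding cfF .
    show "dg X = nB K {} ?D" using IspD(2)[OF I X' nz] n[of "{}"] by (simp add: dg_add)
    show "snd ` ks X \<subseteq> A K" using IspD(3)[OF I X' nz] unfolding ks_single_add by simp
  next
    fix B assume B: "K \<notin> B" and nz: "nB K B ?D \<noteq> 0"
    obtain c where c: "c \<in> set ?D" "K \<in> c" "B \<subseteq> c" using nB_ex[OF nz] by (elim bexE conjE)
    have BK: "B \<subseteq> {1..K}" using nB_B(1)[OF nz] rows_wit[OF w] by (rule order_trans)
    \<comment> \<open>Left columns are \<open>k\<close>-full; one that contains the top row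
      \<open>K\<close> would reach row \<open>K + 1\<close>.\<close>
    have "c \<notin> set L"
    proof
      assume cL: "c \<in> set L"
      hence "K + 1 \<in> c" using w c(2) kK by (auto simp: descent_witness_def col_full_def)
      hence "K + 1 \<in> rowset ?D" using c(1) unfolding rowset_def by blast
      thus False using rows_wit[OF w] by auto
    qed
    moreover have "c \<noteq> a - {k}" using c(2) kK by blast
    ultimately have "c \<in> set R" using c(1) by simp
    hence "c \<inter> {1..k + 1} \<subseteq> a" using w by (auto simp: descent_witness_def)
    hence Ba: "B \<subseteq> a" using c(3) BK kK by fastforce
    have z: "rA A (V (0, j) * V (j, p)) = (0 :: 'k matpoly)" if "j \<in> B" for j
    proof -
      have "1 \<le> j" "j < K" using that BK B by (auto simp: order.strict_iff_order)
      thus ?thesis using p(2)[of j] kK by (simp add: rA_mult rA_V)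
    qed
    have "rA A (sigma K B (V (k, p))) = (V (0, 0) * V (K, p) :: 'k matpoly)"
      unfolding kK sigma_V using p(1) kK by (simp add: rA_add rA_sum z rA_mult[of A "V (0, 0)"] rA_V)
    hence "rA A (sigma K B (V (k, p) * H)) = V (0, 0) * (V (K, p) * rA A (sigma K B H))"
      by (simp add: sigma_def psub_mult rA_mult mult.assoc)
    hence "V (0, 0) * V (0, 0) ^ nB K B ?D dvd V (0, 0) * (V (K, p) * rA A (sigma K B H))"
      using IspD(4)[OF I B] n[OF B] Ba by simp
    hence "V (0, 0) ^ nB K B ?D dvd V (K, p) * rA A (sigma K B H)" by simp
    moreover have "\<not> V (0, 0) dvd (V (K, p) :: 'k matpoly)" using K1 by (simp add: V_dvd_V)
    ultimately show "V (0, 0) ^ nB K B ?D dvd rA A (sigma K B H)" by (rule V_power_dvd_mult)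
  qed
  moreover have "tau k K = K + 1" using kK by simp
  moreover have "rowset (swp k ?D) \<subseteq> {1..K + 1}"
    by (rule swp_rows[OF _ k]) (use rows_wit[OF w] kK in auto)
  ultimately show "H \<in> FM A ?D" using wit_done[OF w K1] by simp
qed

text \<open>The hypothesis speaks about row \<open>K\<close>. The degree in row \<open>k\<close> is
  found inside the coefficients along row \<open>K\<close>, which lie in
  \<open>FM A (delrow K D)\<close>; coefficient extraction in the two rows commutes.\<close>

lemma hom_x:
  assumes kK: "K = k + 1" and X: "ks X \<subseteq> rvars k" and nz: "cf (rvars k) X (V (k, p) * H) \<noteq> 0"
  shows "dg X = nB k {} D" "snd ` ks X \<subseteq> A k"
proof -
  let ?F = "V (k, p) * H"
  have "\<exists>Y. ks Y \<subseteq> rvars K \<and> cf (rvars K) Y (cf (rvars k) X ?F) \<noteq> 0"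
  proof (rule ccontr)
    assume "\<nexists>Y. ks Y \<subseteq> rvars K \<and> cf (rvars K) Y (cf (rvars k) X ?F) \<noteq> 0"
    hence "cf (rvars K) Y (cf (rvars k) X ?F) = cf (rvars K) Y 0" if "ks Y \<subseteq> rvars K" for Y using that by simp
    hence "cf (rvars k) X ?F = 0" by (rule cf_eqI)
    thus False using nz by simp
  qed
  then obtain Y where Y: "ks Y \<subseteq> rvars K" "cf (rvars K) Y (cf (rvars k) X ?F) \<noteq> 0" by blast
  have disj: "rvars K \<inter> rvars k = {}" using kK by (auto simp: rvars_def)
  have "cf (rvars k) X (cf (rvars K) Y ?F) \<noteq> 0" using Y(2) cf_comm[OF disj Y(1) X, of ?F] by simp
  hence "dg X = nB k {} (delrow K D) \<and> snd ` ks X \<subseteq> A k"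
    by (rule FM_cf(2)[OF IspD(1)[OF I Y(1)] is_diagram_delrow[OF dD] k X])
  moreover have "nB k {} (delrow K D) = nB k {} D" by (rule nB_delrow) (use kK in auto)
  ultimately show "dg X = nB k {} D" "snd ` ks X \<subseteq> A k" by simp_all
qed

lemma cf_shift: "cf (rvars k) (sg (k, p) 1 + X) (V (k, p) * H) = cf (rvars k) X H"
  by (rule cf_V_mult) (simp add: rvars_def)

lemma ks_shift: "ks X \<subseteq> rvars k \<Longrightarrow> ks (sg (k, p) 1 + X) \<subseteq> rvars k" for X :: "nat \<times> nat \<Rightarrow>\<^sub>0 nat"
  unfolding ks_single_add by (simp add: rvars_def)

lemma hom_H:
  assumes kK: "K = k + 1" and X: "ks X \<subseteq> rvars k" and nz: "cf (rvars k) X H \<noteq> 0"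
  shows "Suc (dg X) = nB k {} D" "snd ` ks X \<subseteq> A k"
proof -
  have nz': "cf (rvars k) (sg (k, p) 1 + X) (V (k, p) * H) \<noteq> 0" using nz by (simp only: cf_shift not_False_eq_True)
  show "Suc (dg X) = nB k {} D" using hom_x(1)[OF kK ks_shift[OF X] nz'] by (simp add: dg_add)
  show "snd ` ks X \<subseteq> A k" using hom_x(2)[OF kK ks_shift[OF X] nz'] unfolding ks_single_add by simp
qed

lemma A_rows: "K = k + 1 \<Longrightarrow> j \<in> rowset D \<Longrightarrow> A j \<subseteq> A k"
proof -
  assume kK: "K = k + 1" and j: "j \<in> rowset D"
  have "j \<in> {1..K}" using j rows by (rule subsetD[rotated])
  hence "A j \<subseteq> A K" using incA_mono[OF A, of j K] by simp
  thus ?thesis using Ak kK by simp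
qed

lemma letters_F: "vars (V (k, p) * H) \<subseteq> {(l, q). l \<in> rowset D \<and> q \<in> A l}"
  by (rule Isp_letters[OF I dD K])

lemma letters_H: "vars H \<subseteq> {(l, q). l \<in> rowset D \<and> q \<in> A l}"
  using vars_V_mult letters_F by (rule order_trans)

lemma zero_rows: "0 \<notin> rowset D" using rows by auto

lemma vars_H_row: "(l, q) \<in> vars H \<Longrightarrow> l \<noteq> 0"
proof -
  assume "(l, q) \<in> vars H"
  hence "l \<in> rowset D" using subsetD[OF letters_H] by blast
  thus ?thesis using zero_rows by metis
qed

text \<open>The substitution can be applied term by term to the expansion along row
  \<open>K\<close>. Each coefficient is in \<open>FM A (delrow K D)\<close> and has the required
  divisibility, and deleting row \<open>K\<close> does not change a count for a set \<open>B\<close>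
  without \<open>K\<close>.\<close>

lemma alpha1:
  assumes kK: "K = k + 1" and B: "k \<notin> B" "K \<notin> B"
  shows "V (0, 0) ^ nB k B D dvd rA A (sigma k B (V (k, p) * H))"
proof -
  let ?F = "V (k, p) * H"
  have n: "nB k B (delrow K D) = nB k B D" by (rule nB_delrow) (use kK B in auto)
  have "rA A (sigma k B ?F) = rA A (sigma k B (\<Sum>X\<in>pr (rvars K) ` ks ?F. sg X 1 * cf (rvars K) X ?F))"
    using cf_decomp[of ?F "rvars K"] by simp
  also have "\<dots> = (\<Sum>X\<in>pr (rvars K) ` ks ?F. rA A (sigma k B (sg X 1)) * rA A (sigma k B (cf (rvars K) X ?F)))"
    by (simp only: sigma_def psub_sum psub_mult rA_sum rA_mult)
  also have "V (0, 0) ^ nB k B D dvd \<dots>"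
  proof (rule dvd_sum, rule dvd_mult)
    fix X assume "X \<in> pr (rvars K) ` ks ?F"
    hence X: "ks X \<subseteq> rvars K" by (auto simp: keys_pr)
    have "A j \<subseteq> A k" if "j \<in> rowset (delrow K D)" for j using that A_rows[OF kK] by (simp add: rowset_delrow)
    thus "V (0, 0) ^ nB k B D dvd rA A (sigma k B (cf (rvars K) X ?F))"
      using FM_sigma[OF IspD(1)[OF I X] is_diagram_delrow[OF dD] k B(1)] unfolding n by blast
  qed
  finally show ?thesis .
qed

text \<open>The hypothesis concerns row \<open>K\<close> with \<open>k\<close> in the parameter set;
  here the two rows have changed roles. The same columns are counted, and the two substitutions are
  related by a change of variables up to a power of \<open>V (0, K)\<close>, which \<epsilon> does
  not divide.\<close>

lemma alpha2:
  assumes kK: "K = k + 1" and B: "k \<notin> B" "K \<notin> B" and nz: "nB k (insert K B) D \<noteq> 0"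
  shows "V (0, 0) ^ nB k (insert K B) D dvd rA A (sigma k (insert K B) (V (k, p) * H))"
proof -
  let ?F = "V (k, p) * H" and ?m = "nB K {} D" and ?n = "nB k (insert K B) D"
  have BD: "B \<subseteq> rowset D" using nB_B(1)[OF nz] by simp
  have fB: "finite B" by (rule finite_subset[OF order_trans[OF BD rows]]) simp
  have B0: "j \<noteq> 0" if "j \<in> B" for j
  proof
    assume "j = 0"
    thus False using that subsetD[OF BD] zero_rows by simp
  qed
  have AB: "A j \<subseteq> A k" if "j \<in> B" for j by (rule A_rows[OF kK subsetD[OF BD that]])
  have kK': "k \<noteq> K" "k \<noteq> 0" "K \<noteq> 0" using kK k by auto
  define W :: "nat \<Rightarrow> 'k matpoly" where "W q = (\<Sum>j\<in>B. V (0, j) * V (j, q)) + V (0, K) * V (K, q) + V (0, 0) * V (k, q)" for q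
  \<comment> \<open>Chosen so that after \<open>sigma K (insert k B)\<close> row \<open>K\<close>
    becomes \<open>W q\<close> minus the sum over \<open>B\<close> minus
    \<open>V (0, 0) * V (k, q)\<close>, which collapses to \<open>V (0, K) * V (K, q)\<close>, while
    row \<open>k\<close> becomes \<open>W q\<close>. Hence the setting of \<open>V (0, k)\<close> to
    1 and the signs. Homogeneity in row \<open>K\<close> then extracts the power of
    \<open>V (0, K)\<close>.\<close>
  define g :: "nat \<times> nat \<Rightarrow> 'k matpoly" where
    "g = (\<lambda>(l, q). if l = 0 then (if q = k then 1 else if q \<in> B then - V (0, q) else V (0, q))
       else if l = K then - V (k, q) else if l = k then W q else V (l, q))"
  have gB: "g (0, j) = - V (0, j)" "g (j, q) = V (j, q)" if "j \<in> B" for j q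
    using that B B0[OF that] kK' by (auto simp: g_def)
  have "0 \<notin> B" using B0 by fastforce
  have g0: "g (0, 0) = V (0, 0)" "g (0, k) = 1" "g (k, q) = W q" "g (K, q) = - V (k, q)" for q
    using kK' \<open>0 \<notin> B\<close> by (auto simp: g_def)
  have sK: "sigma k (insert K B) (V (k, q)) = W q" for q
    unfolding sigma_V W_def using fB B(2) by (simp add: algebra_simps)
  have 1: "psub g (sigma K (insert k B) (V (K, q))) = V (0, K) * (V (K, q) :: 'k matpoly)" for q
  proof -
    have "psub g (sigma K (insert k B) (V (K, q))) = g (0, k) * g (k, q) + (\<Sum>j\<in>B. g (0, j) * g (j, q)) + g (0, 0) * g (K, q)"
      unfolding sigma_V using fB B(1) by (simp add: psub_add psub_mult psub_sum)
    also have "\<dots> = W q + (\<Sum>j\<in>B. - (V (0, j) * V (j, q))) - V (0, 0) * V (k, q)"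
      unfolding g0 using gB by (simp add: sum_negf)
    also have "\<dots> = V (0, K) * V (K, q)" by (simp add: W_def sum_negf)
    finally show ?thesis .
  qed
  have 2: "psub g (sigma K (insert k B) (V (l, q))) = sigma k (insert K B) (V (l, q))" if "l \<noteq> K" "l \<noteq> 0" for l q
  proof (cases "l = k")
    case True
    thus ?thesis using sK g0 kK' that by (simp add: sigma_V[of K])
  next
    case False
    thus ?thesis using that by (simp add: sigma_V g_def)
  qed
  have hom: "psub (\<lambda>v. psub g (sigma K (insert k B) (V v))) ?F = V (0, K) ^ ?m * psub (\<lambda>v. sigma k (insert K B) (V v)) ?F"
  proof (rule psub_homog[of "rvars K"])
    fix X :: "nat \<times> nat \<Rightarrow>\<^sub>0 nat" assume "ks X \<subseteq> rvars K" "cf (rvars K) X ?F \<noteq> 0"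
    thus "dg X = ?m" by (rule IspD(2)[OF I])
  next
    fix v assume "v \<in> rvars K"
    then obtain q where "v = (K, q)" by (auto simp: rvars_def)
    thus "psub g (sigma K (insert k B) (V v)) = V (0, K) * sigma k (insert K B) (V v)"
      using 1[of q] kK' by (simp add: sigma_V[of k])
  next
    fix v assume "v \<notin> rvars K" "v \<in> vars ?F"
    moreover obtain l q where v: "v = (l, q)" by (cases v)
    ultimately have "l \<noteq> K" "l \<in> rowset D" using letters_F by (auto simp: rvars_def)
    hence "l \<noteq> 0" using zero_rows by metis
    thus "psub g (sigma K (insert k B) (V v)) = sigma k (insert K B) (V v)"
      unfolding v using 2[OF \<open>l \<noteq> K\<close>] by simp
  qed
  have psg: "psub g (sigma K (insert k B) ?F) = psub (\<lambda>v. psub g (sigma K (insert k B) (V v))) ?F"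
    using psub_psub[of g "\<lambda>v. sigma K (insert k B) (V v)" ?F] by (simp only: sigma_conv)
  have hom': "psub g (sigma K (insert k B) ?F) = V (0, K) ^ ?m * sigma k (insert K B) ?F"
    unfolding psg hom by (simp only: sigma_conv)
  have AK: "A K = A k" using Ak kK by simp
  \<comment> \<open>Entries removed by the flag are sent to polynomials that the flag removes again,
    because \<open>A K = A k\<close> and \<open>A j \<subseteq> A k\<close> for \<open>j\<close> in
    \<open>B\<close>.\<close>
  have 3: "rA A (psub g (rA A (V v))) = rA A (psub g (V v))" for v
  proof -
    obtain l q where v: "v = (l, q)" by (cases v)
    have "rA A (g (l, q)) = 0" if "l \<noteq> 0" "q \<notin> A l"
    proof (cases "l = k")
      case True
      hence "q \<notin> A k" using that by simp
      hence z: "q \<notin> A j" if "j \<in> B" for j using subsetD[OF AB[OF that], of q] by metis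
      have "rA A (\<Sum>j\<in>B. V (0, j) * V (j, q)) = (0 :: 'k matpoly)"
        unfolding rA_sum by (rule sum.neutral) (simp add: rA_mult rA_V z B0)
      thus ?thesis unfolding True g0 W_def using \<open>q \<notin> A k\<close> AK kK' by (simp add: rA_add rA_mult rA_V)
    next
      case False
      thus ?thesis using that AK kK' by (cases "l = K") (auto simp: g_def rA_V rA_def psub_uminus)
    qed
    thus ?thesis unfolding v rA_V[of A l] by (auto simp: rA_def)
  qed
  have 4: "rA A (psub g (rA A G)) = rA A (psub g G)" for G
  proof -
    have "rA A (psub g (rA A G)) = psub (\<lambda>v. rA A (psub g (rA A (V v)))) G" for G :: "'k matpoly"
      unfolding rA_def psub_psub psub_V ..
    moreover have "rA A (psub g G) = psub (\<lambda>v. rA A (psub g (V v))) G" for G :: "'k matpoly"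
      unfolding rA_def psub_psub psub_V ..
    ultimately show ?thesis unfolding 3 by simp
  qed
  have "K \<notin> insert k B" using B kK' by simp
  hence "V (0, 0) ^ nB K (insert k B) D dvd rA A (sigma K (insert k B) ?F)" by (rule IspD(4)[OF I])
  then obtain G where G: "rA A (sigma K (insert k B) ?F) = V (0, 0) ^ ?n * G"
    unfolding nB_swap_index[of K k] by blast
  have "V (0, K) ^ ?m * rA A (sigma k (insert K B) ?F) = rA A (psub g (sigma K (insert k B) ?F))"
    unfolding hom' by (simp add: rA_mult, simp add: rA_def psub_power)
  also have "\<dots> = rA A (psub g (V (0, 0) ^ ?n * G))" unfolding G[symmetric] 4 ..
  also have "\<dots> = V (0, 0) ^ ?n * rA A (psub g G)"
    by (simp add: rA_def psub_mult psub_power g0)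
  finally have "V (0, 0) ^ ?n dvd V (0, K) ^ ?m * rA A (sigma k (insert K B) ?F)" by simp
  moreover have "\<not> V (0, 0) dvd (V (0, K) ^ ?m :: 'k matpoly)" using kK' by (intro not_V_dvd_power) simp
  ultimately show ?thesis by (rule V_power_dvd_mult)
qed

text \<open>The letter \<open>p\<close> enters the flag at row \<open>k\<close>, so the only row of
  \<open>B\<close> that can retain an entry at \<open>p\<close> is \<open>K\<close>.\<close>

lemma rA_sigma_fac:
  assumes "B \<subseteq> {1..K}" "k \<notin> B" and kK: "K = k + 1"
  shows "rA A (sigma k B (V (k, p))) = (if K \<in> B then V (0, K) * V (K, p) else 0) + V (0, 0) * (V (k, p) :: 'k matpoly)"
proof -
  have fB: "finite B" by (rule finite_subset[OF assms(1)]) simp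
  have z: "rA A (V (0, j) * V (j, p)) = (if j = K then V (0, K) * V (K, p) else 0 :: 'k matpoly)" if "j \<in> B" for j
  proof (cases "j = K")
    case True
    thus ?thesis using p(1) Ak kK by (simp add: rA_mult rA_V)
  next
    case False
    have j: "j \<in> {1..K}" by (rule subsetD[OF assms(1) that])
    have "j \<noteq> k" using that assms(2) by metis
    with j False kK have "1 \<le> j" "j < k" by auto
    thus ?thesis using p(2)[of j] False by (simp add: rA_mult rA_V)
  qed
  have "rA A (\<Sum>j\<in>B. V (0, j) * V (j, p)) = (\<Sum>j\<in>B. if j = K then V (0, K) * V (K, p) else 0 :: 'k matpoly)"
    unfolding rA_sum by (rule sum.cong[OF refl]) (rule z)
  also have "\<dots> = (if K \<in> B then V (0, K) * V (K, p) else 0)" using fB by (simp add: sum.delta)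
  finally show ?thesis using p(1) by (simp add: sigma_V rA_add rA_mult[of A "V (0, 0)"] rA_V)
qed

lemma sigma_F: "rA A (sigma k B (V (k, p) * H)) = rA A (sigma k B (V (k, p))) * rA A (sigma k B H)"
  by (simp add: sigma_def psub_mult rA_mult)

text \<open>At \<epsilon> = 0 the factor computed in \<open>rA_sigma_fac\<close> is
  \<open>V (0, K) * V (K, p)\<close>, which is not 0. The whole power of \<epsilon> therefore falls
  to \<open>H\<close>.\<close>

lemma dvd_H:
  assumes kK: "K = k + 1" and B: "k \<notin> B" "K \<in> B" and nz: "nB k B D \<noteq> 0"
  shows "V (0, 0) ^ nB k B D dvd rA A (sigma k B H)"
proof -
  have iB: "insert K (B - {K}) = B" using B by blast
  have BK: "B \<subseteq> {1..K}" using nB_B(1)[OF nz] rows by (rule order_trans)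
  have "V (0, 0) ^ nB k B D dvd rA A (sigma k B (V (k, p) * H))"
    using alpha2[OF kK, of "B - {K}"] B nz unfolding iB by simp
  moreover have "\<not> V (0, 0) dvd (V (0, K) * V (K, p) + V (0, 0) * V (k, p) :: 'k matpoly)"
    unfolding V_dvd_iff using K1 by (simp add: psub_add psub_mult)
  ultimately show ?thesis
    unfolding sigma_F rA_sigma_fac[OF BK B(1) kK] using B(2) V_power_dvd_mult by auto
qed

text \<open>A degree argument: every column with \<open>k\<close> also contains \<open>K\<close>, so
  the power of \<epsilon> in the substitution of \<open>H\<close> is at least the full number of
  columns with \<open>k\<close>, whereas \<open>H\<close> has degree one less in row
  \<open>k\<close>.\<close>

lemma core_next_full:
  assumes kK: "K = k + 1" and full: "k_full k D"
  shows "H = 0"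
proof (rule ccontr)
  assume "H \<noteq> 0"
  have kK': "k \<noteq> K" "k \<noteq> 0" "K \<noteq> 0" "k \<noteq> 0" using kK k by auto
  have "\<exists>X. ks X \<subseteq> rvars k \<and> cf (rvars k) X H \<noteq> 0"
  proof (rule ccontr)
    assume "\<nexists>X. ks X \<subseteq> rvars k \<and> cf (rvars k) X H \<noteq> 0"
    hence "cf (rvars k) Y H = cf (rvars k) Y 0" if "ks Y \<subseteq> rvars k" for Y using that by simp
    hence "H = 0" by (rule cf_eqI)
    thus False using \<open>H \<noteq> 0\<close> by simp
  qed
  then obtain m where m: "nB k {} D = Suc m" using hom_H(1)[OF kK] by metis
  have "nB k {K} D = nB k {} D" by (rule nB_eqI) (use full kK in \<open>auto simp: k_full_def col_full_def\<close>)
  hence n: "nB k {K} D = Suc m" using m by simp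
  have dv: "V (0, 0) ^ Suc m dvd rA A (sigma k {K} H)"
    using dvd_H[OF kK, of "{K}"] n kK' by simp
  have AK: "A K = A k" using Ak kK by simp
  have rAH: "rA A (sigma k {K} H) = sigma k {K} H"
  proof -
    have "rA A (sigma k {K} H) = psub (\<lambda>v. rA A (sigma k {K} (V v))) H"
      unfolding rA_def sigma_def psub_psub psub_V ..
    also have "\<dots> = psub (\<lambda>v. sigma k {K} (V v)) H"
    proof (rule psub_cong)
      fix v assume v: "v \<in> vars H"
      obtain l q where lq: "v = (l, q)" by (cases v)
      have "q \<in> A l" using v letters_H lq by blast
      thus "rA A (sigma k {K} (V v)) = sigma k {K} (V v)"
        unfolding lq sigma_V by (cases "l = k") (simp_all add: AK rA_add rA_mult rA_V)
    qed
    finally show ?thesis by (simp only: sigma_conv)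
  qed
  \<comment> \<open>Scaling \<open>V (0, K)\<close> by \<epsilon> makes the substituted row
    \<epsilon> times the row given by \<open>h\<close>, so exactly \<open>V (0, 0) ^ m\<close> comes
    out. One more factor \<epsilon> would have to divide \<open>psub h H\<close>, which does not
    contain \<epsilon>; so \<open>psub h H\<close> is 0, and \<open>V (0, K) = 0\<close> recovers
    \<open>H\<close>.\<close>
  define g :: "nat \<times> nat \<Rightarrow> 'k matpoly" where "g = V((0, K) := V (0, 0) * V (0, K))"
  define h :: "nat \<times> nat \<Rightarrow> 'k matpoly" where
    "h = (\<lambda>(l, q). if l = k then V (0, K) * V (K, q) + V (k, q) else V (l, q))"
  note nz = vars_H_row
  have "psub (\<lambda>v. psub g (sigma k {K} (V v))) H = V (0, 0) ^ m * psub h H"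
  proof (rule psub_homog[of "rvars k"])
    fix X :: "nat \<times> nat \<Rightarrow>\<^sub>0 nat" assume "ks X \<subseteq> rvars k" "cf (rvars k) X H \<noteq> 0"
    thus "dg X = m" using hom_H(1)[OF kK] m by auto
  next
    fix v assume "v \<in> rvars k"
    then obtain q where v: "v = (k, q)" by (auto simp: rvars_def)
    show "psub g (sigma k {K} (V v)) = V (0, 0) * h v"
      unfolding v sigma_V using kK' by (simp add: psub_add psub_mult g_def h_def algebra_simps)
  next
    fix v assume v: "v \<notin> rvars k" "v \<in> vars H"
    obtain l q where lq: "v = (l, q)" by (cases v)
    have "l \<noteq> 0" using nz v lq by blast
    thus "psub g (sigma k {K} (V v)) = h v"
      using v(1) unfolding lq sigma_V by (auto simp: rvars_def g_def h_def)
  qed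
  moreover have "psub g (sigma k {K} H) = psub (\<lambda>v. psub g (sigma k {K} (V v))) H"
    using psub_psub[of g "\<lambda>v. sigma k {K} (V v)" H] by (simp only: sigma_conv)
  ultimately have e: "psub g (sigma k {K} H) = V (0, 0) ^ m * psub h H" by simp
  obtain G where "sigma k {K} H = V (0, 0) ^ Suc m * G" using dv unfolding rAH by blast
  hence "psub g (sigma k {K} H) = V (0, 0) ^ m * (V (0, 0) * psub g G)"
    using kK' by (simp add: psub_mult psub_power g_def mult.assoc mult.left_commute)
  hence "V (0, 0) ^ m * psub h H = V (0, 0) ^ m * (V (0, 0) * psub g G)" using e by simp
  hence "psub h H = V (0, 0) * psub g G" by (simp only: mult_cancel_left) (simp add: power_not_zero)
  hence "V (0, 0) dvd psub h H" by simp
  hence "psub (V((0, 0) := 0)) (psub h H) = 0" by (simp only: V_dvd_iff)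
  moreover have "psub (V((0, 0) := 0)) (psub h H) = psub h H"
    unfolding psub_psub using kK' nz by (intro psub_cong) (auto simp: h_def psub_add psub_mult split: prod.splits)
  ultimately have "psub (V((0, K) := 0)) (psub h H) = 0" by simp
  moreover have "psub (V((0, K) := 0)) (psub h H) = psub V H"
    unfolding psub_psub using kK' nz by (intro psub_cong) (auto simp: h_def psub_add psub_mult split: prod.splits)
  ultimately show False using \<open>H \<noteq> 0\<close> by simp
qed

text \<open>Since \<open>k\<close> is not the top row, deleting it is handled through the swap:
  there it becomes the deletion of the top row \<open>K\<close> of a transparent diagram. The
  coefficient inherits the description along row \<open>K\<close>, because extraction in row
  \<open>k\<close> commutes with the substitution in row \<open>K\<close> when \<open>B\<close>
  avoids \<open>k\<close>.\<close>

lemma core_next_beta: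
  assumes kK: "K = k + 1" and w: "descent_witness k D L a R" and X: "ks X \<subseteq> rvars k"
  shows "cf (rvars k) X H \<in> FM A (delrow k (L @ (a - {k}) # R))"
proof -
  let ?D = "L @ (a - {k}) # R" and ?F = "V (k, p) * H"
  let ?E = "delrow k ?D" and ?\<mu> = "sg (k, p) 1 + X" and ?G = "cf (rvars k) X H"
  have kK': "k \<noteq> K" "K \<noteq> k" "k \<noteq> 0" "K \<noteq> 0" using kK k by auto
  have mu: "ks ?\<mu> \<subseteq> rvars k" by (rule ks_shift[OF X])
  have G: "cf (rvars k) ?\<mu> ?F = ?G" by (rule cf_shift)
  have m: "mset D = mset (L @ a # R)" by (rule swp_witness_mset[OF w])
  have mE: "mset (delrow k D) = mset ?E" using delrow_mset[OF m, of k] by simp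
  have mE': "mset (delrow k (delrow K D)) = mset (delrow K ?E)"
    unfolding delrow_commute[of k K] by (rule delrow_mset[OF mE])
  have d: "is_diagram ?D" by (rule is_diagram_witness(2)[OF dD w])
  have dE: "is_diagram ?E" by (rule is_diagram_delrow[OF d])
  have n: "nB K B ?E = nB K B D" if "k \<notin> B" for B
    using nB_mset[OF mE, of K B] nB_delrow[of k K B D] that kK' by simp
  have disj: "rvars k \<inter> rvars K = {}" using kK by (auto simp: rvars_def)
  have cc: "cf (rvars K) Y ?G = cf (rvars k) ?\<mu> (cf (rvars K) Y ?F)" if Y: "ks Y \<subseteq> rvars K" for Y
    unfolding G[symmetric] by (rule cf_comm[OF disj mu Y, symmetric])
  have I': "Isp K A ?E ?G"
  proof (rule IspI)
    fix Y :: "nat \<times> nat \<Rightarrow>\<^sub>0 nat" assume Y: "ks Y \<subseteq> rvars K"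
    have "cf (rvars k) ?\<mu> (cf (rvars K) Y ?F) \<in> FM A (delrow k (delrow K D))"
      by (rule FM_cf(1)[OF IspD(1)[OF I Y] is_diagram_delrow[OF dD] k mu])
    moreover have "FM A (delrow k (delrow K D)) = (FM A (delrow K ?E) :: 'k matpoly set)" by (rule FM_mset[OF mE'])
    ultimately show "cf (rvars K) Y ?G \<in> FM A (delrow K ?E)" unfolding cc[OF Y] by simp
    assume "cf (rvars K) Y ?G \<noteq> 0"
    hence nz: "cf (rvars K) Y ?F \<noteq> 0" unfolding cc[OF Y] by auto
    show "dg Y = nB K {} ?E" using IspD(2)[OF I Y nz] n[of "{}"] by simp
    show "snd ` ks Y \<subseteq> A K" by (rule IspD(3)[OF I Y nz])
  next
    fix B assume B: "K \<notin> B" and nz: "nB K B ?E \<noteq> 0"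
    have kB: "k \<notin> B" using nB_B(1)[OF nz] by (auto simp: rowset_delrow)
    define g where "g v = (rA A (sigma K B (V v)) :: 'k matpoly)" for v
    \<comment> \<open>Agrees with \<open>g\<close> on the variables of the product, but fixes all of
      row \<open>k\<close>, including the letters outside the flag, as required for commuting with
      coefficients.\<close>
    define g' where "g' v = (if v \<in> rvars k then V v else g v)" for v
    have gg: "g v = g' v" if v: "v \<in> vars ?F" for v
    proof (cases "v \<in> rvars k")
      case True
      then obtain q where q: "v = (k, q)" by (auto simp: rvars_def)
      have "q \<in> A k" using v letters_F unfolding q by blast
      thus ?thesis using True kK' unfolding g_def g'_def q sigma_V by (simp add: rA_V)
    qed (simp add: g'_def)
    have pF: "rA A (sigma K B F') = psub g F'" for F'
      unfolding g_def rA_def sigma_def psub_psub psub_V ..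
    have gF: "psub g ?F = psub g' ?F" by (rule psub_cong) (rule gg)
    have gG: "psub g ?G = psub g' ?G"
      unfolding G[symmetric] by (rule psub_cong, rule gg, erule subsetD[OF vars_cf_subset])
    have fr: "vars (g' v) \<inter> rvars k = {}" if "v \<in> vars ?F - rvars k" for v
    proof -
      obtain l q where v: "v = (l, q)" by (cases v)
      have lk: "l \<noteq> k" using that by (auto simp: v rvars_def)
      let ?S = "insert 0 (insert K (insert l B))"
      have "vars (g v) \<subseteq> vars (sigma K B (V v) :: 'k matpoly)" unfolding g_def by (rule vars_rA)
      also have "\<dots> \<subseteq> {(l', q). l' \<in> ?S}" by (rule vars_sigma) (auto simp: v)
      finally have "vars (g v) \<inter> rvars k = {}" using kK' kB lk by (auto simp: rvars_def)
      thus ?thesis using that by (simp add: g'_def)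
    qed
    have "V (0, 0) ^ nB K B D dvd rA A (sigma K B ?F)" by (rule IspD(4)[OF I B])
    then obtain G' where G': "psub g' ?F = V (0, 0) ^ nB K B D * G'" unfolding pF gF by blast
    have "rA A (sigma K B ?G) = psub g' (cf (rvars k) ?\<mu> ?F)" unfolding pF gG G ..
    also have "\<dots> = cf (rvars k) ?\<mu> (psub g' ?F)"
      by (rule cf_psub[symmetric]) (use fr mu in \<open>simp_all add: g'_def\<close>)
    also have "\<dots> = V (0, 0) ^ nB K B D * cf (rvars k) ?\<mu> G'"
      unfolding G'
    proof (rule cf_free_mult[OF _ mu])
      have "vars (V (0, 0) ^ nB K B D :: 'k matpoly) \<subseteq> vars (V (0, 0) :: 'k matpoly)" by (rule vars_power)
      thus "vars (V (0, 0) ^ nB K B D :: 'k matpoly) \<inter> rvars k = {}" using kK' by (auto simp: rvars_def)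
    qed
    finally show "V (0, 0) ^ nB K B ?E dvd rA A (sigma K B ?G)" unfolding n[OF kB] by simp
  qed
  have tk: "tau k K = k" "tau k k = K" using kK by simp_all
  have I'': "Isp k A (swp k ?E) (rs k ?G)" using rs_Isp[OF I' dE k Ak K1] unfolding tk .
  have sE: "swp k ?E = delrow K (swp k ?D)" using delrow_swp[of k k ?D] unfolding tk by simp
  have r: "rowset (swp k ?D) \<subseteq> {1..K}" by (rule swp_rows[OF rows_wit[OF w] k]) (simp add: kK)
  have ds: "is_diagram (swp k ?D)" by (rule is_diagram_swp[OF d k])
  have "rs k ?G \<in> FM A (swp k ?E)"
  proof (rule IHI[OF _ _ _ A _ I''])
    show "num_boxes (swp k ?E) < num_boxes D"
      unfolding sE using num_boxes_witness[OF dD w] num_boxes_delrow[OF ds, of K] by simp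
    show "transparent (swp k ?E)" unfolding sE
      by (rule transparent_delrow_top[OF transparent_witness[OF trD dD w] ds r])
    show "is_diagram (swp k ?E)" by (rule is_diagram_swp[OF dE k])
    show "rowset (swp k ?E) \<subseteq> {1..k}" unfolding sE rowset_delrow using r kK by (auto simp: le_Suc_eq)
  qed
  thus ?thesis using rs_FM_iff[OF dE k Ak] by blast
qed

text \<open>\<open>H\<close> is described along row \<open>k\<close>, which the swap turns into the
  top row \<open>K\<close>. The divisibility is checked according to which columns of the
  predecessor contain \<open>k\<close> and \<open>B\<close>.\<close>

lemma core_next_desc:
  assumes kK: "K = k + 1" and w: "descent_witness k D L a R"
  shows "H \<in> FM A (L @ (a - {k}) # R)"
proof -
  let ?D = "L @ (a - {k}) # R"
  have kK': "k \<noteq> K" "K \<noteq> k" "k \<noteq> 0" "K \<noteq> 0" using kK k by auto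
  have m: "mset D = mset (L @ a # R)" by (rule swp_witness_mset[OF w])
  have ka: "k \<in> a" "K \<notin> a" using witness_col(2,3)[OF dD w] kK by auto
  have n: "nB k B D = (if B \<subseteq> a then 1 else 0) + nB k B ?D" if "k \<notin> B" for B
    using nB_mset[OF m, of k B] ka by simp
  have Lf: "K \<in> c" if "c \<in> set L" "k \<in> c" for c using that w kK by (auto simp: descent_witness_def col_full_def)
  have Rf: "c \<inter> {1..K} \<subseteq> a" if "c \<in> set R" for c using that w kK by (auto simp: descent_witness_def)
  have AK: "A K = A k" using Ak kK by simp
  note nz0 = vars_H_row
  have "Isp k A ?D H"
  proof (rule IspI)
    fix X :: "nat \<times> nat \<Rightarrow>\<^sub>0 nat" assume X: "ks X \<subseteq> rvars k"
    show "cf (rvars k) X H \<in> FM A (delrow k ?D)" by (rule core_next_beta[OF kK w X])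
    assume nz: "cf (rvars k) X H \<noteq> 0"
    show "dg X = nB k {} ?D" using hom_H(1)[OF kK X nz] n[of "{}"] by simp
    show "snd ` ks X \<subseteq> A k" by (rule hom_H(2)[OF kK X nz])
  next
    fix B assume B: "k \<notin> B" and nz: "nB k B ?D \<noteq> 0"
    have BK: "B \<subseteq> {1..K}" using nB_B(1)[OF nz] rows_wit[OF w] by (rule order_trans)
    have fB: "finite B" by (rule finite_subset[OF BK]) simp
    consider "K \<in> B" | "K \<notin> B" "B \<subseteq> a" | "K \<notin> B" "\<not> B \<subseteq> a" by blast
    thus "V (0, 0) ^ nB k B ?D dvd rA A (sigma k B H)"
    proof cases
      case 1
      \<comment> \<open>Since \<open>a\<close> avoids \<open>K\<close>, it was not counted, and its
        loss of the box in row \<open>k\<close> does not change the count.\<close>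
      hence "\<not> B \<subseteq> a" using ka by blast
      hence e: "nB k B D = nB k B ?D" using n[OF B] by simp
      have "V (0, 0) ^ nB k B D dvd rA A (sigma k B H)" by (rule dvd_H[OF kK B 1]) (use e nz in simp)
      thus ?thesis unfolding e .
    next
      case 2
      \<comment> \<open>Here \<open>a\<close> was counted and no longer is; this is balanced by the
        factor \<epsilon> contributed by \<open>V (k, p)\<close>.\<close>
      have "V (0, 0) ^ nB k B D dvd rA A (sigma k B (V (k, p) * H))" by (rule alpha1[OF kK B 2(1)])
      hence "V (0, 0) * V (0, 0) ^ nB k B ?D dvd V (0, 0) * (V (k, p) * rA A (sigma k B H))"
        unfolding sigma_F rA_sigma_fac[OF BK B kK] n[OF B] using 2 by (simp add: mult.assoc)
      hence "V (0, 0) ^ nB k B ?D dvd V (k, p) * rA A (sigma k B H)" by simp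
      moreover have "\<not> V (0, 0) dvd (V (k, p) :: 'k matpoly)" using kK' by (simp add: V_dvd_V)
      ultimately show ?thesis by (rule V_power_dvd_mult)
    next
      case 3
      \<comment> \<open>A right column containing \<open>B\<close> would put \<open>B\<close> inside
        \<open>a\<close>. The counted columns are thus left columns with \<open>k\<close>, and these
        contain \<open>K\<close> by fullness. So \<open>K\<close> can be added to \<open>B\<close>,
        which makes \<open>dvd_H\<close> applicable, and setting \<open>V (0, K)\<close> to 0
        afterwards returns to \<open>B\<close>.\<close>
      have e1: "nB k B ?D = nB k (insert K B) ?D"
      proof (rule nB_eqI)
        fix c assume "c \<in> set ?D"
        then consider "c \<in> set L" | "c = a - {k}" | "c \<in> set R" by auto
        thus "k \<in> c \<and> B \<subseteq> c \<longleftrightarrow> k \<in> c \<and> insert K B \<subseteq> c"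
        proof cases
          case 1
          thus ?thesis using Lf by blast
        next
          case 2
          thus ?thesis by blast
        next
          case 3
          hence "\<not> B \<subseteq> c" using Rf[OF 3] BK \<open>\<not> B \<subseteq> a\<close> by blast
          thus ?thesis by blast
        qed
      qed
      have kB': "k \<notin> insert K B" using B kK' by simp
      have e2: "nB k (insert K B) D = nB k (insert K B) ?D" using n[OF kB'] 3 by simp
      have e: "nB k (insert K B) D = nB k B ?D" using e1 e2 by simp
      have "V (0, 0) ^ nB k (insert K B) D dvd rA A (sigma k (insert K B) H)"
        by (rule dvd_H[OF kK kB']) (use e nz in simp_all)
      then obtain G where G: "rA A (sigma k (insert K B) H) = V (0, 0) ^ nB k B ?D * G" unfolding e by blast
      let ?z = "psub (V((0, K) := 0)) :: 'k matpoly \<Rightarrow> _"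
      have zr: "?z (V (0, j) * rA A (V (j, q))) = V (0, j) * rA A (V (j, q))" if "j \<in> B" for j q
      proof -
        have "j \<noteq> 0" "j \<noteq> K" using that BK 3 by auto
        thus ?thesis by (simp add: rA_V psub_mult)
      qed
      have "?z (rA A (sigma k (insert K B) H)) = psub (\<lambda>v. ?z (rA A (sigma k (insert K B) (V v)))) H"
        unfolding rA_def sigma_def psub_psub psub_V ..
      also have "\<dots> = psub (\<lambda>v. rA A (sigma k B (V v))) H"
      proof (rule psub_cong)
        fix v assume v: "v \<in> vars H"
        obtain l q where lq: "v = (l, q)" by (cases v)
        have l0: "l \<noteq> 0" using v nz0 lq by blast
        show "?z (rA A (sigma k (insert K B) (V v))) = rA A (sigma k B (V v))"
        proof (cases "l = k")
          case True
          have "?z (rA A (sigma k (insert K B) (V (k, q))))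
              = (\<Sum>j\<in>B. ?z (V (0, j) * rA A (V (j, q)))) + ?z (rA A (V (0, 0) * V (k, q)))"
            unfolding sigma_V using fB 3 by (simp add: rA_add rA_sum rA_mult rA_V psub_add psub_sum psub_mult)
          also have "\<dots> = (\<Sum>j\<in>B. V (0, j) * rA A (V (j, q))) + rA A (V (0, 0) * V (k, q))"
            using kK' zr by (simp add: rA_mult rA_V psub_mult)
          also have "\<dots> = rA A (sigma k B (V (k, q)))"
            unfolding sigma_V by (simp add: rA_add rA_sum rA_mult rA_V)
          finally show ?thesis unfolding lq True .
        next
          case False
          thus ?thesis unfolding lq sigma_V using l0 by (simp add: rA_V)
        qed
      qed
      also have "\<dots> = rA A (sigma k B H)" unfolding rA_def sigma_def psub_psub psub_V ..
      finally have "rA A (sigma k B H) = ?z (V (0, 0) ^ nB k B ?D * G)" unfolding G by simp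
      also have "\<dots> = V (0, 0) ^ nB k B ?D * ?z G" using kK' by (simp add: psub_mult psub_power)
      finally show ?thesis by simp
    qed
  qed
  moreover have "tau k k = K" using kK by simp
  moreover have "rowset (swp k ?D) \<subseteq> {1..K}" by (rule swp_rows[OF rows_wit[OF w] k]) (simp add: kK)
  ultimately show ?thesis using wit_done[OF w k] by simp
qed

lemma core: "E_concl k D A H"
proof -
  consider "K < k" | "k = K" | "k + 1 < K" | "K = k + 1" by linarith
  thus ?thesis
  proof cases
    case 4
    thus ?thesis unfolding E_concl_def using core_next_full core_next_desc by simp
  qed (rule core_high core_top core_low; assumption)+
qed

end

text \<open>Induction on the size of the flag. With one letter removed, \<open>F\<close> is an
  element of the smaller span; lifting that element leaves a difference divisible by the removed
  variable. The quotient is controlled by exactness and multiplied back by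
  \<open>V_mult_FM\<close>.\<close>

lemma exact_I_from_core:
  assumes trD: "transparent D" and dD: "is_diagram D" and rows: "rowset D \<subseteq> {1..K}" and K: "K \<in> rowset D"
    and core: "\<And>A k p (H :: 'k::field matpoly). incA A \<Longrightarrow> 1 \<le> k \<Longrightarrow> p \<in> A k \<Longrightarrow> (\<And>l. 1 \<le> l \<Longrightarrow> l < k \<Longrightarrow> p \<notin> A l) \<Longrightarrow>
      A k = A (k + 1) \<Longrightarrow> Isp K A D (V (k, p) * H) \<Longrightarrow> E_concl k D A H"
    and A: "incA A" and I: "Isp K A D (F :: 'k matpoly)"
  shows "F \<in> FM A D"
  using A I
proof (induction "\<Sum>l\<in>{1..K}. card (A l)" arbitrary: A F rule: less_induct)
  case less
  note A = less.prems(1) and I = less.prems(2)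
  have K1: "1 \<le> K" using K rows by auto
  have fin: "finite (A l)" if "1 \<le> l" for l using A that by (simp add: incA_def)
  show ?case
  proof (cases "A K = {}")
    case True
    have "cf (rvars K) X F = cf (rvars K) X 0" if X: "ks X \<subseteq> rvars K" for X
    proof (rule ccontr)
      assume "cf (rvars K) X F \<noteq> cf (rvars K) X 0"
      hence nz: "cf (rvars K) X F \<noteq> 0" by simp
      have "dg X > 0" using IspD(2)[OF I X nz] K nB_pos[of K D] by simp
      hence "ks X \<noteq> {}" by (auto simp: dg_def)
      thus False using IspD(3)[OF I X nz] True by auto
    qed
    hence "F = 0" by (rule cf_eqI)
    thus ?thesis by (simp add: pm.subspace_0[OF subspace_FM])
  next
    case False
    \<comment> \<open>The first row at which the flag reaches its final letters: a letter enters
      there, and the flag stays constant up to row \<open>K\<close>.\<close>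
    define k where "k = (LEAST k. 1 \<le> k \<and> A k = A K)"
    have kp: "1 \<le> k \<and> A k = A K" unfolding k_def by (rule LeastI[of _ K]) (use K1 in simp)
    have kl: "A l \<noteq> A K" if "1 \<le> l" "l < k" for l using not_less_Least[of l "\<lambda>k. 1 \<le> k \<and> A k = A K"] that unfolding k_def by simp
    have kK: "k \<le> K" unfolding k_def by (rule Least_le) (use K1 in simp)
    have k1: "1 \<le> k" and AkK: "A k = A K" using kp by simp_all
    have "\<exists>p. p \<in> A k \<and> (\<forall>l. 1 \<le> l \<longrightarrow> l < k \<longrightarrow> p \<notin> A l)"
    proof (cases "k = 1")
      case True
      thus ?thesis using False AkK by auto
    next
      case k2: False
      hence "A (k - 1) \<subseteq> A k" "A (k - 1) \<noteq> A k" using incA_mono[OF A, of "k - 1" k] kl[of "k - 1"] k1 AkK by auto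
      then obtain p where p: "p \<in> A k" "p \<notin> A (k - 1)" by blast
      have "p \<notin> A l" if "1 \<le> l" "l < k" for l
      proof -
        have "l \<le> k - 1" using that by simp
        from subsetD[OF incA_mono[OF A that(1) this], of p] show ?thesis using p(2) by blast
      qed
      thus ?thesis using p(1) by blast
    qed
    then obtain p where p: "p \<in> A k" "\<And>l. 1 \<le> l \<Longrightarrow> l < k \<Longrightarrow> p \<notin> A l" by blast
    define A' where "A' = A(k := A k - {p})"
    have A': "incA A'" unfolding incA_def
    proof (intro conjI allI impI)
      fix l m :: nat assume lm: "1 \<le> l" "l \<le> m"
      show "A' l \<subseteq> A' m"
      proof (cases "m = k")
        case True
        thus ?thesis using incA_mono[OF A lm] p(2)[of l] lm by (cases "l = k") (auto simp: A'_def)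
      next
        case False
        thus ?thesis using incA_mono[OF A lm] lm by (auto simp: A'_def)
      qed
    qed (use fin in \<open>auto simp: A'_def\<close>)
    have "(\<Sum>l\<in>{1..K}. card (A' l)) < (\<Sum>l\<in>{1..K}. card (A l))"
    proof (rule sum_strict_mono_ex1)
      show "\<forall>l\<in>{1..K}. card (A' l) \<le> card (A l)" using fin by (auto simp: A'_def card_mono)
      show "\<exists>l\<in>{1..K}. card (A' l) < card (A l)"
      proof (rule bexI[of _ k])
        show "card (A' k) < card (A k)" unfolding A'_def fun_upd_same by (rule card_Diff1_less[OF fin[OF k1] p(1)])
        show "k \<in> {1..K}" using k1 kK by simp
      qed
    qed simp
    moreover have "Isp K A' D (psub (V((k, p) := 0)) F)"
      unfolding A'_def by (rule Isp_restrict[OF I dD rows K k1 kK p(2)])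
    ultimately have "psub (V((k, p) := 0)) F \<in> FM A' D" using less.hyps[OF _ A'] by blast
    then obtain P where P: "P \<in> pm.span (gens D)" "psub (V((k, p) := 0)) F = rA A' P" unfolding FM_image by blast
    \<comment> \<open>The same combination \<open>P\<close>, restricted only to the larger flag, so
      it agrees with \<open>F\<close> once \<open>V (k, p)\<close> is set to 0.\<close>
    define F1 where "F1 = rA A P"
    have F1: "F1 \<in> FM A D" unfolding F1_def FM_image using P(1) by blast
    have "psub (V((k, p) := 0)) (F - F1) = 0"
      unfolding psub_diff P(2) F1_def rA_restrict[OF k1] A'_def by simp
    hence "V (k, p) dvd F - F1" by (simp only: V_dvd_iff)
    then obtain H where H: "F - F1 = V (k, p) * H" by (rule dvdE)
    have rA: "A j \<subseteq> A K" if "j \<in> rowset D" for j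
      using subsetD[OF rows that] incA_mono[OF A, of j K] by simp
    have I2: "Isp K A D (V (k, p) * H)"
      unfolding H[symmetric] by (rule Isp_diff[OF I FM_Isp[OF F1 dD K1 rA]])
    \<comment> \<open>Rows beyond \<open>K\<close> do not occur in \<open>D\<close>. Making the flag
      constant there gives \<open>B k = B (k + 1)\<close> also for \<open>k = K\<close>.\<close>
    define B where "B l = (if l \<le> K then A l else A K)" for l
    have BA: "B l = A l" if "l \<in> rowset D" for l using subsetD[OF rows that] by (simp add: B_def)
    have "incA B" unfolding incA_def
    proof (intro conjI allI impI)
      fix l m :: nat assume lm: "1 \<le> l" "l \<le> m"
      show "B l \<subseteq> B m" using incA_mono[OF A, of l m] incA_mono[OF A, of l K] lm by (auto simp: B_def)
    qed (use fin K1 in \<open>auto simp: B_def\<close>)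
    moreover have "B k = B (k + 1)"
      using incA_mono[OF A, of k "k + 1"] incA_mono[OF A, of "k + 1" K] k1 kK AkK by (auto simp: B_def)
    moreover have "p \<in> B k" using p(1) kK by (simp add: B_def)
    moreover have "p \<notin> B l" if "1 \<le> l" "l < k" for l using p(2)[OF that] that kK by (simp add: B_def)
    moreover have "Isp K B D (V (k, p) * H)" by (rule Isp_cong[OF I2 dD K]) (simp add: BA)
    ultimately have E: "E_concl k D B H" using core k1 by blast
    have "V (k, p) * H \<in> FM A D"
    proof (cases "k_full k D")
      case True
      thus ?thesis using E_conclD(1)[OF E] by (simp add: pm.subspace_0[OF subspace_FM])
    next
      case False
      then obtain L a R where w: "descent_witness k D L a R" using transparent_clear[OF trD k1] by blast
      let ?D = "L @ (a - {k}) # R"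
      have "rowset ?D \<subseteq> rowset D" using rowset_mset[OF swp_witness_mset[OF w]] by auto
      hence "FM B ?D = (FM A ?D :: 'k matpoly set)"
        by (intro FM_cong is_diagram_witness(2)[OF dD w] BA) (rule subsetD)
      hence HD: "H \<in> FM A ?D" using E_conclD(2)[OF E w] by simp
      show ?thesis by (rule V_mult_FM[OF w dD p(1) _ HD]) (rule p(2))
    qed
    hence "F1 + (F - F1) \<in> FM A D" unfolding H by (rule pm.subspace_add[OF subspace_FM F1])
    thus ?thesis by simp
  qed
qed

text \<open>The statements are interlocked: exactness for \<open>D\<close> uses both of them for
  fewer boxes, and sufficiency of \<open>Isp\<close> for \<open>D\<close> uses exactness for
  \<open>D\<close> itself.\<close>

lemma exactness_aux:
  assumes "transparent D" "is_diagram D"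
  shows "(\<forall>A K (F :: 'k::field matpoly). incA A \<longrightarrow> rowset D \<subseteq> {1..K} \<longrightarrow> Isp K A D F \<longrightarrow> F \<in> FM A D) \<and>
    (\<forall>A k p (H :: 'k matpoly). incA A \<longrightarrow> 1 \<le> k \<longrightarrow> p \<in> A k \<longrightarrow> (\<forall>l. 1 \<le> l \<longrightarrow> l < k \<longrightarrow> p \<notin> A l) \<longrightarrow>
      A k = A (k + 1) \<longrightarrow> V (k, p) * H \<in> FM A D \<longrightarrow> E_concl k D A H)"
  using assms
proof (induction "num_boxes D" arbitrary: D rule: less_induct)
  case less
  note d = less.prems(2)
  have IHI: "F \<in> FM A D'" if "num_boxes D' < num_boxes D" "transparent D'" "is_diagram D'"
      "incA A" "rowset D' \<subseteq> {1..K}" "Isp K A D' F" for D' A K and F :: "'k matpoly"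
    using conjunct1[OF less.hyps[OF that(1-3)]] that(4-6) by simp
  have IHE: "E_concl k D' A H" if "num_boxes D' < num_boxes D" "transparent D'" "is_diagram D'"
      "incA A" "1 \<le> k" "p \<in> A k" "\<And>l. 1 \<le> l \<Longrightarrow> l < k \<Longrightarrow> p \<notin> A l" "A k = A (k + 1)" "V (k, p) * H \<in> FM A D'"
      for D' A k p and H :: "'k matpoly"
    using conjunct2[OF less.hyps[OF that(1-3)]] that(4-9) by simp
  have core: "E_concl k D A H"
    if "rowset D \<subseteq> {1..K}" "K \<in> rowset D" "incA A" "1 \<le> k" "p \<in> A k" "\<And>l. 1 \<le> l \<Longrightarrow> l < k \<Longrightarrow> p \<notin> A l"
      "A k = A (k + 1)" "Isp K A D (V (k, p) * H)" for A K k p and H :: "'k matpoly"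
    by (rule core[OF less.prems IHI IHE that(3,1,2,4,5,6,7,8)])
  show ?case
  proof (intro conjI allI impI)
    fix A K and F :: "'k matpoly"
    assume 1: "incA A" "rowset D \<subseteq> {1..K}" "Isp K A D F"
    show "F \<in> FM A D"
    proof (cases "K \<in> rowset D")
      case True
      show ?thesis by (rule exact_I_from_core[OF less.prems 1(2) True core[OF 1(2) True] 1(1,3)])
    next
      case False
      thus ?thesis by (rule Isp_empty_row[OF 1(3)])
    qed
  next
    fix A k p and H :: "'k matpoly"
    assume 2: "incA A" "1 \<le> k" "p \<in> A k" "\<forall>l. 1 \<le> l \<longrightarrow> l < k \<longrightarrow> p \<notin> A l" "A k = A (k + 1)" "V (k, p) * H \<in> FM A D"
    have z: "0 \<notin> rowset D" using d by (auto simp: rowset_def is_diagram_def)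
    have f: "finite (rowset D)" using d by (auto simp: rowset_def is_diagram_def)
    show "E_concl k D A H"
    proof (cases "rowset D = {}")
      case True
      hence "vars (V (k, p) * H) = {}" using vars_FM[OF d 2(6)] by auto
      hence "H = 0" using not_V_dvd_free[of "(k, p)" "V (k, p) * H"] by auto
      thus ?thesis by (simp add: E_concl_def pm.subspace_0[OF subspace_FM])
    next
      case False
      define K where "K = Max (rowset D)"
      have K: "K \<in> rowset D" unfolding K_def using f False by (rule Max_in)
      have r: "rowset D \<subseteq> {1..K}"
      proof
        fix j assume j: "j \<in> rowset D"
        have "j \<noteq> 0" using j z by metis
        moreover have "j \<le> K" unfolding K_def using f j by (rule Max_ge)
        ultimately show "j \<in> {1..K}" by simp
      qed
      have K1: "1 \<le> K" using subsetD[OF r K] by simp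
      have "A j \<subseteq> A K" if "j \<in> rowset D" for j
        using subsetD[OF r that] incA_mono[OF 2(1), of j K] by simp
      hence I: "Isp K A D (V (k, p) * H)" by (rule FM_Isp[OF 2(6) d K1])
      show ?thesis by (rule core[OF r K 2(1-3) _ 2(5) I]) (use 2(4) in blast)
    qed
  qed
qed

lemma exact_descent:
  assumes "transparent D" "is_diagram D" "incA A" "1 \<le> k" "p \<in> A k" "\<And>l. 1 \<le> l \<Longrightarrow> l < k \<Longrightarrow> p \<notin> A l"
    "A k = A (k + 1)" "V (k, p) * H \<in> FM A D"
  shows "E_concl k D A (H :: 'k::field matpoly)"
  using conjunct2[OF exactness_aux[OF assms(1,2)]] assms(3-8) by blast

section \<open>Coordinate subspaces and linear images\<close>

lemma subspace_ks: "pm.subspace {v :: 'b \<Rightarrow>\<^sub>0 'k::field. ks v \<subseteq> S}"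
proof (rule pm.subspaceI)
  fix x y :: "'b \<Rightarrow>\<^sub>0 'k" assume "x \<in> {v. ks v \<subseteq> S}" "y \<in> {v. ks v \<subseteq> S}"
  thus "x + y \<in> {v. ks v \<subseteq> S}" using keys_add[of x y] by auto
qed (auto simp: in_keys_iff)

lemma subspace_map_image:
  fixes h :: "('b \<Rightarrow>\<^sub>0 'k::field) \<Rightarrow> ('c \<Rightarrow>\<^sub>0 'k)"
  assumes "\<And>x y. h (x + y) = h x + h y" "\<And>c x. h (scale c x) = scale c (h x)" "pm.subspace W"
  shows "pm.subspace (h ` W)"
proof (rule pm.subspaceI)
  have "h (scale 0 0) = scale 0 (h 0)" by (rule assms(2))
  hence "h 0 = 0" by simp
  thus "0 \<in> h ` W" using pm.subspace_0[OF assms(3)] by (metis imageI)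
next
  fix x y assume "x \<in> h ` W" "y \<in> h ` W"
  then obtain u v where "u \<in> W" "v \<in> W" "x = h u" "y = h v" by blast
  thus "x + y \<in> h ` W" using pm.subspace_add[OF assms(3)] assms(1) by (metis imageI)
next
  fix c x assume "x \<in> h ` W"
  then obtain u where "u \<in> W" "x = h u" by blast
  thus "scale c x \<in> h ` W" using pm.subspace_scale[OF assms(3)] assms(2) by (metis imageI)
qed

section \<open>The relations of the flagged Schur module\<close>

abbreviation Fl :: "(nat \<Rightarrow> nat) \<Rightarrow> nat \<Rightarrow> nat set" where "Fl f \<equiv> \<lambda>l. {1..f l}"

text \<open>With \<open>f\<close> the identity these are the subsets \<open>b\<close> that are not
  componentwise at most \<open>a\<close>; their wedges span the kernel of the flagged quotient of
  the exterior power (\<open>flag_ker_conv\<close>).\<close>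

definition bad_col :: "(nat \<Rightarrow> nat) \<Rightarrow> nat set \<Rightarrow> nat set \<Rightarrow> bool" where
  "bad_col f a b \<longleftrightarrow> (\<exists>i<card a. f (sl a ! i) < sl b ! i)"

text \<open>The rows up to \<open>i\<close> vanish in all columns from \<open>i\<close> on, and
  every permutation sends one of the first \<open>i + 1\<close> indices to an index that is at least
  \<open>i\<close>.\<close>

lemma rA_minor_bad:
  assumes f: "mono f" and a: "finite a" "0 \<notin> a" and b: "card b = card a" and bad: "bad_col f a b"
  shows "rA (Fl f) (minor a b) = (0 :: 'k::field matpoly)"
proof -
  obtain i where i: "i < card a" "f (sl a ! i) < sl b ! i" using bad by (auto simp: bad_col_def)
  let ?g = "\<lambda>(l, q). if l = 0 \<or> q \<in> {1..f l} then V (l, q) else (0 :: 'k matpoly)"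
  let ?M = "mat (card a) (card b) (\<lambda>(i, j). ?g (sl a ! i, sl b ! j))"
  have z: "?M $$ (r, c) = 0" if "r \<le> i" "i \<le> c" "c < card a" for r c
  proof -
    have "sl a ! r \<le> sl a ! i" using that i a by (intro sorted_nth_mono) auto
    hence 1: "f (sl a ! r) \<le> f (sl a ! i)" using f by (simp add: monoD)
    have "sl b ! i \<le> sl b ! c" using that b by (intro sorted_nth_mono) auto
    hence "f (sl a ! r) < sl b ! c" using 1 i by simp
    moreover have "sl a ! r \<noteq> 0" using sl_nth_in[of a r] a that i by (metis le_less_trans)
    ultimately show ?thesis using that i b by simp
  qed
  have "det ?M = (\<Sum>\<pi>\<in>{\<pi>. \<pi> permutes {0..<card a}}. signof \<pi> * (\<Prod>r = 0..<card a. ?M $$ (r, \<pi> r)))"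
    by (rule det_def') (simp add: b)
  also have "\<dots> = 0"
  proof (rule sum.neutral, rule ballI)
    fix \<pi> assume "\<pi> \<in> {\<pi>. \<pi> permutes {0..<card a}}"
    hence \<pi>: "\<pi> permutes {0..<card a}" by simp
    have "\<exists>r\<le>i. i \<le> \<pi> r"
    proof (rule ccontr)
      assume "\<nexists>r. r \<le> i \<and> i \<le> \<pi> r"
      hence "\<pi> r < i" if "r \<le> i" for r using that by (meson not_less)
      hence "\<pi> ` {..i} \<subseteq> {..<i}" by auto
      hence "card (\<pi> ` {..i}) \<le> i" using card_mono[of "{..<i}"] by fastforce
      moreover have "card (\<pi> ` {..i}) = Suc i" by (subst card_image) (use permutes_inj[OF \<pi>] in \<open>auto intro: inj_on_subset\<close>)
      ultimately show False by simp
    qed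
    then obtain r where r: "r \<le> i" "i \<le> \<pi> r" by blast
    have "\<pi> r \<in> {0..<card a}" using permutes_in_image[OF \<pi>, of r] r i by simp
    hence "?M $$ (r, \<pi> r) = 0" using z[OF r] by simp
    hence "(\<Prod>r = 0..<card a. ?M $$ (r, \<pi> r)) = 0" using r i by (intro prod_zero bexI[of _ r]) auto
    thus "signof \<pi> * (\<Prod>r = 0..<card a. ?M $$ (r, \<pi> r)) = 0" by simp
  qed
  finally show ?thesis unfolding rA_def psub_minor .
qed

lemma rA_minor_letter:
  assumes "finite a" "finite b" "card b = card a" "0 \<notin> a" "q \<in> b" "\<And>l. l \<in> a \<Longrightarrow> q \<notin> A l"
  shows "rA A (minor a b) = (0 :: 'k::field matpoly)"
proof -
  obtain s :: "nat \<Rightarrow> 'k" where s: "minor a b = (\<Sum>x\<in>a. C (s x) * V (x, q) * minor (a - {x}) (b - {q}))"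
    using minor_col[OF assms(1-3,5)] by blast
  have "rA A (V (x, q)) = (0 :: 'k matpoly)" if "x \<in> a" for x
  proof -
    have "x \<noteq> 0" using assms(4) that by metis
    thus ?thesis using assms(6)[OF that] by (simp add: rA_V)
  qed
  thus ?thesis unfolding s rA_sum rA_mult by (intro sum.neutral) simp
qed

lemma rA_mprod_0:
  assumes "length \<tau> = length D" "j < length D" "rA A (minor (D ! j) (\<tau> ! j)) = (0 :: 'k::field matpoly)"
  shows "rA A (mprod D \<tau>) = (0 :: 'k matpoly)"
proof -
  have "map2 minor D \<tau> ! j \<in> set (map2 minor D \<tau> :: 'k matpoly list)" using assms(1,2) by (intro nth_mem) simp
  hence "(minor (D ! j) (\<tau> ! j) :: 'k matpoly) \<in> set (map2 minor D \<tau>)" using assms(1,2) by simp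
  hence "rA A (minor (D ! j) (\<tau> ! j)) \<in> set (map (rA A) (map2 minor D \<tau> :: 'k matpoly list))" by (simp only: set_map imageI)
  hence "0 \<in> set (map (rA A) (map2 minor D \<tau> :: 'k matpoly list))" using assms(3) by simp
  thus ?thesis unfolding rA_def mprod_def psub_prod_list by (simp only: prod_list_zero_iff)
qed

lemma mprod_append: "length D1 = length \<tau>1 \<Longrightarrow> mprod (D1 @ c # D2) (\<tau>1 @ b # \<tau>2) = mprod D1 \<tau>1 * minor c b * mprod D2 \<tau>2"
  by (simp add: mprod_def mult.assoc)

lemma minor_map_single:
  assumes "length \<tau> = length D" shows "minor_map D (sg \<tau> c) = C c * (mprod D \<tau> :: 'k::field matpoly)"
proof -
  have "mprod D \<tau> = (\<Prod>j<length D. minor (D ! j) (\<tau> ! j) :: 'k matpoly)"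
    unfolding mprod_def prod.list_conv_set_nth using assms by (simp add: atLeast0LessThan)
  thus ?thesis by (cases "c = 0") (simp_all add: minor_map_def C_def)
qed

lemma minor_map_lin:
  "minor_map D 0 = 0" "minor_map D (u + v) = minor_map D u + minor_map D v"
  "minor_map D (scale c v) = scale c (minor_map D v)"
  by (simp add: minor_map_def, rule minor_map_add, simp add: minor_map_scale scale_conv C_def)

lemma minor_map_diff: "minor_map D (u - v) = minor_map D u - minor_map D v"
  using minor_map_lin(2)[of D "u - v" v] by simp

lemma minor_map_sum: "minor_map D (sum f S) = (\<Sum>s\<in>S. minor_map D (f s))"
  by (induction S rule: infinite_finite_induct) (simp_all add: minor_map_lin)

section \<open>Tuples, and tuples that are bad for a flag\<close>

definition TEs :: "nat \<Rightarrow> diagram \<Rightarrow> nat set list set" where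
  "TEs n D = {\<tau>. list_all2 (\<lambda>a b. b \<subseteq> {1..n} \<and> card b = card a) D \<tau>}"

lemma TE_conv: "TE n D = {v. ks v \<subseteq> TEs n D}" by (auto simp: TE_def TEs_def)

lemma sum_singles: "v = (\<Sum>t\<in>ks v. sg t (lk v t))" by (rule mp_single_sum)

lemma TEs_length: "\<tau> \<in> TEs n D \<Longrightarrow> length \<tau> = length D"
  unfolding TEs_def by (auto dest: list_all2_lengthD)

lemma TEs_nth: "\<tau> \<in> TEs n D \<Longrightarrow> j < length D \<Longrightarrow> \<tau> ! j \<subseteq> {1..n} \<and> card (\<tau> ! j) = card (D ! j)"
  unfolding TEs_def by (auto dest: list_all2_nthD)

lemma TEs_adm: "\<tau> \<in> TEs n D \<Longrightarrow> adm D \<tau>"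
  unfolding TEs_def adm_def mem_Collect_eq
  by (erule list_all2_mono) (blast intro: finite_subset[OF _ finite_atLeastAtMost])

lemma minor_map_conv:
  assumes "ks v \<subseteq> TEs n D" shows "minor_map D v = (\<Sum>\<tau>\<in>ks v. C (lk v \<tau>) * mprod D \<tau>)"
proof -
  have "minor_map D v = (\<Sum>\<tau>\<in>ks v. minor_map D (sg \<tau> (lk v \<tau>)))"
    by (subst sum_singles[of v]) (rule minor_map_sum)
  also have "\<dots> = (\<Sum>\<tau>\<in>ks v. C (lk v \<tau>) * mprod D \<tau>)"
    using assms by (intro sum.cong refl minor_map_single TEs_length) blast
  finally show ?thesis .
qed

lemma rA_uncontained:
  assumes "adm D \<tau>" "is_diagram D" "\<tau> \<notin> TEs n D" "\<And>l. l \<in> rowset D \<Longrightarrow> A l \<subseteq> {1..n}"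
  shows "rA A (mprod D \<tau>) = (0 :: 'k::field matpoly)"
proof -
  have len: "length \<tau> = length D" using assms(1) by (auto simp: adm_def dest: list_all2_lengthD)
  have "\<exists>j<length D. \<not> \<tau> ! j \<subseteq> {1..n}"
    using assms(1,3) len by (auto simp: TEs_def adm_def list_all2_conv_all_nth)
  then obtain j q where j: "j < length D" "q \<in> \<tau> ! j" "q \<notin> {1..n}" by blast
  have fin: "finite (\<tau> ! j)" "card (\<tau> ! j) = card (D ! j)"
    using assms(1) j(1) by (auto simp: adm_def dest: list_all2_nthD)
  have d: "finite (D ! j)" "0 \<notin> D ! j" using assms(2) nth_mem[OF j(1)] by (auto simp: is_diagram_def)
  have "q \<notin> A l" if "l \<in> D ! j" for l
  proof -
    have "l \<in> rowset D" using that nth_mem[OF j(1)] by (auto simp: rowset_def)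
    thus ?thesis using j(3) assms(4) by blast
  qed
  hence "rA A (minor (D ! j) (\<tau> ! j)) = (0 :: 'k matpoly)" by (intro rA_minor_letter[OF d(1) fin d(2) j(2)])
  thus ?thesis by (rule rA_mprod_0[OF len j(1)])
qed

lemma rA_mm_lin: "rA A (minor_map D (u + v)) = rA A (minor_map D u) + rA A (minor_map D v)"
  "rA A (minor_map D (scale c v)) = scale c (rA A (minor_map D v))"
  by (simp_all add: minor_map_lin rA_add rA_scale)

lemma TE_FM:
  assumes "v \<in> TE n D" shows "rA A (minor_map D v) \<in> FM A D"
proof -
  have "ks v \<subseteq> TEs n D" using assms by (simp add: TE_conv)
  hence "rA A (minor_map D v) = (\<Sum>\<tau>\<in>ks v. scale (lk v \<tau>) (rA A (mprod D \<tau>)))"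
    by (simp add: minor_map_conv rA_sum scale_conv rA_mult) (simp add: rA_def)
  moreover have "scale (lk v \<tau>) (rA A (mprod D \<tau>)) \<in> FM A D" if "\<tau> \<in> ks v" for \<tau>
  proof -
    have "adm D \<tau>" using TEs_adm subsetD[OF \<open>ks v \<subseteq> TEs n D\<close> that] by blast
    hence "mprod D \<tau> \<in> gens D" by (auto simp: gens_def)
    thus ?thesis unfolding FM_def by (intro pm.span_scale pm.span_base imageI)
  qed
  ultimately show ?thesis by (simp add: pm.subspace_sum[OF subspace_FM])
qed

definition bad :: "(nat \<Rightarrow> nat) \<Rightarrow> diagram \<Rightarrow> nat set list \<Rightarrow> bool" where
  "bad f D \<tau> \<longleftrightarrow> (\<exists>j<length D. bad_col f (D ! j) (\<tau> ! j))"

definition Bad :: "nat \<Rightarrow> (nat \<Rightarrow> nat) \<Rightarrow> diagram \<Rightarrow> (nat set list \<Rightarrow>\<^sub>0 'k::field) set" where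
  "Bad n f D = {u. ks u \<subseteq> {\<tau> \<in> TEs n D. bad f D \<tau>}}"

lemma Bad_TE: "Bad n f D \<subseteq> TE n D" by (auto simp: Bad_def TE_conv)

lemma subspace_Bad: "pm.subspace (Bad n f D)" unfolding Bad_def by (rule subspace_ks)

lemma bad_mono: "bad f D \<tau> \<Longrightarrow> (\<And>l. g l \<le> f l) \<Longrightarrow> bad g D \<tau>"
  unfolding bad_def bad_col_def by (meson le_less_trans)

lemma rA_Bad:
  assumes "u \<in> Bad n f D" "is_diagram D" "mono f"
  shows "rA (Fl f) (minor_map D u) = (0 :: 'k::field matpoly)"
proof -
  have k: "\<tau> \<in> TEs n D" "bad f D \<tau>" if "\<tau> \<in> ks u" for \<tau> using assms(1) that by (auto simp: Bad_def)
  have "rA (Fl f) (mprod D \<tau>) = (0 :: 'k matpoly)" if t: "\<tau> \<in> ks u" for \<tau>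
  proof -
    obtain j where j: "j < length D" "bad_col f (D ! j) (\<tau> ! j)" using k(2)[OF t] by (auto simp: bad_def)
    have d: "finite (D ! j)" "0 \<notin> D ! j" using assms(2) nth_mem[OF j(1)] by (auto simp: is_diagram_def)
    have "rA (Fl f) (minor (D ! j) (\<tau> ! j)) = (0 :: 'k matpoly)"
      using TEs_nth[OF k(1)[OF t] j(1)] by (intro rA_minor_bad[OF assms(3) d _ j(2)]) simp
    thus ?thesis by (rule rA_mprod_0[OF TEs_length[OF k(1)[OF t]] j(1)])
  qed
  moreover have "ks u \<subseteq> TEs n D" using k(1) by blast
  ultimately show ?thesis by (simp add: minor_map_conv rA_sum rA_mult)
qed

text \<open>The computation of \<open>V_mult_FM\<close>, with the tuples kept in view. Inserting
  \<open>p\<close> gives a tuple that is bad for the flag lowered at \<open>k\<close>: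
  \<open>k\<close> is the last row of \<open>a\<close>, and the last letter is at least
  \<open>p\<close>, which exceeds the lowered bound.\<close>

lemma V_FM_Bad:
  assumes d: "is_diagram D" and w: "descent_witness k D L a R" and f: "mono f" "\<And>l. f l \<le> n"
    and p: "p = f k" "1 \<le> p" "\<And>l. 1 \<le> l \<Longrightarrow> l < k \<Longrightarrow> f l < p"
    and H: "H \<in> FM (Fl f) (L @ (a - {k}) # R)"
  shows "\<exists>u \<in> Bad n (f(k := f k - 1)) D. rA (Fl f) (minor_map D u) = V (k, p) * (H :: 'k::field matpoly)"
proof -
  let ?f = "f(k := f k - 1)" and ?A = "Fl f"
  note wc = witness_col[OF d w]
  obtain D1 D2 where D: "D = D1 @ a # D2" using split_list[OF wc(5)] by blast
  have "mset (L @ (a - {k}) # R) = mset (D1 @ (a - {k}) # D2)"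
    using swp_witness_mset[OF w] D by simp
  hence "FM ?A (L @ (a - {k}) # R) = (FM ?A (D1 @ (a - {k}) # D2) :: 'k matpoly set)" by (rule FM_mset)
  hence H': "H \<in> FM ?A (D1 @ (a - {k}) # D2)" using H by simp
  let ?I = "(\<lambda>u. rA ?A (minor_map D u)) ` Bad n ?f D :: 'k matpoly set"
  have subI: "pm.subspace ?I"
    by (rule subspace_map_image[OF rA_mm_lin subspace_Bad])
  have al: "l \<in> a - {k} \<Longrightarrow> 1 \<le> l \<and> l < k" for l
    using subsetD[OF wc(3), of l] by (auto simp: order.strict_iff_order)
  have "FM ?A (D1 @ (a - {k}) # D2) \<subseteq> {H. V (k, p) * H \<in> ?I}"
  proof (rule FM_least[OF subspace_vimage_mult[OF subI]])
    fix P :: "'k matpoly" assume "P \<in> gens (D1 @ (a - {k}) # D2)"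
    then obtain \<tau> where t: "adm (D1 @ (a - {k}) # D2) \<tau>" "P = mprod (D1 @ (a - {k}) # D2) \<tau>" by (auto simp: gens_def)
    then obtain \<tau>1 \<tau>' where t1: "\<tau> = \<tau>1 @ \<tau>'" "list_all2 (\<lambda>c b. finite b \<and> card b = card c) D1 \<tau>1"
        "list_all2 (\<lambda>c b. finite b \<and> card b = card c) ((a - {k}) # D2) \<tau>'"
      by (auto simp: adm_def list_all2_append1)
    then obtain b \<tau>2 where t2: "\<tau>' = b # \<tau>2" "finite b" "card b = card (a - {k})"
        "list_all2 (\<lambda>c b. finite b \<and> card b = card c) D2 \<tau>2"
      by (auto simp: list_all2_Cons1)
    have l1: "length D1 = length \<tau>1" using t1(2) by (rule list_all2_lengthD)
    have P: "rA ?A P = rA ?A (mprod D1 \<tau>1) * rA ?A (minor (a - {k}) b) * rA ?A (mprod D2 \<tau>2)"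
      unfolding t(2) t1(1) t2(1) by (simp only: mprod_append[OF l1] rA_mult)
    show "rA ?A P \<in> {H. V (k, p) * H \<in> ?I}"
    proof (cases "p \<in> b")
      case True
      have pl: "p \<notin> {1..f l}" if "l \<in> a - {k}" for l using p(3)[of l] al[OF that] by auto
      have z: "rA ?A (minor (a - {k}) b) = (0 :: 'k matpoly)"
        by (rule rA_minor_letter[OF _ t2(2,3) _ True pl]) (use wc(1) al in auto)
      show ?thesis unfolding P z mult_zero_right mult_zero_left mem_Collect_eq by (rule pm.subspace_0[OF subI])
    next
      case False
      let ?b = "insert p b"
      have cd: "card ?b = card a" using False t2(2,3) card.remove[OF wc(1,2)] by simp
      obtain s :: "nat \<Rightarrow> 'k" where s: "s k \<noteq> 0"
        "minor a ?b = (\<Sum>x\<in>a. C (s x) * V (x, p) * minor (a - {x}) (?b - {p}))"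
        using minor_col[OF wc(1) _ cd, of p, where ?'k='k] t2(2) by auto
      have ib: "?b - {p} = b" using False by auto
      have r0: "rA ?A (V (l, p)) = (0 :: 'k matpoly)" if "l \<in> a - {k}" for l
        using al[OF that] p(3)[of l] by (simp add: rA_V)
      have rk: "rA ?A (V (k, p)) = (V (k, p) :: 'k matpoly)" using p by (simp add: rA_V)
      have "rA ?A (minor a ?b) = (\<Sum>x\<in>a. C (s x) * rA ?A (V (x, p)) * rA ?A (minor (a - {x}) b))"
        unfolding s(2) ib by (simp add: rA_def psub_sum psub_mult)
      also have "\<dots> = C (s k) * rA ?A (V (k, p)) * rA ?A (minor (a - {k}) b) + (\<Sum>x\<in>a - {k}. C (s x) * rA ?A (V (x, p)) * rA ?A (minor (a - {x}) b))"
        using wc(1,2) by (rule sum.remove)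
      also have "(\<Sum>x\<in>a - {k}. C (s x) * rA ?A (V (x, p)) * rA ?A (minor (a - {x}) b)) = 0"
        by (rule sum.neutral, rule ballI) (simp only: r0 mult_zero_right mult_zero_left)
      finally have m: "rA ?A (minor a ?b) = C (s k) * (V (k, p) * rA ?A (minor (a - {k}) b))" by (simp only: rk add_0_right mult.assoc)
      have ci: "C (inverse (s k)) * C (s k) = (1 :: 'k matpoly)" using s(1) by (simp flip: C_simps(4))
      let ?\<tau> = "\<tau>1 @ ?b # \<tau>2"
      have adm: "adm D ?\<tau>" unfolding D adm_def
        using t1(2) t2(2,4) cd by (intro list_all2_appendI) auto
      have "C (inverse (s k)) * rA ?A (mprod D ?\<tau>) = (C (inverse (s k)) * C (s k)) * (V (k, p) * rA ?A P)"
        unfolding P unfolding D by (simp only: mprod_append[OF l1] rA_mult m ac_simps)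
      hence e: "C (inverse (s k)) * rA ?A (mprod D ?\<tau>) = V (k, p) * rA ?A P" unfolding ci by simp
      show ?thesis
      proof (cases "?\<tau> \<in> TEs n D")
        case False
        hence "rA ?A (mprod D ?\<tau>) = (0 :: 'k matpoly)" by (rule rA_uncontained[OF adm d]) (simp add: f(2))
        hence "V (k, p) * rA ?A P = 0" using e by simp
        thus ?thesis by (simp only: mem_Collect_eq pm.subspace_0[OF subI])
      next
        case True
        have c0: "card a > 0" using wc(1,2) by (auto simp: card_gt_0_iff)
        have la: "sl a ! (card a - 1) = k"
        proof -
          obtain i where i: "i < card a" "sl a ! i = k" using sl_index[OF wc(1,2)] by (elim exE conjE)
          have "sl a ! i \<le> sl a ! (card a - 1)" using i by (intro sorted_nth_mono) auto
          moreover have "sl a ! (card a - 1) \<in> a" using wc(1) c0 by (intro sl_nth_in) auto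
          ultimately show ?thesis using subsetD[OF wc(3)] i(2) by fastforce
        qed
        have "p \<le> sl ?b ! (card a - 1)"
        proof -
          have "\<exists>i<card ?b. sl ?b ! i = p" by (rule sl_index) (use t2(2) in auto)
          then obtain i where i: "i < card ?b" "sl ?b ! i = p" by (elim exE conjE)
          have "sl ?b ! i \<le> sl ?b ! (card a - 1)" using i(1) cd by (intro sorted_nth_mono) auto
          thus ?thesis using i(2) by simp
        qed
        hence "bad_col ?f a ?b" unfolding bad_col_def
          using c0 la p(1,2) by (intro exI[of _ "card a - 1"]) auto
        hence "bad ?f D ?\<tau>" unfolding bad_def D using l1 by (intro exI[of _ "length D1"]) (simp add: nth_append)
        hence B: "sg ?\<tau> (inverse (s k)) \<in> Bad n ?f D" using True by (auto simp: Bad_def split: if_splits)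
        have E: "rA ?A (minor_map D (sg ?\<tau> (inverse (s k)))) = V (k, p) * rA ?A P"
          using e by (simp add: minor_map_single[OF TEs_length[OF True]] rA_mult) (simp add: rA_def)
        show ?thesis unfolding mem_Collect_eq E[symmetric] by (rule imageI[OF B])
      qed
    qed
  qed
  hence "H \<in> {H. V (k, p) * H \<in> ?I}" using H' by (rule subsetD)
  hence "V (k, p) * H \<in> ?I" by (rule CollectD)
  then obtain u where u: "V (k, p) * H = rA ?A (minor_map D u)" "u \<in> Bad n ?f D" by (rule imageE)
  show ?thesis using u by (intro bexI[of _ u]) simp_all
qed

text \<open>Interpolates between two flags: for the constant flag the kernel is
  \<open>exchange_rels\<close> itself, and for the standard flag it becomes
  \<open>schur_rels\<close>.\<close>

definition kernel_split :: "nat \<Rightarrow> diagram \<Rightarrow> 'k::field itself \<Rightarrow> (nat \<Rightarrow> nat) \<Rightarrow> bool" where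
  "kernel_split n D _ f \<longleftrightarrow> (\<forall>v \<in> TE n D. rA (Fl f) (minor_map D v) = (0 :: 'k matpoly) \<longrightarrow>
     (\<exists>u \<in> Bad n f D. v - u \<in> exchange_rels n D))"

text \<open>What survives for \<open>f\<close> but dies for the lowered flag is a multiple of
  \<open>V (k, f k)\<close>. Exactness shows that this multiple comes from a combination of bad
  tuples, and subtracting it leads back to the kernel for \<open>f\<close>.\<close>

lemma kernel_split_step:
  assumes tr: "transparent D" "is_diagram D" and f: "mono f" "\<And>l. f l \<le> n"
    and k: "1 \<le> k" and p: "1 \<le> f k" "f k = f (k + 1)" "\<And>l. 1 \<le> l \<Longrightarrow> l < k \<Longrightarrow> f l < f k"
    and S: "kernel_split n D TYPE('k::field) f"
  shows "kernel_split n D TYPE('k) (f(k := f k - 1))"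
  unfolding kernel_split_def
proof (intro ballI impI)
  let ?f = "f(k := f k - 1)" and ?p = "f k"
  fix v :: "nat set list \<Rightarrow>\<^sub>0 'k" assume v: "v \<in> TE n D" "rA (Fl ?f) (minor_map D v) = 0"
  have le: "?f l \<le> f l" for l by simp
  let ?F = "rA (Fl f) (minor_map D v)"
  have eq: "(Fl f)(k := Fl f k - {?p}) = Fl ?f" using p(1) by (auto simp: fun_eq_iff)
  have "psub (V((k, ?p) := 0)) ?F = 0" unfolding rA_restrict[OF k] eq by (rule v(2))
  hence "V (k, ?p) dvd ?F" by (simp only: V_dvd_iff)
  then obtain H where H: "?F = V (k, ?p) * H" by (rule dvdE)
  have incf: "incA (Fl f)" using f(1) by (auto simp: incA_def dest: monoD intro: order_trans)
  have "V (k, ?p) * H \<in> FM (Fl f) D" unfolding H[symmetric] by (rule TE_FM[OF v(1)])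
  hence E: "E_concl k D (Fl f) H"
    by (rule exact_descent[OF tr incf k, rotated -1]) (use p in \<open>auto simp: not_le\<close>)
  have "\<exists>u \<in> Bad n ?f D. rA (Fl f) (minor_map D u) = ?F"
  proof (cases "k_full k D")
    case True
    hence "?F = 0" using E_conclD(1)[OF E] H by simp
    thus ?thesis by (intro bexI[of _ 0] subspace_Bad pm.subspace_0) (simp add: minor_map_lin rA_def)
  next
    case False
    then obtain L a R where w: "descent_witness k D L a R" using transparent_clear[OF tr(1) k] by blast
    show ?thesis unfolding H by (rule V_FM_Bad[OF tr(2) w f refl p(1) _ E_conclD(2)[OF E w]]) (rule p(3))
  qed
  then obtain u where u: "u \<in> Bad n ?f D" "rA (Fl f) (minor_map D u) = ?F" by blast
  have "v - u \<in> TE n D" by (rule pm.subspace_diff[OF subspace_TE v(1) subsetD[OF Bad_TE u(1)]])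
  moreover have "rA (Fl f) (minor_map D (v - u)) = 0"
    using u(2) by (simp add: minor_map_diff) (simp add: rA_def psub_diff)
  ultimately obtain u' where u': "u' \<in> Bad n f D" "v - u - u' \<in> exchange_rels n D"
    using S unfolding kernel_split_def by blast
  have "bad ?f D \<tau>" if "bad f D \<tau>" for \<tau> by (rule bad_mono[OF that le])
  hence "u' \<in> Bad n ?f D" using u'(1) unfolding Bad_def by blast
  hence "u + u' \<in> Bad n ?f D" by (rule pm.subspace_add[OF subspace_Bad u(1)])
  moreover have "v - (u + u') \<in> exchange_rels n D" using u'(2) by (simp add: algebra_simps)
  ultimately show "\<exists>u\<in>Bad n ?f D. v - u \<in> exchange_rels n D" by blast
qed

lemma rA_TE_id:
  assumes "v \<in> TE n D" "is_diagram D" shows "rA (Fl (\<lambda>_. n)) (minor_map D v) = (minor_map D v :: 'k::field matpoly)"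
proof -
  have k: "ks v \<subseteq> TEs n D" using assms by (simp add: TE_conv)
  have "rA (Fl (\<lambda>_. n)) (mprod D \<tau>) = (mprod D \<tau> :: 'k matpoly)" if "\<tau> \<in> TEs n D" for \<tau>
  proof -
    have "rA (Fl (\<lambda>_. n)) m = m" if m: "m \<in> set (map2 minor D \<tau>)" for m :: "'k matpoly"
    proof -
      have "\<exists>j < length (map2 minor D \<tau> :: 'k matpoly list). map2 minor D \<tau> ! j = m"
        using m by (rule in_set_conv_nth[THEN iffD1])
      then obtain j where j0: "j < length (map2 minor D \<tau> :: 'k matpoly list)" "map2 minor D \<tau> ! j = m"
        by (elim exE conjE)
      have j: "j < length D" "m = minor (D ! j) (\<tau> ! j)"
        using j0 TEs_length[OF \<open>\<tau> \<in> TEs n D\<close>] by auto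
      note tj = TEs_nth[OF \<open>\<tau> \<in> TEs n D\<close> j(1)]
      have "finite (D ! j)" using assms(2) nth_mem[OF j(1)] by (auto simp: is_diagram_def)
      moreover have "finite (\<tau> ! j)" using tj finite_subset[of "\<tau> ! j" "{1..n}"] by blast
      ultimately have "vars m \<subseteq> (D ! j) \<times> (\<tau> ! j)" unfolding j(2) using tj by (intro vars_minor) simp_all
      thus ?thesis using tj by (intro rA_id) auto
    qed
    hence "map (rA (Fl (\<lambda>_. n))) (map2 minor D \<tau> :: 'k matpoly list) = map2 minor D \<tau>" by (intro map_idI)
    thus ?thesis unfolding mprod_def rA_def psub_prod_list by (simp only: rA_def[symmetric])
  qed
  moreover have "rA (Fl (\<lambda>_. n)) (C c) = (C c :: 'k matpoly)" for c by (simp add: rA_def)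
  ultimately show ?thesis unfolding minor_map_conv[OF k] rA_sum rA_mult
    using k by (intro sum.cong refl) (simp add: subset_iff)
qed

lemma kernel_split_flag:
  assumes tr: "transparent D" "is_diagram D"
  shows "kernel_split n D TYPE('k::field) (\<lambda>l. min l n)"
proof -
  \<comment> \<open>Up to truncation at \<open>n\<close>, rows up to \<open>k\<close> have bound
    \<open>l + m + 1\<close> and later rows \<open>l + m\<close>. In \<open>g m (k + 1)\<close> the
    row \<open>k + 1\<close> then has the same bound as the next row and a larger one than all
    earlier rows, which is what a step requires; lowering it gives \<open>g m k\<close>. So for each
    \<open>m\<close> the rows are lowered from \<open>n\<close> down to 1.\<close>
  define g where "g m k l = (if l = 0 then 0 else min (l + m + (if l \<le> k then 1 else 0)) n)" for m k l :: nat
  have mono: "mono (g m k)" for m k by (rule monoI) (auto simp: g_def)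
  have down: "kernel_split n D TYPE('k) (g m 0)" if "kernel_split n D TYPE('k) (g m k)" for m k
    using that
  proof (induction k)
    case (Suc k)
    show ?case
    proof (cases "Suc k + m < n")
      case True
      have eq: "g m k = (g m (Suc k))(Suc k := g m (Suc k) (Suc k) - 1)"
        using True by (auto simp: g_def fun_eq_iff)
      have "kernel_split n D TYPE('k) (g m k)" unfolding eq
        by (rule kernel_split_step[OF tr mono _ _ _ _ _ Suc.prems]) (use True in \<open>auto simp: g_def\<close>)
      thus ?thesis by (rule Suc.IH)
    next
      case False
      hence "g m k = g m (Suc k)" by (auto simp: g_def fun_eq_iff)
      thus ?thesis using Suc by simp
    qed
  qed
  have "kernel_split n D TYPE('k) (g m 0)" if "m \<le> n" for m
    using that
  proof (induction rule: inc_induct)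
    case base
    have e: "rA (Fl (g n 0)) F = rA (Fl (\<lambda>_. n)) F" for F :: "'k matpoly"
      by (rule rA_cong) (simp add: g_def)
    show ?case unfolding kernel_split_def e
      using rA_TE_id[OF _ tr(2), where ?'k='k]
      by (intro ballI impI bexI[of _ 0]) (auto simp: exchange_rels_def Bad_def)
  next
    case (step m)
    \<comment> \<open>Rows up to \<open>n\<close> have the same bound by definition, and rows beyond
      \<open>n\<close> are truncated to \<open>n\<close> on both sides.\<close>
    have "g (Suc m) 0 = g m n" using step by (auto simp: g_def fun_eq_iff)
    thus ?case using step.IH down[of m n] by simp
  qed
  from this[of 0] have "kernel_split n D TYPE('k) (g 0 0)" by simp
  moreover have "g 0 0 = (\<lambda>l. min l n)" by (auto simp: g_def fun_eq_iff)
  ultimately show ?thesis by simp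
qed

section \<open>The flag relations as a coordinate subspace\<close>

lemma ks_wedge:
  "ks (wedge u v) \<subseteq> {b \<union> c | b c. b \<in> ks u \<and> c \<in> ks v \<and> b \<inter> c = {}}"
proof -
  let ?S = "{b \<union> c | b c. b \<in> ks u \<and> c \<in> ks v \<and> b \<inter> c = {}}"
  have "wedge u v \<in> {w. ks w \<subseteq> ?S}" unfolding wedge_def
  proof (intro pm.subspace_sum[OF subspace_ks])
    fix b c assume "b \<in> ks u" "c \<in> ks v"
    thus "(if b \<inter> c = {} then sg (b \<union> c) ((-1) ^ card {(x, y). x \<in> b \<and> y \<in> c \<and> y < x} * lk u b * lk v c) else 0) \<in> {w. ks w \<subseteq> ?S}"
      by (auto split: if_splits)
  qed
  thus ?thesis by simp
qed

text \<open>If the letter at position \<open>i\<close> of \<open>b \<union> c\<close> did not exceed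
  the row at position \<open>i\<close>, the first \<open>i + 1\<close> letters would all lie in
  \<open>b\<close>, which has only \<open>i\<close>. Conversely a bad \<open>b\<close> is cut at its
  bad position: all letters from there on exceed the row, and the wedge of the two parts is
  \<open>b\<close> up to sign.\<close>

lemma flag_ker_conv:
  assumes "finite a"
  shows "flag_ker n a = {u :: nat set \<Rightarrow>\<^sub>0 'k::field. ks u \<subseteq> {b. b \<subseteq> {1..n} \<and> card b = card a \<and> bad_col (\<lambda>l. l) a b}}"
    (is "_ = {u. ks u \<subseteq> ?S}")
proof
  show "flag_ker n a \<subseteq> {u :: nat set \<Rightarrow>\<^sub>0 'k. ks u \<subseteq> ?S}" unfolding flag_ker_def
  proof (rule pm.span_minimal[OF _ subspace_ks], rule subsetI)
    fix w :: "nat set \<Rightarrow>\<^sub>0 'k"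
    assume "w \<in> (\<Union>i<card a. {wedge u v |u v. u \<in> ext {1..n} i \<and> v \<in> ext {sl a ! i<..n} (card a - i)})"
    then obtain i u v where i: "i < card a" and w: "w = wedge u v" and u: "u \<in> ext {1..n} i" and v: "v \<in> ext {sl a ! i<..n} (card a - i)"
      by blast
    have "b \<union> c \<in> ?S" if bc: "b \<in> ks u" "c \<in> ks v" "b \<inter> c = {}" for b c
    proof -
      have b: "finite b" "b \<subseteq> {1..n}" "card b = i" using u bc(1) by (auto simp: ext_def)
      have c: "finite c" "c \<subseteq> {sl a ! i<..n}" "card c = card a - i" using v bc(2) by (auto simp: ext_def)
      have cd: "card (b \<union> c) = card a" using b c bc(3) i by (simp add: card_Un_disjoint)
      have "sl a ! i < sl (b \<union> c) ! i"
      proof (rule ccontr)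
        assume n: "\<not> sl a ! i < sl (b \<union> c) ! i"
        have "sl (b \<union> c) ! j \<in> b" if "j \<le> i" for j
        proof -
          have "sl (b \<union> c) ! j \<le> sl (b \<union> c) ! i" using that i cd by (intro sorted_nth_mono) auto
          hence "sl (b \<union> c) ! j \<notin> c" using n subsetD[OF c(2)] by fastforce
          moreover have "sl (b \<union> c) ! j \<in> b \<union> c" using b(1) c(1) cd i that by (intro sl_nth_in) auto
          ultimately show ?thesis by blast
        qed
        hence "(!) (sl (b \<union> c)) ` {..i} \<subseteq> b" by auto
        hence "card ((!) (sl (b \<union> c)) ` {..i}) \<le> i" using card_mono[OF b(1)] b(3) by blast
        moreover have "inj_on ((!) (sl (b \<union> c))) {..i}"
          using sl_inj[of "b \<union> c"] b(1) c(1) cd i by (auto simp: inj_on_def)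
        ultimately show False by (simp add: card_image)
      qed
      thus ?thesis using b c cd i by (auto simp: bad_col_def)
    qed
    thus "w \<in> {u. ks u \<subseteq> ?S}" unfolding w using ks_wedge[of u v] by blast
  qed
  have sub: "pm.subspace (flag_ker n a :: (nat set \<Rightarrow>\<^sub>0 'k) set)" unfolding flag_ker_def by (rule pm.subspace_span)
  show "{u :: nat set \<Rightarrow>\<^sub>0 'k. ks u \<subseteq> ?S} \<subseteq> flag_ker n a"
  proof
    fix u :: "nat set \<Rightarrow>\<^sub>0 'k" assume u: "u \<in> {u. ks u \<subseteq> ?S}"
    have "sg b c \<in> (flag_ker n a :: (nat set \<Rightarrow>\<^sub>0 'k) set)" if b: "b \<in> ?S" for b c
    proof -
      obtain i where i: "i < card a" "sl a ! i < sl b ! i" using b by (auto simp: bad_col_def)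
      have fb: "finite b" using b by (auto intro: finite_subset)
      have cb: "card b = card a" using b by simp
      define b1 b2 where "b1 = set (take i (sl b))" and "b2 = set (drop i (sl b))"
      have "b1 \<union> b2 = set (take i (sl b) @ drop i (sl b))" by (simp only: b1_def b2_def set_append)
      also have "\<dots> = b" by (simp only: append_take_drop_id set_sorted_list_of_set[OF fb])
      finally have un: "b1 \<union> b2 = b" .
      have dj: "b1 \<inter> b2 = {}" unfolding b1_def b2_def by (rule set_take_disj_set_drop_if_distinct) auto
      have c1: "card b1 = i" "card b2 = card a - i"
        using i cb by (simp_all add: b1_def b2_def distinct_card)
      have b2s: "b2 \<subseteq> {sl a ! i<..n}"
      proof
        fix x assume x: "x \<in> b2"
        then obtain j where j: "j < card b - i" "x = sl b ! (i + j)" by (auto simp: b2_def in_set_conv_nth)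
        have "sl b ! i \<le> sl b ! (i + j)" using j by (intro sorted_nth_mono) auto
        moreover have "x \<in> b" using x un by blast
        ultimately show "x \<in> {sl a ! i<..n}" using i j b by auto
      qed
      let ?m = "card {(x, y). x \<in> b1 \<and> y \<in> b2 \<and> y < x}"
      have "wedge (sg b1 1) (sg b2 1) = (sg b ((-1) ^ ?m) :: nat set \<Rightarrow>\<^sub>0 'k)"
        using dj un by (simp add: wedge_def)
      note W = this
      have e: "sg b1 1 \<in> (ext {1..n} i :: (nat set \<Rightarrow>\<^sub>0 'k) set)" "sg b2 1 \<in> (ext {sl a ! i<..n} (card a - i) :: (nat set \<Rightarrow>\<^sub>0 'k) set)"
        using un b c1 b2s fb finite_subset[of b1 b] finite_subset[of b2 b] by (auto simp: ext_def)
      have "sg b ((-1) ^ ?m) \<in> (flag_ker n a :: (nat set \<Rightarrow>\<^sub>0 'k) set)"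
        unfolding flag_ker_def
      proof (rule pm.span_base, rule UN_I[of i])
        show "i \<in> {..<card a}" using i(1) by simp
        show "sg b ((-1) ^ ?m) \<in> {wedge u v |u v. u \<in> ext {1..n} i \<and> v \<in> (ext {sl a ! i<..n} (card a - i) :: (nat set \<Rightarrow>\<^sub>0 'k) set)}"
          unfolding mem_Collect_eq by (rule exI[of _ "sg b1 1"], rule exI[of _ "sg b2 1"]) (intro conjI W[symmetric] e)
      qed
      hence "scale (c * (-1) ^ ?m) (sg b ((-1) ^ ?m)) \<in> (flag_ker n a :: (nat set \<Rightarrow>\<^sub>0 'k) set)"
        by (rule pm.subspace_scale[OF sub])
      moreover have "scale (c * (-1) ^ ?m) (sg b ((-1) ^ ?m)) = (sg b c :: nat set \<Rightarrow>\<^sub>0 'k)"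
        by (rule poly_mapping_eqI) (simp add: lookup_single when_def mult.assoc flip: power_mult_distrib)
      ultimately show ?thesis by simp
    qed
    hence "(\<Sum>b\<in>ks u. sg b (lk u b)) \<in> flag_ker n a" using u by (intro pm.subspace_sum[OF sub]) blast
    thus "u \<in> flag_ker n a" using sum_singles[of u] by simp
  qed
qed

text \<open>All letters of the tuple are at most \<open>n\<close>, so a bound truncated to
  \<open>n\<close> is violated only where the original one is.\<close>

lemma bad_min:
  assumes "\<tau> \<in> TEs n D" shows "bad (\<lambda>l. min l n) D \<tau> \<longleftrightarrow> bad (\<lambda>l. l) D \<tau>"
proof -
  have "sl (\<tau> ! j) ! i \<le> n" if "j < length D" "i < card (D ! j)" for i j
  proof -
    have t: "\<tau> ! j \<subseteq> {1..n}" "card (\<tau> ! j) = card (D ! j)" using TEs_nth[OF assms that(1)] by simp_all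
    hence "sl (\<tau> ! j) ! i \<in> \<tau> ! j" using that(2) by (intro sl_nth_in) (auto intro: finite_subset)
    thus ?thesis using t(1) by auto
  qed
  thus ?thesis unfolding bad_def bad_col_def by (metis min_less_iff_disj not_less)
qed

text \<open>A factor in \<open>flag_ker\<close> is supported on bad columns, which makes the tensor
  a combination of bad tuples. A single bad tuple is in turn a pure tensor with a bad
  factor.\<close>

lemma flag_rels_conv:
  assumes d: "is_diagram D"
  shows "flag_rels n D = (Bad n (\<lambda>l. min l n) D :: (nat set list \<Rightarrow>\<^sub>0 'k::field) set)"
proof
  have fk: "flag_ker n (D ! j) = {u :: nat set \<Rightarrow>\<^sub>0 'k. ks u \<subseteq> {b. b \<subseteq> {1..n} \<and> card b = card (D ! j) \<and> bad_col (\<lambda>l. l) (D ! j) b}}"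
    if "j < length D" for j
    using d nth_mem[OF that] by (intro flag_ker_conv) (auto simp: is_diagram_def)
  show "flag_rels n D \<subseteq> (Bad n (\<lambda>l. min l n) D :: (nat set list \<Rightarrow>\<^sub>0 'k) set)" unfolding flag_rels_def
  proof (rule pm.span_minimal[OF _ subspace_Bad], rule subsetI)
    fix x :: "nat set list \<Rightarrow>\<^sub>0 'k"
    assume "x \<in> {tensor ws |ws. list_all2 (\<lambda>a w. w \<in> ext {1..n} (card a)) D ws \<and> (\<exists>j<length D. ws ! j \<in> flag_ker n (D ! j))}"
    then obtain ws j where x: "x = tensor ws" and ws: "list_all2 (\<lambda>a w. w \<in> ext {1..n} (card a)) D ws"
      and j: "j < length D" "ws ! j \<in> flag_ker n (D ! j)" by blast
    have len: "length ws = length D" using ws by (auto dest: list_all2_lengthD)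
    have "sg \<tau> c \<in> Bad n (\<lambda>l. min l n) D" if "\<tau> \<in> listset (map ks ws)" for \<tau> and c :: 'k
    proof -
      have t: "list_all2 (\<lambda>b B. b \<in> B) \<tau> (map ks ws)"
        using that by (induction ws arbitrary: \<tau>) (auto simp: set_Cons_def)
      have lt: "length \<tau> = length D" using t len by (auto dest: list_all2_lengthD)
      have ti: "\<tau> ! i \<in> ks (ws ! i)" if "i < length D" for i using t that len by (auto simp: list_all2_conv_all_nth)
      have "\<tau> \<in> TEs n D" unfolding TEs_def mem_Collect_eq list_all2_conv_all_nth
        using lt ti ws by (auto simp: ext_def list_all2_conv_all_nth)
      moreover have "bad_col (\<lambda>l. l) (D ! j) (\<tau> ! j)" using j(2) ti[OF j(1)] unfolding fk[OF j(1)] by blast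
      hence "bad (\<lambda>l. l) D \<tau>" using j(1) by (auto simp: bad_def)
      ultimately show ?thesis using bad_min by (auto simp: Bad_def split: if_splits)
    qed
    thus "x \<in> Bad n (\<lambda>l. min l n) D" unfolding x tensor_def by (intro pm.subspace_sum[OF subspace_Bad])
  qed
  have sub: "pm.subspace (flag_rels n D :: (nat set list \<Rightarrow>\<^sub>0 'k) set)" unfolding flag_rels_def by (rule pm.subspace_span)
  show "Bad n (\<lambda>l. min l n) D \<subseteq> (flag_rels n D :: (nat set list \<Rightarrow>\<^sub>0 'k) set)"
  proof
    fix u :: "nat set list \<Rightarrow>\<^sub>0 'k" assume u: "u \<in> Bad n (\<lambda>l. min l n) D"
    have "scale c (sg \<tau> 1) \<in> (flag_rels n D :: (nat set list \<Rightarrow>\<^sub>0 'k) set)" if t: "\<tau> \<in> TEs n D" "bad (\<lambda>l. min l n) D \<tau>" for \<tau> c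
    proof -
      let ?ws = "map (\<lambda>b. sg b 1 :: nat set \<Rightarrow>\<^sub>0 'k) \<tau>"
      have len: "length \<tau> = length D" by (rule TEs_length[OF t(1)])
      have ls: "listset (map ks ?ws) = {\<tau>}" by (induction \<tau>) (auto simp: set_Cons_def)
      have tens: "tensor ?ws = sg \<tau> 1" unfolding tensor_def ls by simp
      obtain j where j: "j < length D" "bad_col (\<lambda>l. l) (D ! j) (\<tau> ! j)"
        using t bad_min[OF t(1)] by (auto simp: bad_def)
      have "list_all2 (\<lambda>a w. w \<in> ext {1..n} (card a)) D ?ws"
        using TEs_nth[OF t(1)] len by (auto simp: list_all2_conv_all_nth ext_def intro: finite_subset)
      moreover have "?ws ! j \<in> flag_ker n (D ! j)" unfolding fk[OF j(1)] using TEs_nth[OF t(1) j(1)] j len by simp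
      ultimately have "tensor ?ws \<in> flag_rels n D" unfolding flag_rels_def using j(1) by (intro pm.span_base) blast
      thus ?thesis unfolding tens by (rule pm.subspace_scale[OF sub])
    qed
    hence "(\<Sum>\<tau>\<in>ks u. scale (lk u \<tau>) (sg \<tau> 1)) \<in> flag_rels n D" using u by (intro pm.subspace_sum[OF sub]) (auto simp: Bad_def)
    moreover have "scale (lk u \<tau>) (sg \<tau> 1) = sg \<tau> (lk u \<tau>)" for \<tau> by (rule poly_mapping_eqI) (simp add: lookup_single when_def)
    ultimately show "u \<in> flag_rels n D" using sum_singles[of u] by simp
  qed
qed

lemma schur_rels_conv:
  assumes "transparent D" "is_diagram D"
  shows "schur_rels n D = {v \<in> TE n D. rA (Fl (\<lambda>l. min l n)) (minor_map D v) = (0 :: 'k::field matpoly)}"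
proof (intro Set.set_eqI iffI)
  let ?f = "\<lambda>l. min l n"
  have mono: "mono ?f" by (rule monoI) auto
  fix v :: "nat set list \<Rightarrow>\<^sub>0 'k"
  {
    assume "v \<in> schur_rels n D"
    then obtain u w where v: "v = u + w" "u \<in> Bad n ?f D" "w \<in> exchange_rels n D"
      unfolding schur_rels_def flag_rels_conv[OF assms(2)] by blast
    have "w \<in> TE n D" "minor_map D w = 0" using v(3) by (auto simp: exchange_rels_def)
    moreover have "v \<in> TE n D" unfolding v(1) by (rule pm.subspace_add[OF subspace_TE subsetD[OF Bad_TE v(2)] \<open>w \<in> TE n D\<close>])
    ultimately show "v \<in> {v \<in> TE n D. rA (Fl ?f) (minor_map D v) = 0}"
      using rA_Bad[OF v(2) assms(2) mono] unfolding v(1) by (simp add: minor_map_lin)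
  next
    assume "v \<in> {v \<in> TE n D. rA (Fl ?f) (minor_map D v) = 0}"
    then obtain u where u: "u \<in> Bad n ?f D" "v - u \<in> exchange_rels n D"
      using kernel_split_flag[OF assms, of n, where ?'k='k] unfolding kernel_split_def by blast
    have "v = u + (v - u)" by simp
    thus "v \<in> schur_rels n D" unfolding schur_rels_def flag_rels_conv[OF assms(2)] using u by blast
  }
qed

section \<open>Dimensions\<close>

text \<open>The representation of \<open>v\<close> in the basis would be supported in both disjoint
  parts.\<close>

lemma independent_span_disjoint:
  assumes "pm.independent B" "B1 \<subseteq> B" "B2 \<subseteq> B" "B1 \<inter> B2 = {}" "v \<in> pm.span B1" "v \<in> pm.span B2"
  shows "v = (0 :: 'b \<Rightarrow>\<^sub>0 'k::field)"
proof -
  have i: "pm.independent B1" by (rule pm.independent_mono[OF assms(1,2)])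
  have "pm.representation B v = pm.representation B1 v" by (rule pm.representation_extend[OF assms(1,5,2)])
  moreover have "pm.representation B v = pm.representation B2 v" by (rule pm.representation_extend[OF assms(1,6,3)])
  ultimately have z: "pm.representation B1 v b = 0" for b
    using pm.representation_ne_zero[of B1 v b] pm.representation_ne_zero[of B2 v b] assms(4) by fastforce
  have "v = (\<Sum>b | pm.representation B1 v b \<noteq> 0. scale (pm.representation B1 v b) b)"
    by (rule pm.sum_nonzero_representation_eq[OF i assms(5), symmetric])
  thus ?thesis unfolding z by simp
qed

text \<open>Rank and nullity inside a possibly infinite-dimensional space; the finite set
  \<open>T\<close> provides the finiteness. A basis of the kernel is extended to one of
  \<open>M\<close>, and \<open>e\<close> is injective on the span of the added vectors.\<close>

lemma dim_exact:
  fixes e :: "('b \<Rightarrow>\<^sub>0 'k::field) \<Rightarrow> ('c \<Rightarrow>\<^sub>0 'k)"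
  assumes add: "\<And>x y. e (x + y) = e x + e y" and scl: "\<And>c x. e (scale c x) = scale c (e x)"
    and M: "pm.subspace M" and T: "finite T" "M \<subseteq> pm.span T"
  shows "pm.dim M = pm.dim {x \<in> M. e x = 0} + pm.dim (e ` M)"
proof -
  have hom: "module_hom scale scale e" unfolding module_hom_iff by (intro conjI allI add scl pm.module_axioms)
  interpret e: module_hom scale scale e by (rule hom)
  let ?K = "{x \<in> M. e x = 0}"
  obtain BK where BK: "BK \<subseteq> ?K" "pm.independent BK" "?K \<subseteq> pm.span BK" "card BK = pm.dim ?K"
    by (rule pm.basis_exists)
  have "BK \<subseteq> M" using BK(1) by blast
  then obtain B where B: "BK \<subseteq> B" "B \<subseteq> M" "pm.independent B" "M \<subseteq> pm.span B"
    by (rule pm.maximal_independent_subset_extend[OF _ BK(2)])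
  have fB: "finite B" using pm.independent_span_bound[OF T(1) B(3)] B(2) T(2) by blast
  have dM: "card B = pm.dim M" by (rule pm.basis_card_eq_dim[OF B(2,4,3)])
  define B2 where "B2 = B - BK"
  have B2: "B2 \<subseteq> B" "BK \<inter> B2 = {}" "B = BK \<union> B2" using B(1) by (auto simp: B2_def)
  have s2: "pm.span B2 \<subseteq> M" using B2(1) B(2) by (intro pm.span_minimal M) blast
  have inj: "inj_on e (pm.span B2)"
  proof (rule inj_onI)
    fix x y assume xy: "x \<in> pm.span B2" "y \<in> pm.span B2" "e x = e y"
    have d: "x - y \<in> pm.span B2" by (rule pm.span_diff[OF xy(1,2)])
    have "e (x - y) = 0" using xy(3) by (simp add: e.diff)
    hence "x - y \<in> pm.span BK" using BK(3) subsetD[OF s2 d] by blast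
    hence "x - y = 0" using independent_span_disjoint[OF B(3,1) B2(1,2)] d by blast
    thus "x = y" by simp
  qed
  have ind: "pm.independent (e ` B2)"
    by (rule e.independent_injective_image[OF pm.independent_mono[OF B(3) B2(1)] inj])
  have sp: "e ` M \<subseteq> pm.span (e ` B2)"
  proof
    fix z assume "z \<in> e ` M"
    then obtain x where x: "x \<in> M" "z = e x" by blast
    have "x \<in> pm.span (BK \<union> B2)" using B(4) x(1) B2(3) by blast
    then obtain u w where uw: "u \<in> pm.span BK" "w \<in> pm.span B2" "x = u + w" unfolding pm.span_Un by blast
    have "BK \<subseteq> {x. e x = 0}" using BK(1) by blast
    hence "e u = 0" using uw(1) e.eq_0_on_span[of BK u] by blast
    hence "z = e w" by (simp add: x(2) uw(3) add)
    thus "z \<in> pm.span (e ` B2)" unfolding e.span_image using uw(2) by blast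
  qed
  have "pm.dim (e ` M) = card (e ` B2)"
    by (rule pm.basis_card_eq_dim[OF image_mono sp ind, symmetric]) (use B2 B in blast)
  also have "\<dots> = card B2" using inj_on_subset[OF inj pm.span_superset] by (rule card_image)
  finally have "pm.dim (e ` M) = card B2" .
  moreover have "card B = card BK + card B2"
    using B2 fB card_Un_disjoint[of BK B2] finite_subset[of BK B] finite_subset[of B2 B] B(1) by metis
  ultimately show ?thesis using dM BK(4) by simp
qed

lemma dim_inj_image:
  fixes e :: "('b \<Rightarrow>\<^sub>0 'k::field) \<Rightarrow> ('c \<Rightarrow>\<^sub>0 'k)"
  assumes "\<And>x y. e (x + y) = e x + e y" "\<And>c x. e (scale c x) = scale c (e x)"
    and "pm.subspace M" "finite T" "M \<subseteq> pm.span T" "\<And>x. e x = 0 \<Longrightarrow> x = 0"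
  shows "pm.dim (e ` M) = pm.dim M"
proof -
  have "e (scale 0 0) = scale 0 (e 0)" by (rule assms(2))
  hence "e 0 = 0" by simp
  hence "{x \<in> M. e x = 0} = {0}" using assms(6) pm.subspace_0[OF assms(3)] by auto
  moreover have "pm.dim {0 :: 'b \<Rightarrow>\<^sub>0 'k} = 0" using pm.dim_le_card[of "{0}" "{}"] by simp
  ultimately show ?thesis using dim_exact[OF assms(1-5)] by simp
qed

text \<open>\<open>vectorspace.dim\<close> is the least size of a finite generating set. The map
  \<open>\<psi>\<close> translates generating sets of the carrier into spanning sets of
  \<open>M\<close>, where the least size is that of a basis.\<close>

lemma vectorspace_dim_eq:
  fixes M :: "('b \<Rightarrow>\<^sub>0 'k::field) set" and X :: "('k, 'c) module"
  assumes vs: "vectorspace class_ring X"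
    and add: "\<And>x y. x \<in> carrier X \<Longrightarrow> y \<in> carrier X \<Longrightarrow> \<psi> (x \<oplus>\<^bsub>X\<^esub> y) = \<psi> x + \<psi> y"
    and smult: "\<And>c x. x \<in> carrier X \<Longrightarrow> \<psi> (c \<odot>\<^bsub>X\<^esub> x) = scale c (\<psi> x)"
    and inj: "inj_on \<psi> (carrier X)" and img: "\<psi> ` carrier X = M" and T: "finite T" "M \<subseteq> pm.span T"
  shows "vectorspace.dim class_ring X = pm.dim M"
proof -
  interpret vectorspace class_ring X by (rule vs)
  have zero: "\<psi> \<zero>\<^bsub>X\<^esub> = 0" using add[of "\<zero>\<^bsub>X\<^esub>" "\<zero>\<^bsub>X\<^esub>"] by simp
  have lc: "\<psi> (lincomb a A) = (\<Sum>x\<in>A. scale (a x) (\<psi> x))" if "finite A" "A \<subseteq> carrier X" for a A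
    using that
  proof (induction A)
    case empty
    thus ?case by (simp add: lincomb_def zero)
  next
    case (insert x A)
    have c: "a y \<odot>\<^bsub>X\<^esub> y \<in> carrier X" if "y \<in> insert x A" for y
      using that insert.prems by (intro smult_closed) (auto simp: class_ring_simps)
    have "lincomb a (insert x A) = a x \<odot>\<^bsub>X\<^esub> x \<oplus>\<^bsub>X\<^esub> lincomb a A"
      unfolding lincomb_def using insert.hyps c by (intro finsum_insert) auto
    moreover have "lincomb a A \<in> carrier X" unfolding lincomb_def using c by (intro finsum_closed) auto
    ultimately have "\<psi> (lincomb a (insert x A)) = \<psi> (a x \<odot>\<^bsub>X\<^esub> x) + \<psi> (lincomb a A)" using c by (simp add: add)
    thus ?case using insert by (simp add: smult)
  qed
  have gen: "gen_set A \<longleftrightarrow> M \<subseteq> pm.span (\<psi> ` A)" if A: "finite A" "A \<subseteq> carrier X" for A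
  proof
    assume g: "gen_set A"
    show "M \<subseteq> pm.span (\<psi> ` A)"
    proof
      fix m assume "m \<in> M"
      then obtain x where x: "x \<in> carrier X" "m = \<psi> x" using img by blast
      have "x \<in> span A" using g x(1) by simp
      then obtain a A' where a: "finite A'" "A' \<subseteq> A" "x = lincomb a A'" unfolding span_def by blast
      have "A' \<subseteq> carrier X" using a(2) A(2) by (rule order_trans)
      hence m: "m = (\<Sum>x\<in>A'. scale (a x) (\<psi> x))" unfolding x(2) a(3) by (rule lc[OF a(1)])
      show "m \<in> pm.span (\<psi> ` A)" unfolding m
        by (intro pm.span_sum pm.span_scale pm.span_base imageI) (use a(2) in blast)
    qed
  next
    assume g: "M \<subseteq> pm.span (\<psi> ` A)"
    have "carrier X \<subseteq> span A"
    proof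
      fix x assume x: "x \<in> carrier X"
      hence "\<psi> x \<in> pm.span (\<psi> ` A)" using g img by blast
      then obtain u where "\<psi> x = (\<Sum>y\<in>\<psi> ` A. scale (u y) y)" using pm.span_finite[OF finite_imageI[OF A(1)]] by blast
      also have "\<dots> = (\<Sum>y\<in>A. scale (u (\<psi> y)) (\<psi> y))"
        by (subst sum.reindex[OF inj_on_subset[OF inj A(2)]]) simp
      also have "\<dots> = \<psi> (lincomb (\<lambda>y. u (\<psi> y)) A)" by (rule lc[OF A, symmetric])
      finally have e: "\<psi> x = \<psi> (lincomb (\<lambda>y. u (\<psi> y)) A)" .
      have "lincomb (\<lambda>y. u (\<psi> y)) A \<in> carrier X"
        unfolding lincomb_def using A by (intro finsum_closed Pi_I smult_closed) (auto simp: class_ring_simps)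
      hence "x = lincomb (\<lambda>y. u (\<psi> y)) A" using e x inj by (simp add: inj_on_def)
      thus "x \<in> span A" unfolding span_def using A(1) by (auto simp: class_ring_simps)
    qed
    moreover have "span A \<subseteq> carrier X" using A(2) by (rule span_is_subset2)
    ultimately show "gen_set A" by blast
  qed
  obtain B where B: "B \<subseteq> M" "pm.independent B" "M \<subseteq> pm.span B" "card B = pm.dim M" by (rule pm.basis_exists)
  have fB: "finite B" using pm.independent_span_bound[OF T(1) B(2)] B(1) T(2) by blast
  \<comment> \<open>Preimages of a basis of \<open>M\<close> generate the carrier and attain the
    minimum.\<close>
  define A where "A = inv_into (carrier X) \<psi> ` B"
  have im: "\<psi> ` A = B" unfolding A_def by (rule image_inv_into_cancel[OF img B(1)])
  have Ac: "A \<subseteq> carrier X" unfolding A_def using B(1) img by (auto intro: inv_into_into)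
  have fA: "finite A" unfolding A_def using fB by simp
  have cA: "card A = pm.dim M" using card_image[OF inj_on_subset[OF inj Ac]] im B(4) by simp
  have gA: "gen_set A" by (rule iffD2[OF gen[OF fA Ac]]) (simp only: im B(3))
  have ex: "\<exists>A. finite A \<and> card A = pm.dim M \<and> A \<subseteq> carrier X \<and> gen_set A"
    by (intro exI[of _ A] conjI fA cA Ac gA)
  show ?thesis unfolding dim_def
  proof (rule Least_equality, rule ex)
    fix d assume "\<exists>A. finite A \<and> card A = d \<and> A \<subseteq> carrier X \<and> gen_set A"
    then obtain A where A: "finite A" "card A = d" "A \<subseteq> carrier X" "gen_set A" by blast
    have "pm.dim M \<le> card (\<psi> ` A)" using gen[OF A(1,3)] A(1,4) by (intro pm.dim_le_card) auto
    also have "\<dots> \<le> d" using card_image_le[OF A(1)] A(2) by simp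
    finally show "pm.dim M \<le> d" .
  qed
qed

section \<open>Weights\<close>

text \<open>The weight under the torus, which acts on the letters; rows are forgotten.\<close>

definition wtm :: "(nat \<times> nat \<Rightarrow>\<^sub>0 nat) \<Rightarrow> expvec" where
  "wtm m = (\<Sum>v\<in>ks m. sg (snd v) (lk m v))"

definition Hw :: "expvec \<Rightarrow> 'k::field matpoly set" where "Hw l = {F. ks F \<subseteq> {m. wtm m = l}}"

lemma subspace_Hw: "pm.subspace (Hw l)" unfolding Hw_def by (rule subspace_ks)

lemma wtm_superset: "finite S \<Longrightarrow> ks m \<subseteq> S \<Longrightarrow> wtm m = (\<Sum>v\<in>S. sg (snd v) (lk m v))"
  unfolding wtm_def by (intro sum.mono_neutral_left) (auto simp: in_keys_iff)

lemma wtm_0 [simp]: "wtm 0 = 0" by (simp add: wtm_def)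
lemma wtm_single [simp]: "wtm (sg v n) = sg (snd v) n" by (cases "n = 0") (simp_all add: wtm_def)
lemma wtm_add: "wtm (m + n) = wtm m + wtm n"
  using keys_add[of m n] by (simp add: wtm_superset[of "ks m \<union> ks n"] lookup_add single_add sum.distrib)

lemma Hw_mult: "F \<in> Hw a \<Longrightarrow> G \<in> Hw b \<Longrightarrow> F * G \<in> Hw (a + b)"
proof -
  assume a: "F \<in> Hw a" "G \<in> Hw b"
  have "wtm x = a + b" if x: "x \<in> ks (F * G)" for x
  proof -
    obtain m n where mn: "x = m + n" "m \<in> ks F" "n \<in> ks G" using keys_mult[of F G] x by blast
    have "wtm m = a" "wtm n = b" using a mn(2,3) by (auto simp: Hw_def)
    thus ?thesis by (simp add: mn(1) wtm_add)
  qed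
  thus ?thesis by (auto simp: Hw_def)
qed
lemma Hw_1 [simp]: "1 \<in> Hw 0" by (simp add: Hw_def)
lemma Hw_C [simp]: "C c \<in> Hw 0" by (auto simp: Hw_def C_def split: if_splits)
lemma Hw_V [simp]: "V v \<in> Hw (sg (snd v) 1)" by (auto simp: Hw_def V_def)
lemmas Hw_V_Suc [simp] = Hw_V[unfolded One_nat_def]
lemma Hw_0 [simp]: "0 \<in> Hw a" by (simp add: Hw_def)

lemma Hw_power: "F \<in> Hw (sg q 1) \<Longrightarrow> F ^ n \<in> Hw (sg q n)"
proof (induction n)
  case (Suc n)
  have "F * F ^ n \<in> Hw (sg q 1 + sg q n)" using Suc by (intro Hw_mult) auto
  thus ?case by (simp add: single_add[symmetric])
qed simp

lemma psub_Hw: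
  assumes "F \<in> Hw l" "\<And>v. v \<in> vars F \<Longrightarrow> g v \<in> Hw (sg (snd v) 1)"
  shows "psub g F \<in> Hw l"
  unfolding psub_def
proof (rule pm.subspace_sum[OF subspace_Hw])
  fix m assume m: "m \<in> ks F"
  have "(\<Prod>v\<in>S. g v ^ lk m v) \<in> Hw (\<Sum>v\<in>S. sg (snd v) (lk m v))" if "S \<subseteq> ks m" for S
    using finite_subset[OF that finite_keys] that
  proof (induction S rule: finite_induct)
    case (insert v S)
    have "v \<in> vars F" using insert.prems m by (auto simp: vars_def)
    hence "g v ^ lk m v \<in> Hw (sg (snd v) (lk m v))" by (intro Hw_power assms(2))
    thus ?case using insert by (simp add: Hw_mult)
  qed simp
  from this[of "ks m"] have "mon g m \<in> Hw (wtm m)" by (simp add: mon_def wtm_def)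
  hence "C (lk F m) * mon g m \<in> Hw (0 + wtm m)" by (intro Hw_mult) auto
  thus "C (lk F m) * mon g m \<in> Hw l" using assms(1) m by (auto simp: Hw_def)
qed

lemma rA_Hw: "F \<in> Hw l \<Longrightarrow> rA A F \<in> Hw l"
  unfolding rA_def by (rule psub_Hw) (auto split: prod.splits intro: Hw_V[of "(_, _)", simplified])

text \<open>Each term of the expansion uses every letter of \<open>b\<close> exactly once.\<close>

lemma minor_Hw:
  assumes "finite c" "finite b" "card b = card c"
  shows "minor c b \<in> (Hw (\<Sum>i\<in>b. sg i 1) :: 'k::field matpoly set)"
  using assms
proof (induction "card c" arbitrary: c b)
  case 0
  thus ?case by simp
next
  case (Suc n)
  then obtain x where x: "x \<in> c" by fastforce
  obtain s :: "nat \<Rightarrow> 'k" where s: "minor c b = (\<Sum>q\<in>b. C (s q) * V (x, q) * minor (c - {x}) (b - {q}))"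
    using minor_row[OF Suc.prems x] by blast
  show ?case unfolding s
  proof (rule pm.subspace_sum[OF subspace_Hw])
    fix q assume q: "q \<in> b"
    have "minor (c - {x}) (b - {q}) \<in> (Hw (\<Sum>i\<in>b - {q}. sg i 1) :: 'k matpoly set)"
      using Suc.hyps(2) Suc.prems x q by (intro Suc.hyps(1)) auto
    hence "C (s q) * V (x, q) * minor (c - {x}) (b - {q}) \<in> (Hw (0 + sg q 1 + (\<Sum>i\<in>b - {q}. sg i 1)) :: 'k matpoly set)"
      using Hw_V[of "(x, q)"] by (intro Hw_mult) simp_all
    moreover have "(\<Sum>i\<in>b. sg i 1) = sg q 1 + (\<Sum>i\<in>b - {q}. sg i (1::nat))" using Suc.prems(2) q by (rule sum.remove)
    ultimately show "C (s q) * V (x, q) * minor (c - {x}) (b - {q}) \<in> Hw (\<Sum>i\<in>b. sg i 1)" by simp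
  qed
qed

lemma mprod_Hw:
  assumes "adm D \<tau>" "is_diagram D" shows "mprod D \<tau> \<in> (Hw (weight \<tau>) :: 'k::field matpoly set)"
  using assms unfolding adm_def
proof (induction D \<tau> rule: list_all2_induct)
  case (Cons c D b \<tau>)
  have "minor c b \<in> (Hw (\<Sum>i\<in>b. sg i 1) :: 'k matpoly set)" using Cons by (intro minor_Hw) (auto simp: is_diagram_Cons)
  moreover have "mprod D \<tau> \<in> (Hw (weight \<tau>) :: 'k matpoly set)" using Cons by (simp add: is_diagram_Cons)
  ultimately have "minor c b * mprod D \<tau> \<in> (Hw ((\<Sum>i\<in>b. sg i 1) + weight \<tau>) :: 'k matpoly set)" by (rule Hw_mult)
  thus ?case by (simp add: mprod_def weight_def)
qed (simp add: mprod_def weight_def)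

lemma V_mult_Hw: "V v * F \<in> Hw (sg (snd v) 1 + l) \<longleftrightarrow> F \<in> Hw l"
proof
  assume a: "V v * F \<in> Hw (sg (snd v) 1 + l)"
  have "wtm m = l" if "m \<in> ks F" for m
  proof -
    have "lk (V v * F) (sg v 1 + m) = lk F m" by (simp add: V_def lookup_single_mult)
    hence "sg v 1 + m \<in> ks (V v * F)" using that by (simp add: in_keys_iff)
    hence "sg (snd v) 1 + wtm m = sg (snd v) 1 + l" using a by (auto simp: Hw_def wtm_add)
    thus ?thesis by simp
  qed
  thus "F \<in> Hw l" by (auto simp: Hw_def)
qed (intro Hw_mult Hw_V)

lemma V_mult_Hw_0:
  assumes "V v * F \<in> Hw l" "lk l (snd v) = 0" shows "F = 0"
proof (rule ccontr)
  assume "F \<noteq> 0"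
  then obtain m where "m \<in> ks F" by (metis keys_eq_empty ex_in_conv)
  moreover have "lk (V v * F) (sg v 1 + m) = lk F m" by (simp add: V_def lookup_single_mult)
  ultimately have "sg v 1 + m \<in> ks (V v * F)" by (simp add: in_keys_iff)
  hence "sg (snd v) 1 + wtm m = l" using assms(1) by (auto simp: Hw_def wtm_add)
  hence "lk l (snd v) = 1 + lk (wtm m) (snd v)" by (auto simp: lookup_add)
  thus False using assms(2) by simp
qed

section \<open>The operators on polynomials\<close>

lemma of_int_C: "of_int c = (C c :: ('v, int) mp)"
proof -
  have n: "of_nat n = (C (int n) :: ('v, int) mp)" for n by (induction n) simp_all
  obtain a b where c: "c = int a + - int b" by (cases c rule: int_diff_cases) auto
  show ?thesis unfolding c by (simp only: of_int_add of_int_minus of_int_of_nat_eq n C_simps)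
qed

lemma x_var_V: "x_var i = V i" by (simp add: x_var_def V_def)

lemma R_op_psub: "R_op k f = psub (\<lambda>i. if i < k then V i else if i = k then 0 else V (i - 1)) f"
  unfolding R_op_def subst_vars_def psub_def mon_def of_int_C x_var_V ..

definition shf :: "nat \<Rightarrow> nat \<Rightarrow> nat" where "shf j i = (if i < j then i else Suc i)"
text \<open>The exponent vector \<open>\<mu>\<close> with a zero inserted at position
  \<open>j\<close>.\<close>

definition ins :: "nat \<Rightarrow> expvec \<Rightarrow> expvec" where "ins j \<mu> = (\<Sum>i\<in>ks \<mu>. sg (shf j i) (lk \<mu> i))"

lemma inj_shf: "inj (shf j)" by (rule injI) (auto simp: shf_def split: if_splits)

lemma lookup_ins: "lk (ins j \<mu>) i = (if i < j then lk \<mu> i else if i = j then 0 else lk \<mu> (i - 1))"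
proof -
  have e: "lk (ins j \<mu>) i = (\<Sum>t\<in>ks \<mu>. if shf j t = i then lk \<mu> t else 0)"
    by (simp add: ins_def lookup_sum lookup_single when_def)
  consider "i < j" | "i = j" | "i > j" by linarith
  thus ?thesis
  proof cases
    case 1
    have "(\<Sum>t\<in>ks \<mu>. if shf j t = i then lk \<mu> t else 0) = (\<Sum>t\<in>ks \<mu>. if t = i then lk \<mu> t else 0)"
      using 1 by (intro sum.cong refl) (auto simp: shf_def)
    thus ?thesis unfolding e using 1 by (simp add: in_keys_iff)
  next
    case 2
    have "(\<Sum>t\<in>ks \<mu>. if shf j t = i then lk \<mu> t else 0) = 0" using 2 by (intro sum.neutral) (auto simp: shf_def)
    thus ?thesis unfolding e using 2 by simp
  next
    case 3
    have "(\<Sum>t\<in>ks \<mu>. if shf j t = i then lk \<mu> t else 0) = (\<Sum>t\<in>ks \<mu>. if t = i - 1 then lk \<mu> t else 0)"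
      using 3 by (intro sum.cong refl) (auto simp: shf_def)
    thus ?thesis unfolding e using 3 by (simp add: in_keys_iff)
  qed
qed

lemma lookup_ins_shf: "lk (ins j \<mu>) (shf j i) = lk \<mu> i" by (simp add: lookup_ins shf_def)

lemma lookup_del: "lk (Poly_Mapping.map_key (shf j) m) i = lk m (shf j i)"
  by (simp add: map_key.rep_eq inj_shf)

lemma ins_eq_iff: "m = ins j \<mu> \<longleftrightarrow> lk m j = 0 \<and> Poly_Mapping.map_key (shf j) m = \<mu>"
proof
  assume m: "m = ins j \<mu>"
  show "lk m j = 0 \<and> Poly_Mapping.map_key (shf j) m = \<mu>"
    unfolding m by (intro conjI poly_mapping_eqI) (simp_all add: lookup_del lookup_ins_shf, simp add: lookup_ins)
next
  assume m: "lk m j = 0 \<and> Poly_Mapping.map_key (shf j) m = \<mu>"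
  have "lk m i = lk (ins j \<mu>) i" for i
  proof -
    have "lk \<mu> i = lk m (shf j i)" for i using m lookup_del by blast
    thus ?thesis using m by (auto simp: lookup_ins shf_def)
  qed
  thus "m = ins j \<mu>" by (rule poly_mapping_eqI)
qed

lemma mon_sum: "mon g (\<Sum>i\<in>S. f i) = (\<Prod>i\<in>S. mon g (f i))"
  by (induction S rule: infinite_finite_induct) (simp_all add: mon_add mon_0)

lemma R_single: "R_op j (sg m c) = (if lk m j = 0 then sg (Poly_Mapping.map_key (shf j) m) c else 0)"
proof (cases "lk m j = 0")
  case True
  define \<mu> where "\<mu> = Poly_Mapping.map_key (shf j) m"
  have m: "m = ins j \<mu>" using True by (simp add: ins_eq_iff \<mu>_def)
  let ?g = "\<lambda>i. if i < j then V i else if i = j then 0 else V (i - 1) :: zpoly"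
  have "mon ?g m = (\<Prod>i\<in>ks \<mu>. ?g (shf j i) ^ lk \<mu> i)" unfolding m ins_def mon_sum mon_single ..
  also have "\<dots> = mon V \<mu>" unfolding mon_def by (intro prod.cong refl) (auto simp: shf_def)
  finally have e: "mon ?g m = mon V \<mu>" .
  have "R_op j (sg m c) = C c * mon ?g m" unfolding R_op_psub by (rule psub_single)
  also have "\<dots> = sg \<mu> c" unfolding e by (rule sg_C_mon[symmetric])
  finally show ?thesis using True by (simp add: \<mu>_def)
next
  case False
  hence "j \<in> ks m" by (simp add: in_keys_iff)
  hence "mon (\<lambda>i. if i < j then V i else if i = j then 0 else V (i - 1) :: zpoly) m = 0"
    unfolding mon_def using False by (intro prod_zero bexI[of _ j]) (simp_all add: power_0_left)
  thus ?thesis using False by (simp add: R_op_psub psub_single)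
qed

text \<open>\<open>R_op j\<close> keeps the monomials without the variable \<open>j\<close> and
  closes the gap, so each coefficient has a unique source. This turns identities between the
  operators into identities between weight multiplicities.\<close>

lemma lookup_R: "lk (R_op j f) \<mu> = lk f (ins j \<mu>)"
proof -
  have "R_op j f = (\<Sum>m\<in>ks f. R_op j (sg m (lk f m)))"
    unfolding R_op_psub psub_sum[symmetric] mp_single_sum[symmetric] ..
  hence "lk (R_op j f) \<mu> = (\<Sum>m\<in>ks f. lk (R_op j (sg m (lk f m))) \<mu>)" by (simp add: lookup_sum)
  also have "\<dots> = (\<Sum>m\<in>ks f. if m = ins j \<mu> then lk f m else 0)"
    by (intro sum.cong refl) (simp add: R_single ins_eq_iff lookup_single when_def)
  also have "\<dots> = lk f (ins j \<mu>)" by (simp add: in_keys_iff)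
  finally show ?thesis .
qed

lemma R_add: "R_op j (f + g) = R_op j f + R_op j g" by (rule poly_mapping_eqI) (simp add: lookup_R lookup_add)
lemma R_diff: "R_op j (f - g) = R_op j f - R_op j g" by (rule poly_mapping_eqI) (simp add: lookup_R lookup_minus)
lemma R_sum: "R_op j (sum f S) = (\<Sum>s\<in>S. R_op j (f s))" by (rule poly_mapping_eqI) (simp add: lookup_R lookup_sum)
lemma R_0 [simp]: "R_op j 0 = 0" by (rule poly_mapping_eqI) (simp add: lookup_R)

lemma lookup_x_mult: "lk (x_var k * f) \<mu> = (if lk \<mu> k \<ge> 1 then lk f (\<mu> - sg k 1) else 0)"
proof (cases "lk \<mu> k \<ge> 1")
  case True
  hence e: "\<mu> = sg k 1 + (\<mu> - sg k 1)"
    by (intro poly_mapping_eqI) (auto simp: lookup_add lookup_minus lookup_single when_def)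
  have "lk (x_var k * f) (sg k 1 + (\<mu> - sg k 1)) = lk f (\<mu> - sg k 1)" by (simp add: x_var_def lookup_single_mult)
  thus ?thesis using e True by simp
next
  case False
  have "\<mu> \<noteq> sg k 1 + m" for m using False by (auto simp: lookup_add)
  thus ?thesis using False unfolding x_var_def by (simp add: lookup_single_mult_0)
qed

text \<open>Polynomials on which \<open>R_op 1\<close> is nilpotent. The weaker \<open>inner\<close>
  admits a constant term, because the empty word yields 1.\<close>

definition nice :: "nat \<Rightarrow> zpoly \<Rightarrow> bool" where "nice N f \<longleftrightarrow> (\<forall>m\<in>ks f. m \<noteq> 0 \<and> ks m \<subseteq> {1..N})"
definition inner :: "nat \<Rightarrow> zpoly \<Rightarrow> bool" where "inner N f \<longleftrightarrow> (\<forall>m\<in>ks f. ks m \<subseteq> {1..N})"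

lemma nice_mono: "nice N f \<Longrightarrow> N \<le> N' \<Longrightarrow> nice N' f" unfolding nice_def by fastforce
lemma nice_inner: "nice N f \<Longrightarrow> inner N f" unfolding nice_def inner_def by blast

lemma nice_add: "nice N f \<Longrightarrow> nice N g \<Longrightarrow> nice N (f + g)" using keys_add[of f g] unfolding nice_def by blast
lemma nice_diff: "nice N f \<Longrightarrow> nice N g \<Longrightarrow> nice N (f - g)" using keys_diff[of f g] unfolding nice_def by blast
lemma nice_0 [simp]: "nice N 0" by (simp add: nice_def)
lemma nice_sum: "(\<And>s. s \<in> S \<Longrightarrow> nice N (f s)) \<Longrightarrow> nice N (sum f S)"
  by (induction S rule: infinite_finite_induct) (simp_all add: nice_add)

lemma ks_ins: "i \<in> ks \<mu> \<Longrightarrow> shf j i \<in> ks (ins j \<mu>)" by (simp add: in_keys_iff lookup_ins_shf)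

lemma inner_R: "inner N f \<Longrightarrow> 1 \<le> j \<Longrightarrow> inner N (R_op j f)"
  unfolding inner_def
proof (intro ballI subsetI)
  fix \<mu> i assume a: "\<forall>m\<in>ks f. ks m \<subseteq> {1..N}" "1 \<le> j" "\<mu> \<in> ks (R_op j f)" "i \<in> ks \<mu>"
  have "ins j \<mu> \<in> ks f" using a(3) by (simp add: in_keys_iff lookup_R)
  hence "shf j i \<in> {1..N}" using a(1) ks_ins[OF a(4)] by blast
  thus "i \<in> {1..N}" using a(2) by (auto simp: shf_def split: if_splits)
qed

lemma nice_R1: "nice (Suc N) f \<Longrightarrow> nice N (R_op 1 f)"
  unfolding nice_def
proof (intro ballI conjI subsetI)
  fix \<mu> assume a: "\<forall>m\<in>ks f. m \<noteq> 0 \<and> ks m \<subseteq> {1..Suc N}" "\<mu> \<in> ks (R_op 1 f)"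
  have i: "ins 1 \<mu> \<in> ks f" using a(2) by (simp add: in_keys_iff lookup_R)
  have "ins 1 (0 :: expvec) = 0" by (simp add: ins_def)
  thus "\<mu> \<noteq> 0" using i a(1) by auto
  fix t assume "t \<in> ks \<mu>"
  hence "shf 1 t \<in> {1..Suc N}" using i a(1) ks_ins[of t \<mu> 1] by blast
  thus "t \<in> {1..N}" by (auto simp: shf_def split: if_splits)
qed

lemma nice_R1': "nice N f \<Longrightarrow> nice N (R_op 1 f)" by (rule nice_R1) (rule nice_mono, auto)
lemma nice_R1_pow: "nice N f \<Longrightarrow> nice N ((R_op 1 ^^ p) f)" by (induction p) (simp_all add: nice_R1'[simplified])

text \<open>Each application shifts the variables down by one, so after \<open>N\<close> steps only
  a constant could remain, and constant terms are excluded throughout.\<close>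

lemma R1_pow_0: "nice N f \<Longrightarrow> N \<le> p \<Longrightarrow> (R_op 1 ^^ p) f = 0"
proof -
  have "nice M f \<Longrightarrow> nice (M - p) ((R_op 1 ^^ p) f)" for M p
  proof (induction p)
    case (Suc p)
    hence "nice (Suc (M - Suc p)) ((R_op 1 ^^ p) f)" by (auto elim: nice_mono)
    thus ?case using nice_R1 by simp
  qed simp
  moreover assume "nice N f" "N \<le> p"
  ultimately have "nice 0 ((R_op 1 ^^ p) f)" by (metis diff_is_0_eq)
  hence "ks ((R_op 1 ^^ p) f) = {}" unfolding nice_def by fastforce
  thus ?thesis by simp
qed

lemma Z_conv: assumes "nice N f" shows "Z_op f = (\<Sum>p<N. (R_op 1 ^^ p) f)"
  unfolding Z_op_def using R1_pow_0[OF assms] by (intro Sum_any.expand_superset) (auto simp: not_less[symmetric])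

lemma nice_Z: assumes "nice N f" shows "nice N (Z_op f)"
  unfolding Z_conv[OF assms] by (intro nice_sum nice_R1_pow assms)

lemma R1_pow_add: "(R_op 1 ^^ p) (f + g) = (R_op 1 ^^ p) f + (R_op 1 ^^ p) g"
  by (induction p) (simp_all add: R_add)
lemma R1_pow_diff: "(R_op 1 ^^ p) (f - g) = (R_op 1 ^^ p) f - (R_op 1 ^^ p) g"
  by (induction p) (simp_all add: R_diff)

lemma Z_sum:
  assumes "finite S" "\<And>s. s \<in> S \<Longrightarrow> \<exists>N. nice N (f s)"
  shows "(\<exists>N. nice N (sum f S)) \<and> Z_op (sum f S) = (\<Sum>s\<in>S. Z_op (f s))"
  using assms
proof (induction S rule: finite_induct)
  case empty
  have "Z_op 0 = 0" using Z_conv[of 0 0] by simp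
  thus ?case by auto
next
  case (insert s S)
  obtain N1 N2 where "nice N1 (f s)" "nice N2 (sum f S)" using insert by blast
  hence n: "nice (max N1 N2) (f s)" "nice (max N1 N2) (sum f S)" by (auto elim: nice_mono)
  hence "Z_op (f s + sum f S) = Z_op (f s) + Z_op (sum f S)"
    by (simp add: Z_conv[OF nice_add[OF n]] Z_conv[OF n(1)] Z_conv[OF n(2)] R1_pow_add[simplified] sum.distrib)
  thus ?case using insert n nice_add[OF n] by auto
qed

lemma Z_telescope: assumes "nice N h" shows "Z_op (h - R_op 1 h) = h"
proof -
  have "nice N (h - R_op 1 h)" by (intro nice_diff assms nice_R1')
  hence "Z_op (h - R_op 1 h) = (\<Sum>p<N. (R_op 1 ^^ p) (h - R_op 1 h))" by (rule Z_conv)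
  also have "\<dots> = (\<Sum>p<N. (R_op 1 ^^ p) h - (R_op 1 ^^ Suc p) h)"
    by (intro sum.cong refl) (simp only: R1_pow_diff funpow_Suc_right comp_def)
  also have "\<dots> = (R_op 1 ^^ 0) h - (R_op 1 ^^ N) h" by (rule sum_lessThan_telescope')
  also have "\<dots> = h" using R1_pow_0[OF assms, of N] by simp
  finally show ?thesis .
qed

lemma nice_x: "inner N f \<Longrightarrow> 1 \<le> k \<Longrightarrow> nice (max N k) (x_var k * f)"
  unfolding nice_def
proof (intro ballI conjI subsetI)
  fix m assume a: "inner N f" "1 \<le> k" "m \<in> ks (x_var k * f)"
  hence m: "lk m k \<ge> 1" "m - sg k 1 \<in> ks f" by (auto simp: in_keys_iff lookup_x_mult split: if_splits)
  show "m \<noteq> 0" using m(1) by auto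
  fix i assume i: "i \<in> ks m"
  show "i \<in> {1..max N k}"
  proof (cases "i = k")
    case False
    hence "i \<in> ks (m - sg k 1)" using i by (simp add: in_keys_iff lookup_minus lookup_single)
    hence "i \<in> {1..N}" by (rule subsetD[OF bspec[OF a(1)[unfolded inner_def] m(2)]])
    thus ?thesis by auto
  qed (use a(2) in auto)
qed

section \<open>Reduced words\<close>

lemma Des_rowset: "is_diagram D \<Longrightarrow> Des D \<subseteq> rowset D"
  unfolding Des_def rowset_def using witness_col(2,5) by blast

lemma finite_Des: "is_diagram D \<Longrightarrow> finite (Des D)"
  by (rule finite_subset[OF Des_rowset]) (auto simp: rowset_def is_diagram_def)

lemma Des_pos: "is_diagram D \<Longrightarrow> k \<in> Des D \<Longrightarrow> 1 \<le> k"
  unfolding Des_def using witness_col(4) by blast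

lemma num_boxes_s_diag:
  assumes "is_diagram D" "k \<in> Des D" shows "num_boxes D = Suc (num_boxes (s_diag k D))"
proof -
  obtain L a R where w: "descent_witness k D L a R" using assms(2) by (auto simp: Des_def)
  show ?thesis using num_boxes_witness[OF assms(1) w] num_boxes_cong[OF s_diag_witness[OF assms(1) w]] by simp
qed

lemma Red_Nil: "D \<simeq> [] \<Longrightarrow> Red D = {[]}"
proof -
  assume D: "D \<simeq> []"
  hence n: "num_boxes D = 0" using num_boxes_cong by fastforce
  show ?thesis unfolding Red_def n using D by (auto intro!: exI[of _ "[D]"])
qed

text \<open>The chain in \<open>Red\<close> ends at \<open>D\<close>, so the last letter of a word
  is the descent by which \<open>D\<close> itself is left.\<close>

lemma Red_Suc:
  assumes d: "is_diagram D" and n: "num_boxes D = Suc l"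
  shows "Red D = (\<Union>k\<in>Des D. (\<lambda>w. w @ [k]) ` Red (s_diag k D))"
proof (intro Set.set_eqI iffI)
  fix w assume "w \<in> Red D"
  then obtain Ds where w: "length w = Suc l" "length Ds = Suc (Suc l)" "Ds ! Suc l \<simeq> D" "Ds ! 0 \<simeq> []"
    and st: "\<And>j. j < Suc l \<Longrightarrow> w ! j \<in> Des (Ds ! Suc j) \<and> Ds ! j \<simeq> s_diag (w ! j) (Ds ! Suc j)"
    unfolding Red_def n by blast
  let ?k = "w ! l"
  have dd: "is_diagram (Ds ! Suc l)" using is_diagram_cong[OF w(3)] d by simp
  have k': "?k \<in> Des (Ds ! Suc l)" using st[of l] by simp
  have k: "?k \<in> Des D" using k' Des_cong[OF w(3)] by simp
  have eq: "Ds ! l \<simeq> s_diag ?k D"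
    using st[of l] s_diag_cong[OF w(3) dd k'] by (auto intro: diag_eq_trans)
  have nb: "num_boxes (s_diag ?k D) = l" using num_boxes_s_diag[OF d k] n by simp
  have "butlast w \<in> Red (s_diag ?k D)" unfolding Red_def nb mem_Collect_eq
  proof (intro conjI exI[of _ "take (Suc l) Ds"])
    show "length (butlast w) = l" using w(1) by simp
    show "length (take (Suc l) Ds) = Suc l" using w(2) by simp
    show "take (Suc l) Ds ! l \<simeq> s_diag ?k D" using eq by simp
    show "take (Suc l) Ds ! 0 \<simeq> []" using w(4) by simp
    show "\<forall>j<l. butlast w ! j \<in> Des (take (Suc l) Ds ! Suc j) \<and> take (Suc l) Ds ! j \<simeq> s_diag (butlast w ! j) (take (Suc l) Ds ! Suc j)"
      using st w(1) by (auto simp: nth_butlast)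
  qed
  moreover have "w = butlast w @ [?k]"
    using w(1) append_butlast_last_id[of w] last_conv_nth[of w] by fastforce
  ultimately show "w \<in> (\<Union>k\<in>Des D. (\<lambda>w. w @ [k]) ` Red (s_diag k D))" using k by blast
next
  fix w assume "w \<in> (\<Union>k\<in>Des D. (\<lambda>w. w @ [k]) ` Red (s_diag k D))"
  then obtain k w' where k: "k \<in> Des D" "w = w' @ [k]" "w' \<in> Red (s_diag k D)" by blast
  have nb: "num_boxes (s_diag k D) = l" using num_boxes_s_diag[OF d k(1)] n by simp
  obtain Ds where w: "length w' = l" "length Ds = Suc l" "Ds ! l \<simeq> s_diag k D" "Ds ! 0 \<simeq> []"
    and st: "\<And>j. j < l \<Longrightarrow> w' ! j \<in> Des (Ds ! Suc j) \<and> Ds ! j \<simeq> s_diag (w' ! j) (Ds ! Suc j)"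
    using k(3) unfolding Red_def nb by blast
  have "w ! j \<in> Des ((Ds @ [D]) ! Suc j) \<and> (Ds @ [D]) ! j \<simeq> s_diag (w ! j) ((Ds @ [D]) ! Suc j)" if "j < Suc l" for j
  proof (cases "j = l")
    case True
    thus ?thesis using w k by (simp add: nth_append)
  next
    case False
    thus ?thesis using st[of j] that w k(2) by (simp add: nth_append)
  qed
  thus "w \<in> Red D" unfolding Red_def n mem_Collect_eq k(2)
    using w by (intro conjI exI[of _ "Ds @ [D]"]) (simp_all add: nth_append k(2))
qed

lemma word_poly_snoc: "word_poly (w @ [k]) = Z_op (x_var k * R_op (k + 1) (word_poly w))"
  by (simp add: word_poly_def)

lemma word_poly_inner: "\<forall>i\<in>set w. 1 \<le> i \<Longrightarrow> \<exists>N. inner N (word_poly w)"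
proof (induction w rule: rev_induct)
  case Nil
  show ?case by (simp add: word_poly_def inner_def)
next
  case (snoc k w)
  then obtain N where "inner N (word_poly w)" by auto
  hence "inner N (R_op (k + 1) (word_poly w))" by (rule inner_R) simp
  hence "nice (max N k) (x_var k * R_op (k + 1) (word_poly w))" using snoc.prems by (intro nice_x) auto
  thus ?case unfolding word_poly_snoc using nice_inner[OF nice_Z] by blast
qed

lemma Red_props: "is_diagram D \<Longrightarrow> finite (Red D) \<and> (\<forall>w\<in>Red D. \<forall>i\<in>set w. 1 \<le> i)"
proof (induction "num_boxes D" arbitrary: D)
  case 0
  hence "D \<simeq> []" by (auto simp: diag_eq_Nil num_boxes_def is_diagram_def)
  thus ?case by (simp add: Red_Nil)
next
  case (Suc l)
  note R = Red_Suc[OF Suc.prems Suc.hyps(2)[symmetric]]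
  have "finite (Red (s_diag k D)) \<and> (\<forall>w\<in>Red (s_diag k D). \<forall>i\<in>set w. 1 \<le> i)" if "k \<in> Des D" for k
    using num_boxes_s_diag[OF Suc.prems that] Suc.hyps(2) by (intro Suc.hyps(1) is_diagram_s_diag[OF Suc.prems that]) simp
  thus ?case unfolding R using finite_Des[OF Suc.prems] Des_pos[OF Suc.prems] by auto
qed

text \<open>The outermost operator of \<open>word_poly\<close> belongs to the last letter, so the
  recursion for \<open>h\<close> matches \<open>Red_Suc\<close>. Niceness of the summands is tracked
  because it allows \<open>Z_op\<close> to be applied to each word separately.\<close>

lemma word_sum_recursion:
  assumes nil: "\<And>D. D \<simeq> [] \<Longrightarrow> h D = 1"
    and step: "\<And>D. transparent D \<Longrightarrow> is_diagram D \<Longrightarrow> \<not> D \<simeq> [] \<Longrightarrow>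
      h D = Z_op (\<Sum>k\<in>Des D. x_var k * R_op (k + 1) (h (s_diag k D)))"
  shows "transparent D \<Longrightarrow> is_diagram D \<Longrightarrow> h D = (\<Sum>w\<in>Red D. word_poly w)"
proof (induction "num_boxes D" arbitrary: D)
  case 0
  hence "D \<simeq> []" by (auto simp: diag_eq_Nil num_boxes_def is_diagram_def)
  thus ?case by (simp add: Red_Nil nil word_poly_def)
next
  case (Suc l)
  note d = Suc.prems(2)
  have ne: "\<not> D \<simeq> []" using Suc.hyps(2) num_boxes_cong by fastforce
  have tr: "transparent (s_diag k D)" if "k \<in> Des D" for k
    using Suc.prems(1) ne that by cases auto
  have IH: "h (s_diag k D) = (\<Sum>w\<in>Red (s_diag k D). word_poly w)" if "k \<in> Des D" for k
    using num_boxes_s_diag[OF d that] Suc.hyps(2) by (intro Suc.hyps(1) tr that is_diagram_s_diag[OF d that]) simp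
  have ds: "is_diagram (s_diag k D)" if "k \<in> Des D" for k by (rule is_diagram_s_diag[OF d that])
  let ?g = "\<lambda>k w. x_var k * R_op (k + 1) (word_poly w)"
  have nice: "\<exists>N. nice N (?g k w)" if kw: "k \<in> Des D" "w \<in> Red (s_diag k D)" for k w
  proof -
    obtain N where "inner N (word_poly w)" using word_poly_inner[of w] Red_props[OF ds[OF kw(1)]] kw(2) by blast
    hence "inner N (R_op (k + 1) (word_poly w))" by (rule inner_R) simp
    thus ?thesis using nice_x Des_pos[OF d kw(1)] by blast
  qed
  have s1: "(\<exists>N. nice N (\<Sum>w\<in>Red (s_diag k D). ?g k w)) \<and> Z_op (\<Sum>w\<in>Red (s_diag k D). ?g k w) = (\<Sum>w\<in>Red (s_diag k D). Z_op (?g k w))"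
    if "k \<in> Des D" for k
    using Red_props[OF ds[OF that]] nice[OF that] by (intro Z_sum) auto
  have "h D = Z_op (\<Sum>k\<in>Des D. x_var k * R_op (k + 1) (h (s_diag k D)))" by (rule step[OF Suc.prems ne])
  also have "(\<Sum>k\<in>Des D. x_var k * R_op (k + 1) (h (s_diag k D))) = (\<Sum>k\<in>Des D. \<Sum>w\<in>Red (s_diag k D). ?g k w)"
    by (intro sum.cong refl) (simp add: IH R_sum sum_distrib_left)
  also have "Z_op \<dots> = (\<Sum>k\<in>Des D. Z_op (\<Sum>w\<in>Red (s_diag k D). ?g k w))"
    using Z_sum[OF finite_Des[OF d], of "\<lambda>k. \<Sum>w\<in>Red (s_diag k D). ?g k w"] s1 by blast
  also have "\<dots> = (\<Sum>k\<in>Des D. \<Sum>w\<in>Red (s_diag k D). word_poly (w @ [k]))"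
    by (intro sum.cong refl) (simp only: s1 word_poly_snoc)
  also have "\<dots> = (\<Sum>k\<in>Des D. \<Sum>w\<in>(\<lambda>w. w @ [k]) ` Red (s_diag k D). word_poly w)"
    by (rule sum.cong[OF refl], subst sum.reindex) (auto simp: inj_on_def)
  also have "\<dots> = (\<Sum>w\<in>(\<Union>k\<in>Des D. (\<lambda>w. w @ [k]) ` Red (s_diag k D)). word_poly w)"
    using finite_Des[OF d] Red_props[OF ds] by (intro sum.UNION_disjoint[symmetric]) auto
  also have "\<dots> = (\<Sum>w\<in>Red D. word_poly w)" by (simp only: Red_Suc[OF d Suc.hyps(2)[symmetric]])
  finally show ?case .
qed

section \<open>The character\<close>

text \<open>The multiplicity is taken in the span of flagged products, where exactness applies; it
  is compared with the module in \<open>dim_weight_space\<close>.\<close>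

definition dm :: "'k::field itself \<Rightarrow> diagram \<Rightarrow> expvec \<Rightarrow> nat" where
  "dm _ D l = pm.dim (FM (Fl (\<lambda>l. l)) D \<inter> (Hw l :: 'k matpoly set))"

section \<open>Finite generation and weight components\<close>

lemma finite_TEs: "finite (TEs n D)"
proof (rule finite_subset)
  show "TEs n D \<subseteq> {\<tau>. set \<tau> \<subseteq> Pow {1..n} \<and> length \<tau> = length D}"
  proof (rule subsetI, rule CollectI, rule conjI)
    fix \<tau> assume t: "\<tau> \<in> TEs n D"
    show l: "length \<tau> = length D" by (rule TEs_length[OF t])
    show "set \<tau> \<subseteq> Pow {1..n}"
    proof
      fix b assume "b \<in> set \<tau>"
      then obtain j where "j < length \<tau>" "b = \<tau> ! j" by (metis in_set_conv_nth)
      thus "b \<in> Pow {1..n}" using TEs_nth[OF t, of j] l by simp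
    qed
  qed
  show "finite {\<tau>. set \<tau> \<subseteq> Pow {1..n} \<and> length \<tau> = length D}" by (rule finite_lists_length_eq) simp
qed

lemma FM_finite_span:
  assumes "is_diagram D" "\<And>l. l \<in> rowset D \<Longrightarrow> A l \<subseteq> {1..n}"
  shows "FM A D \<subseteq> pm.span ((\<lambda>\<tau>. rA A (mprod D \<tau>)) ` TEs n D :: 'k::field matpoly set)"
proof (rule FM_least[OF pm.subspace_span])
  fix P :: "'k matpoly" assume "P \<in> gens D"
  then obtain \<tau> where t: "adm D \<tau>" "P = mprod D \<tau>" by (auto simp: gens_def)
  show "rA A P \<in> pm.span ((\<lambda>\<tau>. rA A (mprod D \<tau>)) ` TEs n D)"
  proof (cases "\<tau> \<in> TEs n D")
    case True
    thus ?thesis unfolding t(2) by (intro pm.span_base imageI)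
  next
    case False
    hence "rA A P = 0" unfolding t(2) by (rule rA_uncontained[OF t(1) assms(1)]) (rule assms(2))
    thus ?thesis by (simp add: pm.span_zero)
  qed
qed

lemma rows_bound:
  assumes "is_diagram D" shows "\<exists>n. rowset D \<subseteq> {1..n}"
proof -
  have "finite (rowset D)" "0 \<notin> rowset D" using assms by (auto simp: rowset_def is_diagram_def)
  moreover from this have "j \<in> {1..Max (rowset D)}" if "j \<in> rowset D" for j
  proof -
    have "j \<noteq> 0" using that \<open>0 \<notin> rowset D\<close> by metis
    thus ?thesis using Max_ge[OF \<open>finite (rowset D)\<close> that] by simp
  qed
  ultimately show ?thesis by blast
qed

lemma FM_fin:
  assumes "is_diagram D" "\<And>l. A l \<subseteq> {1..l}"
  shows "\<exists>T. finite T \<and> FM A D \<subseteq> (pm.span T :: 'k::field matpoly set)"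
proof -
  obtain n where n: "rowset D \<subseteq> {1..n}" using rows_bound[OF assms(1)] by blast
  have "A l \<subseteq> {1..n}" if "l \<in> rowset D" for l
  proof -
    have "l \<le> n" using subsetD[OF n that] by simp
    thus ?thesis using assms(2)[of l] by fastforce
  qed
  hence "FM A D \<subseteq> pm.span ((\<lambda>\<tau>. rA A (mprod D \<tau>)) ` TEs n D :: 'k matpoly set)" by (rule FM_finite_span[OF assms(1)])
  thus ?thesis by (intro exI[of _ "(\<lambda>\<tau>. rA A (mprod D \<tau>)) ` TEs n D"] conjI finite_imageI finite_TEs)
qed

definition TEw :: "nat \<Rightarrow> diagram \<Rightarrow> expvec \<Rightarrow> (nat set list \<Rightarrow>\<^sub>0 'k::field) set" where
  "TEw n D l = {v. ks v \<subseteq> {\<tau> \<in> TEs n D. weight \<tau> = l}}"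

lemma TEw_TE: "TEw n D l \<subseteq> TE n D" by (auto simp: TEw_def TE_conv)

text \<open>Tuples of other weights contribute only monomials of other weights. If the total has
  weight \<open>l\<close>, these contributions cancel and may be dropped.\<close>

lemma FM_Hw_image:
  assumes d: "is_diagram D" and A: "\<And>l. l \<in> rowset D \<Longrightarrow> A l \<subseteq> {1..n}"
  shows "FM A D \<inter> Hw l = (\<lambda>v. rA A (minor_map D v)) ` (TEw n D l :: (nat set list \<Rightarrow>\<^sub>0 'k::field) set)"
proof -
  let ?f = "\<lambda>v :: nat set list \<Rightarrow>\<^sub>0 'k. rA A (minor_map D v)"
  have conv: "?f v = (\<Sum>\<tau>\<in>ks v. scale (lk v \<tau>) (rA A (mprod D \<tau>)))" if "ks v \<subseteq> TEs n D" for v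
    unfolding minor_map_conv[OF that] rA_sum scale_conv rA_mult by (simp add: rA_def)
  have Hwt: "rA A (mprod D \<tau>) \<in> (Hw (weight \<tau>) :: 'k matpoly set)" if "\<tau> \<in> TEs n D" for \<tau>
    by (intro rA_Hw mprod_Hw TEs_adm[OF that] d)
  have fHw: "?f v \<in> Hw l" if v: "v \<in> TEw n D l" for v
  proof -
    have k: "\<tau> \<in> TEs n D" "weight \<tau> = l" if t: "\<tau> \<in> ks v" for \<tau> using v t by (auto simp: TEw_def)
    have e: "?f v = (\<Sum>\<tau>\<in>ks v. scale (lk v \<tau>) (rA A (mprod D \<tau>)))" by (rule conv) (use k in blast)
    show ?thesis unfolding e
    proof (intro pm.subspace_sum[OF subspace_Hw] pm.subspace_scale[OF subspace_Hw])
      fix \<tau> assume t: "\<tau> \<in> ks v"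
      show "rA A (mprod D \<tau>) \<in> (Hw l :: 'k matpoly set)" using Hwt[OF k(1)[OF t]] unfolding k(2)[OF t] .
    qed
  qed
  show ?thesis
  proof (intro Set.set_eqI iffI)
    fix F assume "F \<in> ?f ` TEw n D l"
    then obtain v where v: "v \<in> TEw n D l" "F = ?f v" by blast
    have "F \<in> Hw l" unfolding v(2) by (rule fHw[OF v(1)])
    moreover have "F \<in> FM A D" unfolding v(2) by (rule TE_FM[OF subsetD[OF TEw_TE v(1)]])
    ultimately show "F \<in> FM A D \<inter> Hw l" by blast
  next
    fix F assume F: "F \<in> FM A D \<inter> (Hw l :: 'k matpoly set)"
    have "FM A D \<subseteq> ?f ` TE n D"
    proof (rule order_trans[OF FM_finite_span[OF d A]])
      show "pm.span ((\<lambda>\<tau>. rA A (mprod D \<tau>)) ` TEs n D) \<subseteq> ?f ` TE n D"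
      proof (rule pm.span_minimal[OF _ subspace_map_image[OF rA_mm_lin subspace_TE]], rule image_subsetI)
        fix \<tau> assume t: "\<tau> \<in> TEs n D"
        have "sg \<tau> 1 \<in> (TE n D :: (nat set list \<Rightarrow>\<^sub>0 'k) set)" using t by (simp add: TE_conv)
        moreover have "?f (sg \<tau> 1) = rA A (mprod D \<tau>)" by (simp add: minor_map_single[OF TEs_length[OF t]])
        ultimately show "rA A (mprod D \<tau>) \<in> ?f ` TE n D" by (metis imageI)
      qed
    qed simp
    then obtain v where v: "v \<in> TE n D" "F = ?f v" using F by blast
    have kv: "ks v \<subseteq> TEs n D" using v(1) by (simp add: TE_conv)
    define v1 where "v1 = (\<Sum>\<tau>\<in>{\<tau> \<in> ks v. weight \<tau> = l}. sg \<tau> (lk v \<tau>))"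
    define v2 where "v2 = (\<Sum>\<tau>\<in>{\<tau> \<in> ks v. weight \<tau> \<noteq> l}. sg \<tau> (lk v \<tau>))"
    have "v = (\<Sum>\<tau>\<in>ks v. sg \<tau> (lk v \<tau>))" by (rule sum_singles)
    also have "\<dots> = v1 + v2" unfolding v1_def v2_def
      by (subst sum.union_disjoint[symmetric]) (auto intro!: sum.cong)
    finally have vv: "v = v1 + v2" .
    have v1: "v1 \<in> TEw n D l" unfolding v1_def TEw_def
      by (rule pm.subspace_sum[OF subspace_ks]) (use kv in \<open>auto split: if_splits\<close>)
    have v2: "v2 \<in> {v. ks v \<subseteq> {\<tau> \<in> TEs n D. weight \<tau> \<noteq> l}}" unfolding v2_def
      by (rule pm.subspace_sum[OF subspace_ks]) (use kv in \<open>auto split: if_splits\<close>)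
    have k2: "\<tau> \<in> TEs n D" "weight \<tau> \<noteq> l" if "\<tau> \<in> ks v2" for \<tau> using v2 that by auto
    have f2: "?f v2 = (\<Sum>\<tau>\<in>ks v2. scale (lk v2 \<tau>) (rA A (mprod D \<tau>)))" by (rule conv) (use k2 in blast)
    have "?f v2 \<in> {G. ks G \<subseteq> {m. wtm m \<noteq> l}}" unfolding f2
    proof (intro pm.subspace_sum[OF subspace_ks] pm.subspace_scale[OF subspace_ks])
      fix \<tau> assume t: "\<tau> \<in> ks v2"
      have "rA A (mprod D \<tau>) \<in> (Hw (weight \<tau>) :: 'k matpoly set)" by (rule Hwt[OF k2(1)[OF t]])
      thus "rA A (mprod D \<tau>) \<in> {G :: 'k matpoly. ks G \<subseteq> {m. wtm m \<noteq> l}}" using k2(2)[OF t] by (auto simp: Hw_def)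
    qed
    note n2 = this
    have "F - ?f v1 \<in> Hw l" using F fHw[OF v1] by (intro pm.subspace_diff[OF subspace_Hw]) auto
    moreover have "F - ?f v1 = ?f v2" unfolding v(2) vv rA_mm_lin(1) by simp
    ultimately have n1: "?f v2 \<in> Hw l" by simp
    have "m \<notin> ks (?f v2)" for m using n1 n2 unfolding Hw_def by blast
    hence "ks (?f v2) = {}" by blast
    hence "?f v2 = 0" by simp
    hence "F = ?f v1" unfolding v(2) vv rA_mm_lin(1) by simp
    thus "F \<in> ?f ` TEw n D l" using v1 by blast
  qed
qed

lemma lookup_wtm: "lk (wtm m) i = (\<Sum>v\<in>ks m. if snd v = i then lk m v else 0)"
  by (simp add: wtm_def lookup_sum lookup_single when_def)

lemma ks_wtm: "ks (wtm m) = snd ` ks m"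
proof (intro Set.set_eqI iffI)
  fix i assume "i \<in> ks (wtm m)"
  hence "(\<Sum>v\<in>ks m. if snd v = i then lk m v else 0) \<noteq> 0" by (simp add: in_keys_iff lookup_wtm)
  then obtain v where "v \<in> ks m" "(if snd v = i then lk m v else 0) \<noteq> 0" by (rule sum.not_neutral_contains_not_neutral)
  thus "i \<in> snd ` ks m" by (auto split: if_splits)
next
  fix i assume "i \<in> snd ` ks m"
  then obtain v where v: "v \<in> ks m" "snd v = i" by blast
  have "lk (wtm m) i \<ge> (if snd v = i then lk m v else 0)" unfolding lookup_wtm by (rule member_le_sum) (use v in auto)
  thus "i \<in> ks (wtm m)" using v by (simp add: in_keys_iff)
qed

lemma Hw_letters:
  assumes "F \<in> Hw l" "(r, q) \<in> vars F" shows "q \<in> ks l"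
proof -
  obtain m where m: "m \<in> ks F" "(r, q) \<in> ks m" using assms(2) by (auto simp: vars_def)
  hence "wtm m = l" using assms(1) by (auto simp: Hw_def)
  thus ?thesis using ks_wtm[of m] m(2) by force
qed

text \<open>In such a weight the letter \<open>r\<close> occurs in no monomial. With
  \<open>r = k + 1\<close> this produces a flag that is equal in the rows \<open>k\<close> and
  \<open>k + 1\<close>, as exactness requires.\<close>

lemma FM_Hw_letter:
  assumes d: "is_diagram D" and r: "lk l r = 0"
  shows "FM (Fl (\<lambda>l. l)) D \<inter> Hw l = FM (\<lambda>l. {1..l} - {r}) D \<inter> (Hw l :: 'k::field matpoly set)"
proof -
  obtain n where n: "rowset D \<subseteq> {1..n}" using rows_bound[OF d] by blast
  have A1: "{1..l} \<subseteq> {1..n}" if "l \<in> rowset D" for l using subsetD[OF n that] by auto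
  have A2: "{1..l} - {r} \<subseteq> {1..n}" if "l \<in> rowset D" for l using A1[OF that] by blast
  have e1: "FM (Fl (\<lambda>l. l)) D \<inter> Hw l = (\<lambda>v. rA (Fl (\<lambda>l. l)) (minor_map D v)) ` (TEw n D l :: (nat set list \<Rightarrow>\<^sub>0 'k) set)"
    by (rule FM_Hw_image[OF d]) (rule A1)
  have e2: "FM (\<lambda>l. {1..l} - {r}) D \<inter> Hw l = (\<lambda>v. rA (\<lambda>l. {1..l} - {r}) (minor_map D v)) ` (TEw n D l :: (nat set list \<Rightarrow>\<^sub>0 'k) set)"
    by (rule FM_Hw_image[OF d]) (rule A2)
  have "rA (Fl (\<lambda>l. l)) (minor_map D v) = rA (\<lambda>l. {1..l} - {r}) (minor_map D v)"
    if v: "v \<in> TEw n D l" for v :: "nat set list \<Rightarrow>\<^sub>0 'k"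
  proof -
    let ?F = "rA (Fl (\<lambda>l. l)) (minor_map D v)"
    have F: "?F \<in> FM (Fl (\<lambda>l. l)) D \<inter> Hw l" unfolding e1 using v by (rule imageI)
    have "q \<in> {1..s} - {r}" if sq: "(s, q) \<in> vars ?F" for s q
    proof -
      have "q \<in> {1..s}" using vars_FM[OF d, of ?F] F sq by blast
      moreover have "q \<in> ks l" using Hw_letters[OF _ sq] F by blast
      hence "q \<noteq> r" using r by (auto simp: in_keys_iff)
      ultimately show ?thesis by blast
    qed
    note sub = this
    have "vars ?F \<subseteq> {(s, q). q \<in> {1..s} - {r}}"
    proof
      fix v assume v: "v \<in> vars ?F"
      obtain s q where "v = (s, q)" by (cases v)
      thus "v \<in> {(s, q). q \<in> {1..s} - {r}}" using sub[of s q] v by simp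
    qed
    hence "rA (\<lambda>l. {1..l} - {r}) ?F = ?F" by (rule rA_id)
    moreover have "rA (\<lambda>l. {1..l} - {r}) ?F = rA (\<lambda>l. {1..l} - {r}) (minor_map D v)"
      unfolding rA_def psub_psub by (rule psub_cong) (auto split: prod.splits)
    ultimately show ?thesis by simp
  qed
  thus ?thesis unfolding e1 e2 by (intro image_cong refl)
qed

lemma dm_letter:
  assumes "is_diagram D" "lk l r = 0"
  shows "dm TYPE('k::field) D l = pm.dim (FM (\<lambda>l. {1..l} - {r}) D \<inter> (Hw l :: 'k matpoly set))"
  unfolding dm_def FM_Hw_letter[OF assms] ..

section \<open>Exchange of two letters\<close>

definition lsv :: "nat \<Rightarrow> nat \<times> nat \<Rightarrow> nat \<times> nat" where "lsv k = (\<lambda>(l, q). (l, tau k q))"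
definition ls :: "nat \<Rightarrow> 'k::field matpoly \<Rightarrow> 'k matpoly" where "ls k = psub (\<lambda>v. V (lsv k v))"

lemma lsv_lsv: "lsv k (lsv k v) = v" by (cases v) (simp add: lsv_def)
lemma ls_ls: "ls k (ls k F) = F" by (simp add: ls_def psub_psub lsv_lsv)
lemma ls_mult: "ls k (F * G) = ls k F * ls k G" by (simp add: ls_def psub_mult)

lemma minor_transpose:
  assumes "card b = card a"
  shows "minor a b = psub (\<lambda>(l, q). V (q, l)) (minor b a :: 'k::field matpoly)"
proof -
  let ?M = "mat (card b) (card a) (\<lambda>(i, j). V (sl a ! j, sl b ! i)) :: 'k matpoly mat"
  have "psub (\<lambda>(l, q). V (q, l)) (minor b a :: 'k matpoly) = det ?M"
    unfolding psub_minor by (simp add: case_prod_unfold)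
  also have "\<dots> = det (transpose_mat ?M)" by (rule det_transpose[symmetric, of _ "card a"]) (simp add: assms)
  also have "transpose_mat ?M = mat (card a) (card b) (\<lambda>(i, j). z_var (sl a ! i) (sl b ! j))"
    by (rule eq_matI) (simp_all add: z_var_V)
  finally show ?thesis by (simp add: minor_def)
qed

text \<open>Transposing the matrix turns the exchange of letters into the swap of rows already
  treated in \<open>rs_minor\<close>.\<close>

lemma ls_minor:
  assumes c: "finite c" and b: "finite b" "0 \<notin> b" "card b = card c"
  shows "\<exists>s :: 'k::field. ls k (minor c b) = C s * minor c (tau k ` b)"
proof -
  let ?t = "psub (\<lambda>(l, q). V (q, l)) :: 'k matpoly \<Rightarrow> 'k matpoly"
  have v: "vars (minor b c :: 'k matpoly) \<subseteq> b \<times> c" using b c by (intro vars_minor) auto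
  have cd: "card (tau k ` b) = card c" using b by (simp only: card_image[OF inj_tau])
  obtain s :: 'k where s: "rs k (minor b c) = C s * minor (tau k ` b) c" using rs_minor[OF b(1,2), of c k] b(3) by metis
  have "ls k (minor c b) = ls k (?t (minor b c))" using minor_transpose[OF b(3), where ?'k='k] by simp
  also have "\<dots> = ?t (rs k (minor b c))"
    unfolding ls_def rs_def psub_psub
  proof (rule psub_cong)
    fix v assume "v \<in> vars (minor b c :: 'k matpoly)"
    then obtain l q where lq: "v = (l, q)" "l \<in> b" using v by blast
    hence "l \<noteq> 0" using b(2) by metis
    thus "psub (\<lambda>v. V (lsv k v)) (case v of (l, q) \<Rightarrow> V (q, l)) = ?t (V (rsv k v))"
      by (simp add: lq lsv_def rsv_def)
  qed
  also have "\<dots> = C s * ?t (minor (tau k ` b) c)" unfolding s by (simp add: psub_mult)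
  also have "?t (minor (tau k ` b) c) = minor c (tau k ` b)" by (rule minor_transpose[OF cd, symmetric])
  finally show ?thesis by blast
qed

lemma ls_mprod:
  assumes "\<tau> \<in> TEs n D" "is_diagram D"
  shows "\<exists>(s :: 'k::field) P. P \<in> gens D \<and> ls k (mprod D \<tau>) = C s * (P :: 'k matpoly)"
  using assms unfolding TEs_def mem_Collect_eq
proof (induction D \<tau> rule: list_all2_induct)
  case Nil
  show ?case by (intro exI[of _ 1]) (simp add: mprod_def ls_def)
next
  case (Cons c D b \<tau>)
  obtain s :: 'k and P where P: "P \<in> gens D" "ls k (mprod D \<tau>) = C s * P" using Cons by (auto simp: is_diagram_Cons)
  have b: "finite b" "0 \<notin> b" "card b = card c" using Cons.hyps(1) finite_subset[of b "{1..n}"] by auto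
  obtain t :: 'k where t: "ls k (minor c b) = C t * minor c (tau k ` b)"
    using ls_minor[OF _ b, of k] Cons.prems by (auto simp: is_diagram_Cons)
  have "card (tau k ` b) = card c" using b(3) by (simp only: card_image[OF inj_tau])
  hence "minor c (tau k ` b) * P \<in> gens (c # D)" unfolding gens_Cons using P(1) b(1) by blast
  moreover have "ls k (mprod (c # D) (b # \<tau>)) = C (t * s) * (minor c (tau k ` b) * P)"
    using t P(2) by (simp add: mprod_def ls_mult ac_simps)
  ultimately show ?case by blast
qed

lemma ls_FM:
  assumes F: "F \<in> FM A D" and d: "is_diagram D" and A: "\<And>l. l \<in> rowset D \<Longrightarrow> A l \<subseteq> {1..n}"
  shows "ls k F \<in> FM (\<lambda>l. tau k ` A l) D"
proof -
  let ?B = "\<lambda>l. tau k ` A l"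
  have c: "ls k (rA A G) = rA ?B (ls k G)" for G :: "'a matpoly"
  proof -
    have "psub (\<lambda>v. V (lsv k v)) (case v of (l, q) \<Rightarrow> if l = 0 \<or> q \<in> A l then V (l, q) else 0)
      = psub (\<lambda>(l, q). if l = 0 \<or> q \<in> ?B l then V (l, q) else 0) (V (lsv k v) :: 'a matpoly)" for v
      by (cases v) (simp add: lsv_def inj_image_mem_iff[OF inj_transpose])
    thus ?thesis unfolding ls_def rA_def psub_psub by presburger
  qed
  have "FM A D \<subseteq> {F :: 'a matpoly. ls k F \<in> FM ?B D}"
  proof (rule order_trans[OF FM_finite_span[OF d A]])
    show "pm.span ((\<lambda>\<tau>. rA A (mprod D \<tau>)) ` TEs n D) \<subseteq> {F :: 'a matpoly. ls k F \<in> FM ?B D}"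
    proof (rule pm.span_minimal, rule image_subsetI)
      fix \<tau> assume t: "\<tau> \<in> TEs n D"
      obtain s and P :: "'a matpoly" where P: "P \<in> gens D" "ls k (mprod D \<tau>) = C s * P" using ls_mprod[OF t d] by blast
      have "ls k (rA A (mprod D \<tau>)) = scale s (rA ?B P)"
        unfolding c P(2) scale_conv by (simp add: rA_mult) (simp add: rA_def)
      also have "\<dots> \<in> FM ?B D" unfolding FM_def using P(1) by (intro pm.span_scale pm.span_base imageI)
      finally show "rA A (mprod D \<tau>) \<in> {F :: 'a matpoly. ls k F \<in> FM ?B D}" by (rule CollectI)
    next
      show "pm.subspace {F :: 'a matpoly. ls k F \<in> FM ?B D}"
        using subspace_FM[of ?B D, where ?'a='a] unfolding pm.subspace_def ls_def by (simp add: psub_add psub_scale)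
    qed
  qed simp
  thus ?thesis using F by blast
qed

definition sw :: "nat \<Rightarrow> expvec \<Rightarrow> expvec" where "sw k l = Poly_Mapping.map_key (tau k) l"

lemma lookup_sw: "lk (sw k l) i = lk l (tau k i)"
  unfolding sw_def by (rule lookup_mk) simp

lemma sw_sw: "sw k (sw k l) = l" by (rule poly_mapping_eqI) (simp add: lookup_sw)

lemma ls_Hw: "F \<in> Hw l \<Longrightarrow> ls k F \<in> Hw (sw k l)"
proof -
  assume F: "F \<in> Hw l"
  have "wtm m = sw k l" if m: "m \<in> ks (ls k F)" for m
  proof -
    let ?m = "Poly_Mapping.map_key (lsv k) m"
    have "?m \<in> ks F" using m lookup_psub_rename[of "lsv k" F m] lsv_lsv by (simp add: in_keys_iff ls_def)
    hence w: "wtm ?m = l" using F by (auto simp: Hw_def)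
    have "lk (wtm m) i = lk (wtm ?m) (tau k i)" for i
    proof -
      have a: "ks ?m = lsv k ` ks m" by (rule ks_mk) (rule lsv_lsv)
      have b: "lk ?m v = lk m (lsv k v)" for v by (rule lookup_mk) (rule lsv_lsv)
      have inj: "inj_on (lsv k) (ks m)" by (rule inj_on_subset[OF inj_invol subset_UNIV]) (rule lsv_lsv)
      have sn: "snd (lsv k v) = tau k (snd v)" for v by (cases v) (simp add: lsv_def)
      have "lk (wtm ?m) (tau k i) = (\<Sum>v\<in>ks m. if snd (lsv k v) = tau k i then lk m (lsv k (lsv k v)) else 0)"
        unfolding lookup_wtm a b sum.reindex[OF inj] comp_def ..
      also have "\<dots> = lk (wtm m) i" unfolding lookup_wtm by (simp only: sn tau_eq_iff lsv_lsv)
      finally show ?thesis by simp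
    qed
    thus ?thesis unfolding w by (intro poly_mapping_eqI) (simp only: lookup_sw)
  qed
  thus ?thesis by (auto simp: Hw_def)
qed

lemma dim_ls:
  assumes d: "is_diagram D" and A: "\<And>l. A l \<subseteq> {1..l}" and B: "\<And>l. l \<in> rowset D \<Longrightarrow> tau k ` A l \<subseteq> {1..l}"
  shows "pm.dim (FM A D \<inter> (Hw l :: 'k::field matpoly set)) = pm.dim (FM (\<lambda>l. tau k ` A l) D \<inter> (Hw (sw k l) :: 'k matpoly set))"
proof -
  let ?M = "FM A D \<inter> (Hw l :: 'k matpoly set)" and ?B = "\<lambda>l. tau k ` A l"
  obtain n where n: "rowset D \<subseteq> {1..n}" using rows_bound[OF d] by blast
  have le: "{1..l} \<subseteq> {1..n}" if "l \<in> rowset D" for l using subsetD[OF n that] by auto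
  obtain T where T: "finite T" "FM A D \<subseteq> (pm.span T :: 'k matpoly set)" using FM_fin[OF d A] by blast
  have "pm.dim (ls k ` ?M) = pm.dim ?M"
  proof (rule dim_inj_image)
    show "ls k (x + y) = ls k x + ls k y" for x y :: "'k matpoly" by (simp add: ls_def psub_add)
    show "ls k (scale c x) = scale c (ls k x)" for c and x :: "'k matpoly" by (simp add: ls_def psub_scale)
    show "pm.subspace ?M" by (intro pm.subspace_inter subspace_FM subspace_Hw)
    show "finite T" "?M \<subseteq> pm.span T" using T by blast+
    show "x = 0" if "ls k x = 0" for x :: "'k matpoly"
    proof -
      have "ls k (ls k x) = 0" unfolding that by (simp add: ls_def)
      thus ?thesis by (simp only: ls_ls)
    qed
  qed
  moreover have "ls k ` ?M = FM ?B D \<inter> Hw (sw k l)"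
  proof (intro Set.set_eqI iffI)
    fix F assume "F \<in> ls k ` ?M"
    then obtain G where G: "F = ls k G" "G \<in> FM A D" "G \<in> Hw l" by blast
    have "F \<in> FM ?B D" unfolding G(1) by (rule ls_FM[OF G(2) d], rule order_trans[OF A le])
    moreover have "F \<in> Hw (sw k l)" unfolding G(1) by (rule ls_Hw[OF G(3)])
    ultimately show "F \<in> FM ?B D \<inter> Hw (sw k l)" by (rule IntI)
  next
    fix F assume F: "F \<in> FM ?B D \<inter> (Hw (sw k l) :: 'k matpoly set)"
    have "ls k F \<in> FM (\<lambda>l. tau k ` ?B l) D"
      by (rule ls_FM[OF IntD1[OF F] d], rule order_trans[OF B le])
    moreover have "(\<lambda>l. tau k ` ?B l) = A" by (simp add: image_comp comp_def)
    ultimately have "ls k F \<in> FM A D" by simp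
    moreover have "ls k F \<in> Hw l" using ls_Hw[of F "sw k l" k] F unfolding sw_sw by blast
    ultimately show "F \<in> ls k ` ?M" using ls_ls[of k F] by (metis IntI imageI)
  qed
  ultimately show ?thesis by simp
qed

section \<open>Comparison of the multiplicities of two exchanged weights\<close>

lemma dim_zero: "pm.dim {0 :: 'b \<Rightarrow>\<^sub>0 'k::field} = 0"
  using pm.dim_le_card[of "{0 :: 'b \<Rightarrow>\<^sub>0 'k}" "{}"] by simp

text \<open>Rank and nullity for setting \<open>V (k, k)\<close> to 0, on the flag without the
  letter \<open>k + 1\<close>. The image belongs to the flag in which \<open>k\<close> is also
  removed from row \<open>k\<close>; exchanging the letters \<open>k\<close> and
  \<open>k + 1\<close> makes this the standard flag without the letter \<open>k\<close>, which
  computes the multiplicity of the exchanged weight.\<close>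

lemma dm_split:
  assumes d: "is_diagram D" and k: "1 \<le> k" and l: "lk l (k + 1) = 0"
  shows "dm TYPE('k::field) D l = dm TYPE('k) D (sw k l) +
    pm.dim {F \<in> FM (\<lambda>l. {1..l} - {k + 1}) D \<inter> (Hw l :: 'k matpoly set). psub (V((k, k) := 0)) F = 0}"
proof -
  let ?A = "\<lambda>l. {1..l} - {k + 1}" and ?e = "psub (V((k, k) := 0)) :: 'k matpoly \<Rightarrow> 'k matpoly"
  let ?A2 = "?A(k := ?A k - {k})"
  let ?M = "FM ?A D \<inter> (Hw l :: 'k matpoly set)"
  obtain T where T: "finite T" "FM ?A D \<subseteq> (pm.span T :: 'k matpoly set)" using FM_fin[OF d, of ?A] by blast
  have 1: "pm.dim ?M = pm.dim {F \<in> ?M. ?e F = 0} + pm.dim (?e ` ?M)"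
  proof (rule dim_exact)
    show "?e (x + y) = ?e x + ?e y" for x y by (rule psub_add)
    show "?e (scale c x) = scale c (?e x)" for c x by (rule psub_scale)
    show "pm.subspace ?M" by (intro pm.subspace_inter subspace_FM subspace_Hw)
    show "finite T" "?M \<subseteq> pm.span T" using T by blast+
  qed
  obtain n where n: "rowset D \<subseteq> {1..n}" using rows_bound[OF d] by blast
  have A: "?A l \<subseteq> {1..n}" if "l \<in> rowset D" for l using subsetD[OF n that] by auto
  have A2: "?A2 l \<subseteq> {1..n}" if "l \<in> rowset D" for l using subsetD[OF n that] by auto
  have i1: "FM ?A D \<inter> Hw l = (\<lambda>v. rA ?A (minor_map D v)) ` (TEw n D l :: (nat set list \<Rightarrow>\<^sub>0 'k) set)"
    by (rule FM_Hw_image[OF d]) (rule A)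
  have i2: "FM ?A2 D \<inter> Hw l = (\<lambda>v. rA ?A2 (minor_map D v)) ` (TEw n D l :: (nat set list \<Rightarrow>\<^sub>0 'k) set)"
    by (rule FM_Hw_image[OF d]) (rule A2)
  have im: "?e ` ?M = FM ?A2 D \<inter> Hw l"
    unfolding i1 i2 image_image rA_restrict[OF k] ..
  have tA2: "tau k ` ?A2 l = {1..l} - {k}" for l
  proof -
    have t: "x \<in> tau k ` S \<longleftrightarrow> tau k x \<in> S" for x S using tau_mem[of k "tau k x" S] by simp
    show ?thesis
      by (rule Set.set_eqI) (use k in \<open>auto simp: t[simplified] transpose_def\<close>)
  qed
  have "pm.dim (FM ?A2 D \<inter> (Hw l :: 'k matpoly set)) = pm.dim (FM (\<lambda>l. tau k ` ?A2 l) D \<inter> (Hw (sw k l) :: 'k matpoly set))"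
  proof (rule dim_ls[OF d])
    show "?A2 l \<subseteq> {1..l}" for l by auto
    show "tau k ` ?A2 l \<subseteq> {1..l}" for l unfolding tA2 by blast
  qed
  also have "\<dots> = dm TYPE('k) D (sw k l)"
    unfolding tA2 by (rule dm_letter[OF d, symmetric]) (use l in \<open>simp add: lookup_sw\<close>)
  finally show ?thesis using 1 im dm_letter[OF d l, where ?'k='k] by simp
qed

context
  fixes D :: diagram and k :: nat and l :: expvec
  assumes trD: "transparent D" and dD: "is_diagram D" and k1: "1 \<le> k" and lk0: "lk l (k + 1) = 0"
begin

lemma descent_flag: "incA (\<lambda>l. {1..l} - {k + 1})" by (auto simp: incA_def)

lemma descent_kernel:
  assumes "F \<in> FM (\<lambda>l. {1..l} - {k + 1}) D" "psub (V((k, k) := 0)) F = 0"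
  shows "\<exists>H. F = V (k, k) * H \<and> E_concl k D (\<lambda>l. {1..l} - {k + 1}) (H :: 'k::field matpoly)"
proof -
  have "V (k, k) dvd F" using assms(2) by (simp only: V_dvd_iff)
  then obtain H where H: "F = V (k, k) * H" by (rule dvdE)
  have "E_concl k D (\<lambda>l. {1..l} - {k + 1}) H"
    by (rule exact_descent[OF trD dD descent_flag k1, of k]) (use assms(1) k1 H in auto)
  thus ?thesis using H by blast
qed

lemma dm_full:
  assumes "k_full k D" shows "dm TYPE('k::field) D l = dm TYPE('k) D (sw k l)"
proof -
  let ?M = "FM (\<lambda>l. {1..l} - {k + 1}) D \<inter> (Hw l :: 'k matpoly set)"
  have "{F \<in> ?M. psub (V((k, k) := 0)) F = 0} = {0}"
  proof (intro Set.set_eqI iffI)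
    fix F assume "F \<in> {F \<in> ?M. psub (V((k, k) := 0)) F = 0}"
    then obtain H where "F = V (k, k) * H" "E_concl k D (\<lambda>l. {1..l} - {k + 1}) H" using descent_kernel by blast
    thus "F \<in> {0}" using E_conclD(1) assms by fastforce
  next
    fix F :: "'k matpoly" assume "F \<in> {0}"
    thus "F \<in> {F \<in> ?M. psub (V((k, k) := 0)) F = 0}" by (simp add: pm.subspace_0[OF subspace_FM])
  qed
  thus ?thesis using dm_split[OF dD k1 lk0, where ?'k='k] by (simp add: dim_zero)
qed

text \<open>By exactness and \<open>V_mult_FM\<close> the kernel is \<open>V (k, k)\<close> times a
  weight component for the unswapped predecessor, and swapping rows identifies that component with
  one for \<open>s_diag k D\<close>. The factor removes one letter \<open>k\<close> from the weight;
  if there is none, the kernel is 0.\<close>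

lemma dm_descent:
  assumes kD: "k \<in> Des D"
  shows "dm TYPE('k::field) D l = dm TYPE('k) D (sw k l) + (if lk l k \<ge> 1 then dm TYPE('k) (s_diag k D) (l - sg k 1) else 0)"
proof -
  let ?A = "\<lambda>l. {1..l} - {k + 1}"
  let ?K = "{F \<in> FM ?A D \<inter> (Hw l :: 'k matpoly set). psub (V((k, k) := 0)) F = 0}"
  obtain L a R where w: "descent_witness k D L a R" using kD by (auto simp: Des_def)
  let ?D = "L @ (a - {k}) # R" and ?n = "l - sg k 1"
  have d: "is_diagram ?D" by (rule is_diagram_witness(2)[OF dD w])
  have ker: "\<exists>H. F = V (k, k) * H \<and> H \<in> FM ?A ?D" if F: "F \<in> ?K" for F
  proof -
    obtain H where "F = V (k, k) * H" "E_concl k D ?A H" using descent_kernel F by blast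
    thus ?thesis using E_conclD(2)[OF _ w] by blast
  qed
  have "pm.dim ?K = (if lk l k \<ge> 1 then dm TYPE('k) (s_diag k D) ?n else 0)"
  proof (cases "lk l k \<ge> 1")
    case False
    have "?K = {0}"
    proof (intro Set.set_eqI iffI)
      fix F assume F: "F \<in> ?K"
      then obtain H where H: "F = V (k, k) * H" using ker by blast
      have "V (k, k) * H \<in> Hw l" using F unfolding H by blast
      hence "H = 0" by (rule V_mult_Hw_0) (use False in simp)
      thus "F \<in> {0}" using H by simp
    next
      fix F :: "'k matpoly" assume "F \<in> {0}"
      thus "F \<in> ?K" by (simp add: pm.subspace_0[OF subspace_FM])
    qed
    thus ?thesis using False by (simp add: dim_zero)
  next
    case True
    have ln: "l = sg k 1 + ?n"
      using True by (intro poly_mapping_eqI) (auto simp: lookup_add lookup_minus lookup_single when_def)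
    let ?N = "FM ?A ?D \<inter> (Hw ?n :: 'k matpoly set)"
    have VH: "V (k, k) * H \<in> Hw l \<longleftrightarrow> H \<in> Hw ?n" for H :: "'k matpoly"
      using V_mult_Hw[of "(k, k)" H ?n] ln by simp
    have "?K = (\<lambda>H. V (k, k) * H) ` ?N"
    proof (intro Set.set_eqI iffI)
      fix F assume F: "F \<in> ?K"
      then obtain H where H: "F = V (k, k) * H" "H \<in> FM ?A ?D" using ker by blast
      have "V (k, k) * H \<in> Hw l" using F unfolding H by blast
      hence "H \<in> ?N" using H(2) unfolding VH by blast
      thus "F \<in> (\<lambda>H. V (k, k) * H) ` ?N" unfolding H(1) by (rule imageI)
    next
      fix F assume "F \<in> (\<lambda>H. V (k, k) * H) ` ?N"
      then obtain H where H: "F = V (k, k) * H" "H \<in> FM ?A ?D" "H \<in> Hw ?n" by blast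
      have "F \<in> FM ?A D" unfolding H(1) by (rule V_mult_FM[OF w dD _ _ H(2)]) (use k1 in auto)
      moreover have "F \<in> Hw l" unfolding H(1) VH by (rule H(3))
      moreover have "psub (V((k, k) := 0)) F = 0" unfolding H(1) by (simp add: psub_mult)
      ultimately show "F \<in> ?K" by blast
    qed
    moreover obtain T where T: "finite T" "FM ?A ?D \<subseteq> (pm.span T :: 'k matpoly set)" using FM_fin[OF d, of ?A] by blast
    have sub: "pm.subspace ?N" by (intro pm.subspace_inter subspace_FM subspace_Hw)
    have NT: "?N \<subseteq> pm.span T" using T(2) by blast
    have "pm.dim ((\<lambda>H. V (k, k) * H) ` ?N) = pm.dim ?N"
      by (rule dim_inj_image[OF _ _ sub T(1) NT]) (simp_all add: distrib_left scale_conv mult.left_commute)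
    moreover have "pm.dim (rs k ` ?N) = pm.dim ?N"
      by (rule dim_inj_image[OF _ _ sub T(1) NT]) (simp_all add: rs_def psub_add psub_scale, simp add: rs_eq_0[OF k1, unfolded rs_def])
    moreover have "rs k ` ?N = FM ?A (swp k ?D) \<inter> Hw ?n"
    proof -
      have Ak: "?A k = ?A (k + 1)" by auto
      have hw: "rs k F \<in> Hw m" if F: "F \<in> FM ?A E" "is_diagram E" "F \<in> Hw m" for F :: "'k matpoly" and E m
        unfolding rs_def
      proof (rule psub_Hw[OF F(3)])
        fix v assume v: "v \<in> vars F"
        obtain x q where xq: "v = (x, q)" by (cases v)
        have "x \<in> rowset E" using vars_FM[OF F(2,1)] v unfolding xq by blast
        hence "x \<noteq> 0" using F(2) by (auto simp: rowset_def is_diagram_def)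
        thus "V (rsv k v) \<in> (Hw (sg (snd v) 1) :: 'k matpoly set)"
          using Hw_V[of "(tau k x, q)"] by (simp add: xq rsv_def)
      qed
      have ds: "is_diagram (swp k ?D)" by (rule is_diagram_swp[OF d k1])
      show ?thesis
      proof (intro Set.set_eqI iffI)
        fix F assume "F \<in> rs k ` ?N"
        thus "F \<in> FM ?A (swp k ?D) \<inter> Hw ?n" using rs_FM[OF _ d k1 Ak] hw[OF _ d] by blast
      next
        fix F assume F: "F \<in> FM ?A (swp k ?D) \<inter> (Hw ?n :: 'k matpoly set)"
        have "rs k F \<in> FM ?A (swp k (swp k ?D))" using F rs_FM[OF _ ds k1 Ak] by blast
        hence "rs k F \<in> ?N" unfolding swp_swp using F hw[OF _ ds] by blast
        thus "F \<in> rs k ` ?N" using rs_rs[OF k1, of F] by (metis imageI)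
      qed
    qed
    moreover have "FM ?A (swp k ?D) = (FM ?A (s_diag k D) :: 'k matpoly set)"
      by (rule FM_equiv[OF diag_eq_sym[OF s_diag_witness[OF dD w]]])
    moreover have "lk ?n (k + 1) = 0" using lk0 by (simp add: lookup_minus)
    ultimately show ?thesis
      using True dm_letter[OF is_diagram_s_diag[OF dD kD], of ?n "k + 1", where ?'k='k] by simp
  qed
  thus ?thesis using dm_split[OF dD k1 lk0, where ?'k='k] by simp
qed

end

section \<open>Weight spaces of the flagged Schur module\<close>

lemma coset_eq:
  fixes v w :: "'b \<Rightarrow>\<^sub>0 'k::field"
  assumes "pm.subspace U" "v - w \<in> U" shows "coset U v = coset U w"
proof -
  have "coset U v \<subseteq> coset U w" if "v - w \<in> U" for v w :: "'b \<Rightarrow>\<^sub>0 'k"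
  proof
    fix x assume "x \<in> coset U v"
    then obtain u where "u \<in> U" "x = v + u" by (auto simp: coset_def)
    hence "x = w + ((v - w) + u)" "(v - w) + u \<in> U" using pm.subspace_add[OF assms(1) that] by auto
    thus "x \<in> coset U w" unfolding coset_def by blast
  qed
  moreover have "w - v \<in> U" using pm.subspace_neg[OF assms(1,2)] by simp
  ultimately show ?thesis using assms(2) by blast
qed

text \<open>The restricted minor map has kernel \<open>schur_rels\<close>, so it is injective on
  cosets, and it sends the weight vectors onto a weight component of \<open>FM\<close>.\<close>

lemma dim_weight_space:
  assumes tr: "transparent D" and d: "is_diagram D" and n: "rowset D \<subseteq> {1..n}"
  shows "vectorspace.dim class_ring (weight_space n D l :: ('k::field, _) module) = dm TYPE('k) D l"
    "l \<notin> weight ` TEs n D \<Longrightarrow> dm TYPE('k) D l = 0"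
proof -
  let ?U = "schur_rels n D :: (nat set list \<Rightarrow>\<^sub>0 'k) set"
  let ?A = "Fl (\<lambda>l. min l n)"
  define f where "f v = rA ?A (minor_map D v)" for v :: "nat set list \<Rightarrow>\<^sub>0 'k"
  let ?W = "{v \<in> TE n D. \<forall>\<mu>. lk (generic_torus v - sg l v) \<mu> \<in> ?U}"
  let ?X = "weight_space n D l :: ('k, _) module"
  note U = subspace_schur_rels[of n D, where ?'a='k]
  have Uf: "?U = {v \<in> TE n D. f v = 0}" unfolding f_def by (rule schur_rels_conv[OF tr d])
  have fadd: "f (u + v) = f u + f v" and fscl: "f (scale c v) = scale c (f v)" for u v c
    unfolding f_def by (rule rA_mm_lin)+
  have fU: "f (v + u) = f v" if "u \<in> ?U" for u v using that Uf by (simp add: fadd)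
  \<comment> \<open>Any representative may be chosen, since \<open>f\<close> is constant on a
    coset.\<close>
  define \<psi> where "\<psi> X = f (SOME v. v \<in> X)" for X :: "(nat set list \<Rightarrow>\<^sub>0 'k) set"
  have psi: "\<psi> (coset ?U v) = f v" for v
  proof -
    have "v + 0 \<in> coset ?U v" unfolding coset_def using pm.subspace_0[OF U] by blast
    hence "(SOME w. w \<in> coset ?U v) \<in> coset ?U v" by (rule someI)
    then obtain u where "u \<in> ?U" "(SOME w. w \<in> coset ?U v) = v + u" unfolding coset_def by blast
    thus ?thesis unfolding \<psi>_def using fU by simp
  qed
  have car: "carrier ?X = coset ?U ` ?W" by (simp add: weight_space_def weight_vectors_def)
  have WT: "v \<in> TE n D" if "v \<in> ?W" for v using that by blast
  have rows: "?A r \<subseteq> {1..n}" for r by auto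
  have FMe: "FM ?A D = (FM (Fl (\<lambda>l. l)) D :: 'k matpoly set)"
    by (rule FM_cong[OF d]) (use n in auto)
  have img: "FM (Fl (\<lambda>l. l)) D \<inter> Hw l = f ` TEw n D l"
    unfolding FMe[symmetric] f_def by (rule FM_Hw_image[OF d rows])
  have gt: "lk (generic_torus v) \<mu> = (\<Sum>\<tau>\<in>{\<tau> \<in> ks v. weight \<tau> = \<mu>}. sg \<tau> (lk v \<tau>))" for v :: "nat set list \<Rightarrow>\<^sub>0 'k" and \<mu>
    unfolding generic_torus_def lookup_poly_mapping_sum lookup_single when_def
    by (simp add: sum.If_cases Int_def)
  have fW: "f ` ?W = f ` TEw n D l"
  proof (intro Set.set_eqI iffI)
    fix F assume "F \<in> f ` ?W"
    then obtain v where v: "v \<in> ?W" "F = f v" by blast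
    \<comment> \<open>The component of weight \<open>l\<close> lies in the same coset as
      \<open>v\<close>, by the defining condition at \<open>\<mu> = l\<close>.\<close>
    let ?v = "lk (generic_torus v) l"
    have "lk (generic_torus v - sg l v) l \<in> ?U" using v(1) by blast
    hence "?v - v \<in> ?U" by (simp add: lookup_minus)
    hence "f (v + (?v - v)) = f v" by (rule fU)
    hence "f ?v = F" using v(2) by simp
    moreover have "?v \<in> TEw n D l" unfolding gt TEw_def
      by (rule pm.subspace_sum[OF subspace_ks]) (use WT[OF v(1)] in \<open>auto simp: TE_conv split: if_splits\<close>)
    ultimately show "F \<in> f ` TEw n D l" by blast
  next
    fix F assume "F \<in> f ` TEw n D l"
    then obtain v where v: "v \<in> TEw n D l" "F = f v" by blast
    have "lk (generic_torus v - sg l v) \<mu> = 0" for \<mu>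
    proof (cases "\<mu> = l")
      case True
      have e: "{\<tau> \<in> ks v. weight \<tau> = l} = ks v" using v(1) by (auto simp: TEw_def)
      have "lk (generic_torus v) l = v" unfolding gt e by (rule sum_singles[symmetric])
      thus ?thesis using True by (simp add: lookup_minus)
    next
      case False
      hence e: "{\<tau> \<in> ks v. weight \<tau> = \<mu>} = {}" using v(1) by (auto simp: TEw_def)
      have "lk (generic_torus v) \<mu> = 0" unfolding gt e by simp
      thus ?thesis using False by (simp add: lookup_minus lookup_single)
    qed
    hence "v \<in> ?W" using subsetD[OF TEw_TE v(1)] pm.subspace_0[OF U] by simp
    thus "F \<in> f ` ?W" using v(2) by blast
  qed
  obtain T where T: "finite T" "FM (Fl (\<lambda>l. l)) D \<subseteq> (pm.span T :: 'k matpoly set)" using FM_fin[OF d, of "Fl (\<lambda>l. l)"] by blast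
  show "vectorspace.dim class_ring ?X = dm TYPE('k) D l"
    unfolding dm_def
  proof (rule vectorspace_dim_eq[OF vectorspace_weight_space, where \<psi>=\<psi> and T=T])
    fix x y assume "x \<in> carrier ?X" "y \<in> carrier ?X"
    then obtain v w where vw: "x = coset ?U v" "y = coset ?U w" unfolding car by blast
    have "x \<oplus>\<^bsub>?X\<^esub> y = coset ?U (v + w)"
      unfolding vw by (simp add: weight_space_def flagged_schur_module_def quot_simps[OF U])
    thus "\<psi> (x \<oplus>\<^bsub>?X\<^esub> y) = \<psi> x + \<psi> y" unfolding vw by (simp add: psi fadd)
  next
    fix c x assume "x \<in> carrier ?X"
    then obtain v where v: "x = coset ?U v" unfolding car by blast
    have "c \<odot>\<^bsub>?X\<^esub> x = coset ?U (scale c v)"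
      unfolding v by (simp add: weight_space_def flagged_schur_module_def quot_simps[OF U])
    thus "\<psi> (c \<odot>\<^bsub>?X\<^esub> x) = scale c (\<psi> x)" unfolding v by (simp add: psi fscl)
  next
    show "inj_on \<psi> (carrier ?X)" unfolding car
    proof (rule inj_onI)
      fix x y assume "x \<in> coset ?U ` ?W" "y \<in> coset ?U ` ?W" and e: "\<psi> x = \<psi> y"
      then obtain v w where vw: "x = coset ?U v" "v \<in> ?W" "y = coset ?U w" "w \<in> ?W" by blast
      have "f v = f w" using e unfolding vw(1,3) psi .
      hence "f (v - w) = 0" using fadd[of "v - w" w] by simp
      moreover have "v - w \<in> TE n D" by (rule pm.subspace_diff[OF subspace_TE WT[OF vw(2)] WT[OF vw(4)]])
      ultimately have "v - w \<in> ?U" unfolding Uf by blast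
      thus "x = y" unfolding vw(1,3) by (rule coset_eq[OF U])
    qed
  next
    show "\<psi> ` carrier ?X = FM (Fl (\<lambda>l. l)) D \<inter> Hw l"
      unfolding car image_image psi img by (rule fW)
  next
    show "finite T" "FM (Fl (\<lambda>l. l)) D \<inter> Hw l \<subseteq> pm.span T" using T by blast+
  qed
  assume h: "l \<notin> weight ` TEs n D"
  have "x = 0" if x: "x \<in> TEw n D l" for x :: "nat set list \<Rightarrow>\<^sub>0 'k"
  proof -
    have "t \<notin> ks x" for t using x h by (auto simp: TEw_def)
    hence "ks x = {}" by blast
    thus ?thesis by simp
  qed
  moreover have "0 \<in> (TEw n D l :: (nat set list \<Rightarrow>\<^sub>0 'k) set)" by (simp add: TEw_def)
  ultimately have "TEw n D l = {0 :: nat set list \<Rightarrow>\<^sub>0 'k}" by blast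
  hence "FM (Fl (\<lambda>l. l)) D \<inter> Hw l = {f 0}" unfolding img by simp
  moreover have "f 0 = 0" by (simp add: f_def minor_map_lin rA_def)
  ultimately show "dm TYPE('k) D l = 0" unfolding dm_def by (simp add: dim_zero)
qed

lemma lookup_schur_char:
  assumes "transparent D" "is_diagram D" "rowset D \<subseteq> {1..n}"
  shows "lk (schur_char TYPE('k::field) n D) l = int (dm TYPE('k) D l)"
proof -
  note dw = dim_weight_space[OF assms, where ?'k='k]
  have "schur_char TYPE('k) n D = Sum_any (\<lambda>l. sg l (int (dm TYPE('k) D l)))"
    unfolding schur_char_def dw(1) ..
  also have "\<dots> = (\<Sum>l\<in>weight ` TEs n D. sg l (int (dm TYPE('k) D l)))"
  proof (rule Sum_any.expand_superset)
    show "{l. sg l (int (dm TYPE('k) D l)) \<noteq> 0} \<subseteq> weight ` TEs n D"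
    proof (rule subsetI, rule ccontr)
      fix l assume "l \<in> {l. sg l (int (dm TYPE('k) D l)) \<noteq> 0}" "l \<notin> weight ` TEs n D"
      thus False using dw(2)[of l] by simp
    qed
  qed (intro finite_imageI finite_TEs)
  finally have "lk (schur_char TYPE('k) n D) l = (\<Sum>m\<in>weight ` TEs n D. if m = l then int (dm TYPE('k) D m) else 0)"
    by (simp add: lookup_sum lookup_single when_def)
  also have "\<dots> = int (dm TYPE('k) D l)" using finite_TEs[of n D] dw(2)[of l] by (simp add: sum.delta')
  finally show ?thesis .
qed

section \<open>The empty diagram and the support of the character\<close>

lemma dm_Nil:
  assumes "D \<simeq> []" shows "dm TYPE('k::field) D l = (if l = 0 then 1 else 0)"
proof -
  have F: "FM (Fl (\<lambda>l. l)) D = (pm.span {1} :: 'k matpoly set)"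
    using FM_equiv[OF assms, of "Fl (\<lambda>l. l)", where ?'a='k] by (simp add: FM_Nil)
  have s: "pm.span {1 :: 'k matpoly} \<subseteq> Hw 0" by (rule pm.span_minimal[OF _ subspace_Hw]) simp
  show ?thesis
  proof (cases "l = 0")
    case True
    hence "FM (Fl (\<lambda>l. l)) D \<inter> Hw l = (pm.span {1} :: 'k matpoly set)" using s F by auto
    moreover have "pm.dim {1 :: 'k matpoly} = 1" using pm.dim_eq_card_independent[of "{1 :: 'k matpoly}"] by (simp add: pm.dependent_single)
    ultimately show ?thesis using True by (simp add: dm_def)
  next
    case False
    have "FM (Fl (\<lambda>l. l)) D \<inter> Hw l = {0 :: 'k matpoly}"
    proof (intro Set.set_eqI iffI)
      fix x :: "'k matpoly" assume "x \<in> FM (Fl (\<lambda>l. l)) D \<inter> Hw l"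
      hence h: "x \<in> Hw 0" "x \<in> Hw l" using s F by auto
      have "m \<notin> ks x" for m using h False unfolding Hw_def by blast
      hence "ks x = {}" by blast
      thus "x \<in> {0}" by simp
    qed (simp add: pm.subspace_0[OF subspace_FM])
    thus ?thesis using False by (simp add: dm_def dim_zero)
  qed
qed

lemma dm_support:
  assumes d: "is_diagram D" and nz: "dm TYPE('k::field) D l \<noteq> 0" and n: "rowset D \<subseteq> {1..n}"
  shows "ks l \<subseteq> {1..n}" "rowset D \<noteq> {} \<Longrightarrow> l \<noteq> 0"
proof -
  let ?M = "FM (Fl (\<lambda>l. l)) D \<inter> (Hw l :: 'k matpoly set)"
  have "?M \<noteq> {0}" using nz dim_zero unfolding dm_def by metis
  moreover have "0 \<in> ?M" by (simp add: pm.subspace_0[OF subspace_FM])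
  ultimately obtain F where F: "F \<in> ?M" "F \<noteq> 0" by blast
  then obtain m where m: "m \<in> ks F" by (metis keys_eq_empty ex_in_conv)
  have w: "wtm m = l" using F(1) m by (auto simp: Hw_def)
  show "ks l \<subseteq> {1..n}"
  proof
    fix q assume "q \<in> ks l"
    then obtain r where "(r, q) \<in> ks m" using w ks_wtm[of m] by force
    hence "(r, q) \<in> vars F" using m by (auto simp: vars_def)
    hence "r \<in> rowset D" "q \<in> {1..r}" using vars_FM[OF d, of F] F(1) by blast+
    thus "q \<in> {1..n}" using subsetD[OF n \<open>r \<in> rowset D\<close>] by auto
  qed
  assume "rowset D \<noteq> {}"
  then obtain x where x: "x \<in> rowset D" by blast
  have x1: "x \<ge> 1" using subsetD[OF n x] by simp
  show "l \<noteq> 0"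
  proof
    assume "l = 0"
    hence "ks m = {}" using w ks_wtm[of m] by simp
    hence m0: "m = 0" by simp
    \<comment> \<open>A constant monomial would give a nonzero coefficient of degree 0 in row
      \<open>x\<close>, whereas an occupied row has positive degree.\<close>
    have "lk (cf (rvars x) 0 F) 0 = lk F 0" by (simp add: lookup_cf)
    hence "cf (rvars x) 0 F \<noteq> 0" using m m0 by (auto simp: in_keys_iff)
    hence "dg (0 :: nat \<times> nat \<Rightarrow>\<^sub>0 nat) = nB x {} D" using FM_cf(2)[OF _ d x1, of F "Fl (\<lambda>l. l)" 0] F(1) by auto
    thus False using nB_pos[of x D] x by simp
  qed
qed

text \<open>The bound is computed from the diagram, because \<open>s_diag k D\<close> may reach one
  row further than \<open>D\<close>. Inserting 0 covers a diagram without boxes.\<close>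

definition hD :: "'k::field itself \<Rightarrow> diagram \<Rightarrow> zpoly" where
  "hD T D = schur_char T (Max (insert 0 (rowset D))) D"

lemma rowset_Max:
  assumes "is_diagram D" shows "rowset D \<subseteq> {1..Max (insert 0 (rowset D))}"
proof
  fix j assume j: "j \<in> rowset D"
  have f: "finite (rowset D)" "0 \<notin> rowset D" using assms by (auto simp: rowset_def is_diagram_def)
  have "j \<noteq> 0" using j f(2) by metis
  moreover have "j \<le> Max (insert 0 (rowset D))" using f(1) j by (intro Max_ge) auto
  ultimately show "j \<in> {1..Max (insert 0 (rowset D))}" by simp
qed

lemma lookup_hD:
  assumes "transparent D" "is_diagram D"
  shows "lk (hD TYPE('k::field) D) l = int (dm TYPE('k) D l)"
  unfolding hD_def by (rule lookup_schur_char[OF assms rowset_Max[OF assms(2)]])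

text \<open>At \<open>\<mu>\<close> the two operators read off the weights with a zero inserted at
  \<open>k + 1\<close> and at \<open>k\<close>. These are exchanged by \<open>sw k\<close>, so their
  multiplicities differ by the kernel of the comparison above.\<close>

lemma R_difference:
  assumes tr: "transparent D" and d: "is_diagram D" and k: "1 \<le> k"
  shows "R_op (Suc k) (hD TYPE('k::field) D) - R_op k (hD TYPE('k) D) =
    (if k \<in> Des D then x_var k * R_op (k + 1) (hD TYPE('k) (s_diag k D)) else 0)"
proof (rule poly_mapping_eqI)
  fix \<mu> :: expvec
  let ?l = "ins (k + 1) \<mu>"
  have l0: "lk ?l (k + 1) = 0" by (simp add: lookup_ins)
  have lk: "lk ?l k = lk \<mu> k" by (simp add: lookup_ins)
  have s: "sw k ?l = ins k \<mu>"
    by (rule poly_mapping_eqI) (auto simp: lookup_sw lookup_ins transpose_def)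
  have m: "?l - sg k 1 = ins (k + 1) (\<mu> - sg k 1)" if "lk \<mu> k \<ge> 1"
    by (rule poly_mapping_eqI) (auto simp: lookup_minus lookup_ins lookup_single when_def)
  have a: "lk (R_op (Suc k) (hD TYPE('k) D) - R_op k (hD TYPE('k) D)) \<mu> = int (dm TYPE('k) D ?l) - int (dm TYPE('k) D (sw k ?l))"
    unfolding s by (simp add: lookup_minus lookup_R lookup_hD[OF tr d])
  show "lk (R_op (Suc k) (hD TYPE('k) D) - R_op k (hD TYPE('k) D)) \<mu> =
      lk (if k \<in> Des D then x_var k * R_op (k + 1) (hD TYPE('k) (s_diag k D)) else 0) \<mu>"
  proof (cases "k \<in> Des D")
    case True
    obtain L a R where w: "descent_witness k D L a R" using True by (auto simp: Des_def)
    have "\<not> D \<simeq> []" using witness_col(2,5)[OF d w] by (auto simp: diag_eq_Nil)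
    with tr have "transparent (s_diag k D)" by cases (use True in auto)
    hence "lk (R_op (k + 1) (hD TYPE('k) (s_diag k D))) \<nu> = int (dm TYPE('k) (s_diag k D) (ins (k + 1) \<nu>))" for \<nu>
      unfolding lookup_R using lookup_hD is_diagram_s_diag[OF d True] by blast
    thus ?thesis unfolding a dm_descent[OF tr d k l0 True, where ?'k='k] lk using True m
      by (simp add: lookup_x_mult)
  next
    case False
    hence "k_full k D" using transparent_clear[OF tr k] by (auto simp: Des_def)
    thus ?thesis unfolding a using False dm_full[OF tr d k l0, where ?'k='k] by simp
  qed
qed

lemma hD_step:
  assumes tr: "transparent D" and d: "is_diagram D" and ne: "\<not> D \<simeq> []"
  shows "hD TYPE('k::field) D = Z_op (\<Sum>k\<in>Des D. x_var k * R_op (k + 1) (hD TYPE('k) (s_diag k D)))"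
proof -
  let ?h = "hD TYPE('k) D"
  obtain n where n: "rowset D \<subseteq> {1..n}" using rows_bound[OF d] by blast
  have r: "rowset D \<noteq> {}" using ne by (auto simp: diag_eq_Nil rowset_def)
  have sup: "ks l \<subseteq> {1..n} \<and> l \<noteq> 0" if "dm TYPE('k) D l \<noteq> 0" for l
    using dm_support[OF d that n] r by blast
  have nice: "nice n ?h" unfolding nice_def
  proof
    fix m assume "m \<in> ks ?h"
    hence "dm TYPE('k) D m \<noteq> 0" by (simp add: in_keys_iff lookup_hD[OF tr d])
    thus "m \<noteq> 0 \<and> ks m \<subseteq> {1..n}" using sup by blast
  qed
  \<comment> \<open>Only the variables 1 to \<open>n\<close> occur, so nothing is killed or shifted.
    This is the upper end of the telescoping sum.\<close>
  have "R_op (Suc n) ?h = ?h"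
  proof (rule poly_mapping_eqI)
    fix \<mu>
    show "lk (R_op (Suc n) ?h) \<mu> = lk ?h \<mu>"
    proof (cases "ks \<mu> \<subseteq> {..n}")
      case True
      have "ins (Suc n) \<mu> = \<mu>"
      proof (rule poly_mapping_eqI)
        fix i
        have "lk \<mu> j = 0" if "j > n" for j using True that by (auto simp: in_keys_iff subset_iff)
        thus "lk (ins (Suc n) \<mu>) i = lk \<mu> i" by (simp add: lookup_ins)
      qed
      thus ?thesis by (simp add: lookup_R)
    next
      case False
      then obtain i where "i \<in> ks \<mu>" "i \<notin> {..n}" by blast
      hence i: "i \<in> ks \<mu>" "n < i" by auto
      have "\<not> ks \<mu> \<subseteq> {1..n}" using i by fastforce
      hence z1: "dm TYPE('k) D \<mu> = 0" using sup by blast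
      have "shf (Suc n) i \<in> ks (ins (Suc n) \<mu>)" by (rule ks_ins[OF i(1)])
      moreover have "shf (Suc n) i \<notin> {1..n}" using i(2) by (simp add: shf_def)
      ultimately have "\<not> ks (ins (Suc n) \<mu>) \<subseteq> {1..n}" by blast
      hence "dm TYPE('k) D (ins (Suc n) \<mu>) = 0" using sup by blast
      thus ?thesis using z1 by (simp add: lookup_R lookup_hD[OF tr d])
    qed
  qed
  hence "?h - R_op 1 ?h = R_op (Suc n) ?h - R_op 1 ?h" by simp
  also have "\<dots> = (\<Sum>k = 1..n. R_op (Suc k) ?h - R_op k ?h)"
    by (rule sum_Suc_diff[symmetric]) simp
  also have "\<dots> = (\<Sum>k\<in>{1..n}. if k \<in> Des D then x_var k * R_op (k + 1) (hD TYPE('k) (s_diag k D)) else 0)"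
    by (intro sum.cong refl R_difference[OF tr d]) simp
  also have "\<dots> = (\<Sum>k\<in>{1..n} \<inter> Des D. x_var k * R_op (k + 1) (hD TYPE('k) (s_diag k D)))"
    by (rule sum.inter_restrict[symmetric]) simp
  also have "{1..n} \<inter> Des D = Des D" using Des_rowset[OF d] n by blast
  finally show ?thesis using Z_telescope[OF nice] by simp
qed

theorem corollary5p10:
  fixes D :: diagram and n :: nat
  assumes "is_diagram D"
    and "transparent D"
    and "\<forall>a \<in> set D. \<forall>i \<in> a. i \<le> n"
  shows "schur_char TYPE('k::field) n D = (\<Sum>w \<in> Red D. word_poly w)"
proof -
  have "rowset D \<subseteq> {1..n}"
  proof
    fix i assume i: "i \<in> rowset D"
    hence "i \<noteq> 0" using assms(1) by (auto simp: rowset_def is_diagram_def)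
    thus "i \<in> {1..n}" using i assms(3) by (auto simp: rowset_def)
  qed
  \<comment> \<open>The coefficients are the numbers \<open>dm\<close>, which do not involve the
    bound, so every admissible \<open>n\<close> gives the same character.\<close>
  hence "schur_char TYPE('k) n D = hD TYPE('k) D"
    by (intro poly_mapping_eqI) (simp add: lookup_schur_char[OF assms(2,1)] lookup_hD[OF assms(2,1)])
  also have "\<dots> = (\<Sum>w \<in> Red D. word_poly w)"
  proof (rule word_sum_recursion[where h = "hD TYPE('k)", OF _ _ assms(2,1)])
    fix D :: diagram assume D: "D \<simeq> []"
    have "is_diagram D" using is_diagram_cong[OF D] by (simp add: is_diagram_def)
    thus "hD TYPE('k) D = 1"
      by (intro poly_mapping_eqI) (simp add: lookup_hD[OF transparent_empty[OF D]] dm_Nil[OF D] lookup_one)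
  qed (rule hD_step)
  finally show ?thesis .
qed

end
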